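(* Let $G$ be a directed graph with $n$ vertices and $m$ edges in which every vertex has at least one outgoing edge. Let $\alpha\in[1/n,1/4]$ and $\varepsilon\in[\log^3 n/o(S),1]$, where $S$ is the space available per machine. There exists an MPC algorithm that, with probability at least $1-O(1/n)$, computes a $(1+\alpha)$-approximate $\varepsilon$-PageRank vector of $G$ in $\tilde O(\log^2\log n+\log^2(1/\varepsilon))$ rounds, using $\tilde O\left(\frac{m}{\alpha^2}+\frac{n^{1+o(1)}}{\varepsilon^{3.5}\alpha^2}\right)$ total space and strongly sublinear space per machine.
   Context: MPC model: the input edges are distributed over machines with $S$ words of space each; computation proceeds in synchronous rounds of local computation followed by message exchange, with at most $S$ words sent and received per machine per round; strongly sublinear space per machine means $S=O(n^{\gamma})$ for a constant $\gamma\in(0,1)$, and total space is the number of machines times $S$. The $\varepsilon$-PageRank of $G$ is the (unique) stationary distribution $\pi$ of the Markov chain on $V(G)$ which, from $v$, with probability $\varepsilon$ moves to a uniformly random vertex and with probability $1-\varepsilon$ moves along a uniformly random outgoing edge of $v$ (counting parallel edges with multiplicity). A vector $\tilde\pi$ is a $(1+\alpha)$-approximation of $\pi$ if $|\tilde\pi(v)-\pi(v)|\le\alpha\pi(v)$ for all $v$. $\tilde O$ suppresses factors polylogarithmic in the respective argument.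
   Formalization: Assumes additionally that the space per machine is S = Ω(n^δ) for some constant δ > 0 and that m ≤ n^c for some constant c (constants may depend on δ and c); for polylogarithmic S or superpolynomially many parallel edges the round bound fails. *)

theory Defs
  imports
    "HOL-Probability.Probability"
    "HOL-Library.Landau_Symbols"
    "Graph_Theory.Digraph"
begin

section \<open>PageRank\<close>

definition pagerank_step :: "('a, 'b) pre_digraph \<Rightarrow> real \<Rightarrow> 'a \<Rightarrow> 'a pmf" where
  "pagerank_step G \<epsilon> v =
     do { jump \<leftarrow> bernoulli_pmf \<epsilon>;
          if jump then pmf_of_set (verts G)
          else map_pmf (head G) (pmf_of_set (out_arcs G v)) }"

definition stationary_on :: "'a set \<Rightarrow> ('a \<Rightarrow> 'a pmf) \<Rightarrow> 'a pmf \<Rightarrow> bool" where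
  "stationary_on V K \<pi> \<longleftrightarrow> set_pmf \<pi> \<subseteq> V \<and> bind_pmf \<pi> K = \<pi>"

definition pagerank :: "('a, 'b) pre_digraph \<Rightarrow> real \<Rightarrow> 'a pmf" where
  "pagerank G \<epsilon> = (THE \<pi>. stationary_on (verts G) (pagerank_step G \<epsilon>) \<pi>)"

definition multiplicative_approx ::
    "real \<Rightarrow> ('a, 'b) pre_digraph \<Rightarrow> 'a pmf \<Rightarrow> ('a \<Rightarrow> real) \<Rightarrow> bool" where
  "multiplicative_approx \<alpha> G \<pi> \<pi>' \<longleftrightarrow> (\<forall>v\<in>verts G. \<bar>\<pi>' v - pmf \<pi> v\<bar> \<le> \<alpha> * pmf \<pi> v)"

lemma pagerank_unique:
  assumes "fin_digraph G" and ne: "verts G \<noteq> {}" and out: "\<And>v. v \<in> verts G \<Longrightarrow> out_arcs G v \<noteq> {}"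
    and eps: "0 < \<epsilon>" "\<epsilon> \<le> 1"
  shows "\<exists>!\<pi>. stationary_on (verts G) (pagerank_step G \<epsilon>) \<pi>"
proof -
  interpret fin_digraph G by fact
  define U where "U = pmf_of_set (verts G)"
  define P where "P v = map_pmf (head G) (pmf_of_set (out_arcs G v))" for v
  have step: "pagerank_step G \<epsilon> v = bind_pmf (bernoulli_pmf \<epsilon>) (\<lambda>b. if b then U else P v)" for v
    unfolding pagerank_step_def U_def P_def by (rule refl)
  have bind_step: "bind_pmf \<pi> (pagerank_step G \<epsilon>) =
      bind_pmf (bernoulli_pmf \<epsilon>) (\<lambda>b. if b then U else bind_pmf \<pi> P)" for \<pi>
    unfolding step by (subst bind_commute_pmf) (auto intro!: bind_pmf_cong)
  have setU: "set_pmf U \<subseteq> verts G" unfolding U_def using ne by simp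
  have setP: "set_pmf (P v) \<subseteq> verts G" if "v \<in> verts G" for v
    unfolding P_def using out[OF that] by (auto simp: finite_out_arcs)
  define walk where "walk k = ((\<lambda>p. bind_pmf p P) ^^ k) U" for k
  have walk_Suc: "walk (Suc k) = bind_pmf (walk k) P" for k by (simp add: walk_def)
  have set_walk: "set_pmf (walk k) \<subseteq> verts G" for k
  proof (induction k)
    case 0
    then show ?case using setU by (simp add: walk_def)
  next
    case (Suc k)
    then show ?case using setP unfolding walk_Suc by auto
  qed
  define \<pi> where "\<pi> = bind_pmf (geometric_pmf \<epsilon>) walk"
  have "\<pi> = bind_pmf (bernoulli_pmf \<epsilon>) (\<lambda>b. bind_pmf (if b then return_pmf 0
      else map_pmf Suc (geometric_pmf \<epsilon>)) walk)"
    unfolding \<pi>_def using eps by (subst geometric_bind_pmf_unfold) (auto simp: bind_assoc_pmf)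
  also have "\<dots> = bind_pmf (bernoulli_pmf \<epsilon>) (\<lambda>b. if b then U else bind_pmf \<pi> P)"
    by (intro bind_pmf_cong refl)
       (auto simp: \<pi>_def bind_return_pmf bind_map_pmf bind_assoc_pmf walk_Suc walk_def)
  finally have unfold: "\<pi> = bind_pmf (bernoulli_pmf \<epsilon>) (\<lambda>b. if b then U else bind_pmf \<pi> P)" .
  have "set_pmf \<pi> \<subseteq> verts G" using set_walk by (auto simp: \<pi>_def)
  then have "stationary_on (verts G) (pagerank_step G \<epsilon>) \<pi>"
    unfolding stationary_on_def bind_step using unfold[symmetric] by (rule conjI)
  moreover have "p = q" if p: "stationary_on (verts G) (pagerank_step G \<epsilon>) p"
    and q: "stationary_on (verts G) (pagerank_step G \<epsilon>) q" for p q
  proof -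
    have eq: "pmf p v = \<epsilon> * pmf U v + (1 - \<epsilon>) * (\<Sum>u\<in>verts G. pmf p u * pmf (P u) v)"
      if "stationary_on (verts G) (pagerank_step G \<epsilon>) p" for p v
    proof -
      have s: "set_pmf p \<subseteq> verts G" and "p = bind_pmf p (pagerank_step G \<epsilon>)"
        using that by (auto simp: stationary_on_def)
      then have "pmf p v = pmf (bind_pmf (bernoulli_pmf \<epsilon>) (\<lambda>b. if b then U else bind_pmf p P)) v"
        using bind_step by metis
      also have "\<dots> = \<epsilon> * pmf U v + (1 - \<epsilon>) * pmf (bind_pmf p P) v"
        using eps by (simp add: pmf_bind integral_bernoulli_pmf)
      also have "pmf (bind_pmf p P) v = (\<Sum>u\<in>verts G. pmf p u * pmf (P u) v)"
        unfolding pmf_bind using s by (subst integral_measure_pmf[of "verts G"]) auto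
      finally show ?thesis .
    qed
    define D where "D = (\<Sum>v\<in>verts G. \<bar>pmf p v - pmf q v\<bar>)"
    have diff: "\<bar>pmf p v - pmf q v\<bar> \<le> (1 - \<epsilon>) * (\<Sum>u\<in>verts G. \<bar>pmf p u - pmf q u\<bar> * pmf (P u) v)" for v
    proof -
      have "pmf p v - pmf q v = (1 - \<epsilon>) * (\<Sum>u\<in>verts G. (pmf p u - pmf q u) * pmf (P u) v)"
        by (subst eq[OF p], subst eq[OF q]) (simp add: algebra_simps sum_subtractf)
      then have "\<bar>pmf p v - pmf q v\<bar> = (1 - \<epsilon>) * \<bar>\<Sum>u\<in>verts G. (pmf p u - pmf q u) * pmf (P u) v\<bar>"
        using eps by (simp add: abs_mult)
      also have "\<dots> \<le> (1 - \<epsilon>) * (\<Sum>u\<in>verts G. \<bar>(pmf p u - pmf q u) * pmf (P u) v\<bar>)"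
        using eps by (intro mult_left_mono sum_abs) auto
      finally show ?thesis by (simp add: abs_mult)
    qed
    have "D \<le> (\<Sum>v\<in>verts G. (1 - \<epsilon>) * (\<Sum>u\<in>verts G. \<bar>pmf p u - pmf q u\<bar> * pmf (P u) v))"
      unfolding D_def by (intro sum_mono diff)
    also have "\<dots> = (1 - \<epsilon>) * (\<Sum>u\<in>verts G. \<bar>pmf p u - pmf q u\<bar> * (\<Sum>v\<in>verts G. pmf (P u) v))"
      by (subst sum_distrib_left[symmetric], subst sum.swap) (simp add: sum_distrib_left)
    also have "\<dots> = (1 - \<epsilon>) * D"
      unfolding D_def using setP by (simp add: sum_pmf_eq_1)
    finally have "\<epsilon> * D \<le> 0" by (simp add: algebra_simps)
    then have "D \<le> 0" using eps by (simp add: mult_le_0_iff)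
    then have "D = 0" unfolding D_def by (meson antisym sum_nonneg abs_ge_zero)
    then have on: "pmf p v = pmf q v" if "v \<in> verts G" for v
      using that unfolding D_def by (simp add: sum_nonneg_eq_0_iff)
    show "p = q"
    proof (rule pmf_eqI)
      fix v show "pmf p v = pmf q v"
        using on[of v] p q unfolding stationary_on_def
        by (cases "v \<in> verts G") (simp, metis pmf_eq_0_set_pmf subsetD)
    qed
  qed
  ultimately show ?thesis by blast
qed

section \<open>The MPC model\<close>

text \<open>
  A machine word is a natural number below a bound \<open>W\<close>, and the memory of a machine is a list of
  words. In every round each machine, given the round number, its own index and its memory, uses
  private randomness to choose the words it keeps and, for every machine \<open>j\<close>, the words it sends
  to \<open>j\<close>. As usual in this model, local computation is not otherwise restricted.
\<close>

type_synonym mpc_memory = "nat \<Rightarrow> nat list"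
type_synonym mpc_action = "nat list \<times> (nat \<Rightarrow> nat list)"

record mpc_algorithm =
  machines :: nat
  rounds :: nat
  local_step :: "nat \<Rightarrow> nat \<Rightarrow> nat list \<Rightarrow> mpc_action pmf"

definition deliver :: "nat \<Rightarrow> (nat \<Rightarrow> mpc_action) \<Rightarrow> mpc_memory" where
  "deliver M act j = fst (act j) @ concat (map (\<lambda>i. snd (act i) j) [0..<M])"

definition respects_limits :: "nat \<Rightarrow> nat \<Rightarrow> nat \<Rightarrow> (nat \<Rightarrow> mpc_action) \<Rightarrow> bool" where
  "respects_limits W S M act \<longleftrightarrow>
     (\<forall>i<M. (\<Sum>j<M. length (snd (act i) j)) \<le> S \<and>
            (\<Sum>j<M. length (snd (act j) i)) \<le> S \<and>
            length (deliver M act i) \<le> S \<and>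
            set (deliver M act i) \<subseteq> {..<W})"

text \<open>
  An execution that violates the word, space or communication limits is aborted; its probability
  is the missing mass of the subprobability distribution over final memories.
\<close>

definition mpc_round ::
    "nat \<Rightarrow> nat \<Rightarrow> mpc_algorithm \<Rightarrow> nat \<Rightarrow> mpc_memory \<Rightarrow> mpc_memory spmf" where
  "mpc_round W S A r mem =
     map_pmf (\<lambda>act. if respects_limits W S (machines A) act
                    then Some (deliver (machines A) act) else None)
       (Pi_pmf {..<machines A} ([], \<lambda>_. []) (\<lambda>i. local_step A r i (mem i)))"

primrec mpc_run ::
    "nat \<Rightarrow> nat \<Rightarrow> mpc_algorithm \<Rightarrow> mpc_memory \<Rightarrow> nat \<Rightarrow> mpc_memory spmf" where
  "mpc_run W S A mem 0 = return_spmf mem"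
| "mpc_run W S A mem (Suc r) = bind_spmf (mpc_run W S A mem r) (mpc_round W S A r)"

definition mpc_result ::
    "nat \<Rightarrow> nat \<Rightarrow> mpc_algorithm \<Rightarrow> mpc_memory \<Rightarrow> mpc_memory spmf" where
  "mpc_result W S A mem = mpc_run W S A mem (rounds A)"

text \<open>
  The input is the multiset of arcs, each stored as the two words tail and head, split among the
  machines in an arbitrary way that respects their space.
\<close>

definition edge_input ::
    "nat \<Rightarrow> nat \<Rightarrow> (nat, 'b) pre_digraph \<Rightarrow> mpc_memory \<Rightarrow> bool" where
  "edge_input S M G mem \<longleftrightarrow>
     (\<exists>es :: nat \<Rightarrow> (nat \<times> nat) list.
        (\<forall>i<M. mem i = concat (map (\<lambda>(u, v). [u, v]) (es i)) \<and> length (mem i) \<le> S) \<and>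
        (\<Sum>i<M. mset (es i)) = image_mset (arc_to_ends G) (mset_set (arcs G)))"

text \<open>
  The output vector is spread over the machines as triples of words \<open>v\<close>, \<open>p\<close>, \<open>q\<close>, which record
  the rational value \<open>p / q\<close> for vertex \<open>v\<close>.
\<close>

definition vector_output ::
    "nat \<Rightarrow> (nat, 'b) pre_digraph \<Rightarrow> mpc_memory \<Rightarrow> (nat \<Rightarrow> real) \<Rightarrow> bool" where
  "vector_output M G mem x \<longleftrightarrow>
     (\<exists>out :: nat \<Rightarrow> (nat \<times> nat \<times> nat) list.
        (\<forall>i<M. mem i = concat (map (\<lambda>(v, p, q). [v, p, q]) (out i))) \<and>
        (\<forall>v\<in>verts G. {real p / real q | p q. (v, p, q) \<in> (\<Union>i<M. set (out i))} = {x v}))"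

section \<open>Asymptotic notation\<close>

text \<open>
  The functions \<open>soft C k\<close>, for constants \<open>C\<close> and \<open>k\<close>, are the bounds covered by soft-O notation;
  the shift by 2 keeps the logarithm positive for every nonnegative argument.
\<close>

definition soft :: "real \<Rightarrow> nat \<Rightarrow> real \<Rightarrow> real" where
  "soft C k x = C * x * ln (x + 2) ^ k"

end

theory Submission
  imports Defs "HOL-Real_Asymp.Real_Asymp"
begin

text \<open>
  PageRank with jump probability \<open>\<epsilon>\<close> is the law of the endpoint of a walk that starts at a uniform
  vertex and stops with probability \<open>\<epsilon>\<close> before every step. Many walks are simulated at once: on
  every level each vertex owns a pool of slots, each slot draws one outgoing edge and points to a
  random slot of the pool of its head on the next level, and pointer doubling follows all walks to
  their ends in logarithmically many steps. The walks coalesce and are therefore not independent,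
  but a second moment bound shows that their numbers concentrate as soon as every pool is
  proportional to the expected number of visits to its vertex. Such pools are given by estimates
  for a smaller damping factor, so the factor is raised from \<open>1 / (n + 1)\<close> to \<open>1 - \<epsilon>\<close> in phases;
  lengthening the walks by a factor \<open>1 + 1 / q\<close> costs only a factor \<open>n ^ (4 / q)\<close> in space. In every
  phase a majority vote over independent repetitions makes the failure probability polynomially
  small. A phase consists of boundedly many sorts and prefix computations per doubling step, and
  when the space per machine is a fixed power of \<open>n\<close>, nested columnsort does each of them in a
  bounded number of rounds.
\<close>

section \<open>Array programs in the MPC model\<close>

text \<open>Why the second moment stays small: a walk that visits \<open>w\<close> occupies a random
  slot of the pool of \<open>w\<close>, and two walks interfere only after they hit the same slot.
  Pools proportional to the discounted number of visits bound the load of a slot, but the loads add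
  up over all levels. Each walk therefore starts on a random level below \<open>l\<close>, out of
  \<open>2 * l\<close> levels: this divides the load of a slot by \<open>l\<close>, which cancels
  the number of levels, and leaves every walk at least \<open>l\<close> steps. Pools need no
  separate sizing: the pool of \<open>w\<close> in the next phase consists of the tokens that
  stopped at \<open>w\<close> in the last one. Hence the pools of a level always fill exactly one
  row, and one immobile token per vertex and repetition keeps every pool nonempty. The parameter
  \<open>q\<close> is chosen as \<open>slow n\<close>, that is
  \<open>ln (ln (ln n) ^ 2 + 2)\<close>. It tends to infinity, so \<open>n ^ (4 / q)\<close> is
  \<open>n\<close> to the power o(1), yet it is no larger than the logarithmic factor which the
  round bound tolerates. All data moves along permutations fixed in advance, and random access is
  simulated by sorting. The limits of the machines thus hold for every outcome, and only the
  accuracy of the estimates is random.\<close>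

lemma Pi_pmf_blocks:
 assumes "finite I" and "\<And>i. i \<in> I \<Longrightarrow> finite (Bk i)"
  and "\<And>i j. i \<in> I \<Longrightarrow> j \<in> I \<Longrightarrow> i \<noteq> j \<Longrightarrow> Bk i \<inter> Bk j = {}"
 shows "Pi_pmf I d (\<lambda>i. map_pmf (h i) (Pi_pmf (Bk i) d' g)) =
  map_pmf (\<lambda>y i. if i \<in> I then h i (\<lambda>c. if c \<in> Bk i then y c else d') else d)
   (Pi_pmf (\<Union>i\<in>I. Bk i) d' g)"
 using assms
proof (induction I rule: finite_induct)
 case empty
 then show ?case by simp
next
 case (insert i I)
 let ?U = "\<Union>j\<in>I. Bk j"
 have disj: "Bk i \<inter> ?U = {}" using insert by fastforce
 have fin: "finite ?U" "finite (Bk i)" using insert by auto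
 have IH: "Pi_pmf I d (\<lambda>i. map_pmf (h i) (Pi_pmf (Bk i) d' g)) =
  map_pmf (\<lambda>y i. if i \<in> I then h i (\<lambda>c. if c \<in> Bk i then y c else d') else d)
   (Pi_pmf ?U d' g)"
  using insert by (intro insert.IH) auto
 have "Pi_pmf (insert i I) d (\<lambda>i. map_pmf (h i) (Pi_pmf (Bk i) d' g)) =
   map_pmf (\<lambda>(p, q). (\<lambda>j. if j \<in> I then h j (\<lambda>c. if c \<in> Bk j then q c else d') else d)(i := h i p))
    (pair_pmf (Pi_pmf (Bk i) d' g) (Pi_pmf ?U d' g))"
  using insert.hyps
  by (subst Pi_pmf_insert)
    (simp_all add: IH map_pair[symmetric] pmf.map_comp o_def case_prod_unfold)
 also have "\<dots> = map_pmf (\<lambda>(p, q). (\<lambda>j. if j \<in> insert i I then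
    h j (\<lambda>c. if c \<in> Bk j then (if c \<in> Bk i then p c else q c) else d') else d))
    (pair_pmf (Pi_pmf (Bk i) d' g) (Pi_pmf ?U d' g))"
 proof (rule map_pmf_cong[OF refl])
  fix pq assume pq: "pq \<in> set_pmf (pair_pmf (Pi_pmf (Bk i) d' g) (Pi_pmf ?U d' g))"
  obtain p q where eq: "pq = (p, q)" by (cases pq)
  have p: "p \<in> set_pmf (Pi_pmf (Bk i) d' g)" and q: "q \<in> set_pmf (Pi_pmf ?U d' g)"
   using pq by (auto simp: eq)
  \<comment> \<open>Outside its block a draw has the default value, so \<open>h i\<close> may be
    given the restriction of a draw for the whole union.\<close>
  have "p = (\<lambda>c. if c \<in> Bk i then p c else d')"
   using set_Pi_pmf_subset[OF fin(2), of d' g] p by (auto simp: fun_eq_iff)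
  then have "h i p = h i (\<lambda>c. if c \<in> Bk i then p c else d')" by (rule arg_cong)
  moreover have "h i (\<lambda>c. if c \<in> Bk i then if c \<in> Bk i then p c else q c else d') =
   h i (\<lambda>c. if c \<in> Bk i then p c else d')" by (rule arg_cong[of _ _ "h i"]) auto
  ultimately have A: "h i p = h i (\<lambda>c. if c \<in> Bk i then if c \<in> Bk i then p c else q c else d')"
   by simp
  have B: "h j (\<lambda>c. if c \<in> Bk j then q c else d') =
    h j (\<lambda>c. if c \<in> Bk j then if c \<in> Bk i then p c else q c else d')" if "j \<in> I" for j
   using disj that by (intro arg_cong[of _ _ "h j"]) (auto simp: fun_eq_iff)
  show "(case pq of (p, q) \<Rightarrow> (\<lambda>j. if j \<in> I then h j (\<lambda>c. if c \<in> Bk j then q c else d') else d)(i := h i p))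
   = (case pq of (p, q) \<Rightarrow> (\<lambda>j. if j \<in> insert i I then
    h j (\<lambda>c. if c \<in> Bk j then (if c \<in> Bk i then p c else q c) else d') else d))"
   unfolding eq prod.case using A B by (intro ext) auto
 qed
 also have "\<dots> = map_pmf (\<lambda>y j. if j \<in> insert i I then h j (\<lambda>c. if c \<in> Bk j then y c else d') else d)
   (map_pmf (\<lambda>(f, g) x. if x \<in> Bk i then f x else g x)
    (pair_pmf (Pi_pmf (Bk i) d' g) (Pi_pmf ?U d' g)))"
  by (simp add: pmf.map_comp o_def case_prod_unfold)
 also have "map_pmf (\<lambda>(f, g) x. if x \<in> Bk i then f x else g x)
    (pair_pmf (Pi_pmf (Bk i) d' g) (Pi_pmf ?U d' g)) = Pi_pmf (Bk i \<union> ?U) d' g"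
  using fin disj by (subst Pi_pmf_union) auto
 finally show ?case by simp
qed

type_synonym array = "nat \<Rightarrow> nat"
type_synonym array_step = "(array \<Rightarrow> nat \<Rightarrow> nat pmf) \<times> (nat \<Rightarrow> nat)"

text \<open>The first component of a step is a randomised local kernel, the second a permutation
  that moves the results: cell \<open>c\<close> receives what was computed at
  \<open>snd s c\<close>. The permutation never depends on the data, so the traffic is known
  beforehand.\<close>

definition step_sem :: "nat \<Rightarrow> array_step \<Rightarrow> array \<Rightarrow> array pmf" where
 "step_sem L s x = map_pmf (\<lambda>y c. if c < L then y (snd s c) else 0) (Pi_pmf {..<L} 0 (fst s x))"

primrec prog_sem :: "nat \<Rightarrow> array_step list \<Rightarrow> array \<Rightarrow> array pmf" where
 "prog_sem L [] x = return_pmf x"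
| "prog_sem L (s # ss) x = bind_pmf (step_sem L s x) (prog_sem L ss)"

lemma prog_sem_append: "prog_sem L (ss @ ts) x = bind_pmf (prog_sem L ss x) (prog_sem L ts)"
 by (induction ss arbitrary: x) (auto simp: bind_return_pmf bind_assoc_pmf intro!: bind_pmf_cong)

lemma prog_sem_Nil: "prog_sem L [] = return_pmf"
 by (rule ext) simp

lemma prog_sem_single: "prog_sem L [s] x = step_sem L s x"
 by (simp only: prog_sem.simps(2) prog_sem_Nil bind_return_pmf')

definition block_local :: "nat \<Rightarrow> (array \<Rightarrow> nat \<Rightarrow> 'a) \<Rightarrow> bool" where
 "block_local B F \<longleftrightarrow> (\<forall>x y c. (\<forall>c'. c' div B = c div B \<longrightarrow> x c' = y c') \<longrightarrow> F x c = F y c)"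

definition valid_step :: "nat \<Rightarrow> nat \<Rightarrow> nat \<Rightarrow> array_step \<Rightarrow> bool" where
 "valid_step L B W s \<longleftrightarrow> block_local B (fst s) \<and>
   (\<forall>x c. (\<forall>c. x c < W) \<longrightarrow> set_pmf (fst s x c) \<subseteq> {..<W}) \<and>
   inj_on (snd s) {..<L} \<and> snd s ` {..<L} \<subseteq> {..<L}"

lemma step_sem_bounded:
 assumes "valid_step L B W s" "\<And>c. x c < W" "y \<in> set_pmf (step_sem L s x)"
 shows "y c < W"
proof -
 obtain z where z: "z \<in> set_pmf (Pi_pmf {..<L} 0 (fst s x))" "y = (\<lambda>c. if c < L then z (snd s c) else 0)"
  using assms(3) by (auto simp: step_sem_def)
 have "W > 0" using assms(2)[of 0] by simp
 moreover have "z c < W" if "c < L" for c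
 proof -
  have "z c \<in> set_pmf (fst s x c)" using z(1) that by (auto simp: set_Pi_pmf PiE_dflt_def)
  then show ?thesis using assms(1,2) unfolding valid_step_def by blast
 qed
 ultimately show ?thesis using assms(1) z(2) by (auto simp: valid_step_def subset_iff)
qed

text \<open>These are the cells whose new values go to machine \<open>j\<close>, in increasing
  order. Messages are delivered in the order of their senders and blocks are intervals, so the
  values lie in the memory of \<open>j\<close> in just this order.\<close>

definition received :: "nat \<Rightarrow> nat \<Rightarrow> (nat \<Rightarrow> nat) \<Rightarrow> nat \<Rightarrow> nat list" where
 "received L B \<phi> j = filter (\<lambda>p. p \<in> \<phi> ` {c. c < L \<and> c div B = j}) [0..<L]"

text \<open>A memory is a bare list of words without addresses. Zipping it with the known list
  \<open>received\<close> tells to which cell each word belongs; before the first round the memory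
  is the raw input, which \<open>inp\<close> reads.\<close>

definition decode :: "nat \<Rightarrow> nat \<Rightarrow> array_step list \<Rightarrow> (nat list \<Rightarrow> nat \<Rightarrow> nat) \<Rightarrow> nat \<Rightarrow> nat \<Rightarrow>
  nat list \<Rightarrow> nat \<Rightarrow> nat" where
 "decode L B prog inp r i mem c = (if c div B \<noteq> i \<or> L \<le> c then 0 else case r of 0 \<Rightarrow> inp mem (c mod B)
   | Suc r' \<Rightarrow> the (map_of (zip (received L B (snd (prog ! r')) i) mem) (snd (prog ! r') c)))"

text \<open>During the program every value is sent as a message, even to its own machine, so that a
  memory is a pure concatenation of messages. The additional last round writes the output
  locally.\<close>

definition compile :: "nat \<Rightarrow> nat \<Rightarrow> array_step list \<Rightarrow> (nat list \<Rightarrow> nat \<Rightarrow> nat) \<Rightarrow>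
  (array \<Rightarrow> nat \<Rightarrow> nat list) \<Rightarrow> mpc_algorithm" where
 "compile M B prog inp out = \<lparr>machines = M, rounds = length prog + 1,
   local_step = (\<lambda>r i mem. let x = decode (M * B) B prog inp r i mem in
    if r < length prog
    then map_pmf (\<lambda>y. ([], \<lambda>j. map y (filter (\<lambda>p. p div B = i) (received (M * B) B (snd (prog ! r)) j))))
       (Pi_pmf {c. c < M * B \<and> c div B = i} 0 (fst (prog ! r) x))
    else return_pmf (out x i, \<lambda>_. []))\<rparr>"

lemma machines_compile [simp]: "machines (compile M B prog inp out) = M"
 and rounds_compile [simp]: "rounds (compile M B prog inp out) = length prog + 1"
 by (simp_all add: compile_def)

lemma concat_filter_blocks:
 assumes "sorted xs" "\<forall>p\<in>set xs. p < M * B"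
 shows "concat (map (\<lambda>i. filter (\<lambda>p. p div B = i) xs) [0..<M]) = xs"
proof -
 have "concat (map (\<lambda>i. filter (\<lambda>p. p div B = i) xs) [0..<m]) = filter (\<lambda>p. p div B < m) xs" for m
 proof (induction m)
  case 0
  then show ?case by simp
 next
  case (Suc m)
  have "filter (\<lambda>p. p div B < m) xs @ filter (\<lambda>p. p div B = m) xs = filter (\<lambda>p. p div B < Suc m) xs"
   using assms(1)
  proof (induction xs)
   case Nil
   then show ?case by simp
  next
   case (Cons a xs)
   show ?case
   proof (cases "a div B < m")
    case True
    then show ?thesis using Cons by auto
   next
    case False
    then have "filter (\<lambda>p. p div B < m) xs = []"
     using Cons.prems by (auto simp: filter_empty_conv)
      (meson div_le_mono le_trans not_le)
    then show ?thesis using Cons False by auto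
   qed
  qed
  then show ?case using Suc by simp
 qed
 from this[of M] have "concat (map (\<lambda>i. filter (\<lambda>p. p div B = i) xs) [0..<M]) = filter (\<lambda>p. p div B < M) xs" .
 also have "\<dots> = xs" using assms(2) by (auto simp: filter_id_conv less_mult_imp_div_less)
 finally show ?thesis .
qed

lemma length_received_le:
 assumes "inj_on \<phi> {..<L}" "B > 0"
 shows "length (received L B \<phi> j) \<le> B"
proof -
 have "length (received L B \<phi> j) = card (set (received L B \<phi> j))"
  by (subst distinct_card) (auto simp: received_def)
 also have "\<dots> \<le> card (\<phi> ` {c. c < L \<and> c div B = j})"
  by (intro card_mono) (auto simp: received_def)
 also have "\<dots> \<le> card {c. c < L \<and> c div B = j}" by (intro card_image_le) simp
 also have "\<dots> \<le> card {j * B..<j * B + B}"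
  using assms(2) by (intro card_mono) (auto simp: dividend_less_div_times add.commute[of _ B])
 finally show ?thesis by simp
qed

lemma sum_length_sent_le:
 assumes "inj_on \<phi> {..<L}" "B > 0"
 shows "(\<Sum>j<M. length (filter (\<lambda>p. p div B = i) (received L B \<phi> j))) \<le> B"
proof -
 have "(\<Sum>j<M. length (filter (\<lambda>p. p div B = i) (received L B \<phi> j))) =
  (\<Sum>j<M. card {p \<in> \<phi> ` {c. c < L \<and> c div B = j}. p < L \<and> p div B = i})"
 proof (rule sum.cong[OF refl])
  fix j
  have "length (filter (\<lambda>p. p div B = i) (received L B \<phi> j)) =
   card (set (filter (\<lambda>p. p div B = i) (received L B \<phi> j)))"
   by (subst distinct_card) (auto simp: received_def)
  also have "set (filter (\<lambda>p. p div B = i) (received L B \<phi> j)) =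
   {p \<in> \<phi> ` {c. c < L \<and> c div B = j}. p < L \<and> p div B = i}" by (auto simp: received_def)
  finally show "length (filter (\<lambda>p. p div B = i) (received L B \<phi> j)) =
   card {p \<in> \<phi> ` {c. c < L \<and> c div B = j}. p < L \<and> p div B = i}" .
 qed
 also have "\<dots> = card (\<Union>j<M. {p \<in> \<phi> ` {c. c < L \<and> c div B = j}. p < L \<and> p div B = i})"
  using assms(1) by (subst card_UN_disjoint) (auto simp: inj_on_def)
 also have "\<dots> \<le> card {i * B..<i * B + B}"
  using assms(2) by (intro card_mono) (auto simp: dividend_less_div_times add.commute[of _ B])
 finally show ?thesis by simp
qed

definition mem_of :: "nat \<Rightarrow> nat \<Rightarrow> (nat \<Rightarrow> nat) \<Rightarrow> array \<Rightarrow> mpc_memory" where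
 "mem_of L B \<phi> y j = map y (received L B \<phi> j)"

lemma set_received:
 assumes "snd s ` {..<L} \<subseteq> {..<L}"
 shows "set (received L B (snd s) j) = snd s ` {c. c < L \<and> c div B = j}"
 using assms by (auto simp: received_def)

lemma decode_mem_of:
 assumes "valid_step L B W (prog ! r)" "c < L" "c div B = i"
 shows "decode L B prog inp (Suc r) i (mem_of L B (snd (prog ! r)) y i) c = y (snd (prog ! r) c)"
proof -
 let ?l = "received L B (snd (prog ! r)) i"
 have "snd (prog ! r) c \<in> set ?l"
  using assms by (subst set_received) (auto simp: valid_step_def)
 then have "map_of (zip ?l (map y ?l)) (snd (prog ! r) c) = Some (y (snd (prog ! r) c))"
  by (simp add: map_of_zip_map)
 then show ?thesis using assms(2,3) by (auto simp: decode_def mem_of_def)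
qed

text \<open>Each machine sends the values of its own \<open>B\<close> cells once and receives one
  value for each of them, so no outcome violates a limit. Locality of the kernel lets a machine work
  with its partial view \<open>decode\<close> instead of the whole array, and
  \<open>Pi_pmf_blocks\<close> merges the private randomness of the machines into one product over
  all cells.\<close>

lemma mpc_round_compile:
 assumes val: "valid_step (M * B) B W (prog ! r)" and r: "r < length prog" and B: "0 < B" "B \<le> S"
  and dec: "\<And>i c. i < M \<Longrightarrow> c < M * B \<Longrightarrow> c div B = i \<Longrightarrow> decode (M * B) B prog inp r i (mem i) c = x c"
  and bnd: "\<And>c. x c < W"
 shows "mpc_round W S (compile M B prog inp out) r mem =
  map_pmf (\<lambda>y. Some (mem_of (M * B) B (snd (prog ! r)) y)) (Pi_pmf {..<M * B} 0 (fst (prog ! r) x))"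
proof -
 let ?L = "M * B" and ?\<phi> = "snd (prog ! r)" and ?G = "fst (prog ! r)"
 let ?Bk = "\<lambda>i. {c. c < ?L \<and> c div B = i}"
 let ?h = "\<lambda>i y. ([] :: nat list, \<lambda>j. map y (filter (\<lambda>p. p div B = i) (received ?L B ?\<phi> j)))"
 have inj: "inj_on ?\<phi> {..<?L}" and im: "?\<phi> ` {..<?L} \<subseteq> {..<?L}"
  using val by (auto simp: valid_step_def)
 have G: "Pi_pmf (?Bk i) 0 (?G (decode ?L B prog inp r i (mem i))) = Pi_pmf (?Bk i) 0 (?G x)" if "i < M" for i
 proof (rule Pi_pmf_cong[OF refl refl])
  fix c assume c: "c \<in> ?Bk i"
  have "\<forall>c'. c' div B = c div B \<longrightarrow> decode ?L B prog inp r i (mem i) c' = x c'"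
  proof (intro allI impI)
   fix c' assume "c' div B = c div B"
   then have "c' div B = i" "c' < ?L" using c that B
    by (auto simp: less_mult_imp_div_less) (metis div_less_iff_less_mult that)
   then show "decode ?L B prog inp r i (mem i) c' = x c'" using dec that by simp
  qed
  then show "?G (decode ?L B prog inp r i (mem i)) c = ?G x c"
   using val unfolding valid_step_def block_local_def by blast
 qed
 have "Pi_pmf {..<M} ([], \<lambda>_. []) (\<lambda>i. local_step (compile M B prog inp out) r i (mem i)) =
  Pi_pmf {..<M} ([], \<lambda>_. []) (\<lambda>i. map_pmf (?h i) (Pi_pmf (?Bk i) 0 (?G x)))"
  using r by (intro Pi_pmf_cong) (simp_all add: compile_def Let_def G)
 also have "\<dots> = map_pmf (\<lambda>y i. if i \<in> {..<M} then ?h i (\<lambda>c. if c \<in> ?Bk i then y c else 0) else ([], \<lambda>_. []))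
   (Pi_pmf (\<Union>i\<in>{..<M}. ?Bk i) 0 (?G x))"
  by (intro Pi_pmf_blocks) auto
 also have "(\<Union>i\<in>{..<M}. ?Bk i) = {..<?L}" using B by (auto simp: less_mult_imp_div_less)
 finally have P: "Pi_pmf {..<M} ([], \<lambda>_. []) (\<lambda>i. local_step (compile M B prog inp out) r i (mem i)) =
  map_pmf (\<lambda>y i. if i \<in> {..<M} then ?h i (\<lambda>c. if c \<in> ?Bk i then y c else 0) else ([], \<lambda>_. []))
   (Pi_pmf {..<?L} 0 (?G x))" .
 have del: "deliver M (\<lambda>i. if i \<in> {..<M} then ?h i (\<lambda>c. if c \<in> ?Bk i then y c else 0) else ([], \<lambda>_. []))
   = mem_of ?L B ?\<phi> y" for y
 proof
  fix j
  have "deliver M (\<lambda>i. if i \<in> {..<M} then ?h i (\<lambda>c. if c \<in> ?Bk i then y c else 0) else ([], \<lambda>_. [])) j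
   = concat (map (\<lambda>i. map y (filter (\<lambda>p. p div B = i) (received ?L B ?\<phi> j))) [0..<M])"
   unfolding deliver_def by (auto intro!: arg_cong[of _ _ concat] simp: received_def)
  also have "\<dots> = map y (concat (map (\<lambda>i. filter (\<lambda>p. p div B = i) (received ?L B ?\<phi> j)) [0..<M]))"
   by (simp add: map_concat o_def)
  also have "concat (map (\<lambda>i. filter (\<lambda>p. p div B = i) (received ?L B ?\<phi> j)) [0..<M]) = received ?L B ?\<phi> j"
   by (intro concat_filter_blocks) (auto simp: received_def intro: sorted_wrt_filter)
  finally show "deliver M (\<lambda>i. if i \<in> {..<M} then ?h i (\<lambda>c. if c \<in> ?Bk i then y c else 0) else ([], \<lambda>_. [])) j
   = mem_of ?L B ?\<phi> y j" by (simp add: mem_of_def)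
 qed
 have lim: "respects_limits W S M (\<lambda>i. if i \<in> {..<M} then ?h i (\<lambda>c. if c \<in> ?Bk i then y c else 0) else ([], \<lambda>_. []))"
  if y: "y \<in> set_pmf (Pi_pmf {..<?L} 0 (?G x))" for y
 proof -
  have yb: "y c < W" if "c < ?L" for c
  proof -
   have "y c \<in> set_pmf (?G x c)" using y that by (auto simp: set_Pi_pmf PiE_dflt_def)
   then show ?thesis using val bnd unfolding valid_step_def by blast
  qed
  have rec: "(\<Sum>j<M. length (filter (\<lambda>p. p div B = j) (received ?L B ?\<phi> i))) \<le> S" for i
  proof -
   have "(\<Sum>j<M. length (filter (\<lambda>p. p div B = j) (received ?L B ?\<phi> i))) =
    length (concat (map (\<lambda>j. filter (\<lambda>p. p div B = j) (received ?L B ?\<phi> i)) [0..<M]))"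
    by (simp add: length_concat o_def sum_list_distinct_conv_sum_set atLeast0LessThan interv_sum_list_conv_sum_set_nat)
   also have "\<dots> = length (received ?L B ?\<phi> i)"
    by (subst concat_filter_blocks) (auto simp: received_def intro: sorted_wrt_filter)
   also have "\<dots> \<le> S" using length_received_le[OF inj B(1), of i] B(2) by simp
   finally show ?thesis .
  qed
  show ?thesis
   unfolding respects_limits_def del
   using length_received_le[OF inj B(1)] B sum_length_sent_le[OF inj B(1), where M = M] rec yb
   by (auto simp: mem_of_def received_def intro: order_trans)
 qed
 show ?thesis
  unfolding mpc_round_def machines_compile P pmf.map_comp
  by (rule map_pmf_cong[OF refl]) (simp add: lim[simplified] del[simplified] o_def)
qed

text \<open>The memory between two rounds names values by their source cell, whereas
  \<open>prog_sem\<close> describes the array after the move. The invariant translates between them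
  by the inverse of the last permutation.\<close>

lemma mpc_run_compile:
 assumes val: "\<And>s. s \<in> set prog \<Longrightarrow> valid_step (M * B) B W s" and B: "0 < B" "B \<le> S"
  and x0: "\<And>c. x0 c < W" "\<And>c. c < M * B \<Longrightarrow> x0 c = inp (mem (c div B)) (c mod B)"
  and r: "r \<le> length prog"
 shows "mpc_run W S (compile M B prog inp out) mem r = map_pmf (\<lambda>x. Some (case r of 0 \<Rightarrow> mem
   | Suc r' \<Rightarrow> mem_of (M * B) B (snd (prog ! r')) (\<lambda>p. x (inv_into {..<M * B} (snd (prog ! r')) p))))
  (prog_sem (M * B) (take r prog) x0)
  \<and> (\<forall>x\<in>set_pmf (prog_sem (M * B) (take r prog) x0). \<forall>c. x c < W)"
 using r
proof (induction r)
 case 0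
 then show ?case using x0 by simp
next
 case (Suc r)
 let ?L = "M * B"
 let ?s = "prog ! r"
 let ?m = "\<lambda>x. (case r of 0 \<Rightarrow> mem
   | Suc r' \<Rightarrow> mem_of (M * B) B (snd (prog ! r')) (\<lambda>p. x (inv_into {..<M * B} (snd (prog ! r')) p)))"
 have IH: "mpc_run W S (compile M B prog inp out) mem r = map_pmf (\<lambda>x. Some (?m x)) (prog_sem ?L (take r prog) x0)"
  and bnd: "\<And>x c. x \<in> set_pmf (prog_sem ?L (take r prog) x0) \<Longrightarrow> x c < W"
  using Suc by auto
 have vs: "valid_step ?L B W ?s" using val Suc.prems by simp
 have tk: "take (Suc r) prog = take r prog @ [?s]" using Suc.prems by (simp add: take_Suc_conv_app_nth)
 have rnd: "mpc_round W S (compile M B prog inp out) r (?m x) =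
   map_pmf (\<lambda>y. Some (mem_of ?L B (snd ?s) y)) (Pi_pmf {..<?L} 0 (fst ?s x))"
  if x: "x \<in> set_pmf (prog_sem ?L (take r prog) x0)" for x
 proof (rule mpc_round_compile[OF vs _ B])
  fix i c assume c: "i < M" "c < ?L" "c div B = i"
  show "decode ?L B prog inp r i (?m x i) c = x c"
  proof (cases r)
   case 0
   then show ?thesis using c x x0 by (auto simp: decode_def)
  next
   case (Suc r')
   then have "valid_step ?L B W (prog ! r')" using val Suc.prems \<open>Suc r \<le> length prog\<close> by simp
   then show ?thesis using c unfolding Suc
    by (simp add: decode_mem_of) (simp add: valid_step_def inv_into_f_f)
  qed
 qed (use Suc.prems x bnd in auto)
 have "mpc_run W S (compile M B prog inp out) mem (Suc r) =
  bind_pmf (prog_sem ?L (take r prog) x0) (\<lambda>x. mpc_round W S (compile M B prog inp out) r (?m x))"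
  by (simp add: IH bind_spmf_def bind_map_pmf)
 also have "\<dots> = bind_pmf (prog_sem ?L (take r prog) x0) (\<lambda>x.
   map_pmf (\<lambda>y. Some (mem_of ?L B (snd ?s) y)) (Pi_pmf {..<?L} 0 (fst ?s x)))"
  by (intro bind_pmf_cong refl rnd)
 also have "\<dots> = bind_pmf (prog_sem ?L (take r prog) x0) (\<lambda>x.
   map_pmf (\<lambda>y. Some (mem_of ?L B (snd ?s) (\<lambda>p. (if inv_into {..<?L} (snd ?s) p < ?L then
     y (snd ?s (inv_into {..<?L} (snd ?s) p)) else 0)))) (Pi_pmf {..<?L} 0 (fst ?s x)))"
 proof (intro bind_pmf_cong map_pmf_cong refl arg_cong[of _ _ Some] ext)
  fix y j
  show "mem_of ?L B (snd ?s) y j = mem_of ?L B (snd ?s) (\<lambda>p. (if inv_into {..<?L} (snd ?s) p < ?L then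
     y (snd ?s (inv_into {..<?L} (snd ?s) p)) else 0)) j"
   using vs by (auto simp: mem_of_def received_def valid_step_def inv_into_f_f)
 qed
 also have "\<dots> = map_pmf (\<lambda>x. Some (mem_of ?L B (snd ?s) (\<lambda>p. x (inv_into {..<?L} (snd ?s) p))))
   (prog_sem ?L (take (Suc r) prog) x0)"
  by (simp add: tk prog_sem_append step_sem_def map_bind_pmf pmf.map_comp o_def
    prog_sem_Nil bind_return_pmf' bind_map_pmf bind_return_pmf map_pmf_def[symmetric])
 finally have 1: "mpc_run W S (compile M B prog inp out) mem (Suc r) =
   map_pmf (\<lambda>x. Some (mem_of ?L B (snd ?s) (\<lambda>p. x (inv_into {..<?L} (snd ?s) p))))
   (prog_sem ?L (take (Suc r) prog) x0)" .
 moreover have "\<forall>x\<in>set_pmf (prog_sem ?L (take (Suc r) prog) x0). \<forall>c. x c < W"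
  using step_sem_bounded[OF vs bnd] by (auto simp: tk prog_sem_append prog_sem_Nil bind_return_pmf')
 ultimately show ?case by simp
qed

theorem mpc_result_compile:
 assumes val: "\<And>s. s \<in> set prog \<Longrightarrow> valid_step (M * B) B W s" and B: "0 < B" "B \<le> S"
  and x0: "\<And>c. x0 c < W" "\<And>c. c < M * B \<Longrightarrow> x0 c = inp (mem (c div B)) (c mod B)"
  and loc: "\<And>x y i. (\<forall>c. c div B = i \<longrightarrow> x c = y c) \<Longrightarrow> out x i = out y i"
  and out: "\<And>x i. (\<forall>c. x c < W) \<Longrightarrow> length (out x i) \<le> S \<and> set (out x i) \<subseteq> {..<W}"
 shows "mpc_result W S (compile M B prog inp out) mem =
  map_pmf (\<lambda>x. Some (\<lambda>j. if j < M then out x j else [])) (prog_sem (M * B) prog x0)"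
proof -
 let ?L = "M * B" and ?r = "length prog"
 let ?m = "\<lambda>x. (case ?r of 0 \<Rightarrow> mem
   | Suc r' \<Rightarrow> mem_of (M * B) B (snd (prog ! r')) (\<lambda>p. x (inv_into {..<M * B} (snd (prog ! r')) p)))"
 have "mpc_run W S (compile M B prog inp out) mem ?r =
   map_pmf (\<lambda>x. Some (?m x)) (prog_sem ?L (take ?r prog) x0)
  \<and> (\<forall>x\<in>set_pmf (prog_sem ?L (take ?r prog) x0). \<forall>c. x c < W)"
  by (rule mpc_run_compile[OF _ B _ _ order_refl]) (use val x0 in auto)
 then have run: "mpc_run W S (compile M B prog inp out) mem ?r = map_pmf (\<lambda>x. Some (?m x)) (prog_sem ?L prog x0)"
  and bnd: "\<And>x c. x \<in> set_pmf (prog_sem ?L prog x0) \<Longrightarrow> x c < W"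
  by auto
 have rnd: "mpc_round W S (compile M B prog inp out) ?r (?m x) =
   return_pmf (Some (\<lambda>j. if j < M then out x j else []))"
  if x: "x \<in> set_pmf (prog_sem ?L prog x0)" for x
 proof -
  have dec: "out (decode ?L B prog inp ?r i (?m x i)) i = out x i" if "i < M" for i
  proof (intro loc allI impI)
   fix c assume ci: "c div B = i"
   then have c: "c < ?L" using that B by (metis div_less_iff_less_mult)
   show "decode ?L B prog inp ?r i (?m x i) c = x c"
   proof (cases ?r)
    case 0
    then show ?thesis using c ci x x0 by (auto simp: decode_def)
   next
    case (Suc r')
    then have "valid_step ?L B W (prog ! r')" using val by simp
    then show ?thesis using c ci unfolding Suc
     by (simp add: decode_mem_of) (simp add: valid_step_def inv_into_f_f)
   qed
  qed
  have "Pi_pmf {..<M} ([], \<lambda>_. []) (\<lambda>i. local_step (compile M B prog inp out) ?r i (?m x i)) =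
    Pi_pmf {..<M} ([], \<lambda>_. []) (\<lambda>i. return_pmf (out x i, \<lambda>_. []))"
   using dec by (intro Pi_pmf_cong) (simp_all add: compile_def Let_def)
  also have "\<dots> = return_pmf (\<lambda>i. if i \<in> {..<M} then (out x i, \<lambda>_. []) else ([], \<lambda>_. []))"
   by (rule Pi_pmf_return_pmf) simp
  finally have P: "Pi_pmf {..<M} ([], \<lambda>_. []) (\<lambda>i. local_step (compile M B prog inp out) ?r i (?m x i)) =
    return_pmf (\<lambda>i. if i \<in> {..<M} then (out x i, \<lambda>_. []) else ([], \<lambda>_. []))" .
  have del: "deliver M (\<lambda>i. if i \<in> {..<M} then (out x i, \<lambda>_. []) else ([], \<lambda>_. [])) =
    (\<lambda>j. if j < M then out x j else [])"
  proof
   fix j :: nat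
   have "concat (map (\<lambda>i. snd (if i \<in> {..<M} then (out x i, \<lambda>_. []) else ([], \<lambda>_. [])) j) [0..<M]) = []"
    by auto
   then show "deliver M (\<lambda>i. if i \<in> {..<M} then (out x i, \<lambda>_. []) else ([], \<lambda>_. [])) j =
    (if j < M then out x j else [])" unfolding deliver_def by simp
  qed
  have "respects_limits W S M (\<lambda>i. if i \<in> {..<M} then (out x i, \<lambda>_. []) else ([], \<lambda>_. []))"
   unfolding respects_limits_def del using out[of x] bnd[OF x] by auto
  then show ?thesis unfolding mpc_round_def machines_compile P using del by simp
 qed
 have "mpc_result W S (compile M B prog inp out) mem =
  bind_pmf (prog_sem ?L prog x0) (\<lambda>x. mpc_round W S (compile M B prog inp out) ?r (?m x))"
  by (simp add: mpc_result_def run bind_spmf_def bind_map_pmf)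
 also have "\<dots> = bind_pmf (prog_sem ?L prog x0) (\<lambda>x. return_pmf (Some (\<lambda>j. if j < M then out x j else [])))"
  by (intro bind_pmf_cong refl rnd)
 finally show ?thesis by (simp add: map_pmf_def)
qed

section \<open>Columnsort\<close>

definition bsort :: "nat \<Rightarrow> (nat \<Rightarrow> bool) \<Rightarrow> nat \<Rightarrow> bool" where
 "bsort r b c \<longleftrightarrow> c mod r < card {c'. c' div r = c div r \<and> b c'}"

definition seg_sort :: "nat \<Rightarrow> (nat \<Rightarrow> nat) \<Rightarrow> nat \<Rightarrow> nat" where
 "seg_sort r x c = sort (map x [c div r * r..<c div r * r + r]) ! (c mod r)"

lemma div_eq_iff_seg: "0 < r \<Longrightarrow> c div r = q \<longleftrightarrow> q * r \<le> c \<and> c < q * r + (r::nat)"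
 using dividend_less_div_times[of r c] div_times_less_eq_dividend[of c r] div_nat_eqI[of r q c]
 by (auto simp: ac_simps)

lemma seg_eq: "0 < r \<Longrightarrow> {c'. c' div r = q} = {q * r..<q * r + (r::nat)}"
 by (auto simp only: div_eq_iff_seg atLeastLessThan_iff)

lemma finite_seg: "0 < r \<Longrightarrow> finite {c'. c' div r = q \<and> P (c'::nat)}"
 by (rule finite_subset[of _ "{q * r..<q * r + r}"]) (auto simp only: div_eq_iff_seg atLeastLessThan_iff finite_atLeastLessThan)

lemma card_seg_le: "0 < r \<Longrightarrow> card {c'. c' div r = q \<and> P (c'::nat)} \<le> r"
 using card_mono[OF finite_atLeastLessThan, of "{c'. c' div r = q \<and> P c'}" "q * r" "q * r + r"]
 by (simp add: div_eq_iff_seg subset_iff)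

lemma div_less_iff: "0 < r \<Longrightarrow> c div r < s \<longleftrightarrow> c < r * (s::nat)"
 by (simp add: div_less_iff_less_mult mult.commute)

lemma sorted_nth_less_iff:
 fixes ys :: "nat list"
 assumes "sorted ys" "i < length ys"
 shows "ys ! i < \<tau> \<longleftrightarrow> i < length (filter (\<lambda>y. y < \<tau>) ys)"
 using assms
proof (induction ys arbitrary: i)
 case Nil
 then show ?case by simp
next
 case (Cons a ys)
 show ?case
 proof (cases "a < \<tau>")
  case True
  then show ?thesis using Cons by (cases i) auto
 next
  case False
  then have "filter (\<lambda>y. y < \<tau>) (a # ys) = []"
   using Cons.prems by (auto simp: filter_empty_conv)
  moreover have "\<not> (a # ys) ! i < \<tau>"
   using Cons.prems False by (cases i) (simp, metis Suc_less_eq leD le_less_trans length_Cons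
     nth_Cons_Suc nth_mem not_le sorted_simps(2))
  ultimately show ?thesis by simp
 qed
qed

text \<open>The 0-1 principle: sorting commutes with every threshold predicate, and by
  \<open>less_iff_eqI\<close> a number is determined by its thresholds. Columnsort thus has to be
  proved only for sets of marked cells, on which \<open>bsort\<close> acts.\<close>

lemma seg_sort_less_iff:
 assumes "0 < r"
 shows "seg_sort r x c < \<tau> \<longleftrightarrow> bsort r (\<lambda>c. x c < \<tau>) c"
proof -
 let ?l = "[c div r * r..<c div r * r + r]"
 have "seg_sort r x c < \<tau> \<longleftrightarrow> c mod r < length (filter (\<lambda>y. y < \<tau>) (sort (map x ?l)))"
  unfolding seg_sort_def using assms by (subst sorted_nth_less_iff) auto
 also have "length (filter (\<lambda>y. y < \<tau>) (sort (map x ?l))) = length (filter (\<lambda>y. y < \<tau>) (map x ?l))"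
  by (simp add: filter_sort)
 also have "\<dots> = length (filter (\<lambda>c. x c < \<tau>) ?l)" by (simp add: filter_map o_def)
 also have "\<dots> = card (set (filter (\<lambda>c. x c < \<tau>) ?l))" by (subst distinct_card) auto
 also have "set (filter (\<lambda>c. x c < \<tau>) ?l) = {c'. c' div r = c div r \<and> x c' < \<tau>}"
  by (auto simp: div_eq_iff_seg[OF assms])
 finally show ?thesis by (simp add: bsort_def)
qed

lemma less_iff_eqI:
 assumes "\<And>\<tau>::nat. x < \<tau> \<longleftrightarrow> y < \<tau>" shows "x = y"
 using assms[of x] assms[of y] by (cases x y rule: linorder_cases) auto

text \<open>Each aligned block of \<open>r * s\<close> cells is a matrix whose \<open>s\<close>
  columns of height \<open>r\<close> are stored one after another. Reading through
  \<open>rot r s\<close> takes the entries in sequence and lays them out row by row, which is the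
  transposition of columnsort.\<close>

definition rot :: "nat \<Rightarrow> nat \<Rightarrow> nat \<Rightarrow> nat" where
 "rot r s c = c div (r * s) * (r * s) + (c mod r) * s + (c div r) mod s"

text \<open>The shift by half a column. Instead of an extra column with infinite sentinels, the
  first and the last half column, which are left over, share the last column; the smaller of them
  comes first.\<close>

definition shift_down :: "nat \<Rightarrow> nat \<Rightarrow> nat \<Rightarrow> nat" where
 "shift_down r s c = (let p = c mod (r * s) in c div (r * s) * (r * s) +
   (if p < r * s - r then p + r div 2 else if p < r * s - r div 2 then p - (r * s - r) else p))"

definition shift_up :: "nat \<Rightarrow> nat \<Rightarrow> nat \<Rightarrow> nat" where
 "shift_up r s c = (let p = c mod (r * s) in c div (r * s) * (r * s) +
   (if p < r div 2 then p + (r * s - r) else if p < r * s - r div 2 then p - r div 2 else p))"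

lemma card_bsort:
 assumes "0 < r"
 shows "card {c. c < r * s \<and> bsort r b c} = card {c. c < r * s \<and> b c}"
proof -
 have split: "card {c. c < r * s \<and> P c} = (\<Sum>q<s. card {c. c div r = q \<and> P c})" for P
 proof -
  have "{c. c < r * s \<and> P c} = (\<Union>q<s. {c. c div r = q \<and> P c})"
   using assms by (auto simp: div_less_iff_less_mult mult.commute)
  also have "card \<dots> = (\<Sum>q<s. card {c. c div r = q \<and> P c})"
   using assms by (subst card_UN_disjoint) (auto simp: finite_seg)
  finally show ?thesis .
 qed
 have "card {c. c div r = q \<and> bsort r b c} = card {c. c div r = q \<and> b c}" for q
 proof -
  let ?z = "card {c. c div r = q \<and> b c}"
  have "{c. c div r = q \<and> bsort r b c} = (\<lambda>i. q * r + i) ` {..<?z}"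
  proof (intro equalityI subsetI)
   fix c assume "c \<in> {c. c div r = q \<and> bsort r b c}"
   then have "c = q * r + c mod r" "c mod r < ?z" by (auto simp: bsort_def)
   then show "c \<in> (\<lambda>i. q * r + i) ` {..<?z}" by blast
  next
   fix c assume "c \<in> (\<lambda>i. q * r + i) ` {..<?z}"
   then obtain i where i: "c = q * r + i" "i < ?z" by auto
   moreover have "i < r" using i(2) card_seg_le[OF assms, of q b] by linarith
   ultimately show "c \<in> {c. c div r = q \<and> bsort r b c}" by (auto simp: bsort_def)
  qed
  then show ?thesis by (simp add: card_image)
 qed
 then show ?thesis by (simp add: split)
qed

lemma bsort_fixed:
 assumes "0 < r" and dc: "\<And>c c'. c div r = q \<Longrightarrow> c' div r = q \<Longrightarrow> c \<le> c' \<Longrightarrow> b c' \<Longrightarrow> b c"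
  and "c div r = q"
 shows "bsort r b c \<longleftrightarrow> b c"
proof -
 let ?A = "{c'. c' div r = q \<and> b c'}"
 have c: "c = q * r + c mod r" using assms(3) div_mult_mod_eq[of c r] by simp
 have fin: "finite ?A" by (rule finite_seg[OF assms(1)])
 show ?thesis
 proof
  assume "b c"
  have "(\<lambda>i. q * r + i) ` {..c mod r} \<subseteq> ?A"
  proof
   fix c' assume "c' \<in> (\<lambda>i. q * r + i) ` {..c mod r}"
   then obtain i where i: "c' = q * r + i" "i \<le> c mod r" by auto
   then have "i < r" using assms(1) by (meson le_less_trans mod_less_divisor)
   then have d: "c' div r = q" using i by auto
   have "c' \<le> c" using i c by linarith
   then show "c' \<in> ?A" using dc[OF d assms(3)] \<open>b c\<close> d by blast
  qed
  from card_mono[OF fin this] have "Suc (c mod r) \<le> card ?A" by (simp add: card_image)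
  then show "bsort r b c" using assms(3) by (simp add: bsort_def)
 next
  assume srt: "bsort r b c"
  show "b c"
  proof (rule ccontr)
   assume "\<not> b c"
   have "?A \<subseteq> (\<lambda>i. q * r + i) ` {..<c mod r}"
   proof
    fix c' assume c': "c' \<in> ?A"
    then have q': "c' div r = q" and "b c'" by auto
    then have "\<not> c \<le> c'" using dc[OF assms(3) q'] \<open>\<not> b c\<close> by blast
    moreover have "c' = q * r + c' mod r" using div_mult_mod_eq[of c' r] q' by simp
    ultimately have "c' mod r < c mod r" using c by linarith
    then show "c' \<in> (\<lambda>i. q * r + i) ` {..<c mod r}" using \<open>c' = q * r + c' mod r\<close> by blast
   qed
   from card_mono[OF _ this] have "card ?A \<le> c mod r" by (simp add: card_image)
   then show False using srt assms(3) by (simp add: bsort_def)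
  qed
 qed
qed

lemma bsort_mono_seg:
 assumes "bsort r b c'" "c div r = c' div r" "c \<le> c'"
 shows "bsort r b c"
proof -
 have 1: "c' div r * r + c mod r = c" using div_mult_mod_eq[of c r] assms(2) by simp
 have 2: "c' div r * r + c' mod r = c'" by (rule div_mult_mod_eq)
 have "c mod r \<le> c' mod r" using 1 2 assms(3) by linarith
 then show ?thesis using assms(1,2) by (simp add: bsort_def)
qed

lemma bsort_const:
 assumes "0 < r" "\<And>c'. c' div r = c div r \<Longrightarrow> b c' = v"
 shows "bsort r b c = v"
proof -
 have "bsort r b c \<longleftrightarrow> b c"
  by (rule bsort_fixed[OF assms(1) _ refl]) (use assms(2) in blast)
 then show ?thesis using assms(2)[OF refl] by simp
qed

text \<open>The number of marked cells differs by at most \<open>s\<close> between any two columns after the first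
  transposition, because each original column contributes to two new columns up to one cell equally.\<close>

lemma columnsort_window:
 assumes "0 < r" "0 < s" "s dvd r" "2 * (s * s) \<le> r"
  and b1: "\<And>c c'. bsort1 c' \<Longrightarrow> c div r = c' div r \<Longrightarrow> c \<le> c' \<Longrightarrow> bsort1 c"
  and b4: "\<And>p. p < r * s \<Longrightarrow> b4 p = bsort r (\<lambda>p. bsort1 (rot r s p)) (rot s r p)"
 obtains lo hi where "lo \<le> hi" "hi \<le> lo + r div 2" "\<And>p. p < r * s \<Longrightarrow> p < lo \<Longrightarrow> b4 p"
  "\<And>p. p < r * s \<Longrightarrow> hi \<le> p \<Longrightarrow> \<not> b4 p"
proof -
 \<comment> \<open>\<open>R q\<close> collects the marked rows of column \<open>q\<close> after the
   first transposition. As the original columns were sorted, it shrinks when \<open>q\<close> grows,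
   so the columns 0 and \<open>s - 1\<close> are the extreme ones.\<close>
 define R where "R q = {row. row < r \<and> bsort1 (row * s + q)}" for q
 define z where "z q = card (R q)" for q
 have finR: "finite (R q)" for q by (simp add: R_def)
 obtain t where t: "r = s * t" using assms(3) by auto
 have t0: "t > 0" using assms(1) t by auto
 have col: "(row * s + q) div r = row div t" if "q < s" for row q
  using that by (simp add: t div_mult2_eq)
 have z: "card {c'. c' div r = q \<and> bsort1 (rot r s c')} = z q" if "q < s" for q
 proof -
  have "{c'. c' div r = q \<and> bsort1 (rot r s c')} = (\<lambda>row. q * r + row) ` R q"
  proof (intro equalityI subsetI)
   fix c assume c: "c \<in> {c'. c' div r = q \<and> bsort1 (rot r s c')}"
   then have "c < r * s" using that div_less_iff[OF assms(1), of c s] by auto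
   then have "rot r s c = c mod r * s + q" using c that by (auto simp: rot_def)
   then have "c mod r \<in> R q" using c assms(1) by (auto simp: R_def)
   moreover have "c = q * r + c mod r" using c by (auto simp: mult.commute)
   ultimately show "c \<in> (\<lambda>row. q * r + row) ` R q" by blast
  next
   fix c assume "c \<in> (\<lambda>row. q * r + row) ` R q"
   then obtain row where row: "c = q * r + row" "row < r" "bsort1 (row * s + q)"
    by (auto simp: R_def)
   then have d: "c div r = q" "c mod r = row" by auto
   then have "c < r * s" using that div_less_iff[OF assms(1), of c s] by auto
   then have "rot r s c = row * s + q" using d that by (auto simp: rot_def)
   then show "c \<in> {c'. c' div r = q \<and> bsort1 (rot r s c')}" using d row by auto
  qed
  then show ?thesis by (simp add: z_def card_image)
 qed
 have b4': "b4 p \<longleftrightarrow> p div s < z (p mod s)" if "p < r * s" for p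
 proof -
  have m: "p mod s < s" using assms(2) by simp
  have pd: "p div s < r" using that by (simp add: div_less_iff_less_mult assms(2))
  have "rot s r p = p mod s * r + p div s" using that pd by (simp add: rot_def mult.commute)
  then have "rot s r p div r = p mod s" "rot s r p mod r = p div s" using pd by auto
  then show ?thesis using b4[OF that] z[OF m] by (simp add: bsort_def)
 qed
 have sub: "R q2 \<subseteq> R q1" if "q1 \<le> q2" "q2 < s" for q1 q2
 proof
  fix row assume "row \<in> R q2"
  then have "row < r" "bsort1 (row * s + q2)" by (auto simp: R_def)
  moreover have "(row * s + q1) div r = (row * s + q2) div r" using col that by simp
  ultimately show "row \<in> R q1" using b1[of "row * s + q2" "row * s + q1"] that by (simp add: R_def)
 qed
 then have zmono: "z q2 \<le> z q1" if "q1 \<le> q2" "q2 < s" for q1 q2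
  using that by (simp add: z_def card_mono finR)
 have zdiff: "z 0 \<le> z (s - 1) + s"
 proof -
  have inj: "inj_on (\<lambda>row. row div t) (R 0 - R (s - 1))"
  proof (rule inj_onI)
   have *: False if "x \<in> R 0 - R (s - 1)" "y \<in> R 0 - R (s - 1)" "x div t = y div t" "x < y" for x y
   proof -
    have "bsort1 (y * s + 0)" using that by (auto simp: R_def)
    moreover have "(x * s + (s - 1)) div r = (y * s + 0) div r"
     using that assms(2) col[of "s - 1" x] col[of 0 y] by simp
    moreover have "x * s + (s - 1) \<le> y * s + 0"
    proof -
     have "x * s + s \<le> y * s" using \<open>x < y\<close> mult_le_mono1[of "Suc x" y s] by simp
     then show ?thesis by simp
    qed
    ultimately have "bsort1 (x * s + (s - 1))" by (rule b1)
    then show False using that by (auto simp: R_def)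
   qed
   fix x y assume "x \<in> R 0 - R (s - 1)" "y \<in> R 0 - R (s - 1)" "x div t = y div t"
   then show "x = y" using *[of x y] *[of y x] by (metis linorder_neqE_nat)
  qed
  have "(\<lambda>row. row div t) ` (R 0 - R (s - 1)) \<subseteq> {..<s}"
   using t0 by (auto simp: R_def t div_less_iff_less_mult)
  then have "card (R 0 - R (s - 1)) \<le> s"
   using card_inj_on_le[OF inj, of "{..<s}"] by simp
  moreover have "card (R 0) \<le> card (R (s - 1)) + card (R 0 - R (s - 1))"
   using sub[of 0 "s - 1"] assms(2) card_mono[OF finR sub[of 0 "s - 1"]] by (subst card_Diff_subset) (auto simp: finR)
  ultimately show ?thesis by (simp add: z_def)
 qed
 show ?thesis
 \<comment> \<open>Read row by row, the rows before \<open>z (s - 1)\<close> are full and those from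
   \<open>z 0\<close> on are empty. At most \<open>s\<close> rows of length \<open>s\<close> lie
   between them.\<close>
 proof (rule that[of "s * z (s - 1)" "s * z 0"])
  show "s * z (s - 1) \<le> s * z 0" using zmono[of 0 "s - 1"] assms(2) by simp
  have "s * z 0 \<le> s * (z (s - 1) + s)" using zdiff by (rule mult_le_mono2)
  then show "s * z 0 \<le> s * z (s - 1) + r div 2" using assms(4) by (simp add: distrib_left)
  show "b4 p" if "p < r * s" "p < s * z (s - 1)" for p
  proof -
   have "p div s < z (s - 1)" using that(2) assms(2) by (simp add: div_less_iff_less_mult mult.commute)
   also have "\<dots> \<le> z (p mod s)"
    using mod_less_divisor[OF assms(2), of p] by (intro zmono) linarith+
   finally show ?thesis using b4'[OF that(1)] by simp
  qed
  show "\<not> b4 p" if "p < r * s" "s * z 0 \<le> p" for p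
  proof -
   have "z (p mod s) \<le> z 0" using zmono[of 0 "p mod s"] assms(2) by simp
   also have "z 0 \<le> p div s" using that(2) assms(2) by (simp add: less_eq_div_iff_mult_less_eq mult.commute)
   finally show ?thesis using b4'[OF that(1)] by simp
  qed
 qed
qed

lemma down_closed_card:
 fixes T :: nat
 assumes dc: "\<And>p p'. p \<le> p' \<Longrightarrow> p' < T \<Longrightarrow> b p' \<Longrightarrow> b p" and p: "p < T"
 shows "b p \<longleftrightarrow> p < card {p. p < T \<and> b p}"
proof -
 have T: "0 < T" using p by simp
 have div0: "c div T = 0 \<longleftrightarrow> c < T" for c using T by (simp add: div_eq_0_iff)
 have "bsort T b p \<longleftrightarrow> b p"
  by (rule bsort_fixed[OF T, of 0]) (use dc p in \<open>auto simp: div0\<close>)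
 moreover have "bsort T b p \<longleftrightarrow> p < card {p. p < T \<and> b p}"
  using p by (simp add: bsort_def div0)
 ultimately show ?thesis by simp
qed

text \<open>The unsorted window is at most half a column long. If it lies in one column, the third
  sort already orders everything and the two shifts cancel. If it straddles a column boundary, the
  third sort confines the disorder to half a column on either side, and the shift turns exactly this
  range into a column, which the last sort orders.\<close>

lemma columnsort_clean:
 assumes r: "0 < r2" and s: "2 \<le> s"
  and w: "lo \<le> hi" "hi \<le> lo + r2" "\<And>p. p < (2 * r2) * s \<Longrightarrow> p < lo \<Longrightarrow> b4 p"
   "\<And>p. p < (2 * r2) * s \<Longrightarrow> hi \<le> p \<Longrightarrow> \<not> b4 p"
  and p: "p \<le> p'" "p' < (2 * r2) * s"
  and b8: "bsort (2 * r2) (\<lambda>c. bsort (2 * r2) b4 (shift_down (2 * r2) s c)) (shift_up (2 * r2) s p')"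
 shows "bsort (2 * r2) (\<lambda>c. bsort (2 * r2) b4 (shift_down (2 * r2) s c)) (shift_up (2 * r2) s p)"
proof -
 let ?r = "2 * r2"
 define N where "N = ?r * s"
 have r0: "0 < ?r" using r by simp
 have N: "N \<ge> 2 * ?r" using s mult_le_mono2[of 2 s ?r] by (simp add: N_def mult.commute)
 note w = w[folded N_def] and p = p[folded N_def]
 define b5 where "b5 = bsort ?r b4"
 define b6 where "b6 c = b5 (shift_down ?r s c)" for c
 define b7 where "b7 = bsort ?r b6"
 have down: "shift_down ?r s c = (if c < N - ?r then c + r2 else if c < N - r2 then c - (N - ?r) else c)"
  if "c < N" for c using that by (simp add: shift_down_def Let_def N_def)
 have up: "shift_up ?r s c = (if c < r2 then c + (N - ?r) else if c < N - r2 then c - r2 else c)"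
  if "c < N" for c using that by (simp add: shift_up_def Let_def N_def)
 have up_less: "shift_up ?r s c < N" if "c < N" for c
  using that N r by (auto simp: up)
 have down_up: "shift_down ?r s (shift_up ?r s c) = c" if "c < N" for c
 proof -
  have "shift_up ?r s c < N" using up_less that by blast
  then show ?thesis using that N r by (auto simp: up down)
 qed
 have segdiv: "q * ?r \<le> c \<Longrightarrow> c < q * ?r + ?r \<Longrightarrow> c div ?r = q" for q c
  using div_eq_iff_seg[OF r0] by blast
 have segN: "c' < N" if "c' div ?r = c div ?r" "c < N" for c c'
  using that div_less_iff[OF r0, of _ s] by (metis N_def)
 have b6': "b6 = (\<lambda>c. b5 (shift_down ?r s c))" by (rule ext) (rule b6_def)
 have p8: "b7 (shift_up ?r s p')" using b8 unfolding b7_def b6' b5_def .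
 have mono5: "b5 c" if "b5 c'" "c div ?r = c' div ?r" "c \<le> c'" for c c'
  using that unfolding b5_def by (metis bsort_mono_seg)
 have mono7: "b7 c" if "b7 c'" "c div ?r = c' div ?r" "c \<le> c'" for c c'
  using that unfolding b7_def by (metis bsort_mono_seg)
 have Ndiv: "N - ?r = (s - 1) * ?r"
  by (simp only: N_def diff_mult_distrib mult_1 mult.commute)
 consider (A) q where "q * ?r \<le> lo" "hi \<le> q * ?r + ?r" | (B) q where "lo < q * ?r" "q * ?r < hi"
 proof -
  have 1: "lo div ?r * ?r \<le> lo" by simp
  have 2: "lo < lo div ?r * ?r + ?r" using dividend_less_div_times[OF r0, of lo] by simp
  show thesis
  proof (cases "hi \<le> lo div ?r * ?r + ?r")
   case True
   then show ?thesis using A 1 by blast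
  next
   case False
   then show ?thesis using B[of "Suc (lo div ?r)"] 2 by (simp add: add.commute)
  qed
 qed
 then have "b7 (shift_up ?r s p)"
 proof cases
  case A
  have below: "b5 c" if "c < N" "c < q * ?r" for c
  proof -
   have "c div ?r < q" using that(2) r0 by (simp add: div_less_iff_less_mult)
   have "bsort ?r b4 c = True"
   proof (rule bsort_const[OF r0])
    fix c' assume c': "c' div ?r = c div ?r"
    then have "c' < q * ?r" using \<open>c div ?r < q\<close> r0 by (metis div_less_iff_less_mult)
    then show "b4 c' = True" using w(3)[of c'] segN[OF c' that(1)] A by simp
   qed
   then show ?thesis by (simp add: b5_def)
  qed
  have above: "\<not> b5 c" if "c < N" "q * ?r + ?r \<le> c" for c
  proof -
   have cq: "q < c div ?r" using that(2) r0 div_le_mono[of "q * ?r + ?r" c ?r] by simp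
   have "bsort ?r b4 c = False"
   proof (rule bsort_const[OF r0])
    fix c' assume c': "c' div ?r = c div ?r"
    have "q * ?r + ?r \<le> c'" using cq c' r0
     by (metis Suc_leI add.commute less_eq_div_iff_mult_less_eq mult_Suc)
    then show "b4 c' = False" using w(4)[of c'] segN[OF c' that(1)] A by simp
   qed
   then show ?thesis by (simp add: b5_def)
  qed
  have dc5: "b5 c" if "c \<le> c'" "c' < N" "b5 c'" for c c'
  proof -
   have "c' < q * ?r + ?r" using above[of c'] that by (meson not_le)
   show ?thesis
   proof (cases "c < q * ?r")
    case True
    then show ?thesis using below[of c] that by simp
   next
    case False
    then have "c div ?r = q" "c' div ?r = q" using segdiv \<open>c' < q * ?r + ?r\<close> that by auto
    then show ?thesis using mono5 that by simp
   qed
  qed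
  have fix7: "b7 c = b6 c" if "c < N" for c
   unfolding b7_def
  proof (rule bsort_fixed[OF r0 _ refl])
   fix c1 c2 assume c: "c1 div ?r = c div ?r" "c2 div ?r = c div ?r" "c1 \<le> c2" "b6 c2"
   have n: "c1 < N" "c2 < N" using segN c that by auto
   show "b6 c1"
   proof (cases "c1 < N - ?r")
    case True
    then have "c div ?r < s - 1" using c(1) Ndiv r0 by (metis div_less_iff_less_mult)
    then have "c2 < N - ?r" using c(2) Ndiv r0 by (metis div_less_iff_less_mult)
    then show ?thesis using True c n dc5[of "c1 + r2" "c2 + r2"] N by (auto simp: b6_def down)
   next
    case False
    show ?thesis
    proof (cases "c1 < N - r2")
     case True
     have "shift_down ?r s c1 \<le> shift_down ?r s c2" "shift_down ?r s c2 < N"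
      using c n False True N r by (auto simp: down)
     then show ?thesis using c(4) dc5 by (simp add: b6_def)
    next
     case F: False
     have "shift_down ?r s c1 \<le> shift_down ?r s c2" "shift_down ?r s c2 < N"
      using c n False F N r by (auto simp: down)
     then show ?thesis using c(4) dc5 by (simp add: b6_def)
    qed
   qed
  qed
  have pp: "p < N" using p by simp
  have "b5 p'" using p8 fix7[OF up_less[OF p(2)]] down_up[OF p(2)] by (simp add: b6_def)
  then have "b5 p" using dc5 p by blast
  then show ?thesis using fix7[OF up_less[OF pp]] down_up[OF pp] by (simp add: b6_def)
 next
  case B
  have q0: "q \<ge> 1" using B by (cases q) auto
  have qq: "q * ?r = (q - 1) * ?r + ?r" using q0 by (cases q) auto
  have lo: "q * ?r - r2 \<le> lo" and hi: "hi \<le> q * ?r + r2" using B w by auto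
  have below: "b5 c" if "c < N" "c < q * ?r - r2" for c
  proof -
   have "bsort ?r b4 c"
   proof (cases "c div ?r < q - 1")
    case True
    have "bsort ?r b4 c = True"
    proof (rule bsort_const[OF r0])
     fix c' assume c': "c' div ?r = c div ?r"
     then have "c' < (q - 1) * ?r" using True r0 by (metis div_less_iff_less_mult)
     also have "\<dots> \<le> q * ?r - r2" using qq by linarith
     finally show "b4 c' = True" using w(3)[of c'] segN[OF c' that(1)] lo by simp
    qed
    then show ?thesis by simp
   next
    case False
    have "c div ?r < q" using that(2) r0 by (simp add: div_less_iff_less_mult)
    then have cq: "c div ?r = q - 1" using False by simp
    have "(\<lambda>i. (q - 1) * ?r + i) ` {..<r2} \<subseteq> {c'. c' div ?r = c div ?r \<and> b4 c'}"
    proof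
     fix c' assume "c' \<in> (\<lambda>i. (q - 1) * ?r + i) ` {..<r2}"
     then obtain i where i: "c' = (q - 1) * ?r + i" "i < r2" by auto
     have d: "c' div ?r = q - 1" using i by (intro segdiv) auto
     have "c' < q * ?r - r2" using i qq by linarith
     then show "c' \<in> {c'. c' div ?r = c div ?r \<and> b4 c'}"
      using w(3)[of c'] segN[of c' c] that(1) lo d cq by simp
    qed
    from card_mono[OF finite_seg[OF r0] this]
    have "r2 \<le> card {c'. c' div ?r = c div ?r \<and> b4 c'}" by (simp add: card_image)
    moreover have "c mod ?r < r2"
    proof -
     have "c = (q - 1) * ?r + c mod ?r" using cq div_mult_mod_eq[of c ?r] by simp
     moreover have "q * ?r = (q - 1) * ?r + ?r" using q0 by (simp add: diff_mult_distrib)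
     ultimately show ?thesis using that(2) by linarith
    qed
    ultimately show ?thesis by (simp add: bsort_def)
   qed
   then show ?thesis by (simp add: b5_def)
  qed
  have above: "\<not> b5 c" if "c < N" "q * ?r + r2 \<le> c" for c
  proof -
   have "q \<le> c div ?r" using that(2) r0 div_le_mono[of "q * ?r" c ?r] by simp
   have "\<not> bsort ?r b4 c"
   proof (cases "c div ?r = q")
    case False
    then have cq: "q < c div ?r" using \<open>q \<le> c div ?r\<close> by simp
    have "bsort ?r b4 c = False"
    proof (rule bsort_const[OF r0])
     fix c' assume c': "c' div ?r = c div ?r"
     have "q * ?r + ?r \<le> c'" using cq c' r0
      by (metis Suc_leI add.commute less_eq_div_iff_mult_less_eq mult_Suc)
     then show "b4 c' = False" using w(4)[of c'] segN[OF c' that(1)] hi by simp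
    qed
    then show ?thesis by simp
   next
    case True
    have "{c'. c' div ?r = c div ?r \<and> b4 c'} \<subseteq> (\<lambda>i. q * ?r + i) ` {..<r2}"
    proof
     fix c' assume c': "c' \<in> {c'. c' div ?r = c div ?r \<and> b4 c'}"
     then have "c' = q * ?r + c' mod ?r" using True div_mult_mod_eq[of c' ?r] by simp
     moreover have "c' < q * ?r + r2"
     proof (rule ccontr)
      assume "\<not> c' < q * ?r + r2"
      then have "hi \<le> c'" using hi by linarith
      moreover have "c' < N" "b4 c'" using segN[of c' c] c' that(1) by auto
      ultimately show False using w(4) by blast
     qed
     ultimately have "c' mod ?r < r2" by linarith
     then show "c' \<in> (\<lambda>i. q * ?r + i) ` {..<r2}" using \<open>c' = q * ?r + c' mod ?r\<close> by blast
    qed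
    from card_mono[OF _ this] have "card {c'. c' div ?r = c div ?r \<and> b4 c'} \<le> r2" by (simp add: card_image)
    moreover have "r2 \<le> c mod ?r"
    proof -
     have "c = q * ?r + c mod ?r" using True div_mult_mod_eq[of c ?r] by simp
     then show ?thesis using that(2) by linarith
    qed
    ultimately show ?thesis by (simp add: bsort_def)
   qed
   then show ?thesis by (simp add: b5_def)
  qed
  show ?thesis
  proof (cases "q < s")
   case qs: True
   define Q where "Q = q * ?r"
   have qN: "Q \<le> N - ?r" unfolding Ndiv Q_def using qs by (intro mult_le_mono1) simp
   have qr: "?r \<le> Q" unfolding Q_def using qq by linarith
   note below = below[folded Q_def] and above = above[folded Q_def] and qq = qq[folded Q_def]
   \<comment> \<open>Away from the column that collects the disorder the last sort changes nothing.
     The last column needs care because it begins with the first half column, which is entirely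
     marked here.\<close>
   have fix7: "b7 c = b6 c" if "c < N" "c div ?r \<noteq> q - 1" for c
    unfolding b7_def
   proof (rule bsort_fixed[OF r0 _ refl])
    fix c1 c2 assume c: "c1 div ?r = c div ?r" "c2 div ?r = c div ?r" "c1 \<le> c2" "b6 c2"
    have n: "c1 < N" "c2 < N" using segN c that by auto
    show "b6 c1"
    proof (cases "c div ?r < q - 1")
     case True
     then have "c1 < (q - 1) * ?r" using c(1) div_less_iff_less_mult[OF r0, of c1 "q - 1"] by simp
     then have "c1 < Q - ?r" using qq by linarith
     then have "c1 + r2 < Q - r2" "c1 < N - ?r" using qN by auto
     then show ?thesis using below[of "c1 + r2"] n(1) N by (simp add: b6_def down)
    next
     case False
     then have "q \<le> c1 div ?r" "q \<le> c2 div ?r" using that c by auto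
     then have ge: "Q \<le> c1" "Q \<le> c2" unfolding Q_def using r0 by (auto simp: less_eq_div_iff_mult_less_eq)
     have c2: "N - ?r \<le> c2 \<and> c2 < N - r2"
     proof (rule ccontr)
      assume "\<not> (N - ?r \<le> c2 \<and> c2 < N - r2)"
      then have "Q + r2 \<le> shift_down ?r s c2" "shift_down ?r s c2 < N"
       using n ge(2) qN N by (auto simp: down)
      then show False using above c(4) by (auto simp: b6_def)
     qed
     then have "c2 div ?r = s - 1" using N Ndiv by (intro segdiv) auto
     then have "c1 div ?r = s - 1" using c by simp
     then have "N - ?r \<le> c1" using Ndiv div_times_less_eq_dividend[of c1 ?r] by simp
     then have "shift_down ?r s c1 < r2" using c2 c(3) n N by (auto simp: down)
     then show ?thesis using below[of "shift_down ?r s c1"] qr N unfolding b6_def by linarith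
    qed
   qed
   have mid: "c div ?r = q - 1 \<longleftrightarrow> Q - ?r \<le> c \<and> c < Q" for c
   proof -
    show ?thesis using qq div_eq_iff_seg[OF r0, of c "q - 1"] by linarith
   qed
   show ?thesis
   proof (cases "p < Q - r2")
    case True
    have pp: "p < N" using p by simp
    have "shift_up ?r s p div ?r \<noteq> q - 1"
     unfolding mid using True pp qN qr N by (auto simp: up)
    then show ?thesis using fix7[OF up_less[OF pp]] down_up[OF pp] below[OF pp True] by (simp add: b6_def)
   next
    case F: False
    have "p' < Q + r2"
    proof (rule ccontr)
     assume "\<not> p' < Q + r2"
     then have ge: "Q + r2 \<le> p'" by simp
     have "shift_up ?r s p' div ?r \<noteq> q - 1"
      unfolding mid using ge p qN qr N by (auto simp: up)
     then show False using fix7[OF up_less[OF p(2)]] down_up[OF p(2)] above[OF p(2) ge] p8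
      by (simp add: b6_def)
    qed
    then have "shift_up ?r s p = p - r2" "shift_up ?r s p' = p' - r2"
     "(p - r2) div ?r = q - 1" "(p' - r2) div ?r = q - 1"
     unfolding mid using F p qN qr N by (auto simp: up)
    then show ?thesis using mono7[of "p' - r2" "p - r2"] p8 p by simp
   qed
  next
   \<comment> \<open>The boundary is the end of the array or lies beyond it: all cells before the
     last half column are marked, and the last column has just been sorted.\<close>
   case False
   then have "N \<le> q * ?r" using mult_le_mono1[of s q ?r] by (simp add: N_def mult.commute)
   then have all5: "b5 c" if "c < N" "c < N - r2" for c using below that by simp
   have last5: "b5 c" if "b5 c'" "c \<le> c'" "c' < N" for c c'
   proof (cases "c < N - r2")
    case True
    then show ?thesis using all5 that by simp
   next
    case False
    then have "c div ?r = s - 1" "c' div ?r = s - 1" using that N Ndiv by (auto intro!: segdiv)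
    then show ?thesis using mono5 that by simp
   qed
   have fix7: "b7 c = b6 c" if "c < N" for c
    unfolding b7_def
   proof (rule bsort_fixed[OF r0 _ refl])
    fix c1 c2 assume c: "c1 div ?r = c div ?r" "c2 div ?r = c div ?r" "c1 \<le> c2" "b6 c2"
    have n: "c1 < N" "c2 < N" using segN c that by auto
    show "b6 c1"
    proof (cases "shift_down ?r s c1 < N - r2")
     case True
     then show ?thesis using all5[of "shift_down ?r s c1"] by (simp add: b6_def)
    next
     case False
     then have "c1 \<ge> N - r2" using n N r by (auto simp: down split: if_splits)
     then show ?thesis using c n last5[of c2 c1] N by (auto simp: b6_def down)
    qed
   qed
   have pp: "p < N" using p by simp
   have "b5 p'" using p8 fix7[OF up_less[OF p(2)]] down_up[OF p(2)] by (simp add: b6_def)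
   then have "b5 p" using last5 p by blast
   then show ?thesis using fix7[OF up_less[OF pp]] down_up[OF pp] by (simp add: b6_def)
  qed
 qed
 then show ?thesis unfolding b7_def b6' b5_def .
qed

section \<open>Columnsort as an array program\<close>

definition detstep :: "(array \<Rightarrow> array) \<Rightarrow> (nat \<Rightarrow> nat) \<Rightarrow> array_step" where
 "detstep F \<phi> = (\<lambda>x c. return_pmf (F x c), \<phi>)"

definition crop :: "nat \<Rightarrow> array \<Rightarrow> array" where
 "crop L x = (\<lambda>c. if c < L then x c else 0)"

definition wf_array :: "nat \<Rightarrow> nat \<Rightarrow> array \<Rightarrow> bool" where
 "wf_array L W x \<longleftrightarrow> (\<forall>c\<ge>L. x c = 0) \<and> (\<forall>c. x c < W)"

definition computes :: "nat \<Rightarrow> nat \<Rightarrow> nat \<Rightarrow> array_step list \<Rightarrow> (array \<Rightarrow> array) \<Rightarrow> bool" where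
 "computes L B W p f \<longleftrightarrow> (\<forall>s\<in>set p. valid_step L B W s) \<and>
   (\<forall>x. wf_array L W x \<longrightarrow> prog_sem L p x = return_pmf (f x) \<and> wf_array L W (f x))"

lemma computes_append:
 assumes "computes L B W p f" "computes L B W q g"
 shows "computes L B W (p @ q) (\<lambda>x. g (f x))"
 using assms unfolding computes_def by (auto simp: prog_sem_append bind_return_pmf)

lemma computes_cong:
 assumes "computes L B W p f" "\<And>x. wf_array L W x \<Longrightarrow> f x = g x"
 shows "computes L B W p g"
 using assms unfolding computes_def by auto

lemma prog_sem_detstep:
 assumes "\<phi> ` {..<L} \<subseteq> {..<L}"
 shows "prog_sem L [detstep F \<phi>] x = return_pmf (crop L (\<lambda>c. F x (\<phi> c)))"
 unfolding prog_sem_single using assms by (auto simp: step_sem_def detstep_def crop_def fun_eq_iff)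

lemma valid_detstep:
 assumes "block_local B F" "\<And>x c. (\<forall>c. x c < W) \<Longrightarrow> F x c < W"
  "inj_on \<phi> {..<L}" "\<phi> ` {..<L} \<subseteq> {..<L}"
 shows "valid_step L B W (detstep F \<phi>)"
 using assms unfolding valid_step_def detstep_def block_local_def by simp

lemma computes_local:
 assumes "block_local B F" "\<And>x c. (\<forall>c. x c < W) \<Longrightarrow> F x c < W" "0 < W"
 shows "computes L B W [detstep F id] (\<lambda>x. crop L (F x))"
proof -
 have "valid_step L B W (detstep F id)" using assms by (intro valid_detstep) auto
 then show ?thesis using assms prog_sem_detstep[of id L F]
  unfolding computes_def by (auto simp: wf_array_def crop_def)
qed

lemma computes_perm:
 assumes "inj_on \<phi> {..<L}" "\<phi> ` {..<L} \<subseteq> {..<L}" "0 < W"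
 shows "computes L B W [detstep (\<lambda>x. x) \<phi>] (\<lambda>x. crop L (\<lambda>c. x (\<phi> c)))"
proof -
 have "valid_step L B W (detstep (\<lambda>x. x) \<phi>)" using assms by (intro valid_detstep) (auto simp: block_local_def)
 then show ?thesis using assms prog_sem_detstep[of \<phi> L "\<lambda>x. x"]
  unfolding computes_def by (auto simp: wf_array_def crop_def)
qed

lemma seg_less:
 assumes "0 < r" "r dvd L" "c < L" "c' div r = c div r"
 shows "c' < (L::nat)"
proof -
 obtain t where t: "L = r * t" using assms(2) by auto
 have "c div r < t" using assms(1,3) t div_less_iff by blast
 then have "c' div r < t" using assms(4) by simp
 then show ?thesis using t assms(1) div_less_iff by blast
qed

lemma mult_add_less: "i < r \<Longrightarrow> j < s \<Longrightarrow> i * s + j < r * (s::nat)"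
 using mult_le_mono1[of "Suc i" r s] by simp

text \<open>In mixed radix notation \<open>rot r s\<close> exchanges the two low digits. Hence it
  keeps the number of the block and has the inverse \<open>rot s r\<close>.\<close>

lemma rot_digits:
 assumes "0 < r" "0 < s" "i < r" "j < s"
 shows "rot r s (q * (r * s) + j * r + i) = q * (r * s) + i * s + j"
proof -
 have less: "j * r + i < r * s" using mult_add_less[of j s i r] assms by (simp add: mult.commute)
 have "(q * (r * s) + j * r + i) div (r * s) = q"
  using less assms by (simp add: add.assoc)
 moreover have "(q * (r * s) + j * r + i) = (q * s + j) * r + i" by (simp add: algebra_simps)
 moreover have "((q * s + j) * r + i) mod r = i" "((q * s + j) * r + i) div r = q * s + j"
  using assms by auto
 moreover have "(q * s + j) mod s = j" using assms by simp
 ultimately show ?thesis by (simp add: rot_def)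
qed

lemma digits:
 assumes "0 < r" "0 < (s::nat)"
 obtains q i j where "c = q * (r * s) + j * r + i" "i < r" "j < s" "q = c div (r * s)"
  "i = c mod r" "j = c div r mod s"
proof -
 have "c = c div (r * s) * (r * s) + (c div r mod s) * r + c mod r"
 proof -
  have 1: "c div r = c div (r * s) * s + c div r mod s"
   by (simp add: div_mult2_eq)
  have "c = c div r * r + c mod r" by simp
  also have "\<dots> = (c div (r * s) * s + c div r mod s) * r + c mod r" using 1 by simp
  finally show ?thesis by (simp add: algebra_simps)
 qed
 then show ?thesis using that assms by simp
qed

lemma rot_div:
 assumes "0 < r" "0 < s"
 shows "rot r s c div (r * s) = c div (r * s)"
proof -
 obtain q i j where c: "c = q * (r * s) + j * r + i" "i < r" "j < s" "q = c div (r * s)"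
  using digits[OF assms, of c] by metis
 have "rot r s c = q * (r * s) + (i * s + j)" using rot_digits[OF assms c(2,3), of q] c(1) by simp
 moreover have "i * s + j < r * s" using mult_add_less c by simp
 ultimately show ?thesis using c(4) assms by simp
qed

lemma rot_rot:
 assumes "0 < r" "0 < s"
 shows "rot s r (rot r s c) = c"
proof -
 obtain q i j where c: "c = q * (r * s) + j * r + i" "i < r" "j < s"
  using digits[OF assms, of c] by metis
 have "rot r s c = q * (s * r) + i * s + j" using rot_digits[OF assms c(2,3), of q] c(1) by (simp add: mult.commute)
 then have "rot s r (rot r s c) = q * (s * r) + j * r + i"
  using rot_digits[OF assms(2,1) c(3,2), of q] by simp
 then show ?thesis using c(1) by (simp add: mult.commute)
qed

lemma rot_perm:
 assumes "0 < r" "0 < s" "r * s dvd L"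
 shows "inj_on (rot r s) {..<L}" "rot r s ` {..<L} \<subseteq> {..<L}"
proof -
 show "inj_on (rot r s) {..<L}" by (rule inj_on_inverseI[of _ "rot s r"]) (rule rot_rot[OF assms(1,2)])
 show "rot r s ` {..<L} \<subseteq> {..<L}"
  using seg_less[of "r * s" L] rot_div[OF assms(1,2)] assms by auto
qed

lemma shift_aux:
 fixes r2 s :: nat
 assumes "0 < r2" "2 \<le> s"
 defines "r \<equiv> 2 * r2" and "N \<equiv> 2 * r2 * s"
 shows "shift_down r s c div N = c div N" "shift_up r s c div N = c div N"
  "shift_up r s (shift_down r s c) = c" "shift_down r s (shift_up r s c) = c"
proof -
 have N: "4 * r2 \<le> N" using mult_le_mono2[OF assms(2), of "2 * r2"] by (simp add: N_def)
 define dn where "dn p = (if p < N - 2 * r2 then p + r2 else if p < N - r2 then p - (N - 2 * r2) else p)" for p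
 define up where "up p = (if p < r2 then p + (N - 2 * r2) else if p < N - r2 then p - r2 else p)" for p
 have dn: "shift_down r s (q * N + p) = q * N + dn p" "shift_up r s (q * N + p) = q * N + up p" if "p < N" for p q
 proof -
  have "(q * N + p) div N = q" "(q * N + p) mod N = p" using that by auto
  moreover have "r * s = N" by (simp add: r_def N_def)
  ultimately show "shift_down r s (q * N + p) = q * N + dn p" "shift_up r s (q * N + p) = q * N + up p"
   unfolding shift_down_def shift_up_def Let_def by (simp_all add: dn_def up_def r_def)
 qed
 have less: "dn p < N" "up p < N" "up (dn p) = p" "dn (up p) = p" if "p < N" for p
  using that N assms(1) by (auto simp: dn_def up_def)
 have N0: "0 < N" using N assms(1) by simp
 define q p where "q = c div N" and "p = c mod N"
 have c: "c = q * N + p" "p < N" using N0 by (auto simp: q_def p_def)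
 show "shift_down r s c div N = c div N" "shift_up r s c div N = c div N"
  "shift_up r s (shift_down r s c) = c" "shift_down r s (shift_up r s c) = c"
  unfolding c(1) using dn less c(2) by simp_all
qed

lemma shift_perm:
 assumes "0 < r2" "2 \<le> s" "(2 * r2) * s dvd L"
 shows "inj_on (shift_down (2 * r2) s) {..<L}" "shift_down (2 * r2) s ` {..<L} \<subseteq> {..<L}"
  "inj_on (shift_up (2 * r2) s) {..<L}" "shift_up (2 * r2) s ` {..<L} \<subseteq> {..<L}"
proof -
 note sa = shift_aux[OF assms(1,2)]
 have N: "0 < (2 * r2) * s" using assms by simp
 show "inj_on (shift_down (2 * r2) s) {..<L}" by (rule inj_on_inverseI) (rule sa(3))
 show "inj_on (shift_up (2 * r2) s) {..<L}" by (rule inj_on_inverseI) (rule sa(4))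
 show "shift_down (2 * r2) s ` {..<L} \<subseteq> {..<L}" "shift_up (2 * r2) s ` {..<L} \<subseteq> {..<L}"
  using seg_less[OF N assms(3)] sa(1,2) by auto
qed

lemma seg_sort_cong:
 assumes "0 < r" "\<And>c'. c' div r = c div r \<Longrightarrow> x c' = y c'"
 shows "seg_sort r x c = seg_sort r y c"
proof -
 have "map x [c div r * r..<c div r * r + r] = map y [c div r * r..<c div r * r + r]"
  using assms(2) by (auto simp: div_eq_iff_seg[OF assms(1)])
 then show ?thesis unfolding seg_sort_def by (rule arg_cong)
qed

lemma seg_sort_bounded:
 assumes "0 < r" "\<And>c. x c < (W::nat)"
 shows "seg_sort r x c < W"
proof -
 have "seg_sort r x c \<in> set (sort (map x [c div r * r..<c div r * r + r]))"
  unfolding seg_sort_def using assms(1) by (intro nth_mem) simp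
 then show ?thesis using assms(2) by auto
qed

lemma bsort_shift:
 assumes "0 < r" "r dvd A" "r dvd N" "p < N" "\<And>p. p < N \<Longrightarrow> y (A + p) \<longleftrightarrow> b p"
 shows "bsort r y (A + p) \<longleftrightarrow> bsort r b p"
proof -
 obtain a0 where a0: "A = r * a0" using assms(2) by auto
 have "{c'. c' div r = (A + p) div r \<and> y c'} = (\<lambda>p. A + p) ` {p'. p' div r = p div r \<and> b p'}"
 proof (intro equalityI subsetI)
  fix c' assume c': "c' \<in> {c'. c' div r = (A + p) div r \<and> y c'}"
  then have d: "c' div r = a0 + p div r" using assms(1) by (simp add: a0)
  then have "a0 * r \<le> c'" using div_times_less_eq_dividend[of c' r] by (simp add: algebra_simps)
  then obtain p' where p': "c' = A + p'" by (metis a0 le_Suc_ex mult.commute)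
  then have "p' div r = p div r" using d assms(1) by (simp add: a0)
  moreover from this have "p' < N" using seg_less[OF assms(1,3,4)] by simp
  ultimately show "c' \<in> (\<lambda>p. A + p) ` {p'. p' div r = p div r \<and> b p'}"
   using assms(5) c' p' by auto
 next
  fix c' assume "c' \<in> (\<lambda>p. A + p) ` {p'. p' div r = p div r \<and> b p'}"
  then obtain p' where p': "c' = A + p'" "p' div r = p div r" "b p'" by auto
  then have "p' < N" using seg_less[OF assms(1,3,4)] by simp
  then show "c' \<in> {c'. c' div r = (A + p) div r \<and> y c'}"
   using p' assms(1,5) by (simp add: a0)
 qed
 moreover have "(A + p) mod r = p mod r" by (simp add: a0)
 ultimately show ?thesis by (simp add: bsort_def card_image)
qed

lemma card_perm:
 assumes "inj_on \<phi> {..<N}" "\<phi> ` {..<N} \<subseteq> {..<N::nat}"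
 shows "card {p. p < N \<and> b (\<phi> p)} = card {p. p < N \<and> b p}"
proof -
 have im: "\<phi> ` {..<N} = {..<N}" using assms by (intro endo_inj_surj) auto
 have "bij_betw \<phi> {p. p < N \<and> b (\<phi> p)} {p. p < N \<and> b p}"
 proof (rule bij_betwI')
  fix x y assume "x \<in> {p. p < N \<and> b (\<phi> p)}" "y \<in> {p. p < N \<and> b (\<phi> p)}"
  then show "(\<phi> x = \<phi> y) = (x = y)" using assms(1) by (auto simp: inj_on_def)
 next
  fix x assume "x \<in> {p. p < N \<and> b (\<phi> p)}"
  then show "\<phi> x \<in> {p. p < N \<and> b p}" using assms(2) by auto
 next
  fix y assume y: "y \<in> {p. p < N \<and> b p}"
  then have "y \<in> \<phi> ` {..<N}" using im by simp
  then show "\<exists>x\<in>{p. p < N \<and> b (\<phi> p)}. y = \<phi> x" using y by auto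
 qed
 then show ?thesis by (rule bij_betw_same_card)
qed

text \<open>At a fixed threshold, \<open>b1\<close> to \<open>b8\<close> follow the marked cells
  inside the block at offset \<open>A\<close>, and \<open>y1\<close> to \<open>y8\<close> the
  arrays. The last set is an initial segment by \<open>columnsort_window\<close> and
  \<open>columnsort_clean\<close>, and it has the right size because every sort and every
  permutation preserves the number of marks; this determines it.\<close>

theorem columnsort:
 fixes r2 s :: nat
 assumes r2: "0 < r2" and s: "2 \<le> s" "s dvd 2 * r2" "s * s \<le> r2"
 defines "r \<equiv> 2 * r2"
 shows "seg_sort r (\<lambda>c. seg_sort r (\<lambda>c. seg_sort r (\<lambda>c. seg_sort r x (rot r s c)) (rot s r c))
  (shift_down r s c)) (shift_up r s c) = seg_sort (r * s) x c"
proof (rule less_iff_eqI)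
 fix \<tau>
 let ?N = "r * s"
 have r: "0 < r" and s0: "0 < s" and N0: "0 < ?N" and sr: "s dvd r" using r2 s by (auto simp: r_def)
 define A p where "A = c div ?N * ?N" and "p = c mod ?N"
 have c: "c = A + p" "p < ?N"
  by (simp_all only: A_def p_def div_mult_mod_eq mod_less_divisor N0)
 have rA: "r dvd A" and rN: "r dvd ?N" and NA: "?N dvd A" by (auto simp: A_def)
 have Ndvd: "?N dvd ?N" by simp
 have sft: "\<phi> (A + p) = A + \<phi> p" if "\<And>q p. p < ?N \<Longrightarrow> \<phi> (q * ?N + p) = q * ?N + \<phi> p" "p < ?N" for \<phi> p
  using that unfolding A_def by blast
 have rot1: "rot r s (A + p) = A + rot r s p" if "p < ?N" for p
 proof (rule sft[OF _ that])
  fix q p :: nat assume p: "p < ?N"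
  have e: "q * (r * s) = q * s * r" by simp
  have "(q * (r * s) + p) mod r = p mod r" unfolding e by simp
  moreover have "(q * (r * s) + p) div r = q * s + p div r" unfolding e using r by simp
  moreover have "(q * (r * s) + p) div (r * s) = q"
   using p div_eq_iff_seg[OF N0, of "q * (r * s) + p" q] by simp
  ultimately show "rot r s (q * (r * s) + p) = q * (r * s) + rot r s p"
   using p by (simp add: rot_def)
 qed
 have rot2: "rot s r (A + p) = A + rot s r p" if "p < ?N" for p
 proof (rule sft[OF _ that])
  fix q p :: nat assume p: "p < ?N"
  have "(q * (r * s) + p) mod s = p mod s" by (simp add: mult.assoc[symmetric])
  moreover have "(q * (r * s) + p) div s = q * r + p div s"
   using s0 by (simp add: mult.assoc[symmetric])
  moreover have "(q * (r * s) + p) div (s * r) = q"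
   using p div_eq_iff_seg[OF N0, of "q * (r * s) + p" q] by (simp add: mult.commute[of s r])
  ultimately show "rot s r (q * (r * s) + p) = q * (r * s) + rot s r p"
   using p by (simp add: rot_def mult.commute[of s r])
 qed
 have divN: "(q * ?N + p) div ?N = q" if "p < ?N" for q p
  using that div_eq_iff_seg[OF N0, of "q * ?N + p" q] by simp
 have sd: "shift_down r s (A + p) = A + shift_down r s p" if "p < ?N" for p
  by (rule sft[OF _ that]) (simp add: shift_down_def Let_def divN)
 have su: "shift_up r s (A + p) = A + shift_up r s p" if "p < ?N" for p
  by (rule sft[OF _ that]) (simp add: shift_up_def Let_def divN)
 note rp = rot_perm[OF r s0 Ndvd]
 have rp': "inj_on (rot s r) {..<?N}" "rot s r ` {..<?N} \<subseteq> {..<?N}"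
  using rot_perm[OF s0 r, of ?N] by (auto simp: mult.commute)
 have sp: "inj_on (shift_down r s) {..<?N}" "shift_down r s ` {..<?N} \<subseteq> {..<?N}"
  "inj_on (shift_up r s) {..<?N}" "shift_up r s ` {..<?N} \<subseteq> {..<?N}"
  using shift_perm[OF r2 s(1), of ?N] by (auto simp: r_def)
 define b where "b p \<longleftrightarrow> x (A + p) < \<tau>" for p
 define b1 where "b1 = bsort r b"
 define b2 where "b2 p = b1 (rot r s p)" for p
 define b3 where "b3 = bsort r b2"
 define b4 where "b4 p = b3 (rot s r p)" for p
 define b5 where "b5 = bsort r b4"
 define b6 where "b6 p = b5 (shift_down r s p)" for p
 define b7 where "b7 = bsort r b6"
 define b8 where "b8 p = b7 (shift_up r s p)" for p
 define y1 where "y1 = seg_sort r x"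
 define y2 where "y2 c = y1 (rot r s c)" for c
 define y3 where "y3 = seg_sort r y2"
 define y4 where "y4 c = y3 (rot s r c)" for c
 define y5 where "y5 = seg_sort r y4"
 define y6 where "y6 c = y5 (shift_down r s c)" for c
 define y7 where "y7 = seg_sort r y6"
 define y8 where "y8 c = y7 (shift_up r s c)" for c
 have srt: "seg_sort r y (A + p) < \<tau> \<longleftrightarrow> bsort r b' p"
  if "\<And>p. p < ?N \<Longrightarrow> y (A + p) < \<tau> \<longleftrightarrow> b' p" "p < ?N" for y b' p
  unfolding seg_sort_less_iff[OF r] by (rule bsort_shift[OF r rA rN that(2)]) (rule that(1))
 have e1: "y1 (A + p) < \<tau> \<longleftrightarrow> b1 p" if "p < ?N" for p
  unfolding y1_def b1_def by (rule srt[where b' = b]) (use that in \<open>auto simp: b_def\<close>)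
 have e2: "y2 (A + p) < \<tau> \<longleftrightarrow> b2 p" if "p < ?N" for p
  unfolding y2_def b2_def rot1[OF that] by (rule e1) (use rp that in auto)
 have e3: "y3 (A + p) < \<tau> \<longleftrightarrow> b3 p" if "p < ?N" for p
  unfolding y3_def b3_def by (rule srt[where y = y2 and b' = b2]) (use e2 that in auto)
 have e4: "y4 (A + p) < \<tau> \<longleftrightarrow> b4 p" if "p < ?N" for p
  unfolding y4_def b4_def rot2[OF that] by (rule e3) (use rp' that in auto)
 have e5: "y5 (A + p) < \<tau> \<longleftrightarrow> b5 p" if "p < ?N" for p
  unfolding y5_def b5_def by (rule srt[where y = y4 and b' = b4]) (use e4 that in auto)
 have e6: "y6 (A + p) < \<tau> \<longleftrightarrow> b6 p" if "p < ?N" for p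
  unfolding y6_def b6_def sd[OF that] by (rule e5) (use sp that in auto)
 have e7: "y7 (A + p) < \<tau> \<longleftrightarrow> b7 p" if "p < ?N" for p
  unfolding y7_def b7_def by (rule srt[where y = y6 and b' = b6]) (use e6 that in auto)
 have e8: "y8 (A + p) < \<tau> \<longleftrightarrow> b8 p" if "p < ?N" for p
  unfolding y8_def b8_def su[OF that] by (rule e7) (use sp that in auto)
 have mono1: "b1 c" if "b1 c'" "c div r = c' div r" "c \<le> c'" for c c'
  using bsort_mono_seg[of r b c' c] that by (simp add: b1_def)
 have b4': "b4 p = bsort r (\<lambda>p. b1 (rot r s p)) (rot s r p)" for p
 proof -
  have "b2 = (\<lambda>p. b1 (rot r s p))" by (rule ext) (rule b2_def)
  then show ?thesis by (simp add: b4_def b3_def)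
 qed
 have ss: "2 * (s * s) \<le> r" using s(3) by (simp add: r_def)
 obtain lo hi where w: "lo \<le> hi" "hi \<le> lo + r div 2" "\<And>p. p < ?N \<Longrightarrow> p < lo \<Longrightarrow> b4 p"
  "\<And>p. p < ?N \<Longrightarrow> hi \<le> p \<Longrightarrow> \<not> b4 p"
  by (rule columnsort_window[OF r s0 sr ss, of b1 b4]) (use mono1 b4' in blast)+
 have b8': "b8 p = bsort (2 * r2) (\<lambda>c. bsort (2 * r2) b4 (shift_down (2 * r2) s c)) (shift_up (2 * r2) s p)" for p
 proof -
  have "b6 = (\<lambda>c. bsort r b4 (shift_down r s c))" by (rule ext) (simp add: b6_def b5_def)
  then show ?thesis by (simp add: b8_def b7_def r_def)
 qed
 have dc: "b8 p" if "p \<le> p'" "p' < ?N" "b8 p'" for p p'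
  unfolding b8'
  by (rule columnsort_clean[OF r2 s(1) w(1) _ _ _ that(1)]) (use w that b8'[of p'] in \<open>simp_all add: r_def\<close>)
 have cards: "card {p. p < ?N \<and> b8 p} = card {p. p < ?N \<and> b p}"
 proof -
  have "card {p. p < ?N \<and> b8 p} = card {p. p < ?N \<and> b7 p}"
   unfolding b8_def by (rule card_perm[OF sp(3,4)])
  also have "\<dots> = card {p. p < ?N \<and> b6 p}" unfolding b7_def by (rule card_bsort[OF r])
  also have "\<dots> = card {p. p < ?N \<and> b5 p}" unfolding b6_def by (rule card_perm[OF sp(1,2)])
  also have "\<dots> = card {p. p < ?N \<and> b4 p}" unfolding b5_def by (rule card_bsort[OF r])
  also have "\<dots> = card {p. p < ?N \<and> b3 p}" unfolding b4_def by (rule card_perm[OF rp'])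
  also have "\<dots> = card {p. p < ?N \<and> b2 p}" unfolding b3_def by (rule card_bsort[OF r])
  also have "\<dots> = card {p. p < ?N \<and> b1 p}" unfolding b2_def by (rule card_perm[OF rp])
  also have "\<dots> = card {p. p < ?N \<and> b p}" unfolding b1_def by (rule card_bsort[OF r])
  finally show ?thesis .
 qed
 have "y8 c < \<tau> \<longleftrightarrow> b8 p" using e8[OF c(2)] c(1) by simp
 also have "\<dots> \<longleftrightarrow> p < card {p. p < ?N \<and> b8 p}" by (rule down_closed_card[OF dc c(2)])
 also have "\<dots> \<longleftrightarrow> bsort ?N b p"
  using c(2) N0 by (simp add: cards bsort_def div_eq_0_iff)
 also have "\<dots> \<longleftrightarrow> bsort ?N (\<lambda>c. x c < \<tau>) (A + p)"
  by (rule bsort_shift[OF N0 NA Ndvd c(2), symmetric]) (simp add: b_def)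
 also have "\<dots> \<longleftrightarrow> seg_sort ?N x c < \<tau>" using c(1) seg_sort_less_iff[OF N0] by simp
 also have "y8 c = seg_sort r (\<lambda>c. seg_sort r (\<lambda>c. seg_sort r (\<lambda>c. seg_sort r x (rot r s c)) (rot s r c))
  (shift_down r s c)) (shift_up r s c)"
 proof -
  have "y2 = (\<lambda>c. seg_sort r x (rot r s c))" by (rule ext) (simp add: y2_def y1_def)
  then have "y4 = (\<lambda>c. seg_sort r (\<lambda>c. seg_sort r x (rot r s c)) (rot s r c))"
   by (intro ext) (simp add: y4_def y3_def)
  then have "y6 = (\<lambda>c. seg_sort r (\<lambda>c. seg_sort r (\<lambda>c. seg_sort r x (rot r s c)) (rot s r c)) (shift_down r s c))"
   by (intro ext) (simp add: y6_def y5_def)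
  then show ?thesis by (simp add: y8_def y7_def)
 qed
 finally show "(seg_sort r (\<lambda>c. seg_sort r (\<lambda>c. seg_sort r (\<lambda>c. seg_sort r x (rot r s c)) (rot s r c))
  (shift_down r s c)) (shift_up r s c) < \<tau>) = (seg_sort (r * s) x c < \<tau>)" .
qed

text \<open>One level of columnsort arranges \<open>2 ^ a\<close> cells in \<open>2 ^ j\<close>
  columns of height \<open>2 ^ k\<close>. The square of the number of columns must not exceed half
  the height, that is \<open>2 * j + 1 \<le> k\<close>, or \<open>3 * j + 1 \<le> a\<close>; this
  explains the choice of \<open>j\<close>. Columns too long for one machine are sorted
  recursively.\<close>

fun sort_prog :: "nat \<Rightarrow> nat \<Rightarrow> nat \<Rightarrow> array_step list" where
 "sort_prog b 0 a = [detstep (seg_sort (2 ^ a)) id]"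
| "sort_prog b (Suc d) a = (if a \<le> b then [detstep (seg_sort (2 ^ a)) id] else
   let j = (a - 1) div 3; k = a - j in
    sort_prog b d k @ [detstep (\<lambda>x. x) (rot (2 ^ k) (2 ^ j))] @
    sort_prog b d k @ [detstep (\<lambda>x. x) (rot (2 ^ j) (2 ^ k))] @
    sort_prog b d k @ [detstep (\<lambda>x. x) (shift_down (2 ^ k) (2 ^ j))] @
    sort_prog b d k @ [detstep (\<lambda>x. x) (shift_up (2 ^ k) (2 ^ j))])"

text \<open>The exponent of the column height after \<open>d\<close> nested levels. It has to drop
  to the block exponent for the innermost sorts to be local.\<close>

fun shrink :: "nat \<Rightarrow> nat \<Rightarrow> nat" where
 "shrink 0 a = a"
| "shrink (Suc d) a = shrink d (a - (a - 1) div 3)"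

lemma length_sort_prog: "length (sort_prog b d a) \<le> 6 ^ d * 2"
proof (induction d arbitrary: a)
 case (Suc d)
 show ?case
 proof (cases "a \<le> b")
  case False
  have "length (sort_prog b (Suc d) a) = 4 * length (sort_prog b d (a - (a - 1) div 3)) + 4"
   using False by (simp add: Let_def)
  also have "\<dots> \<le> 4 * (6 ^ d * 2) + 4" using Suc[of "a - (a - 1) div 3"] by simp
  also have "\<dots> \<le> 6 ^ Suc d * 2"
  proof -
   have "(1::nat) \<le> 6 ^ d" by simp
   then show ?thesis by simp
  qed
  finally show ?thesis .
 qed simp
qed simp

lemma computes_seg_sort_local:
 assumes "a \<le> b" "0 < W"
 shows "computes L (2 ^ b) W [detstep (seg_sort (2 ^ a)) id] (\<lambda>x. crop L (seg_sort (2 ^ a) x))"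
proof (rule computes_local)
 show "block_local (2 ^ b) (seg_sort (2 ^ a))"
  unfolding block_local_def
 proof (intro allI impI)
  fix x y :: array and c
  assume eq: "\<forall>c'. c' div 2 ^ b = c div 2 ^ b \<longrightarrow> x c' = y c'"
  have pw: "(2::nat) ^ b = 2 ^ a * 2 ^ (b - a)" using assms(1) by (simp add: power_add[symmetric])
  show "seg_sort (2 ^ a) x c = seg_sort (2 ^ a) y c"
  proof (rule seg_sort_cong)
   fix c' assume "c' div 2 ^ a = c div 2 ^ a"
   then have "c' div 2 ^ b = c div 2 ^ b" unfolding pw by (simp add: div_mult2_eq)
   then show "x c' = y c'" using eq by simp
  qed simp
 qed
 show "seg_sort (2 ^ a) x c < W" if "\<forall>c. x c < W" for x c
  by (rule seg_sort_bounded) (use that in auto)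
qed (use assms in simp)

theorem computes_sort_prog:
 assumes "4 \<le> b" "0 < W" "2 ^ a dvd L" "shrink d a \<le> b"
 shows "computes L (2 ^ b) W (sort_prog b d a) (\<lambda>x. crop L (seg_sort (2 ^ a) x))"
 using assms(3,4)
proof (induction d arbitrary: a)
 case 0
 then show ?case using computes_seg_sort_local[of a b W L] assms by simp
next
 case (Suc d)
 show ?case
 proof (cases "a \<le> b")
  case True
  then show ?thesis using computes_seg_sort_local[of a b W L] assms by simp
 next
  case False
  define j k where "j = (a - 1) div 3" and "k = a - j"
  have j: "1 \<le> j" "3 * j + 1 \<le> a" using False assms(1) by (auto simp: j_def)
  have kj: "k + j = a" "2 * j + 1 \<le> k" using j by (auto simp: k_def)
  let ?r = "2 ^ k :: nat" and ?s = "2 ^ j :: nat" and ?r2 = "2 ^ (k - 1) :: nat"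
  have r2: "?r = 2 * ?r2" using kj by (cases k) auto
  have r20: "0 < ?r2" by simp
  have s2: "2 \<le> ?s" using j(1) self_le_power[of 2 j] by simp
  have N: "?r * ?s = 2 ^ a" using kj by (simp add: power_add[symmetric])
  have NL: "?r * ?s dvd L" using N Suc.prems by simp
  have NL': "?s * ?r dvd L" using NL by (simp add: mult.commute)
  have rL: "?r dvd L" using NL by (rule dvd_mult_left)
  have sr: "?s dvd 2 * ?r2" unfolding r2[symmetric] using kj by (intro le_imp_power_dvd) simp
  have ss: "?s * ?s \<le> ?r2"
   unfolding power_add[symmetric] using kj by (intro power_increasing) auto
  have r0: "0 < ?r" and s0: "0 < ?s" by auto
  have IH: "computes L (2 ^ b) W (sort_prog b d k) (\<lambda>x. crop L (seg_sort ?r x))"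
   using Suc.IH[of k] rL Suc.prems(2) by (simp add: k_def j_def)
  note rp = rot_perm[OF r0 s0 NL] and rp' = rot_perm[OF s0 r0 NL']
   and sp = shift_perm[OF r20 s2 NL[unfolded r2], folded r2]
  have P: "computes L (2 ^ b) W [detstep (\<lambda>x. x) \<phi>] (\<lambda>x. crop L (\<lambda>c. x (\<phi> c)))"
   if "inj_on \<phi> {..<L}" "\<phi> ` {..<L} \<subseteq> {..<L}" for \<phi>
   using computes_perm that assms(2) by blast
  have eq: "sort_prog b (Suc d) a = sort_prog b d k @ [detstep (\<lambda>x. x) (rot ?r ?s)] @
    sort_prog b d k @ [detstep (\<lambda>x. x) (rot ?s ?r)] @
    sort_prog b d k @ [detstep (\<lambda>x. x) (shift_down ?r ?s)] @
    sort_prog b d k @ [detstep (\<lambda>x. x) (shift_up ?r ?s)]"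
   using False unfolding sort_prog.simps Let_def j_def k_def by simp
  have "computes L (2 ^ b) W (sort_prog b (Suc d) a) (\<lambda>x. crop L (\<lambda>c. crop L (seg_sort ?r (crop L (\<lambda>c.
    crop L (seg_sort ?r (crop L (\<lambda>c. crop L (seg_sort ?r (crop L (\<lambda>c. crop L (seg_sort ?r x) (rot ?r ?s c))))
     (rot ?s ?r c)))) (shift_down ?r ?s c)))) (shift_up ?r ?s c)))"
   unfolding eq using computes_append[OF IH computes_append[OF P[OF rp] computes_append[OF IH
    computes_append[OF P[OF rp'] computes_append[OF IH computes_append[OF P[OF sp(1,2)]
     computes_append[OF IH P[OF sp(3,4)]]]]]]]]
   by simp
  then show ?thesis
  proof (rule computes_cong)
   fix x
   have sc: "seg_sort ?r (crop L y) c = seg_sort ?r y c" if "c < L" for y c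
    by (rule seg_sort_cong[OF r0]) (use seg_less[OF r0 rL that] in \<open>simp add: crop_def\<close>)
   have cc: "crop L y (\<phi> c) = y (\<phi> c)" if "c < L" "\<phi> ` {..<L} \<subseteq> {..<L}" for y \<phi> c
    using that by (auto simp: crop_def)
   have ct: "crop L y = crop L z" if "\<And>c. c < L \<Longrightarrow> y c = z c" for y z :: array
    using that by (auto simp: crop_def fun_eq_iff)
   have a1: "crop L (\<lambda>c. crop L (seg_sort ?r y) (\<phi> c)) = crop L (\<lambda>c. seg_sort ?r y (\<phi> c))"
    if "\<phi> ` {..<L} \<subseteq> {..<L}" for y \<phi>
    by (rule ct) (rule cc[OF _ that])
   have a2: "crop L (\<lambda>c. seg_sort ?r (crop L y) (\<phi> c)) = crop L (\<lambda>c. seg_sort ?r y (\<phi> c))"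
    if "\<phi> ` {..<L} \<subseteq> {..<L}" for y \<phi>
    by (rule ct) (rule sc, use that in auto)
   show "crop L (\<lambda>c. crop L (seg_sort ?r (crop L (\<lambda>c.
    crop L (seg_sort ?r (crop L (\<lambda>c. crop L (seg_sort ?r (crop L (\<lambda>c. crop L (seg_sort ?r x) (rot ?r ?s c))))
     (rot ?s ?r c)))) (shift_down ?r ?s c)))) (shift_up ?r ?s c)) = crop L (seg_sort (2 ^ a) x)"
    unfolding a1[OF rp(2)] a1[OF rp'(2)] a1[OF sp(2)] a1[OF sp(4)] a2[OF rp(2)] a2[OF rp'(2)] a2[OF sp(2)] a2[OF sp(4)]
    unfolding N[symmetric] columnsort[OF r20 s2 sr ss, folded r2] ..
  qed
 qed
qed

section \<open>Prefix maxima\<close>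

definition smax :: "nat set \<Rightarrow> (nat \<Rightarrow> nat) \<Rightarrow> nat" where
 "smax A f = Max (insert 0 (f ` A))"

lemma smax_less_iff: "finite A \<Longrightarrow> smax A f < \<tau> \<longleftrightarrow> 0 < \<tau> \<and> (\<forall>a\<in>A. f a < \<tau>)"
 unfolding smax_def by (subst Max_less_iff) auto

lemma smax_cong: "A = A' \<Longrightarrow> (\<And>a. a \<in> A' \<Longrightarrow> f a = g a) \<Longrightarrow> smax A f = smax A' g"
 unfolding smax_def by (metis image_cong)

lemma smax_image: "smax (g ` A) f = smax A (\<lambda>a. f (g a))"
 unfolding smax_def by (simp add: image_image)

text \<open>A word consists of a payload and two digits in base \<open>X\<close>: the maximum over
  the current segment and the maximum over its part up to the cell. The final \<open>mod W\<close>
  does not change the words of valid states; it bounds the result for arbitrary arrays, as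
  \<open>valid_step\<close> demands. The same device recurs in later steps.\<close>

definition scan_local :: "nat \<Rightarrow> nat \<Rightarrow> nat \<Rightarrow> array \<Rightarrow> array" where
 "scan_local W X s x c = ((x c div (X * X) * X + smax {c'. c' div s = c div s} (\<lambda>c. x c div X mod X)) * X +
   max (x c mod X) (smax {c'. c' div s = c div s \<and> c' < c} (\<lambda>c. x c div X mod X))) mod W"

definition scan_state :: "nat \<Rightarrow> nat \<Rightarrow> nat \<Rightarrow> array \<Rightarrow> array \<Rightarrow> array" where
 "scan_state L X r u z = crop L (\<lambda>c. (u c * X + smax {c'. c' div r = c div r} z) * X +
   smax {c'. c' div r = c div r \<and> c' \<le> c} z)"

fun scan_prog :: "nat \<Rightarrow> nat \<Rightarrow> nat \<Rightarrow> nat \<Rightarrow> nat \<Rightarrow> nat \<Rightarrow> array_step list" where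
 "scan_prog W X b 0 k a = []"
| "scan_prog W X b (Suc f) k a = (let j = min b (a - k) in
   [detstep (\<lambda>x. x) (rot (2 ^ j) (2 ^ k)), detstep (scan_local W X (2 ^ j)) (rot (2 ^ k) (2 ^ j))] @
   scan_prog W X b f (k + j) a)"

lemma length_scan_prog: "length (scan_prog W X b f k a) = 2 * f"
 by (induction f arbitrary: k) (auto simp: Let_def)

text \<open>The rotation brings together the \<open>s\<close> cells with the same offset in
  \<open>s\<close> consecutive segments of length \<open>r\<close>. Jointly they know all
  \<open>s\<close> segment maxima, which is enough to find the maximum of the merged segment and
  that of the segments before each of them.\<close>

lemma scan_step:
 assumes r: "0 < r" and s: "0 < s" and L: "r * s dvd L"
  and u: "\<And>c. c < L \<Longrightarrow> u c < U" and z: "\<And>c. z c < X" and W: "U * X * X \<le> W" "0 < W"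
 shows "prog_sem L [detstep (\<lambda>x. x) (rot s r), detstep (scan_local W X s) (rot r s)] (scan_state L X r u z) =
  return_pmf (scan_state L X (r * s) u z)"
proof -
 have X0: "0 < X" using z[of 0] by simp
 have L': "s * r dvd L" using L by (simp add: mult.commute)
 note rp = rot_perm[OF r s L] and rp' = rot_perm[OF s r L']
 define x1 where "x1 = crop L (\<lambda>c. scan_state L X r u z (rot s r c))"
 have smX: "smax A z < X" if "finite A" for A using smax_less_iff[OF that, of z X] z X0 by simp
 have finr: "finite {c'. c' div t = q}" if "0 < t" for q t :: nat using finite_seg[OF that, of q "\<lambda>_. True"] by simp
 have "crop L (\<lambda>c. scan_local W X s x1 (rot r s c)) = scan_state L X (r * s) u z"
  unfolding scan_state_def
 proof (rule ext)
  fix c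
  show "crop L (\<lambda>c. scan_local W X s x1 (rot r s c)) c = crop L (\<lambda>c. (u c * X + smax {c'. c' div (r * s) = c div (r * s)} z) * X +
   smax {c'. c' div (r * s) = c div (r * s) \<and> c' \<le> c} z) c"
  proof (cases "c < L")
   case False
   then show ?thesis by (simp add: crop_def)
  next
   case cL: True
   obtain q i m where c: "c = q * (r * s) + m * r + i" "i < r" "m < s" "q = c div (r * s)"
    using digits[OF r s, of c] by metis
   \<comment> \<open>\<open>D\<close> numbers the group that contains \<open>c\<close> after the
     rotation, and \<open>e m'\<close> is the member of this group that comes from the segment
     \<open>m'\<close>.\<close>
   define D where "D = q * r + i"
   define e where "e m' = q * (r * s) + m' * r + i" for m'
   have d: "rot r s c = D * s + m"
    using rot_digits[OF r s c(2,3), of q] c(1) by (simp add: D_def algebra_simps)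
   have rD: "rot s r (D * s + m') = e m'" if "m' < s" for m'
   proof -
    have "D * s + m' = q * (s * r) + i * s + m'" by (simp add: D_def algebra_simps)
    then show ?thesis using rot_digits[OF s r that c(2), of q] by (simp add: e_def mult.commute)
   qed
   have eL: "e m' < L" if "m' < s" for m'
   proof (rule seg_less[OF _ L cL])
    have "m' * r + i < r * s" using mult_add_less[OF that c(2)] by (simp add: mult.commute)
    then show "e m' div (r * s) = c div (r * s)" using r s by (simp add: e_def add.assoc c(4)[symmetric])
   qed (use r s in simp)
   have DL: "D * s + m' < L" if "m' < s" for m'
   proof -
    have "rot r s (e m') = D * s + m'"
     using rot_digits[OF r s c(2) that, of q] by (simp add: e_def D_def algebra_simps)
    then show ?thesis using rp(2) eL[OF that] by fastforce
   qed
   have x1: "x1 (D * s + m') = (u (e m') * X + smax {c'. c' div r = e m' div r} z) * X +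
     smax {c'. c' div r = e m' div r \<and> c' \<le> e m'} z" if "m' < s" for m'
    using DL[OF that] rD[OF that] eL[OF that] by (simp add: x1_def crop_def scan_state_def)
   have em: "e m' div r = q * s + m'" for m'
   proof -
    have "e m' = (q * s + m') * r + i" by (simp add: e_def algebra_simps)
    then show ?thesis using c(2) by simp
   qed
   have tot: "x1 (D * s + m') div X mod X = smax {c'. c' div r = q * s + m'} z"
    and pre: "x1 (D * s + m') mod X = smax {c'. c' div r = q * s + m' \<and> c' \<le> e m'} z"
    and uu: "x1 (D * s + m') div (X * X) = u (e m')" if "m' < s" for m'
    using x1[OF that] X0 smX[OF finr[OF r, of "q * s + m'"]] smX[OF finite_seg[OF r, of "q * s + m'" "\<lambda>c'. c' \<le> e m'"]]
    by (simp_all add: em div_mult2_eq)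
   have g1: "{c'. c' div s = D} = (\<lambda>m'. D * s + m') ` {..<s}"
    using seg_eq[OF s, of D] by (simp add: image_add_atLeastLessThan lessThan_atLeast0 add.commute)
   have g2: "{c'. c' div s = D \<and> c' < D * s + m} = (\<lambda>m'. D * s + m') ` {..<m}"
   proof (intro equalityI subsetI)
    fix c' assume c': "c' \<in> {c'. c' div s = D \<and> c' < D * s + m}"
    then have "c' \<in> (\<lambda>m'. D * s + m') ` {..<s}" using g1 by blast
    then show "c' \<in> (\<lambda>m'. D * s + m') ` {..<m}" using c' by auto
   next
    fix c' assume "c' \<in> (\<lambda>m'. D * s + m') ` {..<m}"
    then obtain m' where m': "c' = D * s + m'" "m' < m" by auto
    then show "c' \<in> {c'. c' div s = D \<and> c' < D * s + m}" using c(3) s by simp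
   qed
   have div_q: "c' div (r * s) = q \<longleftrightarrow> (\<exists>m'<s. c' div r = q * s + m')" for c'
   proof
    assume "c' div (r * s) = q"
    then have "c' div r div s = q" by (simp add: div_mult2_eq)
    then have "c' div r = q * s + c' div r mod s" using div_mult_mod_eq[of "c' div r" s] by simp
    then show "\<exists>m'<s. c' div r = q * s + m'" using s mod_less_divisor by blast
   next
    assume "\<exists>m'<s. c' div r = q * s + m'"
    then show "c' div (r * s) = q" by (auto simp: div_mult2_eq)
   qed
   have t: "smax {c'. c' div s = (D * s + m) div s} (\<lambda>c. x1 c div X mod X) = smax {c'. c' div (r * s) = q} z"
   proof (rule less_iff_eqI)
    fix \<tau>
    have "smax {c'. c' div s = (D * s + m) div s} (\<lambda>c. x1 c div X mod X) =
      smax {..<s} (\<lambda>m'. smax {c'. c' div r = q * s + m'} z)"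
     using c(3) s by (simp add: g1 smax_image, intro smax_cong) (auto simp: tot)
    then show "smax {c'. c' div s = (D * s + m) div s} (\<lambda>c. x1 c div X mod X) < \<tau> \<longleftrightarrow> smax {c'. c' div (r * s) = q} z < \<tau>"
     using r s by (auto simp: smax_less_iff finr div_q)
   qed
   have p: "max (x1 (D * s + m) mod X) (smax {c'. c' div s = (D * s + m) div s \<and> c' < D * s + m} (\<lambda>c. x1 c div X mod X))
     = smax {c'. c' div (r * s) = q \<and> c' \<le> c} z"
   proof (rule less_iff_eqI)
    fix \<tau>
    have "smax {c'. c' div s = (D * s + m) div s \<and> c' < D * s + m} (\<lambda>c. x1 c div X mod X) =
      smax {..<m} (\<lambda>m'. smax {c'. c' div r = q * s + m'} z)"
     using c(3) s by (simp add: g2 smax_image, intro smax_cong) (auto simp: tot)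
    then have "max (x1 (D * s + m) mod X) (smax {c'. c' div s = (D * s + m) div s \<and> c' < D * s + m} (\<lambda>c. x1 c div X mod X)) < \<tau>
     \<longleftrightarrow> 0 < \<tau> \<and> (\<forall>c'. c' div r = q * s + m \<and> c' \<le> e m \<longrightarrow> z c' < \<tau>) \<and>
       (\<forall>m'<m. \<forall>c'. c' div r = q * s + m' \<longrightarrow> z c' < \<tau>)"
     using pre[OF c(3)] r by (auto simp: smax_less_iff finr finite_seg)
    also have "e m = c" using c(1) by (simp add: e_def)
    also have "(0 < \<tau> \<and> (\<forall>c'. c' div r = q * s + m \<and> c' \<le> c \<longrightarrow> z c' < \<tau>) \<and>
       (\<forall>m'<m. \<forall>c'. c' div r = q * s + m' \<longrightarrow> z c' < \<tau>)) \<longleftrightarrow>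
      0 < \<tau> \<and> (\<forall>c'. c' div (r * s) = q \<and> c' \<le> c \<longrightarrow> z c' < \<tau>)"
    proof -
     have cr: "c div r = q * s + m" using em[of m] \<open>e m = c\<close> by simp
     have lt: "c' \<le> c" if "c' div r = q * s + m'" "m' < m" for c' m'
     proof (rule ccontr)
      assume "\<not> c' \<le> c"
      then have "c div r \<le> c' div r" by (intro div_le_mono) simp
      then show False using that cr by simp
     qed
     have gt: "m' \<le> m" if "c' div r = q * s + m'" "c' \<le> c" for c' m'
      using div_le_mono[OF that(2), of r] that(1) cr by simp
     show ?thesis using c(3) lt gt unfolding div_q
      by (smt (verit, ccfv_threshold) le_neq_implies_less less_trans)
    qed
    also have "\<dots> \<longleftrightarrow> smax {c'. c' div (r * s) = q \<and> c' \<le> c} z < \<tau>"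
     using r s by (simp add: smax_less_iff finite_seg)
    finally show "max (x1 (D * s + m) mod X) (smax {c'. c' div s = (D * s + m) div s \<and> c' < D * s + m} (\<lambda>c. x1 c div X mod X)) < \<tau>
     \<longleftrightarrow> smax {c'. c' div (r * s) = q \<and> c' \<le> c} z < \<tau>" .
   qed
   have uc: "x1 (D * s + m) div (X * X) = u c" using uu[OF c(3)] c(1) by (simp add: e_def)
   have "u c * X + smax {c'. c' div (r * s) = q} z < U * X"
    using mult_add_less[OF u[OF cL] smX[OF finr[of "r * s"], of q]] r s by simp
   then have "(u c * X + smax {c'. c' div (r * s) = q} z) * X + smax {c'. c' div (r * s) = q \<and> c' \<le> c} z < U * X * X"
    using mult_add_less[OF _ smX[OF finite_seg[of "r * s" q "\<lambda>c'. c' \<le> c"]]] r s by simp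
   then have "scan_local W X s x1 (rot r s c) = (u c * X + smax {c'. c' div (r * s) = q} z) * X +
     smax {c'. c' div (r * s) = q \<and> c' \<le> c} z"
    unfolding scan_local_def d t p uc using W by simp
   then show ?thesis using cL c(4) by (simp add: crop_def)
  qed
 qed
 then show ?thesis
  using prog_sem_append[of L "[detstep (\<lambda>x. x) (rot s r)]" "[detstep (scan_local W X s) (rot r s)]" "scan_state L X r u z"]
  by (simp add: prog_sem_detstep[OF rp(2)] prog_sem_detstep[OF rp'(2)] bind_return_pmf x1_def
    del: prog_sem.simps)
qed

lemma valid_scan_local:
 assumes "j \<le> b" "0 < W" "inj_on \<phi> {..<L}" "\<phi> ` {..<L} \<subseteq> {..<L}"
 shows "valid_step L (2 ^ b) W (detstep (scan_local W X (2 ^ j)) \<phi>)"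
proof (rule valid_detstep[OF _ _ assms(3,4)])
 show "block_local (2 ^ b) (scan_local W X (2 ^ j))"
  unfolding block_local_def
 proof (intro allI impI)
  fix x y :: array and c
  assume eq: "\<forall>c'. c' div 2 ^ b = c div 2 ^ b \<longrightarrow> x c' = y c'"
  have pw: "(2::nat) ^ b = 2 ^ j * 2 ^ (b - j)" using assms(1) by (simp add: power_add[symmetric])
  have e: "x c' = y c'" if "c' div 2 ^ j = c div 2 ^ j" for c'
  proof -
   have "c' div 2 ^ b = c div 2 ^ b" unfolding pw using that by (simp add: div_mult2_eq)
   then show "x c' = y c'" using eq by simp
  qed
  have "smax {c'. c' div 2 ^ j = c div 2 ^ j} (\<lambda>c. x c div X mod X) =
    smax {c'. c' div 2 ^ j = c div 2 ^ j} (\<lambda>c. y c div X mod X)"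
   "smax {c'. c' div 2 ^ j = c div 2 ^ j \<and> c' < c} (\<lambda>c. x c div X mod X) =
    smax {c'. c' div 2 ^ j = c div 2 ^ j \<and> c' < c} (\<lambda>c. y c div X mod X)"
   using e by (auto intro!: smax_cong)
  then show "scan_local W X (2 ^ j) x c = scan_local W X (2 ^ j) y c"
   using e[of c] by (simp add: scan_local_def)
 qed
qed (use assms in \<open>simp add: scan_local_def\<close>)

text \<open>A stage multiplies the segment length by the block size until the whole range is
  reached, so the number \<open>f\<close> of stages is about the ratio of the exponents
  \<open>a\<close> and \<open>b\<close>.\<close>

theorem prog_sem_scan:
 assumes "2 ^ a dvd L" "k \<le> a" "a \<le> k + f * b"
  and "\<And>c. c < L \<Longrightarrow> u c < U" and "\<And>c. z c < X" and "U * X * X \<le> W" "0 < W"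
 shows "prog_sem L (scan_prog W X b f k a) (scan_state L X (2 ^ k) u z) = return_pmf (scan_state L X (2 ^ a) u z)
  \<and> (\<forall>st\<in>set (scan_prog W X b f k a). valid_step L (2 ^ b) W st)"
 using assms(2,3)
proof (induction f arbitrary: k)
 case 0
 then show ?case by simp
next
 case (Suc f)
 define j where "j = min b (a - k)"
 have j: "j \<le> b" "k + j \<le> a" "a \<le> k + j + f * b" using Suc.prems by (auto simp: j_def)
 have "(2::nat) ^ (k + j) dvd 2 ^ a" using j(2) by (rule le_imp_power_dvd)
 then have dv: "2 ^ k * 2 ^ j dvd L" unfolding power_add[symmetric] using assms(1) by (rule dvd_trans)
 have dv': "2 ^ j * 2 ^ k dvd L" using dv by (simp add: mult.commute)
 have pos: "(0::nat) < 2 ^ k" "(0::nat) < 2 ^ j" by auto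
 note rp = rot_perm[OF pos dv] and rp' = rot_perm[OF pos(2,1) dv']
 have eq: "scan_prog W X b (Suc f) k a = [detstep (\<lambda>x. x) (rot (2 ^ j) (2 ^ k)),
   detstep (scan_local W X (2 ^ j)) (rot (2 ^ k) (2 ^ j))] @ scan_prog W X b f (k + j) a"
  by (simp only: scan_prog.simps Let_def j_def)
 have 1: "prog_sem L (scan_prog W X b (Suc f) k a) (scan_state L X (2 ^ k) u z) = return_pmf (scan_state L X (2 ^ a) u z)"
 proof -
  have "prog_sem L [detstep (\<lambda>x. x) (rot (2 ^ j) (2 ^ k)),
   detstep (scan_local W X (2 ^ j)) (rot (2 ^ k) (2 ^ j))] (scan_state L X (2 ^ k) u z) =
   return_pmf (scan_state L X (2 ^ k * 2 ^ j) u z)"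
   by (rule scan_step[OF pos dv assms(4,5,6,7)])
  then show ?thesis using Suc.IH[OF j(2,3)]
   by (simp only: eq prog_sem_append bind_return_pmf power_add)
 qed
 have "valid_step L (2 ^ b) W (detstep (\<lambda>x. x) (rot (2 ^ j) (2 ^ k)))"
  by (rule valid_detstep) (use rp' in \<open>auto simp: block_local_def\<close>)
 moreover have "valid_step L (2 ^ b) W (detstep (scan_local W X (2 ^ j)) (rot (2 ^ k) (2 ^ j)))"
  by (rule valid_scan_local) (use rp j assms in auto)
 ultimately show ?case using Suc.IH[OF j(2,3)] 1 unfolding eq by simp
qed

lemma mult_add_div_mod:
 assumes "v < (T::nat)" shows "(q * T + v) div T = q" "(q * T + v) mod T = v"
 using assms by auto

section \<open>Positions of values in a sorted array\<close>

lemma seg_sort_full_less: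
 assumes "c < L"
 shows "seg_sort L x c < \<tau> \<longleftrightarrow> c < card {d. d < L \<and> x d < \<tau>}"
proof -
 have L: "0 < L" using assms by simp
 have "bsort L (\<lambda>c. x c < \<tau>) c \<longleftrightarrow> c < card {d. d < L \<and> x d < \<tau>}"
  using assms by (simp add: bsort_def div_eq_0_iff L)
 then show ?thesis unfolding seg_sort_less_iff[OF L] .
qed

lemma seg_sort_full_mono:
 assumes "c \<le> c'" "c' < L"
 shows "seg_sort L x c \<le> seg_sort L x c'"
proof -
 have "c' < card {d. d < L \<and> x d < Suc (seg_sort L x c')}"
  using seg_sort_full_less[OF assms(2), of x "Suc (seg_sort L x c')"] by blast
 then have "c < card {d. d < L \<and> x d < Suc (seg_sort L x c')}" using assms(1) by (rule le_less_trans[rotated])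
 then have "seg_sort L x c < Suc (seg_sort L x c')"
  using seg_sort_full_less[OF le_less_trans[OF assms], of x "Suc (seg_sort L x c')"] by blast
 then show ?thesis by simp
qed

lemma seg_sort_full_mem:
 assumes "c < L" shows "\<exists>d<L. seg_sort L x c = x d"
proof -
 have "seg_sort L x c \<in> set (sort (map x [c div L * L..<c div L * L + L]))"
  unfolding seg_sort_def using assms by (intro nth_mem) simp
 then show ?thesis using assms by auto
qed

lemma card_less_Suc_self:
 fixes x :: array
 assumes "d < L"
 shows "card {d'. d' < L \<and> x d' < x d} < card {d'. d' < L \<and> x d' < Suc (x d)}"
 by (rule psubset_card_mono) (use assms in auto)

lemma seg_sort_full_pos:
 fixes x :: array
 assumes "d < L" shows "card {d'. d' < L \<and> x d' < x d} < L"
proof -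
 have "card {d'. d' < L \<and> x d' < Suc (x d)} \<le> card {..<L}" by (intro card_mono) auto
 then show ?thesis using card_less_Suc_self[OF assms, of x] by simp
qed

lemma seg_sort_full_at:
 fixes x :: array
 assumes "d < L" shows "seg_sort L x (card {d'. d' < L \<and> x d' < x d}) = x d"
proof -
 let ?c = "card {d'. d' < L \<and> x d' < x d}"
 have "\<not> seg_sort L x ?c < x d"
  unfolding seg_sort_full_less[OF seg_sort_full_pos[OF assms]] by (rule less_irrefl)
 moreover have "seg_sort L x ?c < Suc (x d)"
  unfolding seg_sort_full_less[OF seg_sort_full_pos[OF assms]] by (rule card_less_Suc_self[OF assms])
 ultimately show ?thesis by simp
qed

lemma seg_sort_full_unique:
 fixes x :: array
 assumes c: "c < L" "d < L" "seg_sort L x c = x d"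
  and uniq: "\<And>d'. d' < L \<Longrightarrow> x d' = x d \<Longrightarrow> d' = d"
 shows "c = card {d'. d' < L \<and> x d' < x d}"
proof -
 have "{d'. d' < L \<and> x d' < Suc (x d)} = insert d {d'. d' < L \<and> x d' < x d}"
 proof (intro equalityI subsetI)
  fix e assume "e \<in> {d'. d' < L \<and> x d' < Suc (x d)}"
  then have "e < L" "x e < x d \<or> x e = x d" by (simp_all add: less_Suc_eq)
  then show "e \<in> insert d {d'. d' < L \<and> x d' < x d}" using uniq[of e] by blast
 next
  fix e assume "e \<in> insert d {d'. d' < L \<and> x d' < x d}"
  then show "e \<in> {d'. d' < L \<and> x d' < Suc (x d)}" using c(2) by (elim insertE) simp_all
 qed
 then have "card {d'. d' < L \<and> x d' < Suc (x d)} = Suc (card {d'. d' < L \<and> x d' < x d})" by simp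
 moreover have "c < card {d'. d' < L \<and> x d' < Suc (x d)}"
  unfolding seg_sort_full_less[OF c(1), symmetric] c(3) by (rule lessI)
 moreover have "\<not> c < card {d'. d' < L \<and> x d' < x d}"
  unfolding seg_sort_full_less[OF c(1), symmetric] c(3) by (rule less_irrefl)
 ultimately show ?thesis by linarith
qed

lemma seg_sort_full_image:
 fixes x :: array and L :: nat
 assumes "0 < L" "d < L"
 shows "seg_sort L x ` {..card {d'. d' < L \<and> x d' < x d}} = x ` {d'. d' < L \<and> x d' \<le> x d}"
proof -
 note ss = seg_sort_full_less[of _ L x] seg_sort_full_mono[of _ _ L x] seg_sort_full_mem[of _ L x]
  seg_sort_full_pos[of _ L x] seg_sort_full_at[of _ L x]
 let ?c = "card {d'. d' < L \<and> x d' < x d}"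
 have 1: "v \<in> x ` {d'. d' < L \<and> x d' \<le> x d}" if v: "v \<in> seg_sort L x ` {..?c}" for v
 proof -
  obtain c where c: "c \<le> ?c" "v = seg_sort L x c" using v by blast
  have cL: "c < L" using c(1) ss(4)[OF assms(2)] by (rule le_less_trans)
  obtain d' where d': "d' < L" "v = x d'" using ss(3)[OF cL] c by auto
  have "v \<le> x d" using ss(2)[OF c(1) ss(4)[OF assms(2)]] unfolding ss(5)[OF assms(2)] c(2) .
  then show ?thesis using d' by blast
 qed
 have 2: "v \<in> seg_sort L x ` {..?c}" if v: "v \<in> x ` {d'. d' < L \<and> x d' \<le> x d}" for v
 proof -
  obtain d' where d': "d' < L" "x d' \<le> x d" "v = x d'" using v by blast
  have "card {e. e < L \<and> x e < x d'} \<le> ?c" using d' by (intro card_mono) auto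
  moreover have "v = seg_sort L x (card {e. e < L \<and> x e < x d'})" using ss(5)[OF d'(1)] d'(3) by simp
  ultimately show ?thesis by (intro image_eqI[of v _ "card {e. e < L \<and> x e < x d'}"]) simp_all
 qed
 show ?thesis using 1 2 by (intro equalityI subsetI)
qed

section \<open>Sorting records and queries together\<close>

definition ss_items :: "nat \<Rightarrow> nat \<Rightarrow> nat \<Rightarrow> (nat \<Rightarrow> nat \<Rightarrow> nat) \<Rightarrow> (nat \<Rightarrow> nat \<Rightarrow> nat) \<Rightarrow> array \<Rightarrow> array" where
 "ss_items W half Y rk qk x c = (if even c then 2 * rk (c div 2) (x c) * (half * Y)
   else ((2 * qk (c div 2) (x (c - 1)) + 1) * half + c div 2) * Y + x (c - 1)) mod W"

definition ss_scan_in :: "nat \<Rightarrow> nat \<Rightarrow> nat \<Rightarrow> nat \<Rightarrow> array \<Rightarrow> array" where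
 "ss_scan_in W half X Y y c = (let z = (if even (y c div (half * Y)) then y c div (half * Y) div 2 else 0) in
   (y c * X + z) * X + z) mod W"

text \<open>Records are replaced by a word that exceeds every returning query, so the second sort
  leaves the queries, ordered by home index, in the first \<open>half\<close> cells. The lowest
  digit reports the position \<open>c\<close> in the first sorted order.\<close>

definition ss_return :: "nat \<Rightarrow> nat \<Rightarrow> nat \<Rightarrow> nat \<Rightarrow> array \<Rightarrow> array" where
 "ss_return W half X Y y c = (let u = y c div (X * X) in
   if even (u div (half * Y)) then half * Y * X * (2 * half)
   else (u mod (half * Y) * X + y c mod X) * (2 * half) + c mod (2 * half)) mod W"

definition ss_home :: "nat \<Rightarrow> nat \<Rightarrow> nat \<Rightarrow> nat \<Rightarrow> (nat \<Rightarrow> nat \<Rightarrow> nat \<Rightarrow> nat \<Rightarrow> nat) \<Rightarrow> array \<Rightarrow> array" where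
 "ss_home W half X Y upd y c = (if c < half then
   upd c (y c div (2 * half * X) mod Y) (y c div (2 * half) mod X) (y c mod (2 * half)) else 0) mod W"

text \<open>Each home cell \<open>d\<close> issues a record in cell \<open>2 * d\<close> and a query
  in cell \<open>2 * d + 1\<close>. The parity of the leading digit puts a record before a query
  exactly if its key \<open>rk\<close> is at most the key \<open>qk\<close>; the query carries its
  home index and its word along. After sorting, the prefix maximum shows each query the largest
  record before it, and a second sort brings the queries home.\<close>

definition sort_scan_prog :: "nat \<Rightarrow> nat \<Rightarrow> nat \<Rightarrow> nat \<Rightarrow> nat \<Rightarrow> nat \<Rightarrow> nat \<Rightarrow> (nat \<Rightarrow> nat \<Rightarrow> nat) \<Rightarrow>
  (nat \<Rightarrow> nat \<Rightarrow> nat) \<Rightarrow> (nat \<Rightarrow> nat \<Rightarrow> nat \<Rightarrow> nat \<Rightarrow> nat) \<Rightarrow> array_step list" where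
 "sort_scan_prog W a b d f X Y rk qk upd =
   [detstep (\<lambda>x. x) (rot 2 (2 ^ (a - 1)))] @ [detstep (ss_items W (2 ^ (a - 1)) Y rk qk) id] @
   sort_prog b d a @ [detstep (ss_scan_in W (2 ^ (a - 1)) X Y) id] @ scan_prog W X b f 0 a @
   [detstep (ss_return W (2 ^ (a - 1)) X Y) id] @ sort_prog b d a @
   [detstep (ss_home W (2 ^ (a - 1)) X Y upd) id]"

lemma length_sort_scan_prog: "length (sort_scan_prog W a b d f X Y rk qk upd) \<le> 4 * 6 ^ d + 2 * f + 5"
 using length_sort_prog[of b d a] by (simp add: sort_scan_prog_def length_scan_prog)

lemma valid_cellwise:
 assumes "\<And>x y c. x c = y c \<Longrightarrow> F x c = F y c" "\<And>x c. F x c < W"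
 shows "valid_step L B W (detstep F id)"
proof (rule valid_detstep)
 show "block_local B F"
  unfolding block_local_def using assms(1) by blast
qed (use assms(2) in auto)

lemma valid_sort_scan_prog:
 assumes "2 ^ a dvd L" "1 \<le> a" "4 \<le> b" "0 < W" "shrink d a \<le> b" "a \<le> f * b" "0 < X"
  and "L = 2 ^ a" and "X * X \<le> W"
 shows "\<forall>s\<in>set (sort_scan_prog W a b d f X Y rk qk upd). valid_step L (2 ^ b) W s"
proof -
 have L: "2 * 2 ^ (a - 1) dvd L" using assms(1,2) by (cases a) auto
 have "valid_step L (2 ^ b) W (detstep (\<lambda>x. x) (rot 2 (2 ^ (a - 1))))"
  using rot_perm[OF _ _ L] by (intro valid_detstep) (auto simp: block_local_def)
 moreover have "valid_step L (2 ^ b) W (detstep (ss_items W (2 ^ (a - 1)) Y rk qk) id)"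
 proof (rule valid_detstep)
  show "block_local (2 ^ b) (ss_items W (2 ^ (a - 1)) Y rk qk)"
   unfolding block_local_def
  proof (intro allI impI)
   fix x y :: array and c assume eq: "\<forall>c'. c' div 2 ^ b = c div 2 ^ b \<longrightarrow> x c' = y c'"
   have b: "(2::nat) ^ b = 2 * 2 ^ (b - 1)" using assms(3) by (cases b) auto
   \<comment> \<open>Blocks have even length, so an odd cell and its predecessor lie on the same
     machine and the query can read the word of its home cell.\<close>
   have "(c - 1) div 2 ^ b = c div 2 ^ b" if "odd c"
   proof -
    have "(c - 1) div 2 = c div 2" using that by presburger
    then show ?thesis unfolding b by (simp add: div_mult2_eq)
   qed
   then show "ss_items W (2 ^ (a - 1)) Y rk qk x c = ss_items W (2 ^ (a - 1)) Y rk qk y c"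
    using eq by (simp add: ss_items_def)
  qed
 qed (use assms in \<open>auto simp: ss_items_def\<close>)
 moreover have "\<forall>s\<in>set (sort_prog b d a). valid_step L (2 ^ b) W s"
  using computes_sort_prog[OF assms(3,4,1,5)] by (simp add: computes_def)
 moreover have "valid_step L (2 ^ b) W (detstep (ss_scan_in W (2 ^ (a - 1)) X Y) id)"
  "valid_step L (2 ^ b) W (detstep (ss_return W (2 ^ (a - 1)) X Y) id)"
  "valid_step L (2 ^ b) W (detstep (ss_home W (2 ^ (a - 1)) X Y upd) id)"
  using assms by (auto intro!: valid_cellwise simp: ss_scan_in_def ss_return_def ss_home_def Let_def)
 moreover have "\<forall>s\<in>set (scan_prog W X b f 0 a). valid_step L (2 ^ b) W s"
  using prog_sem_scan[OF assms(1), of 0 f b "\<lambda>_. 0" 1 "\<lambda>_. 0" X W] assms by simp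
 ultimately show ?thesis by (auto simp: sort_scan_prog_def)
qed

text \<open>The position of a query counts the records with key at most its own and the earlier
  queries, with ties broken by home index. As it is returned together with the prefix maximum, one
  program serves both for lookups and for counting.\<close>

theorem prog_sem_sort_scan:
 fixes a b d f X Y W :: nat and x :: array and rk qk :: "nat \<Rightarrow> nat \<Rightarrow> nat"
 defines "L \<equiv> 2 ^ a" and "half \<equiv> 2 ^ (a - 1)"
 assumes a: "1 \<le> a" and b: "4 \<le> b" and dep: "shrink d a \<le> b" "a \<le> f * b"
  and W: "L * L * X * X * X * Y < W"
  and x: "wf_array L W x" "\<And>c. c < half \<Longrightarrow> x c < Y"
  and rk: "\<And>c. c < half \<Longrightarrow> rk c (x c) < X" and qk: "\<And>c. c < half \<Longrightarrow> qk c (x c) < X"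
 shows "prog_sem L (sort_scan_prog W a b d f X Y rk qk upd) x = return_pmf (crop half (\<lambda>c.
   upd c (x c) (smax {d. d < half \<and> rk d (x d) \<le> qk c (x c)} (\<lambda>d. rk d (x d)))
    (card {d. d < half \<and> rk d (x d) \<le> qk c (x c)} +
    card {d. d < half \<and> (qk d (x d) < qk c (x c) \<or> qk d (x d) = qk c (x c) \<and> d < c)}) mod W))"
proof -
 have L2: "L = 2 * half" using a by (cases a) (auto simp: L_def half_def)
 have half0: "0 < half" by (simp add: half_def)
 have L0: "0 < L" by (simp add: L_def)
 have X0: "0 < X" using rk[OF half0] by simp
 have Y0: "0 < Y" using x(2)[OF half0] by simp
 have W0: "0 < W" using W by simp
 have dvL: "2 ^ a dvd L" by (simp add: L_def)
 have eo: "2 * i \<noteq> 2 * j + (1::nat)" for i j by presburger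
 let ?T = "half * Y"
 have T0: "0 < ?T" using half0 Y0 by simp
 define R where "R d = 2 * rk d (x d) * ?T" for d
 define Q where "Q d = ((2 * qk d (x d) + 1) * half + d) * Y + x d" for d
 define U where "U = 2 * X * half * Y"
 have UW: "U * X * X \<le> W" "U \<le> W" "half * Y * X * L < W"
 proof -
  have LL: "L \<le> L * L" using L0 by simp
  have 0: "U * X * X = L * (X * X * X * Y)" by (simp add: U_def L2)
  have "L * (X * X * X * Y) \<le> (L * L) * (X * X * X * Y)" using LL by (rule mult_le_mono1)
  then have "L * (X * X * X * Y) \<le> L * L * X * X * X * Y" by (simp add: mult.assoc)
  then show UXX: "U * X * X \<le> W" using W unfolding 0 by linarith
  have "U * 1 \<le> U * (X * X)" using X0 by (intro mult_le_mono2) simp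
  then show "U \<le> W" using UXX unfolding mult.assoc[of U] mult_1_right by linarith
  have "half * Y * X * L \<le> L * Y * X * L" using L2 by simp
  also have "\<dots> = L * L * X * Y * 1" by simp
  also have "\<dots> \<le> L * L * X * Y * (X * X)" using X0 by (intro mult_le_mono2) simp
  also have "\<dots> = L * L * X * X * X * Y" by simp
  finally show "half * Y * X * L < W" using W by linarith
 qed
 have low: "d * Y + x d < ?T" if "d < half" for d using mult_add_less[OF that x(2)[OF that]] .
 have Qe: "Q d = (2 * qk d (x d) + 1) * ?T + (d * Y + x d)" for d by (simp add: Q_def algebra_simps)
 have Qdiv: "Q d div ?T = 2 * qk d (x d) + 1" "Q d mod ?T = d * Y + x d" if "d < half" for d
  unfolding Qe by (rule mult_add_div_mod[OF low[OF that]])+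
 have Rdiv: "R d div ?T = 2 * rk d (x d)" for d unfolding R_def using T0 by simp
 have QT: "Q d < (2 * qk d (x d) + 2) * ?T" if "d < half" for d
 proof -
  have e: "(2 * q + 2) * t = (2 * q + 1) * t + t" for q t :: nat by simp
  show ?thesis unfolding Qe e using low[OF that] by linarith
 qed
 have QU: "Q d < U" if "d < half" for d
 proof -
  have "Q d < (2 * qk d (x d) + 2) * ?T" by (rule QT[OF that])
  also have "\<dots> \<le> (2 * X) * ?T" using qk[OF that] by (intro mult_le_mono1) simp
  finally show ?thesis by (simp add: U_def mult.assoc)
 qed
 have RU: "R d < U" if "d < half" for d
 proof -
  have "R d < (2 * X) * ?T" unfolding R_def using rk[OF that] T0 by (intro mult_strict_right_mono) simp_all
  then show ?thesis by (simp add: U_def mult.assoc)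
 qed
 have RQ: "R d < Q e \<longleftrightarrow> rk d (x d) \<le> qk e (x e)" "R d \<noteq> Q e" if "d < half" "e < half" for d e
 proof -
  show "R d \<noteq> Q e"
  proof
   assume "R d = Q e"
   then have "R d div ?T = Q e div ?T" by (rule arg_cong)
   then show False unfolding Qdiv(1)[OF that(2)] Rdiv[of d] using eo by blast
  qed
  show "R d < Q e \<longleftrightarrow> rk d (x d) \<le> qk e (x e)"
  proof
   assume "R d < Q e"
   then have "R d div ?T \<le> Q e div ?T" by (intro div_le_mono) simp
   then show "rk d (x d) \<le> qk e (x e)" using Qdiv(1)[OF that(2)] Rdiv[of d] by simp
  next
   assume "rk d (x d) \<le> qk e (x e)"
   then have "2 * rk d (x d) < 2 * qk e (x e) + 1" by simp
   then have "R d < (2 * qk e (x e) + 1) * ?T" unfolding R_def using T0 by (intro mult_strict_right_mono)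
   then show "R d < Q e" unfolding Qe by simp
  qed
 qed
 have QQ: "Q d < Q e \<longleftrightarrow> qk d (x d) < qk e (x e) \<or> qk d (x d) = qk e (x e) \<and> d < e"
  if "d < half" "e < half" for d e
 proof -
  have dY: "d * Y + x d < e * Y + x e" if "d < e" "d < half" for d e
  proof -
   have "Suc d * Y \<le> e * Y" using that by (intro mult_le_mono1) simp
   then show ?thesis using x(2)[OF that(2)] by simp
  qed
  consider "qk d (x d) < qk e (x e)" | "qk e (x e) < qk d (x d)" | "qk d (x d) = qk e (x e)" by linarith
  then show ?thesis
  proof cases
   case 1
   have "Q d < (2 * qk d (x d) + 2) * ?T" by (rule QT[OF that(1)])
   also have "\<dots> \<le> (2 * qk e (x e) + 1) * ?T" using 1 by (intro mult_le_mono1) simp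
   finally show ?thesis using 1 unfolding Qe[of e] by simp
  next
   case 2
   have "Q e < (2 * qk e (x e) + 2) * ?T" by (rule QT[OF that(2)])
   also have "\<dots> \<le> (2 * qk d (x d) + 1) * ?T" using 2 by (intro mult_le_mono1) simp
   finally show ?thesis using 2 unfolding Qe[of d] by simp
  next
   case 3
   consider "d < e" | "e < d" | "d = e" by linarith
   then show ?thesis
   proof cases
    case 1
    then show ?thesis using 3 dY[OF 1 that(1)] unfolding Qe by simp
   next
    case 2
    then show ?thesis using 3 dY[OF 2 that(2)] unfolding Qe by simp
   qed (use 3 in simp)
  qed
 qed
 have Qinj: "d = e" if "Q d = Q e" "d < half" "e < half" for d e
  using that QQ[of d e] QQ[of e d] by auto
 define x1 where "x1 = crop L (\<lambda>c. x (rot 2 half c))"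
 define x2 where "x2 = crop L (ss_items W half Y rk qk x1)"
 have rotL: "inj_on (rot 2 half) {..<L}" "rot 2 half ` {..<L} \<subseteq> {..<L}"
  using rot_perm[of 2 half L] L2 half0 by auto
 have x1: "x1 (2 * d) = x d" if "d < half" for d
  using that L2 by (simp add: x1_def crop_def rot_def)
 have x2e: "x2 (2 * d) = R d" "x2 (2 * d + 1) = Q d" if "d < half" for d
 proof -
  have "ss_items W half Y rk qk x1 (2 * d) = R d mod W" "ss_items W half Y rk qk x1 (2 * d + 1) = Q d mod W"
   unfolding ss_items_def Q_def R_def using x1[OF that] by simp_all
  then show "x2 (2 * d) = R d" "x2 (2 * d + 1) = Q d"
   using that L2 RU[OF that] QU[OF that] UW(2) unfolding x2_def crop_def by simp_all
 qed
 have cL: "c < L \<longleftrightarrow> (\<exists>d<half. c = 2 * d \<or> c = 2 * d + 1)" for c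
 proof
  assume "c < L"
  then have "c div 2 < half" using L2 by simp
  moreover have "c = 2 * (c div 2) \<or> c = 2 * (c div 2) + 1" by presburger
  ultimately show "\<exists>d<half. c = 2 * d \<or> c = 2 * d + 1" by blast
 qed (use L2 in auto)
 have x2U: "x2 c < U" if cl: "c < L" for c
 proof -
  obtain d where d: "d < half" "c = 2 * d \<or> c = 2 * d + 1" using cl unfolding cL by blast
  from d(2) show ?thesis
  proof
   assume "c = 2 * d"
   then show ?thesis using x2e(1)[OF d(1)] RU[OF d(1)] by simp
  next
   assume "c = 2 * d + 1"
   then show ?thesis using x2e(2)[OF d(1)] QU[OF d(1)] by simp
  qed
 qed
 have wf2: "wf_array L W x2"
  unfolding wf_array_def
 proof (intro conjI allI impI)
  fix c show "x2 c < W" using x2U[of c] UW W0 by (cases "c < L") (auto simp: x2_def crop_def)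
 qed (simp add: x2_def crop_def)
 define y where "y = seg_sort L x2"
 note srt = seg_sort_full_less[of _ L x2, folded y_def] seg_sort_full_mono[of _ _ L x2, folded y_def]
  seg_sort_full_mem[of _ L x2, folded y_def] seg_sort_full_pos[of _ L x2]
  seg_sort_full_at[of _ L x2, folded y_def] seg_sort_full_unique[of _ L _ x2, folded y_def]
 \<comment> \<open>The cell that the query of \<open>d\<close> reaches in the sorted order; it is
   unique because all query words are distinct and differ from all records.\<close>
 define ps where "ps d = card {c. c < L \<and> x2 c < Q d}" for d
 have x2Q: "x2 (2 * d + 1) = Q d" "2 * d + 1 < L" if "d < half" for d using x2e that L2 by auto
 have psL: "ps d < L" and yps: "y (ps d) = Q d" if "d < half" for d
  using srt(4)[OF x2Q(2)[OF that]] srt(5)[OF x2Q(2)[OF that]] x2Q(1)[OF that] by (simp_all add: ps_def)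
 have psu: "c = ps d" if "c < L" "d < half" "y c = Q d" for c d
 proof -
  have "c = card {d'. d' < L \<and> x2 d' < x2 (2 * d + 1)}"
  proof (rule srt(6)[OF that(1) x2Q(2)[OF that(2)]])
   show "y c = x2 (2 * d + 1)" using that x2Q by simp
   fix d' assume d': "d' < L" "x2 d' = x2 (2 * d + 1)"
   obtain e where e: "e < half" "d' = 2 * e \<or> d' = 2 * e + 1" using d'(1) unfolding cL by blast
   have "x2 d' = Q d" using d' x2Q(1)[OF that(2)] by simp
   then show "d' = 2 * d + 1" using e RQ(2)[OF e(1) that(2)] Qinj[OF _ e(1) that(2)] x2e[OF e(1)] by auto
  qed
  then show ?thesis using x2Q(1)[OF that(2)] by (simp add: ps_def)
 qed
 have ps_eq: "ps c = card {d. d < half \<and> rk d (x d) \<le> qk c (x c)} +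
    card {d. d < half \<and> (qk d (x d) < qk c (x c) \<or> qk d (x d) = qk c (x c) \<and> d < c)}" if c: "c < half" for c
 proof -
  let ?A = "{d. d < half \<and> rk d (x d) \<le> qk c (x c)}"
  let ?B = "{d. d < half \<and> (qk d (x d) < qk c (x c) \<or> qk d (x d) = qk c (x c) \<and> d < c)}"
  have "{c'. c' < L \<and> x2 c' < Q c} = (\<lambda>d. 2 * d) ` ?A \<union> (\<lambda>d. 2 * d + 1) ` ?B"
  proof (intro equalityI subsetI)
   fix c' assume c': "c' \<in> {c'. c' < L \<and> x2 c' < Q c}"
   then have "c' < L" by simp
   then obtain e where e: "e < half" "c' = 2 * e \<or> c' = 2 * e + 1" unfolding cL by blast
   from e(2) show "c' \<in> (\<lambda>d. 2 * d) ` ?A \<union> (\<lambda>d. 2 * d + 1) ` ?B"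
   proof
    assume "c' = 2 * e"
    then show ?thesis using c' e(1) x2e[OF e(1)] RQ(1)[OF e(1) c] by auto
   next
    assume "c' = 2 * e + 1"
    moreover have "e \<in> ?B" using c' e(1) x2e[OF e(1)] QQ[OF e(1) c] calculation by auto
    ultimately show ?thesis by blast
   qed
  next
   fix c' assume "c' \<in> (\<lambda>d. 2 * d) ` ?A \<union> (\<lambda>d. 2 * d + 1) ` ?B"
   then show "c' \<in> {c'. c' < L \<and> x2 c' < Q c}"
   proof
    assume "c' \<in> (\<lambda>d. 2 * d) ` ?A"
    then obtain e where "c' = 2 * e" "e < half" "rk e (x e) \<le> qk c (x c)" by auto
    then show ?thesis using x2e[of e] RQ(1)[of e c] c L2 by simp
   next
    assume "c' \<in> (\<lambda>d. 2 * d + 1) ` ?B"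
    then obtain e where "c' = 2 * e + 1" "e < half" "e \<in> ?B" by auto
    then show ?thesis using x2Q[of e] QQ[of e c] c by simp
   qed
  qed
  then have "ps c = card ((\<lambda>d. 2 * d) ` ?A \<union> (\<lambda>d. 2 * d + 1) ` ?B)" by (simp add: ps_def)
  also have "\<dots> = card ((\<lambda>d. 2 * d) ` ?A) + card ((\<lambda>d. 2 * d + 1) ` ?B)"
  proof (rule card_Un_disjoint)
   show "(\<lambda>d. 2 * d) ` ?A \<inter> (\<lambda>d. 2 * d + 1) ` ?B = {}" using eo by blast
  qed simp_all
  also have "\<dots> = card ?A + card ?B" by (simp add: card_image inj_on_def)
  finally show ?thesis .
 qed
 define zf where "zf u = (if even (u div ?T) then u div ?T div 2 else 0)" for u
 have zfX: "zf u < X" if "u < U" for u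
 proof -
  have "u div ?T < 2 * X" using that T0 by (simp add: div_less_iff_less_mult U_def mult.assoc)
  then show ?thesis using X0 by (auto simp: zf_def)
 qed
 have yU: "y c < U" if "c < L" for c using srt(3)[OF that] x2U by auto
 define z where "z c = (if c < L then zf (y c) else 0)" for c
 have zX: "z c < X" for c using zfX yU X0 by (simp add: z_def)
 define y' where "y' = crop L y"
 have y'U: "y' c < U" if "c < L" for c using yU that by (simp add: y'_def crop_def)
 define st where "st = scan_state L X (2 ^ a) y' z"
 have scan0: "crop L (ss_scan_in W half X Y y') = scan_state L X (2 ^ 0) y' z"
 proof (rule ext)
  fix c
  have one: "{c'. c' div 1 = c div (1::nat)} = {c}" "{c'. c' div 1 = c div (1::nat) \<and> c' \<le> c} = {c}" by auto
  have sm: "smax {c} z = z c" by (simp add: smax_def)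
  show "crop L (ss_scan_in W half X Y y') c = scan_state L X (2 ^ 0) y' z c"
  proof (cases "c < L")
   case True
   have yc: "y' c = y c" using True by (simp add: y'_def crop_def)
   have "(y c * X + z c) * X + z c < U * X * X"
    using mult_add_less[OF mult_add_less[OF yU[OF True] zX[of c]] zX[of c]] .
   then have lt: "(y c * X + z c) * X + z c < W" using UW(1) by (rule less_le_trans)
   have "ss_scan_in W half X Y y' c = ((y c * X + z c) * X + z c) mod W"
    using True unfolding ss_scan_in_def Let_def yc z_def zf_def by simp
   then have "ss_scan_in W half X Y y' c = (y c * X + z c) * X + z c"
    unfolding mod_less[OF lt] .
   then show ?thesis using True by (simp only: crop_def scan_state_def power_0 one sm yc if_True)
  qed (simp add: crop_def scan_state_def)
 qed
 have wfy: "wf_array L W y'"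
  unfolding wf_array_def
 proof (intro conjI allI impI)
  fix c show "y' c < W" using y'U[of c] UW(2) W0 by (cases "c < L") (auto simp: y'_def crop_def)
 qed (simp add: y'_def crop_def)
 have scan1: "prog_sem L (scan_prog W X b f 0 a) (scan_state L X (2 ^ 0) y' z) = return_pmf st"
  unfolding st_def using prog_sem_scan[OF dvL _ _ y'U zX UW(1) W0, of 0 f b] dep(2) by simp
 have st: "st c = (y c * X + smax {c'. c' < L} z) * X + smax {..c} z" if "c < L" for c
 proof -
  have "{c'. c' div 2 ^ a = c div 2 ^ a} = {c'. c' < L}" "{c'. c' div 2 ^ a = c div 2 ^ a \<and> c' \<le> c} = {..c}"
   using that by (auto simp: L_def[symmetric] div_eq_0_iff L0)
  then show ?thesis using that by (simp add: st_def scan_state_def crop_def y'_def)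
 qed
 define pr where "pr c = smax {d. d < half \<and> rk d (x d) \<le> qk c (x c)} (\<lambda>d. rk d (x d))" for c
 have smX: "smax A z < X" if "finite A" for A using smax_less_iff[OF that, of z X] zX X0 by simp
 have pre: "smax {..ps c} z = pr c" if c: "c < half" for c
 proof -
  have "smax {..ps c} z = smax (y ` {..ps c}) zf"
   unfolding smax_image using psL[OF c] by (intro smax_cong) (auto simp: z_def)
  also have "y ` {..ps c} = x2 ` {d'. d' < L \<and> x2 d' \<le> Q c}"
   using seg_sort_full_image[OF L0 x2Q(2)[OF c], where x = x2] x2Q(1)[OF c] by (simp add: y_def ps_def)
  also have "smax (x2 ` {d'. d' < L \<and> x2 d' \<le> Q c}) zf = pr c"
   unfolding smax_image pr_def
  proof (rule less_iff_eqI)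
   fix \<tau>
   have zR: "zf (R d) = rk d (x d)" if "d < half" for d by (simp add: zf_def Rdiv)
   \<comment> \<open>Queries contribute the neutral value 0 of \<open>smax\<close>, so only records
     are seen by the prefix maximum.\<close>
   have zQ: "zf (Q d) = 0" if "d < half" for d by (simp add: zf_def Qdiv[OF that])
   have "(\<forall>d'\<in>{d'. d' < L \<and> x2 d' \<le> Q c}. zf (x2 d') < \<tau>) \<longleftrightarrow>
    (\<forall>d\<in>{d. d < half \<and> rk d (x d) \<le> qk c (x c)}. rk d (x d) < \<tau>)" if \<tau>: "0 < \<tau>"
   proof
    assume h: "\<forall>d'\<in>{d'. d' < L \<and> x2 d' \<le> Q c}. zf (x2 d') < \<tau>"
    show "\<forall>d\<in>{d. d < half \<and> rk d (x d) \<le> qk c (x c)}. rk d (x d) < \<tau>"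
    proof
     fix d assume d: "d \<in> {d. d < half \<and> rk d (x d) \<le> qk c (x c)}"
     then have "2 * d \<in> {d'. d' < L \<and> x2 d' \<le> Q c}" using x2e[of d] RQ(1)[of d c] c L2 by auto
     then have "zf (x2 (2 * d)) < \<tau>" using h by blast
     then show "rk d (x d) < \<tau>" using d x2e[of d] zR by simp
    qed
   next
    assume h: "\<forall>d\<in>{d. d < half \<and> rk d (x d) \<le> qk c (x c)}. rk d (x d) < \<tau>"
    show "\<forall>d'\<in>{d'. d' < L \<and> x2 d' \<le> Q c}. zf (x2 d') < \<tau>"
    proof
     fix d' assume d': "d' \<in> {d'. d' < L \<and> x2 d' \<le> Q c}"
     obtain e where e: "e < half" "d' = 2 * e \<or> d' = 2 * e + 1" using d'(1) unfolding cL by blast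
     from e(2) show "zf (x2 d') < \<tau>"
     proof
      assume de: "d' = 2 * e"
      then have "R e < Q c" using d' x2e[OF e(1)] RQ(2)[OF e(1) c] by auto
      then show ?thesis using h de e(1) x2e[OF e(1)] RQ(1)[OF e(1) c] zR by simp
     next
      assume "d' = 2 * e + 1"
      then show ?thesis using x2Q(1)[OF e(1)] zQ[OF e(1)] \<tau> by simp
     qed
    qed
   qed
   then show "smax {d'. d' < L \<and> x2 d' \<le> Q c} (\<lambda>a. zf (x2 a)) < \<tau> \<longleftrightarrow>
    smax {d. d < half \<and> rk d (x d) \<le> qk c (x c)} (\<lambda>d. rk d (x d)) < \<tau>"
    by (auto simp: smax_less_iff)
  qed
  finally show ?thesis .
 qed
 \<comment> \<open>The word with which the query of \<open>d\<close> returns. Its leading digit is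
   \<open>d\<close>, so \<open>vl\<close> is strictly increasing and the second sort places it in
   cell \<open>d\<close>.\<close>
 define vl where "vl d = ((d * Y + x d) * X + pr d) * L + ps d" for d
 define H where "H = half * Y * X * L"
 have prX: "pr d < X" if "d < half" for d using pre[OF that] smX[of "{..ps d}"] by simp
 have vlH: "vl d < H" if "d < half" for d
  unfolding vl_def H_def using mult_add_less[OF mult_add_less[OF low[OF that] prX[OF that]] psL[OF that]] .
 define r where "r = crop L (ss_return W half X Y st)"
 have stu: "st c div (X * X) = y c" "st c mod X = smax {..c} z" if "c < L" for c
  unfolding st[OF that] div_mult2_eq
  using mult_add_div_mod[OF smX[of "{c'. c' < L}"]] mult_add_div_mod[OF smX[of "{..c}"]] by simp_all
 have rQ: "r (ps d) = vl d" if "d < half" for d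
 proof -
  have "ss_return W half X Y st (ps d) = vl d mod W"
   using psL[OF that] stu[OF psL[OF that]] yps[OF that] Qdiv[OF that] pre[OF that] L2
   by (simp add: ss_return_def Let_def vl_def)
  then show ?thesis using psL[OF that] vlH[OF that] UW(3) by (simp add: r_def crop_def H_def)
 qed
 have rR: "r c = H \<or> (\<exists>d<half. c = ps d)" if cl: "c < L" for c
 proof -
  obtain d' where d': "d' < L" "y c = x2 d'" using srt(3)[OF cl] by blast
  obtain e where e: "e < half" "d' = 2 * e \<or> d' = 2 * e + 1" using d'(1) unfolding cL by blast
  from e(2) show ?thesis
  proof
   assume "d' = 2 * e"
   then have "y c div ?T = 2 * rk e (x e)" using d' x2e[OF e(1)] Rdiv by simp
   then have "ss_return W half X Y st c = H mod W"
    using stu[OF cl] L2 by (simp add: ss_return_def Let_def H_def)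
   then show ?thesis using cl UW(3) by (simp add: r_def crop_def H_def)
  next
   assume "d' = 2 * e + 1"
   then have "y c = Q e" using d' x2Q(1)[OF e(1)] by simp
   then show ?thesis using psu[OF cl e(1)] e(1) by blast
  qed
 qed
 have wfr: "wf_array L W r" using W0 by (auto simp: wf_array_def r_def crop_def ss_return_def Let_def)
 have vl_mono: "vl d < vl e" if "d < e" "d < half" for d e
 proof -
  have 1: "(d * Y + x d) + 1 \<le> e * Y + x e"
  proof -
   have "Suc d * Y \<le> e * Y" using that by (intro mult_le_mono1) simp
   then show ?thesis using x(2)[OF that(2)] by simp
  qed
  have "vl d < ((d * Y + x d) * X + X) * L"
   using mult_add_less[OF _ psL[OF that(2)], of "(d * Y + x d) * X + pr d" "(d * Y + x d) * X + X"] prX[OF that(2)]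
   by (simp add: vl_def)
  also have "\<dots> = (((d * Y + x d) + 1) * X) * L" by simp
  also have "\<dots> \<le> ((e * Y + x e) * X) * L" using 1 by (intro mult_le_mono1)
  also have "\<dots> \<le> vl e" by (simp add: vl_def algebra_simps)
  finally show ?thesis .
 qed
 define y2 where "y2 = seg_sort L r"
 note srt2 = seg_sort_full_at[of _ L r, folded y2_def]
 have ps_inj: "inj_on ps {..<half}"
 proof (rule inj_onI)
  fix d e assume de: "d \<in> {..<half}" "e \<in> {..<half}" "ps d = ps e"
  then have "Q d = Q e" using yps[of d] yps[of e] by simp
  then show "d = e" using Qinj de by simp
 qed
 have y2: "y2 c = vl c" if c: "c < half" for c
 proof -
  have "{c'. c' < L \<and> r c' < r (ps c)} = ps ` {..<c}"
  proof (intro equalityI subsetI)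
   fix c' assume c': "c' \<in> {c'. c' < L \<and> r c' < r (ps c)}"
   then have "r c' \<noteq> H" using rQ[OF c] vlH[OF c] by auto
   then obtain d where d: "d < half" "c' = ps d" using rR[of c'] c' by auto
   have "vl d < vl c" using c' d rQ c by auto
   then have "d < c" using vl_mono[of c d] c by (cases d c rule: linorder_cases) auto
   then show "c' \<in> ps ` {..<c}" using d by auto
  next
   fix c' assume "c' \<in> ps ` {..<c}"
   then obtain d where d: "d < c" "c' = ps d" by auto
   then have "d < half" using c by simp
   then show "c' \<in> {c'. c' < L \<and> r c' < r (ps c)}"
    using d rQ[of d] rQ[OF c] psL[of d] vl_mono[of d c] by simp
  qed
  moreover have "inj_on ps {..<c}" using ps_inj by (rule inj_on_subset) (use c in auto)
  ultimately have "card {c'. c' < L \<and> r c' < r (ps c)} = c" by (simp add: card_image)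
  then show ?thesis using srt2[OF psL[OF c]] rQ[OF c] by simp
 qed
 have home: "crop L (ss_home W half X Y upd (crop L y2)) = crop half (\<lambda>c. upd c (x c) (pr c) (ps c) mod W)"
 proof (rule ext)
  fix c
  show "crop L (ss_home W half X Y upd (crop L y2)) c = crop half (\<lambda>c. upd c (x c) (pr c) (ps c) mod W) c"
  proof (cases "c < half")
   case True
   then have cl: "c < L" using L2 by simp
   have v: "crop L y2 c = vl c" using cl y2[OF True] by (simp add: crop_def)
   have 1: "vl c mod (2 * half) = ps c" "vl c div (2 * half) = (c * Y + x c) * X + pr c"
    using mult_add_div_mod[OF psL[OF True]] unfolding vl_def L2 by blast+
   have 2: "vl c div (2 * half) mod X = pr c"
    unfolding 1 by (rule mult_add_div_mod[OF prX[OF True]])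
   have 3: "vl c div (2 * half * X) = c * Y + x c"
    unfolding div_mult2_eq[of _ "2 * half" X] 1 by (rule mult_add_div_mod[OF prX[OF True]])
   show ?thesis using True cl mult_add_div_mod(2)[OF x(2)[OF True], of c]
    by (simp add: crop_def[of L "ss_home W half X Y upd (crop L y2)"] crop_def[of half] ss_home_def v 1(1) 2 3)
  qed (auto simp: crop_def ss_home_def)
 qed
 have loc: "prog_sem L [detstep F id] v = return_pmf (crop L (F v))" for F v
  using prog_sem_detstep[of id L F v] by simp
 have srtp: "prog_sem L (sort_prog b d a) v = return_pmf (crop L (seg_sort L v))" if "wf_array L W v" for v
  using computes_sort_prog[OF b W0 dvL dep(1)] that by (simp add: computes_def L_def)
 have e1: "prog_sem L [detstep (\<lambda>x. x) (rot 2 (2 ^ (a - 1)))] x = return_pmf x1"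
  using prog_sem_detstep[OF rotL(2), of "\<lambda>x. x" x] by (simp add: x1_def half_def)
 have e2: "prog_sem L (sort_prog b d a) x2 = return_pmf y'" using srtp[OF wf2] by (simp add: y'_def y_def)
 have e3: "prog_sem L (sort_prog b d a) r = return_pmf (crop L y2)" using srtp[OF wfr] by (simp add: y2_def)
 show ?thesis
  unfolding sort_scan_prog_def prog_sem_append half_def[symmetric] e1[folded half_def] bind_return_pmf loc
   x2_def[symmetric] e2 scan0 scan1 r_def[symmetric] e3 home
  by (intro arg_cong[of _ _ return_pmf]) (auto simp: crop_def pr_def ps_eq)
qed

section \<open>Coalescing random walks\<close>

text \<open>Redrawing one coordinate leaves a product measure unchanged. First-step analysis uses
  this as its Markov property: the pointer of the starting point is drawn afresh while all others
  stay.\<close>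

lemma Pi_pmf_resample:
 assumes "finite X" "z \<in> X"
 shows "Pi_pmf X d p = bind_pmf (p z) (\<lambda>w. map_pmf (\<lambda>F. F(z := w)) (Pi_pmf X d p))"
proof -
 let ?X' = "X - {z}"
 have X: "X = insert z ?X'" "finite ?X'" "z \<notin> ?X'" using assms by auto
 have P: "Pi_pmf X d p = bind_pmf (p z) (\<lambda>w. map_pmf (\<lambda>f. f(z := w)) (Pi_pmf ?X' d p))"
  by (subst X(1), subst Pi_pmf_insert'[OF X(2,3)]) (simp add: map_pmf_def)
 have "bind_pmf (p z) (\<lambda>w. map_pmf (\<lambda>F. F(z := w)) (Pi_pmf X d p)) =
  bind_pmf (p z) (\<lambda>w. map_pmf (\<lambda>f. f(z := w)) (Pi_pmf ?X' d p))"
  unfolding P by (simp add: map_bind_pmf pmf.map_comp o_def)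
 then show ?thesis using P by simp
qed

text \<open>All pointers are drawn once, so walks that meet stay together. Levels make the pointer
  graph acyclic except for the fixed points, where walks stop.\<close>

locale layered_walk =
 fixes X :: "nat set" and D :: "nat \<Rightarrow> nat pmf" and lev :: "nat \<Rightarrow> nat" and J :: nat
  and Tg :: "nat set"
 assumes finX: "finite X"
  and supp: "x \<in> X \<Longrightarrow> w \<in> set_pmf (D x) \<Longrightarrow> w = x \<or> w \<in> X \<and> lev x < lev w"
  and levJ: "x \<in> X \<Longrightarrow> lev x \<le> J"
begin

definition P where "P = Pi_pmf X 0 D"

definition good :: "(nat \<Rightarrow> nat) \<Rightarrow> bool" where
 "good F \<longleftrightarrow> (\<forall>x\<in>X. F x = x \<or> F x \<in> X \<and> lev x < lev (F x))"

definition Z :: "nat \<Rightarrow> (nat \<Rightarrow> nat) \<Rightarrow> real" where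
 "Z x F = of_bool ((F ^^ J) x \<in> Tg)"

definition Vis :: "nat \<Rightarrow> nat \<Rightarrow> (nat \<Rightarrow> nat) \<Rightarrow> real" where
 "Vis x z F = of_bool (\<exists>k. (F ^^ k) x = z)"

definition h where "h x = measure_pmf.expectation P (Z x)"
definition V where "V x z = measure_pmf.expectation P (Vis x z)"
definition H where "H x y = measure_pmf.expectation P (\<lambda>F. Z x F * Z y F)"

lemma setD: "x \<in> X \<Longrightarrow> set_pmf (D x) \<subseteq> X"
 using supp by blast

lemma good_supp: "F \<in> set_pmf P \<Longrightarrow> good F"
 using supp finX by (auto simp: P_def set_Pi_pmf PiE_dflt_def good_def)

lemma good_upd: "good F \<Longrightarrow> x \<in> X \<Longrightarrow> w \<in> set_pmf (D x) \<Longrightarrow> good (F(x := w))"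
 using supp by (auto simp: good_def)

lemma finite_setP: "finite (set_pmf P)"
proof -
 have "finite (set_pmf (D x))" if "x \<in> X" for x using setD[OF that] finX finite_subset by blast
 then show ?thesis unfolding P_def using finX by (auto simp: set_Pi_pmf)
qed

lemma integrableP [simp]: "integrable (measure_pmf P) (f :: _ \<Rightarrow> real)"
 by (rule integrable_measure_pmf_finite[OF finite_setP])

lemma orbit:
 assumes "good F" "x \<in> X"
 shows "(F ^^ k) x \<in> X \<and> ((F ^^ k) x = x \<or> lev x < lev ((F ^^ k) x)) \<and>
  (F ((F ^^ k) x) = (F ^^ k) x \<or> lev x + k \<le> lev ((F ^^ k) x))"
proof (induction k)
 case 0
 then show ?case using assms by simp
next
 case (Suc k)
 let ?y = "(F ^^ k) x"
 have y: "?y \<in> X" using Suc by simp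
 have "F ?y = ?y \<or> F ?y \<in> X \<and> lev ?y < lev (F ?y)" using assms(1) y by (simp add: good_def)
 then show ?case
 proof
  assume "F ?y = ?y"
  then show ?thesis using Suc by simp
 next
  assume a: "F ?y \<in> X \<and> lev ?y < lev (F ?y)"
  then have "F ?y \<noteq> ?y" by auto
  then have "lev x + k \<le> lev ?y" using Suc by blast
  then show ?thesis using Suc a by auto
 qed
qed

text \<open>A pointer that moves raises the level, and no level exceeds \<open>J\<close>; therefore
  \<open>J\<close> iterations end in a fixed point and one step more does not matter.\<close>

lemma stable:
 assumes "good F" "x \<in> X"
 shows "(F ^^ J) (F x) = (F ^^ J) x"
proof -
 let ?y = "(F ^^ J) x"
 have y: "?y \<in> X" "F ?y = ?y \<or> lev x + J \<le> lev ?y" using orbit[OF assms, of J] by auto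
 have "F ?y = ?y"
 proof (rule ccontr)
  assume n: "F ?y \<noteq> ?y"
  then have "F ?y \<in> X" "lev ?y < lev (F ?y)" using assms(1) y(1) by (auto simp: good_def)
  then show False using levJ[of "F ?y"] n y(2) by simp
 qed
 moreover have "(F ^^ J) (F x) = F ?y" by (metis funpow_swap1)
 ultimately show ?thesis by simp
qed

text \<open>A walk from \<open>y\<close> visits only \<open>y\<close> and higher levels, so it never
  reads the pointer of another point \<open>x\<close> on the same or a lower level. This is the
  source of the independence of two walks before they meet.\<close>

lemma orbit_upd:
 assumes "good F" "y \<in> X" "x \<noteq> y" "lev x \<le> lev y"
 shows "((F(x := w)) ^^ k) y = (F ^^ k) y"
proof (induction k)
 case (Suc k)
 have "(F ^^ k) y \<noteq> x" using orbit[OF assms(1,2), of k] assms(3,4) by auto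
 then show ?case using Suc by simp
qed simp

lemma Z_upd: "good F \<Longrightarrow> y \<in> X \<Longrightarrow> x \<noteq> y \<Longrightarrow> lev x \<le> lev y \<Longrightarrow> Z y (F(x := w)) = Z y F"
 by (simp add: Z_def orbit_upd)

lemma Vis_upd: "good F \<Longrightarrow> y \<in> X \<Longrightarrow> x \<noteq> y \<Longrightarrow> lev x \<le> lev y \<Longrightarrow> Vis y z (F(x := w)) = Vis y z F"
 by (simp add: Vis_def orbit_upd)

lemma Z_step:
 assumes "good F" "x \<in> X" "w \<in> set_pmf (D x)"
 shows "Z x (F(x := w)) = (if w = x then of_bool (x \<in> Tg) else Z w F)"
proof (cases "w = x")
 case True
 have "((F(x := x)) ^^ k) x = x" for k by (induction k) auto
 then show ?thesis using True by (simp add: Z_def)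
next
 case False
 have w: "w \<in> X" "lev x < lev w" using supp[OF assms(2,3)] False by auto
 have "Z x (F(x := w)) = Z w (F(x := w))"
  using stable[OF good_upd[OF assms] assms(2)] by (simp add: Z_def)
 also have "\<dots> = Z w F" using w False by (intro Z_upd[OF assms(1)]) auto
 finally show ?thesis using False by simp
qed

lemma Vis_step:
 assumes "good F" "x \<in> X" "w \<in> set_pmf (D x)" "z \<noteq> x"
 shows "Vis x z (F(x := w)) = (if w = x then 0 else Vis w z F)"
proof (cases "w = x")
 case True
 have "((F(x := x)) ^^ k) x = x" for k by (induction k) auto
 then show ?thesis using True assms(4) by (auto simp: Vis_def)
next
 case False
 have w: "w \<in> X" "lev x < lev w" using supp[OF assms(2,3)] False by auto
 have "(\<exists>k. ((F(x := w)) ^^ k) x = z) \<longleftrightarrow> (\<exists>k. ((F(x := w)) ^^ k) w = z)"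
 proof
  assume "\<exists>k. ((F(x := w)) ^^ k) x = z"
  then obtain k where k: "((F(x := w)) ^^ k) x = z" by blast
  then have "k \<noteq> 0" using assms(4) by (cases k) auto
  then obtain k' where "k = Suc k'" by (cases k) auto
  then have "((F(x := w)) ^^ k') w = z" using k by (simp add: funpow_swap1)
  then show "\<exists>k. ((F(x := w)) ^^ k) w = z" by blast
 next
  assume "\<exists>k. ((F(x := w)) ^^ k) w = z"
  then obtain k where "((F(x := w)) ^^ k) w = z" by blast
  then have "((F(x := w)) ^^ Suc k) x = z" by (simp add: funpow_swap1)
  then show "\<exists>k. ((F(x := w)) ^^ k) x = z" by blast
 qed
 then have "Vis x z (F(x := w)) = Vis w z (F(x := w))" by (simp add: Vis_def)
 also have "\<dots> = Vis w z F" using w False by (intro Vis_upd[OF assms(1)]) auto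
 finally show ?thesis using False by simp
qed

lemma expectation_resample:
 fixes f :: "(nat \<Rightarrow> nat) \<Rightarrow> real"
 assumes "x \<in> X"
 shows "measure_pmf.expectation P f =
  (\<Sum>w\<in>X. pmf (D x) w * measure_pmf.expectation P (\<lambda>F. f (F(x := w))))"
proof -
 have "measure_pmf.expectation P f = measure_pmf.expectation
   (bind_pmf (D x) (\<lambda>w. map_pmf (\<lambda>F. F(x := w)) P)) f"
  using Pi_pmf_resample[OF finX assms, of 0 D] by (simp add: P_def)
 also have "\<dots> = (\<Sum>w\<in>X. pmf (D x) w *\<^sub>R measure_pmf.expectation (map_pmf (\<lambda>F. F(x := w)) P) f)"
  using finX setD[OF assms] finite_setP by (intro pmf_expectation_bind) auto
 finally show ?thesis by simp
qed

lemma expectation_cong_good: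
 fixes f g :: "(nat \<Rightarrow> nat) \<Rightarrow> real"
 assumes "\<And>F. good F \<Longrightarrow> f F = g F"
 shows "measure_pmf.expectation P f = measure_pmf.expectation P g"
 using assms good_supp by (intro integral_cong_AE) (auto simp: AE_measure_pmf_iff)

lemma resample_cong:
 fixes f :: "(nat \<Rightarrow> nat) \<Rightarrow> real"
 assumes "x \<in> X" "\<And>F w. good F \<Longrightarrow> w \<in> set_pmf (D x) \<Longrightarrow> f (F(x := w)) = g w F"
 shows "measure_pmf.expectation P f = (\<Sum>w\<in>X. pmf (D x) w * measure_pmf.expectation P (g w))"
 unfolding expectation_resample[OF assms(1), of f]
proof (rule sum.cong[OF refl])
 fix w assume "w \<in> X"
 show "pmf (D x) w * measure_pmf.expectation P (\<lambda>F. f (F(x := w))) = pmf (D x) w * measure_pmf.expectation P (g w)"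
 proof (cases "w \<in> set_pmf (D x)")
  case True
  then show ?thesis using assms(2) by (intro arg_cong2[of _ _ _ _ "(*)"] expectation_cong_good) auto
 qed (simp add: set_pmf_iff)
qed

lemma h_step: "x \<in> X \<Longrightarrow> h x = (\<Sum>w\<in>X. pmf (D x) w * (if w = x then of_bool (x \<in> Tg) else h w))"
 unfolding h_def
 by (subst resample_cong[where x = x and g = "\<lambda>w F. if w = x then of_bool (x \<in> Tg) else Z w F"])
   (auto simp: Z_step intro!: sum.cong)

lemma V_step: "x \<in> X \<Longrightarrow> z \<noteq> x \<Longrightarrow> V x z = (\<Sum>w\<in>X. pmf (D x) w * (if w = x then 0 else V w z))"
 unfolding V_def
 by (subst resample_cong[where x = x and g = "\<lambda>w F. if w = x then 0 else Vis w z F"])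
   (auto simp: Vis_step intro!: sum.cong)

lemma V_self: "V x x = 1"
proof -
 have "Vis x x = (\<lambda>_. 1)" by (rule ext) (auto simp: Vis_def intro: exI[of _ 0])
 then show ?thesis by (simp add: V_def)
qed

lemma V_zero: "y \<in> X \<Longrightarrow> x \<noteq> y \<Longrightarrow> lev x \<le> lev y \<Longrightarrow> V y x = 0"
proof -
 assume a: "y \<in> X" "x \<noteq> y" "lev x \<le> lev y"
 have "Vis y x F = 0" if "good F" for F
  using orbit[OF that a(1)] a by (fastforce simp: Vis_def)
 then have "V y x = measure_pmf.expectation P (\<lambda>_. 0)" unfolding V_def by (rule expectation_cong_good)
 then show ?thesis by simp
qed

lemma H_step:
 assumes "x \<in> X" "y \<in> X" "x \<noteq> y" "lev x \<le> lev y"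
 shows "H x y = (\<Sum>w\<in>X. pmf (D x) w * (if w = x then of_bool (x \<in> Tg) * h y else H w y))"
 unfolding H_def h_def
 by (subst resample_cong[where x = x and g = "\<lambda>w F. (if w = x then of_bool (x \<in> Tg) else Z w F) * Z y F"])
   (use assms in \<open>auto simp: Z_step Z_upd intro!: sum.cong\<close>)

lemma h_nonneg: "0 \<le> h x" unfolding h_def by (rule integral_nonneg_AE) (simp add: Z_def)
lemma V_nonneg: "0 \<le> V x z" unfolding V_def by (rule integral_nonneg_AE) (simp add: Vis_def)

lemma H_commute: "H x y = H y x" by (simp add: H_def mult.commute)

lemma H_self: "H x x = h x"
proof -
 have "(\<lambda>F. Z x F * Z x F) = Z x" by (rule ext) (simp add: Z_def)
 then show ?thesis by (simp add: H_def h_def)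
qed

definition E where "E x y = (\<Sum>z\<in>X. V x z * V y z * h z)"

text \<open>Moving the walker on the lower level first, the two walks use independent randomness until
  they meet, and \<open>E\<close> bounds the probability that they meet and then end in the target.\<close>

lemma H_le_aux:
 assumes "\<And>w. w \<in> X \<Longrightarrow> lev x < lev w \<Longrightarrow> H w y \<le> h w * h y + E w y"
  and "x \<in> X" "y \<in> X" "x \<noteq> y" "lev x \<le> lev y"
 shows "H x y \<le> h x * h y + E x y"
proof -
 have "H x y \<le> (\<Sum>w\<in>X. pmf (D x) w * (if w = x then of_bool (x \<in> Tg) * h y else h w * h y + E w y))"
  unfolding H_step[OF assms(2-5)]
 proof (rule sum_mono)
  fix w assume w: "w \<in> X"
  show "pmf (D x) w * (if w = x then of_bool (x \<in> Tg) * h y else H w y) \<le>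
   pmf (D x) w * (if w = x then of_bool (x \<in> Tg) * h y else h w * h y + E w y)"
  proof (cases "w \<in> set_pmf (D x)")
   case True
   have "H w y \<le> h w * h y + E w y" if "w \<noteq> x"
    using assms(1)[OF w] supp[OF assms(2) True] that by blast
   then show ?thesis by (intro mult_left_mono) auto
  qed (simp add: set_pmf_iff)
 qed
 also have "\<dots> = (\<Sum>w\<in>X. pmf (D x) w * (if w = x then of_bool (x \<in> Tg) else h w)) * h y +
   (\<Sum>w\<in>X. pmf (D x) w * (if w = x then 0 else E w y))"
  unfolding sum_distrib_right sum.distrib[symmetric]
  by (intro sum.cong refl) (simp add: algebra_simps)
 also have "(\<Sum>w\<in>X. pmf (D x) w * (if w = x then 0 else E w y)) =
   (\<Sum>w\<in>X. \<Sum>z\<in>X. pmf (D x) w * (if w = x then 0 else V w z) * (V y z * h z))"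
  unfolding E_def by (intro sum.cong refl) (simp add: sum_distrib_left mult.assoc)
 also have "\<dots> = (\<Sum>z\<in>X. (\<Sum>w\<in>X. pmf (D x) w * (if w = x then 0 else V w z)) * (V y z * h z))"
  by (subst sum.swap) (simp add: sum_distrib_right)
 also have "\<dots> = (\<Sum>z\<in>X. V x z * (V y z * h z))"
 proof (rule sum.cong[OF refl])
  fix z assume "z \<in> X"
  show "(\<Sum>w\<in>X. pmf (D x) w * (if w = x then 0 else V w z)) * (V y z * h z) = V x z * (V y z * h z)"
  proof (cases "z = x")
   case True
   then show ?thesis using V_zero[OF assms(3,4,5)] by simp
  next
   case False
   then show ?thesis using V_step[OF assms(2) False] by simp
  qed
 qed
 finally show ?thesis unfolding h_step[OF assms(2), symmetric] by (simp add: E_def mult.assoc)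
qed

text \<open>Induction on the levels that the two walkers have left; \<open>H\<close> and
  \<open>E\<close> are symmetric, so the walker on the lower level may be taken as the first. Once
  the walkers coincide, the single term \<open>z = x\<close> of \<open>E\<close> accounts for the
  whole probability.\<close>

lemma H_le: "x \<in> X \<Longrightarrow> y \<in> X \<Longrightarrow> H x y \<le> h x * h y + E x y"
proof (induction "(J - lev x) + (J - lev y)" arbitrary: x y rule: less_induct)
 case less
 have dec: "J - lev w < J - lev v" if "w \<in> X" "lev v < lev w" for v w
  using that levJ[OF that(1)] by simp
 show ?case
 proof (cases "x = y")
  case True
  have "V x x * V x x * h x \<le> E x x"
   unfolding E_def using finX less.prems h_nonneg V_nonneg
   by (intro member_le_sum[of x X "\<lambda>z. V x z * V x z * h z"]) (auto intro!: mult_nonneg_nonneg)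
  then have "h x \<le> E x x" by (simp add: V_self)
  then show ?thesis using True H_self h_nonneg[of x] by (simp add: add_increasing)
 next
  case neq: False
  show ?thesis
  proof (cases "lev x \<le> lev y")
   case True
   show ?thesis
    by (rule H_le_aux[OF _ less.prems neq True]) (use less dec in auto)
  next
   case False
   have "H y x \<le> h y * h x + E y x"
    by (rule H_le_aux[OF _ less.prems(2,1)]) (use less dec False neq H_commute in auto)
   then show ?thesis by (simp add: H_commute E_def mult.commute mult.left_commute)
  qed
 qed
qed

lemma second_moment:
 assumes "finite A" "A \<subseteq> X"
 shows "measure_pmf.expectation P (\<lambda>F. (\<Sum>a\<in>A. Z a F)\<^sup>2) \<le>
  (\<Sum>a\<in>A. h a)\<^sup>2 + (\<Sum>z\<in>X. (\<Sum>a\<in>A. V a z)\<^sup>2 * h z)"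
proof -
 have "measure_pmf.expectation P (\<lambda>F. (\<Sum>a\<in>A. Z a F)\<^sup>2) = (\<Sum>a\<in>A. \<Sum>b\<in>A. H a b)"
  unfolding H_def by (simp add: power2_eq_square sum_product)
 also have "\<dots> \<le> (\<Sum>a\<in>A. \<Sum>b\<in>A. h a * h b + E a b)"
  using assms H_le by (intro sum_mono) auto
 also have "\<dots> = (\<Sum>a\<in>A. h a)\<^sup>2 + (\<Sum>a\<in>A. \<Sum>b\<in>A. E a b)"
  by (simp add: sum.distrib power2_eq_square sum_product)
 also have "(\<Sum>a\<in>A. \<Sum>b\<in>A. E a b) = (\<Sum>a\<in>A. \<Sum>z\<in>X. \<Sum>b\<in>A. V a z * V b z * h z)"
  unfolding E_def by (intro sum.cong refl sum.swap)
 also have "\<dots> = (\<Sum>z\<in>X. \<Sum>a\<in>A. \<Sum>b\<in>A. V a z * V b z * h z)" by (rule sum.swap)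
 also have "\<dots> = (\<Sum>z\<in>X. (\<Sum>a\<in>A. V a z)\<^sup>2 * h z)"
  by (intro sum.cong refl) (simp add: power2_eq_square sum_product sum_distrib_right sum_distrib_left mult_ac)
 finally show ?thesis by simp
qed

text \<open>A walk meets at most one point of a level, and \<open>V x z * h z\<close> stands for
  passing through \<open>z\<close> and then ending in the target. The induction on the first step
  replaces an argument with these disjoint events.\<close>

lemma layer_sum:
 assumes "x \<in> X"
 shows "(\<Sum>z\<in>{z\<in>X. lev z = t}. V x z * h z) \<le> h x"
 using assms
proof (induction "J - lev x" arbitrary: x rule: less_induct)
 case less
 let ?T = "{z\<in>X. lev z = t}"
 have fT: "finite ?T" using finX by simp
 show ?case
 proof (cases "t \<le> lev x")
  case True
  have "(\<Sum>z\<in>?T. V x z * h z) = (\<Sum>z\<in>?T. if z = x then h x else 0)"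
   using True V_zero[OF less.prems] by (intro sum.cong refl) (auto simp: V_self)
  also have "\<dots> \<le> h x" using h_nonneg[of x] fT by (simp add: sum.delta')
  finally show ?thesis .
 next
  case False
  have "(\<Sum>z\<in>?T. V x z * h z) = (\<Sum>z\<in>?T. (\<Sum>w\<in>X. pmf (D x) w * (if w = x then 0 else V w z)) * h z)"
   using False by (intro sum.cong refl) (subst V_step[OF less.prems], auto)
  also have "\<dots> = (\<Sum>w\<in>X. pmf (D x) w * (if w = x then 0 else (\<Sum>z\<in>?T. V w z * h z)))"
   unfolding sum_distrib_right by (subst sum.swap) (auto simp: sum_distrib_left mult.assoc intro!: sum.cong)
  also have "\<dots> \<le> (\<Sum>w\<in>X. pmf (D x) w * (if w = x then of_bool (x \<in> Tg) else h w))"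
  proof (rule sum_mono)
   fix w assume w: "w \<in> X"
   show "pmf (D x) w * (if w = x then 0 else (\<Sum>z\<in>?T. V w z * h z)) \<le>
    pmf (D x) w * (if w = x then of_bool (x \<in> Tg) else h w)"
   proof (cases "w \<in> set_pmf (D x)")
    case True
    have "(\<Sum>z\<in>?T. V w z * h z) \<le> h w" if "w \<noteq> x"
    proof -
     have "lev x < lev w" using supp[OF less.prems True] that by blast
     then have "J - lev w < J - lev x" using levJ[OF w] by simp
     then show ?thesis using less.hyps w by blast
    qed
    then show ?thesis by (intro mult_left_mono) auto
   qed (simp add: set_pmf_iff)
  qed
  also have "\<dots> = h x" by (rule h_step[OF less.prems, symmetric])
  finally show ?thesis .
 qed
qed

lemma deviation:
 assumes "finite A" "A \<subseteq> X" "0 < t"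
  and var: "(\<Sum>z\<in>X. (\<Sum>a\<in>A. V a z)\<^sup>2 * h z) \<le> v"
 shows "measure_pmf.prob P {F. t \<le> \<bar>(\<Sum>a\<in>A. Z a F) - (\<Sum>a\<in>A. h a)\<bar>} \<le> v / t\<^sup>2"
proof -
 let ?f = "\<lambda>F. \<Sum>a\<in>A. Z a F"
 have ex: "measure_pmf.expectation P ?f = (\<Sum>a\<in>A. h a)" by (simp add: h_def)
 have "measure_pmf.variance P ?f = measure_pmf.expectation P (\<lambda>F. (?f F)\<^sup>2) - (measure_pmf.expectation P ?f)\<^sup>2"
  by (rule measure_pmf.variance_eq) simp_all
 also have "\<dots> \<le> v" using second_moment[OF assms(1,2)] var unfolding ex by linarith
 finally have "measure_pmf.variance P ?f \<le> v" .
 moreover have "measure_pmf.prob P {F \<in> space (measure_pmf P). t \<le> \<bar>?f F - measure_pmf.expectation P ?f\<bar>}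
   \<le> measure_pmf.variance P ?f / t\<^sup>2"
  using assms(3) by (intro measure_pmf.Chebyshev_inequality) simp_all
 moreover have "measure_pmf.variance P ?f / t\<^sup>2 \<le> v / t\<^sup>2"
  using calculation(1) by (intro divide_right_mono) auto
 ultimately have "measure_pmf.prob P {F \<in> space (measure_pmf P). t \<le> \<bar>?f F - measure_pmf.expectation P ?f\<bar>} \<le> v / t\<^sup>2"
  by linarith
 then show ?thesis unfolding ex by simp
qed

end

section \<open>PageRank and occupation numbers\<close>

locale markov =
 fixes n :: nat and Pm :: "nat \<Rightarrow> nat \<Rightarrow> real"
 assumes n0: "0 < n" and Pm_nonneg: "\<And>u w. 0 \<le> Pm u w"
  and Pm_sum: "\<And>u. u < n \<Longrightarrow> (\<Sum>w<n. Pm u w) = 1"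
begin

primrec pw :: "nat \<Rightarrow> nat \<Rightarrow> nat \<Rightarrow> real" where
 "pw 0 u w = of_bool (u = w)"
| "pw (Suc k) u w = (\<Sum>w'<n. Pm u w' * pw k w' w)"

definition occ :: "nat \<Rightarrow> nat \<Rightarrow> real" where "occ k w = (\<Sum>u<n. pw k u w) / n"

text \<open>The expected discounted number of visits to \<open>w\<close> within \<open>j\<close>
  steps from a uniform start, a partial sum of the Neumann series behind PageRank. Pool sizes are
  measured against it.\<close>

definition green :: "real \<Rightarrow> nat \<Rightarrow> nat \<Rightarrow> real" where "green \<theta> j w = (\<Sum>k<j. \<theta> ^ k * occ k w)"

text \<open>The law of the stopping vertex of a walk from \<open>u\<close> that stops with
  probability \<open>1 - \<theta>\<close> before each of its at most \<open>j\<close> steps. Its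
  average \<open>iter\<close> over the start is the power iteration for PageRank, by
  \<open>iter_Suc\<close>.\<close>

primrec absorb :: "real \<Rightarrow> nat \<Rightarrow> nat \<Rightarrow> nat \<Rightarrow> real" where
 "absorb \<theta> 0 u v = of_bool (u = v)"
| "absorb \<theta> (Suc j) u v = (1 - \<theta>) * of_bool (u = v) + \<theta> * (\<Sum>w<n. Pm u w * absorb \<theta> j w v)"

definition iter :: "real \<Rightarrow> nat \<Rightarrow> nat \<Rightarrow> real" where "iter \<theta> j v = (\<Sum>u<n. absorb \<theta> j u v) / n"

definition is_pr :: "real \<Rightarrow> (nat \<Rightarrow> real) \<Rightarrow> bool" where
 "is_pr \<theta> \<pi> \<longleftrightarrow> (\<forall>v<n. 0 \<le> \<pi> v) \<and> (\<Sum>v<n. \<pi> v) = 1 \<and>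
   (\<forall>v<n. \<pi> v = (1 - \<theta>) / n + \<theta> * (\<Sum>u<n. \<pi> u * Pm u v))"

lemma is_prD:
 assumes "is_pr \<theta> \<pi>"
 shows is_pr_nonneg: "v < n \<Longrightarrow> 0 \<le> \<pi> v" and is_pr_sum: "(\<Sum>v<n. \<pi> v) = 1"
  and is_pr_eq: "v < n \<Longrightarrow> \<pi> v = (1 - \<theta>) / n + \<theta> * (\<Sum>u<n. \<pi> u * Pm u v)"
 using assms unfolding is_pr_def by blast+

lemma pw_nonneg: "0 \<le> pw k u w"
 by (induction k arbitrary: u) (auto intro!: sum_nonneg mult_nonneg_nonneg Pm_nonneg)

lemma sum_delta_left: "u < n \<Longrightarrow> (\<Sum>w<n. of_bool (u = w) * f w) = (f u :: real)"
 by (simp add: of_bool_def if_distrib[of "\<lambda>x. x * _"] sum.delta cong: if_cong)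

lemma sum_delta_right: "v < n \<Longrightarrow> (\<Sum>w<n. f w * of_bool (w = v)) = (f v :: real)"
 by (simp add: of_bool_def if_distrib[of "\<lambda>x. _ * x"] sum.delta' cong: if_cong)

lemma pw_Suc': "u < n \<Longrightarrow> w < n \<Longrightarrow> pw (Suc k) u w = (\<Sum>w'<n. pw k u w' * Pm w' w)"
proof (induction k arbitrary: u)
 case 0
 then show ?case by (simp add: sum_delta_left sum_delta_right del: of_bool_eq_iff)
next
 case (Suc k)
 have "pw (Suc (Suc k)) u w = (\<Sum>w'<n. Pm u w' * (\<Sum>w''<n. pw k w' w'' * Pm w'' w))"
  using Suc by (subst pw.simps(2)) (intro sum.cong refl, simp)
 also have "\<dots> = (\<Sum>w'<n. \<Sum>w''<n. Pm u w' * pw k w' w'' * Pm w'' w)"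
  by (simp add: sum_distrib_left mult.assoc)
 also have "\<dots> = (\<Sum>w''<n. (\<Sum>w'<n. Pm u w' * pw k w' w'') * Pm w'' w)"
  by (subst sum.swap) (simp add: sum_distrib_right)
 finally show ?case by simp
qed

lemma occ_0: "w < n \<Longrightarrow> occ 0 w = 1 / n"
proof -
 assume "w < n"
 then have "(\<Sum>u<n. of_bool (u = w) :: real) = 1" using sum_delta_right[of w "\<lambda>_. 1"] by simp
 then show ?thesis by (simp add: occ_def)
qed

lemma occ_Suc: "w < n \<Longrightarrow> occ (Suc k) w = (\<Sum>u<n. occ k u * Pm u w)"
proof -
 assume w: "w < n"
 have "(\<Sum>u<n. pw (Suc k) u w) = (\<Sum>u<n. \<Sum>w'<n. pw k u w' * Pm w' w)"
  by (intro sum.cong refl) (rule pw_Suc', use w in auto)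
 also have "\<dots> = (\<Sum>w'<n. (\<Sum>u<n. pw k u w') * Pm w' w)" by (subst sum.swap) (simp add: sum_distrib_right)
 finally have "occ (Suc k) w = (\<Sum>w'<n. (\<Sum>u<n. pw k u w') * Pm w' w) / n" by (simp only: occ_def)
 also have "\<dots> = (\<Sum>w'<n. occ k w' * Pm w' w)"
  unfolding occ_def by (subst sum_divide_distrib) (simp only: times_divide_eq_left)
 finally show ?thesis .
qed

lemma occ_nonneg: "0 \<le> occ k w" by (auto simp: occ_def intro!: divide_nonneg_nonneg sum_nonneg pw_nonneg)

lemma occ_sum: "(\<Sum>w<n. occ k w) = 1"
proof (induction k)
 case 0
 then show ?case using n0 by (simp add: occ_0)
next
 case (Suc k)
 have "(\<Sum>w<n. occ (Suc k) w) = (\<Sum>w<n. \<Sum>u<n. occ k u * Pm u w)" by (simp add: occ_Suc)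
 also have "\<dots> = (\<Sum>u<n. occ k u * (\<Sum>w<n. Pm u w))" by (subst sum.swap) (simp add: sum_distrib_left)
 also have "\<dots> = 1" using Suc by (simp add: Pm_sum)
 finally show ?case .
qed

lemma occ_le_1: "w < n \<Longrightarrow> occ k w \<le> 1"
 using member_le_sum[of w "{..<n}" "occ k"] occ_nonneg occ_sum[of k] by simp

lemma green_Suc:
 assumes "w < n"
 shows "green \<theta> (Suc j) w = 1 / n + \<theta> * (\<Sum>u<n. green \<theta> j u * Pm u w)"
proof -
 have "green \<theta> (Suc j) w = 1 / n + (\<Sum>k<j. \<theta> ^ Suc k * occ (Suc k) w)"
  unfolding green_def using sum.lessThan_Suc_shift[of "\<lambda>k. \<theta> ^ k * occ k w" j] occ_0[OF assms] by simp
 also have "(\<Sum>k<j. \<theta> ^ Suc k * occ (Suc k) w) = (\<Sum>k<j. \<Sum>u<n. \<theta> * (\<theta> ^ k * occ k u * Pm u w))"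
  by (simp add: occ_Suc[OF assms] sum_distrib_left mult.assoc)
 also have "\<dots> = \<theta> * (\<Sum>u<n. green \<theta> j u * Pm u w)"
  by (subst sum.swap) (simp add: green_def sum_distrib_left sum_distrib_right)
 finally show ?thesis .
qed

text \<open>The left-hand side is a truncated Neumann series for \<open>\<pi>\<close>. Both sides
  obey the same monotone recursion, one started at 0 and the other resting at
  \<open>\<pi>\<close>.\<close>

lemma green_le:
 assumes "is_pr \<theta> \<pi>" "0 \<le> \<theta>" "\<theta> \<le> 1" "w < n"
 shows "(1 - \<theta>) * green \<theta> j w \<le> \<pi> w"
 using assms(4)
proof (induction j arbitrary: w)
 case 0
 then show ?case using is_pr_nonneg[OF assms(1)] by (simp add: green_def)
next
 case (Suc j)
 have "(1 - \<theta>) * green \<theta> (Suc j) w = (1 - \<theta>) / n + \<theta> * (\<Sum>u<n. ((1 - \<theta>) * green \<theta> j u) * Pm u w)"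
  unfolding green_Suc[OF Suc.prems] by (simp add: distrib_left sum_distrib_left mult_ac)
 also have "\<dots> \<le> (1 - \<theta>) / n + \<theta> * (\<Sum>u<n. \<pi> u * Pm u w)"
  using Suc.IH assms(2) by (intro add_left_mono mult_left_mono sum_mono mult_right_mono Pm_nonneg) auto
 also have "\<dots> = \<pi> w" by (rule is_pr_eq[OF assms(1) Suc.prems, symmetric])
 finally show ?case .
qed

text \<open>The defining recursion has the transition matrix on the left, which fits walks that move
  forward. With the matrix on the right, summing over the starting vertex gives the equation of
  power iteration.\<close>

lemma absorb_Suc': "u < n \<Longrightarrow> v < n \<Longrightarrow>
 absorb \<theta> (Suc j) u v = (1 - \<theta>) * of_bool (u = v) + \<theta> * (\<Sum>w<n. absorb \<theta> j u w * Pm w v)"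
proof (induction j arbitrary: u)
 case 0
 then show ?case by (simp add: sum_delta_left sum_delta_right del: of_bool_eq_iff)
next
 case (Suc j)
 have "(\<Sum>w<n. Pm u w * absorb \<theta> (Suc j) w v) =
   (\<Sum>w<n. Pm u w * ((1 - \<theta>) * of_bool (w = v) + \<theta> * (\<Sum>w'<n. absorb \<theta> j w w' * Pm w' v)))"
  using Suc by (intro sum.cong refl) (simp only: lessThan_iff)
 also have "\<dots> = (1 - \<theta>) * (\<Sum>w<n. Pm u w * of_bool (w = v)) +
   \<theta> * (\<Sum>w<n. \<Sum>w'<n. Pm u w * absorb \<theta> j w w' * Pm w' v)"
  by (simp only: distrib_left sum.distrib sum_distrib_left mult_ac)
 also have "(\<Sum>w<n. Pm u w * of_bool (w = v)) = (\<Sum>w<n. of_bool (u = w) * Pm w v)"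
  using Suc.prems by (simp only: sum_delta_left sum_delta_right)
 also have "(\<Sum>w<n. \<Sum>w'<n. Pm u w * absorb \<theta> j w w' * Pm w' v) =
   (\<Sum>w'<n. (\<Sum>w<n. Pm u w * absorb \<theta> j w w') * Pm w' v)"
  by (subst sum.swap) (simp add: sum_distrib_right)
 also have "(1 - \<theta>) * (\<Sum>w<n. of_bool (u = w) * Pm w v) + \<theta> * (\<Sum>w'<n. (\<Sum>w<n. Pm u w * absorb \<theta> j w w') * Pm w' v)
   = (\<Sum>w<n. absorb \<theta> (Suc j) u w * Pm w v)"
  by (simp only: absorb.simps(2) distrib_right sum.distrib mult.assoc sum_distrib_left[symmetric])
 finally show ?case by (subst absorb.simps(2)) simp
qed

lemma iter_0: "v < n \<Longrightarrow> iter \<theta> 0 v = 1 / n"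
 using occ_0[of v] by (simp add: iter_def occ_def)

lemma iter_Suc: "v < n \<Longrightarrow> iter \<theta> (Suc j) v = (1 - \<theta>) / n + \<theta> * (\<Sum>u<n. iter \<theta> j u * Pm u v)"
proof -
 assume v: "v < n"
 have "(\<Sum>u<n. absorb \<theta> (Suc j) u v) =
   (\<Sum>u<n. (1 - \<theta>) * of_bool (u = v) + \<theta> * (\<Sum>w<n. absorb \<theta> j u w * Pm w v))"
  by (intro sum.cong refl) (rule absorb_Suc', use v in auto)
 also have "\<dots> = (1 - \<theta>) * (\<Sum>u<n. 1 * of_bool (u = v)) + \<theta> * (\<Sum>u<n. \<Sum>w<n. absorb \<theta> j u w * Pm w v)"
  by (simp add: sum.distrib sum_distrib_left)
 also have "(\<Sum>u<n. 1 * of_bool (u = v)) = (1::real)" using sum_delta_right[OF v, of "\<lambda>_. 1"] by simp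
 also have "(\<Sum>u<n. \<Sum>w<n. absorb \<theta> j u w * Pm w v) = (\<Sum>w<n. (\<Sum>u<n. absorb \<theta> j u w) * Pm w v)"
  by (subst sum.swap) (simp add: sum_distrib_right)
 finally have "iter \<theta> (Suc j) v = (1 - \<theta>) / n + \<theta> * ((\<Sum>w<n. (\<Sum>u<n. absorb \<theta> j u w) * Pm w v) / n)"
  by (simp only: iter_def add_divide_distrib times_divide_eq_right mult_1_right)
 also have "(\<Sum>w<n. (\<Sum>u<n. absorb \<theta> j u w) * Pm w v) / n = (\<Sum>w<n. iter \<theta> j w * Pm w v)"
  unfolding iter_def by (subst sum_divide_distrib) (simp only: times_divide_eq_left)
 finally show ?thesis .
qed

text \<open>Power iteration contracts the L1 distance by \<open>\<theta>\<close>, and two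
  probability vectors have distance at most 2.\<close>

lemma iter_diff_le:
 assumes "is_pr \<theta> \<pi>" "0 \<le> \<theta>" "\<theta> \<le> 1"
 shows "(\<Sum>v<n. \<bar>iter \<theta> j v - \<pi> v\<bar>) \<le> 2 * \<theta> ^ j"
proof (induction j)
 case 0
 have "(\<Sum>v<n. \<bar>iter \<theta> 0 v - \<pi> v\<bar>) \<le> (\<Sum>v<n. 1 / n + \<pi> v)"
  using is_pr_nonneg[OF assms(1)]
  by (intro sum_mono) (auto simp: iter_0 intro!: order_trans[OF abs_triangle_ineq4])
 also have "\<dots> = 2" using is_pr_sum[OF assms(1)] n0 by (simp add: sum.distrib)
 finally show ?case by simp
next
 case (Suc j)
 have "(\<Sum>v<n. \<bar>iter \<theta> (Suc j) v - \<pi> v\<bar>) = (\<Sum>v<n. \<theta> * \<bar>\<Sum>u<n. (iter \<theta> j u - \<pi> u) * Pm u v\<bar>)"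
 proof (rule sum.cong[OF refl])
  fix v assume "v \<in> {..<n}"
  then have v: "v < n" by simp
  have "\<pi> v = (1 - \<theta>) / n + \<theta> * (\<Sum>u<n. \<pi> u * Pm u v)" by (rule is_pr_eq[OF assms(1) v])
  moreover have "(\<Sum>u<n. (iter \<theta> j u - \<pi> u) * Pm u v) = (\<Sum>u<n. iter \<theta> j u * Pm u v) - (\<Sum>u<n. \<pi> u * Pm u v)"
   by (simp only: left_diff_distrib sum_subtractf)
  ultimately have "iter \<theta> (Suc j) v - \<pi> v = \<theta> * (\<Sum>u<n. (iter \<theta> j u - \<pi> u) * Pm u v)"
   using iter_Suc[OF v, of \<theta> j] by (simp only: right_diff_distrib)
  then show "\<bar>iter \<theta> (Suc j) v - \<pi> v\<bar> = \<theta> * \<bar>\<Sum>u<n. (iter \<theta> j u - \<pi> u) * Pm u v\<bar>"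
   using assms(2) by (simp add: abs_mult)
 qed
 also have "\<dots> \<le> (\<Sum>v<n. \<theta> * (\<Sum>u<n. \<bar>iter \<theta> j u - \<pi> u\<bar> * Pm u v))"
 proof (intro sum_mono mult_left_mono assms(2))
  fix v
  show "\<bar>\<Sum>u<n. (iter \<theta> j u - \<pi> u) * Pm u v\<bar> \<le> (\<Sum>u<n. \<bar>iter \<theta> j u - \<pi> u\<bar> * Pm u v)"
   by (rule order_trans[OF sum_abs]) (simp add: abs_mult Pm_nonneg)
 qed
 also have "\<dots> = \<theta> * (\<Sum>u<n. \<bar>iter \<theta> j u - \<pi> u\<bar> * (\<Sum>v<n. Pm u v))"
  by (subst sum_distrib_left[symmetric], subst sum.swap) (simp add: sum_distrib_left)
 also have "\<dots> = \<theta> * (\<Sum>u<n. \<bar>iter \<theta> j u - \<pi> u\<bar>)" by (simp add: Pm_sum)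
 also have "\<dots> \<le> \<theta> * (2 * \<theta> ^ j)" using Suc assms(2) by (intro mult_left_mono)
 finally show ?case by simp
qed

lemma iter_close:
 assumes "is_pr \<theta> \<pi>" "0 \<le> \<theta>" "\<theta> \<le> 1" "v < n"
 shows "\<bar>iter \<theta> j v - \<pi> v\<bar> \<le> 2 * \<theta> ^ j"
 using member_le_sum[of v "{..<n}" "\<lambda>v. \<bar>iter \<theta> j v - \<pi> v\<bar>"] assms(4) iter_diff_le[OF assms(1-3), of j] by simp

lemma pr_ge: "is_pr \<theta> \<pi> \<Longrightarrow> 0 \<le> \<theta> \<Longrightarrow> v < n \<Longrightarrow> (1 - \<theta>) / n \<le> \<pi> v"
proof -
 assume a: "is_pr \<theta> \<pi>" "0 \<le> \<theta>" "v < n"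
 have "0 \<le> \<theta> * (\<Sum>u<n. \<pi> u * Pm u v)"
  using a(2) is_pr_nonneg[OF a(1)] by (auto intro!: mult_nonneg_nonneg sum_nonneg Pm_nonneg)
 moreover have "\<pi> v = (1 - \<theta>) / n + \<theta> * (\<Sum>u<n. \<pi> u * Pm u v)" by (rule is_pr_eq[OF a(1,3)])
 ultimately show ?thesis by linarith
qed

lemma geom_tail_le:
 assumes "0 \<le> \<theta>" "\<theta> < (1::real)"
 shows "(\<Sum>k\<in>{s..<j}. \<theta> ^ k) \<le> \<theta> ^ s / (1 - \<theta>)"
proof -
 have "(\<Sum>k\<in>{s..<j}. \<theta> ^ k) = \<theta> ^ s * (\<Sum>k<j - s. \<theta> ^ k)"
  by (subst sum.atLeastLessThan_shift_0) (simp add: power_add sum_distrib_left lessThan_atLeast0)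
 also have "(\<Sum>k<j - s. \<theta> ^ k) \<le> 1 / (1 - \<theta>)"
  using assms by (subst sum_gp_strict) (auto simp: divide_simps)
 finally show ?thesis using assms by (simp add: mult_left_mono)
qed

text \<open>Comparing two damping factors: the first \<open>s\<close> steps cost the factor \<open>\<rho>\<close>, later ones are negligible.\<close>

lemma green_compare:
 assumes pr: "is_pr \<theta> \<pi>" and \<theta>: "0 \<le> \<theta>" "\<theta> < 1" and \<theta>': "0 \<le> \<theta>'" "\<theta>' < 1" and w: "w < n"
  and head: "\<And>k. k < s \<Longrightarrow> \<theta>' ^ k \<le> \<rho> * \<theta> ^ k" and \<rho>: "1 \<le> \<rho>"
  and tail: "\<theta>' ^ s / (1 - \<theta>') \<le> 1 / n"
 shows "green \<theta>' j w \<le> 2 * \<rho> * \<pi> w / (1 - \<theta>)"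
proof -
 have g: "green \<theta> s w \<le> \<pi> w / (1 - \<theta>)"
  using green_le[OF pr \<theta>(1) _ w, of s] \<theta> by (simp add: field_simps)
 \<comment> \<open>Random jumps alone give every vertex this much. The tail is therefore absorbed by
   a second copy of the main term, whence the factor 2 in the result.\<close>
 have one: "1 / n \<le> \<pi> w / (1 - \<theta>)" using pr_ge[OF pr \<theta>(1) w] \<theta> by (simp add: field_simps)
 have "green \<theta>' j w \<le> (\<Sum>k\<in>{..<s} \<union> {s..<j}. \<theta>' ^ k * occ k w)"
  unfolding green_def using \<theta>' by (intro sum_mono2) (auto intro!: mult_nonneg_nonneg occ_nonneg)
 also have "\<dots> = (\<Sum>k<s. \<theta>' ^ k * occ k w) + (\<Sum>k\<in>{s..<j}. \<theta>' ^ k * occ k w)"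
  by (rule sum.union_disjoint) auto
 also have "(\<Sum>k<s. \<theta>' ^ k * occ k w) \<le> (\<Sum>k<s. \<rho> * \<theta> ^ k * occ k w)"
  using head by (intro sum_mono mult_right_mono occ_nonneg) auto
 also have "\<dots> = \<rho> * green \<theta> s w" by (simp add: green_def sum_distrib_left mult.assoc)
 also have "\<dots> \<le> \<rho> * (\<pi> w / (1 - \<theta>))" using g \<rho> by (intro mult_left_mono) auto
 also have "(\<Sum>k\<in>{s..<j}. \<theta>' ^ k * occ k w) \<le> (\<Sum>k\<in>{s..<j}. \<theta>' ^ k * 1)"
  using \<theta>' occ_le_1[OF w] by (intro sum_mono mult_left_mono) auto
 also have "\<dots> \<le> \<theta>' ^ s / (1 - \<theta>')" using geom_tail_le[OF \<theta>'] by simp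
 also have "\<dots> \<le> 1 / n" by (rule tail)
 also have "\<dots> \<le> \<rho> * (\<pi> w / (1 - \<theta>))"
 proof -
  have "0 \<le> \<pi> w / (1 - \<theta>)" using one n0 by (meson divide_nonneg_nonneg of_nat_0_le_iff order_trans zero_le_one)
  then show ?thesis using one \<rho> mult_right_mono[of 1 \<rho> "\<pi> w / (1 - \<theta>)"] by simp
 qed
 finally show ?thesis by simp
qed

text \<open>With such a small factor a walk hardly moves: step 0 contributes \<open>1 / n\<close>,
  and all later steps together at most as much. The first phase can therefore use equal pools and
  needs no earlier estimates.\<close>

lemma green_uniform:
 assumes "0 \<le> \<theta>" "\<theta> \<le> 1 / (n + 1)" "w < n"
 shows "green \<theta> j w \<le> 2 / n"
proof -
 have n1: "(0::real) < n" using n0 by simp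
 have "1 / (real n + 1) < 1" using n1 by simp
 moreover have "\<theta> \<le> 1 / (real n + 1)" using assms(2) by (simp add: add.commute)
 ultimately have \<theta>1: "\<theta> < 1" by linarith
 have "green \<theta> j w \<le> (\<Sum>k\<in>{..<1} \<union> {1..<j}. \<theta> ^ k * occ k w)"
  unfolding green_def using assms by (intro sum_mono2) (auto intro!: mult_nonneg_nonneg occ_nonneg)
 also have "\<dots> = occ 0 w + (\<Sum>k\<in>{1..<j}. \<theta> ^ k * occ k w)"
  by (subst sum.union_disjoint) auto
 also have "(\<Sum>k\<in>{1..<j}. \<theta> ^ k * occ k w) \<le> (\<Sum>k\<in>{1..<j}. \<theta> ^ k * 1)"
  using assms occ_le_1 by (intro sum_mono mult_left_mono) auto
 also have "\<dots> \<le> \<theta> ^ 1 / (1 - \<theta>)" using geom_tail_le[OF assms(1) \<theta>1, of 1 j] by simp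
 also have "\<dots> \<le> 1 / n"
 proof -
  have "\<theta> * (n + 1) \<le> 1" using assms(2) n1 by (simp add: field_simps)
  then show ?thesis using \<theta>1 n1 by (simp add: field_simps)
 qed
 finally show ?thesis using occ_0[OF assms(3)] by simp
qed

end

lemma pagerank_is_pr:
 fixes G :: "(nat, 'b) pre_digraph"
 assumes fd: "fin_digraph G" and V: "verts G = {..<n}" "0 < n" and out: "\<And>v. v \<in> verts G \<Longrightarrow> out_arcs G v \<noteq> {}"
  and eps: "0 < \<epsilon>" "\<epsilon> \<le> 1"
 defines "Pm \<equiv> \<lambda>u w. if u < n then pmf (map_pmf (head G) (pmf_of_set (out_arcs G u))) w else 0"
 shows "markov n Pm" and "markov.is_pr n Pm (1 - \<epsilon>) (pmf (pagerank G \<epsilon>))"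
proof -
 interpret fin_digraph G by (rule fd)
 have ne: "verts G \<noteq> {}" using V by auto
 have setP: "set_pmf (map_pmf (head G) (pmf_of_set (out_arcs G u))) \<subseteq> {..<n}" if "u < n" for u
 proof -
  have "set_pmf (pmf_of_set (out_arcs G u)) = out_arcs G u"
   using out[of u] that V by (intro set_pmf_of_set) (auto simp: finite_out_arcs)
  then have "set_pmf (map_pmf (head G) (pmf_of_set (out_arcs G u))) = head G ` out_arcs G u" by simp
  also have "\<dots> \<subseteq> verts G" by auto
  finally show ?thesis using V by simp
 qed
 show m: "markov n Pm"
 proof
  show "(\<Sum>w<n. Pm u w) = 1" if "u < n" for u
   using setP[OF that] that by (simp add: Pm_def sum_pmf_eq_1)
 qed (use V in \<open>auto simp: Pm_def\<close>)
 let ?\<pi> = "pagerank G \<epsilon>"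
 have st: "stationary_on (verts G) (pagerank_step G \<epsilon>) ?\<pi>"
  unfolding pagerank_def
  by (rule theI') (rule pagerank_unique[OF fin_digraph_axioms ne out eps])
 then have s: "set_pmf ?\<pi> \<subseteq> {..<n}" and fixp: "bind_pmf ?\<pi> (pagerank_step G \<epsilon>) = ?\<pi>"
  by (auto simp: stationary_on_def V)
 have eq: "pmf ?\<pi> v = \<epsilon> / n + (1 - \<epsilon>) * (\<Sum>u<n. pmf ?\<pi> u * Pm u v)" if v: "v < n" for v
 proof -
  have step: "pmf (pagerank_step G \<epsilon> u) v = \<epsilon> / n + (1 - \<epsilon>) * Pm u v" if "u < n" for u
   using eps v that V ne unfolding pagerank_step_def
   by (simp add: pmf_bind integral_bernoulli_pmf Pm_def indicator_def)
  have "pmf ?\<pi> v = pmf (bind_pmf ?\<pi> (pagerank_step G \<epsilon>)) v" using fixp by simp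
  also have "\<dots> = (\<Sum>u<n. pmf ?\<pi> u * pmf (pagerank_step G \<epsilon> u) v)"
   unfolding pmf_bind using s by (subst integral_measure_pmf[of "{..<n}"]) auto
  also have "\<dots> = (\<Sum>u<n. pmf ?\<pi> u * (\<epsilon> / n) + (1 - \<epsilon>) * (pmf ?\<pi> u * Pm u v))"
   by (intro sum.cong refl) (simp add: step algebra_simps)
  also have "\<dots> = (\<Sum>u<n. pmf ?\<pi> u) * (\<epsilon> / n) + (1 - \<epsilon>) * (\<Sum>u<n. pmf ?\<pi> u * Pm u v)"
   by (simp only: sum.distrib sum_distrib_left sum_distrib_right)
  also have "(\<Sum>u<n. pmf ?\<pi> u) = 1" using s by (simp add: sum_pmf_eq_1)
  finally show ?thesis by simp
 qed
 have "(\<Sum>v<n. pmf ?\<pi> v) = 1" using s by (simp add: sum_pmf_eq_1)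
 then show "markov.is_pr n Pm (1 - \<epsilon>) (pmf ?\<pi>)"
  unfolding markov.is_pr_def[OF m] using eq by (simp only: pmf_nonneg) simp
qed

section \<open>One phase of the walk\<close>

text \<open>A slot is chosen as a residue of a number below a fixed \<open>Q\<close>, because the
  program draws its random numbers before it looks up the pool size \<open>N\<close> of the target.
  The price is that a slot may get up to twice its fair share.\<close>

lemma card_mod_eq_le:
 assumes "0 < N" "N \<le> (Q::nat)"
 shows "real (card {r. r < Q \<and> r mod N = j}) \<le> 2 * real Q / real N"
proof -
 have inj: "inj_on (\<lambda>r. r div N) {r. r < Q \<and> r mod N = j}"
 proof (rule inj_onI)
  fix x y assume "x \<in> {r. r < Q \<and> r mod N = j}" "y \<in> {r. r < Q \<and> r mod N = j}" "x div N = y div N"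
  then show "x = y" using div_mult_mod_eq[of x N] div_mult_mod_eq[of y N] by simp
 qed
 have "(\<lambda>r. r div N) ` {r. r < Q \<and> r mod N = j} \<subseteq> {..Q div N}"
  by (auto simp: div_le_mono)
 then have "card {r. r < Q \<and> r mod N = j} \<le> Q div N + 1"
  using card_inj_on_le[OF inj, of "{..Q div N}"] by simp
 then have "card {r. r < Q \<and> r mod N = j} * N \<le> (Q div N + 1) * N" by (rule mult_le_mono1)
 also have "\<dots> = Q div N * N + N" by simp
 also have "\<dots> \<le> 2 * Q" using assms(2) div_times_less_eq_dividend[of Q N] by linarith
 finally have "real (card {r. r < Q \<and> r mod N = j} * N) \<le> real (2 * Q)" by (rule of_nat_mono)
 then show ?thesis using assms(1) by (simp add: field_simps)
qed

text \<open>If half of the repetitions fail, some set of \<open>R div 2\<close> of them fails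
  entirely. There are at most \<open>2 ^ R\<close> such sets, and each does so with probability at
  most \<open>(1 / 16) ^ (R div 2)\<close>, which is \<open>(1 / 4) ^ R\<close>. The threshold 1/16
  is chosen for this product.\<close>

lemma majority_bound:
 fixes p :: "nat \<Rightarrow> bool pmf"
 assumes R: "even R" and p: "\<And>i. i < R \<Longrightarrow> measure_pmf.prob (p i) {True} \<le> 1 / 16"
 shows "measure_pmf.prob (Pi_pmf {..<R} False p) {f. R \<le> 2 * card {i. i < R \<and> f i}} \<le> (1 / 2) ^ R"
proof -
 let ?M = "Pi_pmf {..<R} False p"
 let ?C = "{S. S \<subseteq> {..<R} \<and> card S = R div 2}"
 have fC: "finite ?C" by simp
 have sub: "{f. R \<le> 2 * card {i. i < R \<and> f i}} \<subseteq> (\<Union>S\<in>?C. {f. \<forall>i\<in>S. f i})"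
 proof
  fix f assume "f \<in> {f. R \<le> 2 * card {i. i < R \<and> f i}}"
  then have "R div 2 \<le> card {i. i < R \<and> f i}" by simp
  then obtain S where "S \<subseteq> {i. i < R \<and> f i}" "card S = R div 2" by (rule obtain_subset_with_card_n)
  then show "f \<in> (\<Union>S\<in>?C. {f. \<forall>i\<in>S. f i})" by auto
 qed
 have each: "measure_pmf.prob ?M {f. \<forall>i\<in>S. f i} \<le> (1 / 4) ^ R" if "S \<in> ?C" for S
 proof -
  have S: "S \<subseteq> {..<R}" "card S = R div 2" using that by auto
  define B where "B i = (if i \<in> S then {True} else UNIV)" for i
  have "{f. \<forall>i\<in>S. f i} = Pi {..<R} B" using S(1) by (auto simp: B_def Pi_def)
  then have "measure_pmf.prob ?M {f. \<forall>i\<in>S. f i} = (\<Prod>i<R. measure_pmf.prob (p i) (B i))"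
   using measure_Pi_pmf_Pi[of "{..<R}" False p B] by simp
  also have "\<dots> = (\<Prod>i<R. if i \<in> S then measure_pmf.prob (p i) {True} else 1)"
   by (intro prod.cong refl) (auto simp: B_def)
  also have "\<dots> = (\<Prod>i\<in>S. measure_pmf.prob (p i) {True})"
   using S(1) by (simp add: prod.If_cases Int_absorb1)
  also have "\<dots> \<le> (\<Prod>i\<in>S. 1 / 16)" using S(1) p by (intro prod_mono) auto
  also have "\<dots> = ((1 / 4) ^ 2) ^ (R div 2)" using S(2) by (simp add: power2_eq_square)
  also have "\<dots> = (1 / 4) ^ R" using R by (simp only: power_mult[symmetric]) simp
  finally show ?thesis .
 qed
 have "measure_pmf.prob ?M {f. R \<le> 2 * card {i. i < R \<and> f i}} \<le>
   measure_pmf.prob ?M (\<Union>S\<in>?C. {f. \<forall>i\<in>S. f i})"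
  by (intro measure_pmf.finite_measure_mono sub) simp
 also have "\<dots> \<le> (\<Sum>S\<in>?C. measure_pmf.prob ?M {f. \<forall>i\<in>S. f i})"
  by (intro measure_pmf.finite_measure_subadditive_finite fC) simp
 also have "\<dots> \<le> (\<Sum>S\<in>?C. (1 / 4) ^ R)" by (intro sum_mono each)
 also have "\<dots> = real (card ?C) * (1 / 4) ^ R" by simp
 also have "\<dots> \<le> 2 ^ R * (1 / 4) ^ R"
 proof (intro mult_right_mono)
  have "card ?C \<le> card (Pow {..<R})" by (intro card_mono) auto
  then have "card ?C \<le> 2 ^ R" by (simp add: card_Pow)
  then have "real (card ?C) \<le> real (2 ^ R)" by (rule of_nat_mono)
  then show "real (card ?C) \<le> 2 ^ R" by simp
 qed simp
 also have "\<dots> = (1 / 2) ^ R" by (simp add: power_mult_distrib[symmetric])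
 finally show ?thesis .
qed

text \<open>There are \<open>R\<close> repetitions, each with \<open>K\<close> walks from every
  vertex. A row has \<open>n * R * (K + 1)\<close> cells, in which the pool of \<open>w\<close> is
  the interval of length \<open>N w\<close> from \<open>off w\<close> on, and \<open>own\<close>
  names the owner of a position. Each level of each repetition has a row of its own with this
  layout. Edges are stored by tail: those of \<open>v\<close> lie at \<open>eo v\<close> and the
  following \<open>dg v\<close> places, with heads \<open>eh\<close>.\<close>

locale phase = markov n Pm for n :: nat and Pm :: "nat \<Rightarrow> nat \<Rightarrow> real" +
 fixes R K l Q J :: nat and \<theta> :: real and own off N eh eo dg :: "nat \<Rightarrow> nat"
 assumes R0: "0 < R" and l0: "0 < l" and \<theta>0: "0 \<le> \<theta>" "\<theta> < 1" and JD: "2 * l \<le> J"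
  and dg0: "v < n \<Longrightarrow> 0 < dg v" and eh: "v < n \<Longrightarrow> i < dg v \<Longrightarrow> eh (eo v + i) < n"
  and PmE: "v < n \<Longrightarrow> w < n \<Longrightarrow> Pm v w = real (card {i. i < dg v \<and> eh (eo v + i) = w}) / real (dg v)"
  and N0: "w < n \<Longrightarrow> 0 < N w" and NQ: "w < n \<Longrightarrow> N w \<le> Q"
  and slotT: "w < n \<Longrightarrow> j < N w \<Longrightarrow> off w + j < n * R * (K + 1)"
  and slot_own: "w < n \<Longrightarrow> j < N w \<Longrightarrow> own (off w + j) = w"
  and own_less: "p < n * R * (K + 1) \<Longrightarrow> own p < n"
begin

definition "Tt = n * R * (K + 1)"
definition "DD = 2 * l"
definition "Xs = {..<(1 + R * DD) * Tt}"
definition slot :: "nat \<Rightarrow> nat \<Rightarrow> nat \<Rightarrow> nat" where "slot rp t p = (1 + rp * DD + t) * Tt + p"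
definition bd :: "nat \<Rightarrow> nat" where "bd c = (if c < Tt then l else dg (own (c mod Tt)))"
text \<open>The first row holds the tokens. Its first \<open>n * R\<close> cells never move; each
  other token enters the pool of its vertex on a random level \<open>i < l\<close>. A slot stops by
  its coin \<open>st\<close> or on the last level, and otherwise passes through edge
  \<open>i\<close> to a slot of the pool of the head on the next level.\<close>

definition nx :: "nat \<Rightarrow> bool \<times> nat \<times> nat \<Rightarrow> nat" where
 "nx c = (\<lambda>(st, i, r). if c < n * R then c
   else if c < Tt then slot (c mod R) i (off (c mod (n * R) div R) + r mod N (c mod (n * R) div R))
   else if st \<or> (c div Tt - 1) mod DD = DD - 1 then c
   else (c div Tt + 1) * Tt + (off (eh (eo (own (c mod Tt)) + i)) + r mod N (eh (eo (own (c mod Tt)) + i))))"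
definition draw :: "nat \<Rightarrow> (bool \<times> nat \<times> nat) pmf" where
 "draw c = pair_pmf (bernoulli_pmf (1 - \<theta>)) (pmf_of_set ({..<bd c} \<times> {..<Q}))"
definition Dk :: "nat \<Rightarrow> nat pmf" where "Dk c = map_pmf (nx c) (draw c)"
definition lev :: "nat \<Rightarrow> nat" where "lev c = (if c < Tt then 0 else Suc ((c div Tt - 1) mod DD))"
definition Tg :: "nat \<Rightarrow> nat set" where "Tg v = {c. Tt \<le> c \<and> own (c mod Tt) = v}"
definition tok :: "nat \<Rightarrow> nat set" where "tok rp = {a. n * R \<le> a \<and> a < Tt \<and> a mod R = rp}"

lemma T0: "0 < Tt" and nR_le: "n * R \<le> Tt" using n0 R0 by (simp_all add: Tt_def)
lemma D0: "0 < DD" and lD: "i < l \<Longrightarrow> i < DD" using l0 by (simp_all add: DD_def)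
lemma slotT': "w < n \<Longrightarrow> j < N w \<Longrightarrow> off w + j < Tt" using slotT by (simp add: Tt_def)
lemma own_less': "p < Tt \<Longrightarrow> own p < n" using own_less by (simp add: Tt_def)
lemma Q0: "0 < Q" using N0[OF n0] NQ[OF n0] by simp

lemma slot_arith:
 assumes "rp < R" "t < DD" "p < Tt"
 shows "slot rp t p \<in> Xs" "Tt \<le> slot rp t p" "slot rp t p div Tt = 1 + rp * DD + t" "slot rp t p mod Tt = p"
  "(slot rp t p div Tt - 1) mod DD = t" "(slot rp t p div Tt - 1) div DD = rp" "lev (slot rp t p) = Suc t"
proof -
 have "rp * DD + t < R * DD" by (rule mult_add_less[OF assms(1,2)])
 then have "1 + rp * DD + t < 1 + R * DD" by simp
 from mult_add_less[OF this assms(3)] show "slot rp t p \<in> Xs" by (simp add: slot_def Xs_def)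
 show ge: "Tt \<le> slot rp t p" unfolding slot_def using mult_le_mono1[of 1 "1 + rp * DD + t" Tt] by simp
 show d: "slot rp t p div Tt = 1 + rp * DD + t" and m: "slot rp t p mod Tt = p"
  unfolding slot_def by (rule mult_add_div_mod[OF assms(3)])+
 have "slot rp t p div Tt - 1 = rp * DD + t" unfolding d by simp
 then show "(slot rp t p div Tt - 1) mod DD = t" "(slot rp t p div Tt - 1) div DD = rp"
  using mult_add_div_mod[OF assms(2), of rp] by simp_all
 then show "lev (slot rp t p) = Suc t" using ge by (simp add: lev_def)
qed

lemma slot_cases:
 assumes "c \<in> Xs" "Tt \<le> c"
 obtains rp t p where "rp < R" "t < DD" "p < Tt" "c = slot rp t p"
proof -
 define row where "row = c div Tt - 1"
 have "c div Tt < 1 + R * DD" using assms(1) T0 by (simp add: Xs_def div_less_iff_less_mult)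
 moreover have "1 \<le> c div Tt" using div_le_mono[OF assms(2), of Tt] T0 by simp
 ultimately have row: "c div Tt = 1 + row" "row < R * DD" unfolding row_def by auto
 have rw: "row div DD * DD + row mod DD = row" by (rule div_mult_mod_eq)
 show ?thesis
 proof (rule that)
  show "row div DD < R" using row(2) D0 by (simp add: div_less_iff_less_mult)
  show "row mod DD < DD" "c mod Tt < Tt" using D0 T0 by (auto intro: mod_less_divisor)
  have "slot (row div DD) (row mod DD) (c mod Tt) = (1 + (row div DD * DD + row mod DD)) * Tt + c mod Tt"
   by (simp only: slot_def add.assoc)
  also have "\<dots> = c div Tt * Tt + c mod Tt" unfolding rw row(1) ..
  finally show "c = slot (row div DD) (row mod DD) (c mod Tt)" by (simp only: div_mult_mod_eq)
 qed
qed

lemma nx_slot: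
 assumes "rp < R" "t < DD" "p < Tt"
 shows "nx (slot rp t p) (st, i, r) = (if st \<or> t = DD - 1 then slot rp t p
  else slot rp (Suc t) (off (eh (eo (own p) + i)) + r mod N (eh (eo (own p) + i))))"
proof -
 note sa = slot_arith[OF assms]
 have "\<not> slot rp t p < n * R" "\<not> slot rp t p < Tt" using sa(2) nR_le by linarith+
 then have n1: "(slot rp t p < n * R) = False" "(slot rp t p < Tt) = False" by blast+
 have e: "(1 + rp * DD + t + 1) * Tt + q = slot rp (Suc t) q" for q by (simp add: slot_def)
 show ?thesis unfolding nx_def prod.case sa(5) unfolding sa(3,4) e n1 if_False ..
qed

lemma token_vertex: "a mod (n * R) div R < n" "R dvd n * R"
 using n0 R0 mod_less_divisor[of "n * R" a] by (auto simp: div_less_iff_less_mult)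

lemma nx_token:
 assumes "n * R \<le> a" "a < Tt"
 shows "nx a (st, i, r) = slot (a mod R) i (off (a mod (n * R) div R) + r mod N (a mod (n * R) div R))"
 using assms by (simp add: nx_def)

lemma slot_pos: "w < n \<Longrightarrow> off w + r mod N w < Tt" "w < n \<Longrightarrow> own (off w + r mod N w) = w"
 using slotT'[of w "r mod N w"] slot_own[of w "r mod N w"] N0[of w] by (auto intro: mod_less_divisor)

lemma bd0: "c \<in> Xs \<Longrightarrow> 0 < bd c"
 using l0 dg0 own_less' T0 by (auto simp: bd_def)

lemma set_draw:
 assumes "c \<in> Xs" "(st, i, r) \<in> set_pmf (draw c)"
 shows "i < bd c" "r < Q"
proof -
 have "set_pmf (pmf_of_set ({..<bd c} \<times> {..<Q})) = {..<bd c} \<times> {..<Q}"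
  using bd0[OF assms(1)] Q0 by (intro set_pmf_of_set) auto
 then show "i < bd c" "r < Q" using assms(2) by (auto simp: draw_def)
qed

lemma Dk_supp:
 assumes c: "c \<in> Xs" and w: "w \<in> set_pmf (Dk c)"
 shows "w = c \<or> w \<in> Xs \<and> lev c < lev w"
proof -
 obtain st i r where d: "(st, i, r) \<in> set_pmf (draw c)" "w = nx c (st, i, r)"
  using w by (auto simp: Dk_def)
 note b = set_draw[OF c d(1)]
 consider "c < n * R" | "n * R \<le> c" "c < Tt" | "Tt \<le> c" by linarith
 then show ?thesis
 proof cases
  case 1
  then show ?thesis using d(2) by (simp add: nx_def)
 next
  case 2
  have "i < l" using b(1) 2 by (simp add: bd_def)
  then have "i < DD" by (rule lD)
  note sa = slot_arith[OF mod_less_divisor[OF R0, of c] this slot_pos(1)[OF token_vertex(1)[of c], of r]]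
  show ?thesis using sa(1,7) 2 unfolding d(2) nx_token[OF 2] by (simp add: lev_def)
 next
  case 3
  obtain rp t p where s: "rp < R" "t < DD" "p < Tt" "c = slot rp t p" using slot_cases[OF c 3] .
  show ?thesis
  proof (cases "st \<or> t = DD - 1")
   case True
   then show ?thesis using d(2) nx_slot[OF s(1-3)] s(4) by simp
  next
   case False
   have "i < dg (own p)" using b(1) 3 slot_arith[OF s(1-3)] s(4) by (simp add: bd_def)
   then have w': "eh (eo (own p) + i) < n" using eh own_less'[OF s(3)] by blast
   have "Suc t < DD" using False s(2) by auto
   note sa = slot_arith[OF s(1) this slot_pos(1)[OF w', of r]]
   show ?thesis using sa(1,7) slot_arith(7)[OF s(1-3)] False unfolding d(2) s(4) nx_slot[OF s(1-3)] by simp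
  qed
 qed
qed

sublocale lw: layered_walk Xs Dk lev J "Tg v" for v
proof
 show "finite Xs" by (simp add: Xs_def)
 show "w = x \<or> w \<in> Xs \<and> lev x < lev w" if "x \<in> Xs" "w \<in> set_pmf (Dk x)" for x w
  using Dk_supp that by blast
 show "lev x \<le> J" if "x \<in> Xs" for x
 proof -
  have "(x div Tt - 1) mod DD < DD" by (rule mod_less_divisor[OF D0])
  then show ?thesis using JD[folded DD_def] by (auto simp: lev_def)
 qed
qed

lemma sum_Dk:
 fixes f :: "nat \<Rightarrow> real"
 assumes c: "c \<in> Xs"
 shows "(\<Sum>w\<in>Xs. pmf (Dk c) w * f w) = (\<Sum>i<bd c. \<Sum>r<Q.
   (1 - \<theta>) * f (nx c (True, i, r)) + \<theta> * f (nx c (False, i, r))) / (real (bd c) * real Q)"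
proof -
 let ?S = "{..<bd c} \<times> {..<Q}"
 have S: "?S \<noteq> {}" "finite ?S" using bd0[OF c] Q0 by auto
 have "(\<Sum>w\<in>Xs. pmf (Dk c) w * f w) = measure_pmf.expectation (Dk c) f"
  using lw.finX lw.setD[OF c]
  by (subst integral_measure_pmf_real[of Xs]) (auto simp: mult.commute)
 also have "\<dots> = measure_pmf.expectation (draw c) (\<lambda>d. f (nx c d))" by (simp add: Dk_def)
 also have "\<dots> = (\<Sum>d\<in>UNIV \<times> ?S. f (nx c d) * pmf (draw c) d)"
 proof (rule integral_measure_pmf_real)
  show "finite (UNIV \<times> ?S :: (bool \<times> nat \<times> nat) set)" by simp
  show "d \<in> UNIV \<times> ?S" if "d \<in> set_pmf (draw c)" for d
   using set_draw[OF c] that by (cases d) auto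
 qed
 also have "\<dots> = (\<Sum>b\<in>UNIV. \<Sum>s\<in>?S. f (nx c (b, s)) * pmf (draw c) (b, s))"
  by (simp add: sum.cartesian_product)
 also have "\<dots> = (\<Sum>b\<in>UNIV. \<Sum>s\<in>?S. f (nx c (b, s)) * (pmf (bernoulli_pmf (1 - \<theta>)) b / (real (bd c) * real Q)))"
  using S by (intro sum.cong refl) (auto simp: draw_def pmf_pair)
 also have "\<dots> = (\<Sum>s\<in>?S. (1 - \<theta>) * f (nx c (True, s)) + \<theta> * f (nx c (False, s))) / (real (bd c) * real Q)"
  using \<theta>0 by (simp add: UNIV_bool sum.distrib sum_divide_distrib add_divide_distrib mult.commute)
 also have "(\<Sum>s\<in>?S. (1 - \<theta>) * f (nx c (True, s)) + \<theta> * f (nx c (False, s))) =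
   (\<Sum>i<bd c. \<Sum>r<Q. (1 - \<theta>) * f (nx c (True, i, r)) + \<theta> * f (nx c (False, i, r)))"
  by (subst sum.cartesian_product) (simp add: case_prod_unfold)
 finally show ?thesis .
qed

lemma Pm_avg:
 assumes "u < n"
 shows "(\<Sum>w<n. Pm u w * f w) = (\<Sum>i<dg u. f (eh (eo u + i))) / real (dg u)"
proof -
 have "(\<Sum>i<dg u. f (eh (eo u + i))) = (\<Sum>w<n. \<Sum>i\<in>{i\<in>{..<dg u}. eh (eo u + i) = w}. f (eh (eo u + i)))"
  using eh[OF assms] by (subst sum.group) auto
 also have "\<dots> = (\<Sum>w<n. real (card {i. i < dg u \<and> eh (eo u + i) = w}) * f w)"
  by (intro sum.cong refl) simp
 finally show ?thesis using assms by (simp add: PmE sum_divide_distrib)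
qed

lemma slot_neq: "rp < R \<Longrightarrow> t < DD \<Longrightarrow> p < Tt \<Longrightarrow> Suc t < DD \<Longrightarrow> p' < Tt \<Longrightarrow> slot rp (Suc t) p' \<noteq> slot rp t p"
 using slot_arith(7)[of rp t p] slot_arith(7)[of rp "Suc t" p'] by auto

lemma sum_Dk_slot:
 fixes f :: "nat \<Rightarrow> real"
 assumes s: "rp < R" "t < DD" "p < Tt" "t \<noteq> DD - 1"
 shows "(\<Sum>w\<in>Xs. pmf (Dk (slot rp t p)) w * (if w = slot rp t p then b else f w)) = (1 - \<theta>) * b +
  \<theta> * (\<Sum>i<dg (own p). (\<Sum>r<Q. f (slot rp (Suc t) (off (eh (eo (own p) + i)) + r mod N (eh (eo (own p) + i))))) / real Q)
   / real (dg (own p))"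
proof -
 note sa = slot_arith[OF s(1-3)]
 let ?x = "slot rp t p" and ?u = "own p"
 let ?y = "\<lambda>i r. slot rp (Suc t) (off (eh (eo ?u + i)) + r mod N (eh (eo ?u + i)))"
 have bd: "bd ?x = dg ?u" using sa(2,4) by (simp add: bd_def)
 have d0: "0 < dg ?u" by (rule dg0[OF own_less'[OF s(3)]])
 have t: "Suc t < DD" using s(2,4) by auto
 have "?y i r \<noteq> ?x" if "i < dg ?u" for i r
  using slot_neq[OF s(1-3) t slot_pos(1)[OF eh[OF own_less'[OF s(3)] that]]] .
 then have "(\<Sum>i<dg ?u. \<Sum>r<Q. (1 - \<theta>) * (if nx ?x (True, i, r) = ?x then b else f (nx ?x (True, i, r))) +
   \<theta> * (if nx ?x (False, i, r) = ?x then b else f (nx ?x (False, i, r)))) =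
  (\<Sum>i<dg ?u. \<Sum>r<Q. (1 - \<theta>) * b + \<theta> * f (?y i r))"
  using s(4) by (intro sum.cong refl) (simp add: nx_slot[OF s(1-3)])
 also have "\<dots> = real (dg ?u) * real Q * ((1 - \<theta>) * b) + \<theta> * (\<Sum>i<dg ?u. \<Sum>r<Q. f (?y i r))"
  by (simp add: sum.distrib sum_distrib_left)
 finally have num: "(\<Sum>i<dg ?u. \<Sum>r<Q. (1 - \<theta>) * (if nx ?x (True, i, r) = ?x then b else f (nx ?x (True, i, r))) +
   \<theta> * (if nx ?x (False, i, r) = ?x then b else f (nx ?x (False, i, r)))) =
  real (dg ?u) * real Q * ((1 - \<theta>) * b) + \<theta> * (\<Sum>i<dg ?u. \<Sum>r<Q. f (?y i r))" .
 have e: "(x * y * c + k * s) / (x * y) = c + k * (s / y) / x" if "0 < x" "0 < y" for x y c k s :: real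
  using that by (simp add: add_divide_distrib)
 have dd: "(\<Sum>i<dg ?u. (\<Sum>r<Q. f (?y i r)) / real Q) = (\<Sum>i<dg ?u. \<Sum>r<Q. f (?y i r)) / real Q"
  by (rule sum_divide_distrib[symmetric])
 show ?thesis unfolding sum_Dk[OF sa(1)] bd num dd by (rule e) (use d0 Q0 in auto)
qed

lemma sum_Dk_token:
 fixes f :: "nat \<Rightarrow> real"
 assumes a: "n * R \<le> a" "a < Tt"
 defines "u \<equiv> a mod (n * R) div R"
 shows "(\<Sum>w\<in>Xs. pmf (Dk a) w * (if w = a then b else f w)) =
  (\<Sum>i<l. (\<Sum>r<Q. f (slot (a mod R) i (off u + r mod N u))) / real Q) / real l"
proof -
 have aX: "a \<in> Xs" using a(2) mult_le_mono1[of 1 "1 + R * DD" Tt] by (simp add: Xs_def)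
 have bd: "bd a = l" using a(2) by (simp add: bd_def)
 have u: "u < n" unfolding u_def by (rule token_vertex)
 have ne: "slot (a mod R) i (off u + r mod N u) \<noteq> a" if "i < l" for i r
  using slot_arith(2)[OF mod_less_divisor[OF R0, of a] lD[OF that] slot_pos(1)[OF u, of r]] a(2) by linarith
 have "(\<Sum>i<l. \<Sum>r<Q. (1 - \<theta>) * (if nx a (True, i, r) = a then b else f (nx a (True, i, r))) +
   \<theta> * (if nx a (False, i, r) = a then b else f (nx a (False, i, r)))) =
  (\<Sum>i<l. \<Sum>r<Q. f (slot (a mod R) i (off u + r mod N u)))"
 proof (intro sum.cong refl)
  fix i r assume "i \<in> {..<l}" "r \<in> {..<Q}"
  then have n: "nx a (st, i, r) = slot (a mod R) i (off u + r mod N u)" "slot (a mod R) i (off u + r mod N u) \<noteq> a" for st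
   using ne nx_token[OF a] by (auto simp: u_def)
  show "(1 - \<theta>) * (if nx a (True, i, r) = a then b else f (nx a (True, i, r))) +
   \<theta> * (if nx a (False, i, r) = a then b else f (nx a (False, i, r))) = f (slot (a mod R) i (off u + r mod N u))"
   using n(2) by (simp add: n(1) algebra_simps)
 qed
 moreover have "(\<Sum>i<l. (\<Sum>r<Q. f (slot (a mod R) i (off u + r mod N u))) / real Q) =
   (\<Sum>i<l. \<Sum>r<Q. f (slot (a mod R) i (off u + r mod N u))) / real Q"
  by (rule sum_divide_distrib[symmetric])
 ultimately show ?thesis unfolding sum_Dk[OF aX] bd by (simp only: divide_divide_eq_left mult.commute[of "real Q"])
qed

text \<open>All slots of a pool have the same future law, so only the owner and the number of levels
  left matter. Running out of levels is the forced stop of \<open>absorb\<close> at 0.\<close>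

lemma h_slot:
 assumes "rp < R" "t < DD" "p < Tt" "v < n"
 shows "lw.h v (slot rp t p) = absorb \<theta> (DD - 1 - t) (own p) v"
 using assms
proof (induction "DD - 1 - t" arbitrary: t p)
 case 0
 note sa = slot_arith[OF 0(2,3,4)]
 have t: "t = DD - 1" using 0 by simp
 let ?x = "slot rp t p"
 have "lw.h v ?x = (\<Sum>w\<in>Xs. pmf (Dk ?x) w * (if w = ?x then of_bool (?x \<in> Tg v) else lw.h v w))"
  by (rule lw.h_step[OF sa(1)])
 also have "\<dots> = of_bool (?x \<in> Tg v)"
 proof -
  have "nx ?x (st, i, r) = ?x" for st i r using nx_slot[OF 0(2,3,4)] t by simp
  then have "(\<Sum>i<bd ?x. \<Sum>r<Q. (1 - \<theta>) * (if nx ?x (True, i, r) = ?x then of_bool (?x \<in> Tg v) else lw.h v (nx ?x (True, i, r))) +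
   \<theta> * (if nx ?x (False, i, r) = ?x then of_bool (?x \<in> Tg v) else lw.h v (nx ?x (False, i, r)))) =
   real (bd ?x) * real Q * of_bool (?x \<in> Tg v)" by (simp add: algebra_simps)
  then show ?thesis unfolding sum_Dk[OF sa(1)] using bd0[OF sa(1)] Q0 by simp
 qed
 finally show ?case using sa(2,4) t by (simp add: Tg_def)
next
 case (Suc k)
 note sa = slot_arith[OF Suc.prems(1-3)]
 have t: "t \<noteq> DD - 1" "Suc t < DD" "k = DD - 1 - Suc t" using Suc.hyps(2) by auto
 have u: "own p < n" by (rule own_less'[OF Suc.prems(3)])
 let ?x = "slot rp t p"
 have IH: "lw.h v (slot rp (Suc t) (off w + r mod N w)) = absorb \<theta> k w v" if "w < n" for w r
  using Suc.hyps(1)[OF t(3) Suc.prems(1) t(2) slot_pos(1)[OF that, of r] Suc.prems(4)] slot_pos(2)[OF that, of r] t(3)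
  by simp
 have "lw.h v ?x = (1 - \<theta>) * of_bool (?x \<in> Tg v) + \<theta> * (\<Sum>i<dg (own p). (\<Sum>r<Q.
   lw.h v (slot rp (Suc t) (off (eh (eo (own p) + i)) + r mod N (eh (eo (own p) + i))))) / real Q) / real (dg (own p))"
  unfolding lw.h_step[OF sa(1), of v] by (rule sum_Dk_slot[OF Suc.prems(1-3) t(1)])
 also have "(\<Sum>i<dg (own p). (\<Sum>r<Q. lw.h v (slot rp (Suc t) (off (eh (eo (own p) + i)) +
   r mod N (eh (eo (own p) + i))))) / real Q) = (\<Sum>i<dg (own p). absorb \<theta> k (eh (eo (own p) + i)) v)"
  using IH eh[OF u] Q0 by (intro sum.cong refl) simp
 also have "\<theta> * (\<Sum>i<dg (own p). absorb \<theta> k (eh (eo (own p) + i)) v) / real (dg (own p)) =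
   \<theta> * (\<Sum>w<n. Pm (own p) w * absorb \<theta> k w v)"
  unfolding Pm_avg[OF u] by simp
 also have "of_bool (?x \<in> Tg v) = (of_bool (own p = v) :: real)" using sa(2,4) by (simp add: Tg_def)
 finally show ?case unfolding Suc.hyps(2)[symmetric] by simp
qed

lemma token_in: "a < Tt \<Longrightarrow> a \<in> Xs"
 using mult_le_mono1[of 1 "1 + R * DD" Tt] by (simp add: Xs_def)

lemma h_token:
 assumes a: "n * R \<le> a" "a < Tt" "v < n"
 shows "lw.h v a = (\<Sum>i<l. absorb \<theta> (DD - 1 - i) (a mod (n * R) div R) v) / real l"
proof -
 let ?u = "a mod (n * R) div R"
 have u: "?u < n" by (rule token_vertex)
 have "lw.h v a = (\<Sum>i<l. (\<Sum>r<Q. lw.h v (slot (a mod R) i (off ?u + r mod N ?u))) / real Q) / real l"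
  unfolding lw.h_step[OF token_in[OF a(2)], of v] by (rule sum_Dk_token[OF a(1,2)])
 also have "\<dots> = (\<Sum>i<l. absorb \<theta> (DD - 1 - i) ?u v) / real l"
  using Q0 by (intro arg_cong2[of _ _ _ _ "(/)"] sum.cong refl)
   (simp add: h_slot[OF mod_less_divisor[OF R0] lD slot_pos(1)[OF u] a(3)] slot_pos(2)[OF u])
 finally show ?thesis .
qed

text \<open>On average over the slot taken in the pool of \<open>u\<close>, a fixed slot
  \<open>k\<close> levels further on is hit with the probability of the discounted
  \<open>k\<close>-step walk, spread over the pool size. The factor 2 is that of
  \<open>card_mod_eq_le\<close>.\<close>

lemma V_avg:
 assumes z: "rz < R" "tz < DD" "pz < Tt" and x: "rp < R" "t + k = tz" and u: "u < n"
 shows "(\<Sum>r<Q. lw.V (slot rp t (off u + r mod N u)) (slot rz tz pz)) / real Q \<le>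
  2 / real (N (own pz)) * \<theta> ^ k * pw k u (own pz)"
 using x u
proof (induction k arbitrary: t u)
 case 0
 let ?z = "slot rz tz pz" and ?w = "own pz"
 note sz = slot_arith[OF z]
 have w: "?w < n" by (rule own_less'[OF z(3)])
 have t: "t = tz" using 0 by simp
 have V: "lw.V (slot rp t (off u + r mod N u)) ?z = of_bool (slot rp t (off u + r mod N u) = ?z)" for r
 proof (cases "slot rp t (off u + r mod N u) = ?z")
  case True
  then show ?thesis using lw.V_self by simp
 next
  case False
  note sx = slot_arith[OF 0(1) z(2) slot_pos(1)[OF 0(3), of r], folded t]
  show ?thesis using lw.V_zero[OF sx(1), of ?z] False sx(7) sz(7) t by auto
 qed
 have imp: "u = ?w \<and> r mod N ?w = pz - off ?w" if e: "slot rp t (off u + r mod N u) = ?z" for r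
 proof -
  have "off u + r mod N u = pz"
   using slot_arith(4)[OF 0(1) z(2) slot_pos(1)[OF 0(3), of r]] sz(4) e t by simp
  then show ?thesis using slot_pos(2)[OF 0(3), of r] by auto
 qed
 have "(\<Sum>r<Q. lw.V (slot rp t (off u + r mod N u)) ?z) = real (card {r. r < Q \<and> slot rp t (off u + r mod N u) = ?z})"
  unfolding V by (simp add: sum.If_cases of_bool_def lessThan_def Collect_conj_eq[symmetric])
 also have "\<dots> \<le> real (card {r. r < Q \<and> r mod N ?w = pz - off ?w}) * of_bool (u = ?w)"
 proof (cases "u = ?w")
  case True
  have "card {r. r < Q \<and> slot rp t (off u + r mod N u) = ?z} \<le> card {r. r < Q \<and> r mod N ?w = pz - off ?w}"
   using imp by (intro card_mono) auto
  moreover have "(of_bool (u = ?w) :: real) = 1" using True by simp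
  ultimately show ?thesis by (simp only: mult_1_right of_nat_le_iff)
 next
  case False
  then have "{r. r < Q \<and> slot rp t (off u + r mod N u) = ?z} = {}" using imp by auto
  then have c0: "card {r. r < Q \<and> slot rp t (off u + r mod N u) = ?z} = 0" by (simp only: card.empty)
  show ?thesis unfolding c0 by simp
 qed
 also have "\<dots> \<le> 2 * real Q / real (N ?w) * of_bool (u = ?w)"
  using card_mod_eq_le[OF N0[OF w] NQ[OF w]] by (intro mult_right_mono) auto
 finally show ?case using Q0 by (simp add: field_simps)
next
 case (Suc k)
 let ?z = "slot rz tz pz" and ?w = "own pz"
 have t: "Suc t < DD" "t < DD" "t \<noteq> DD - 1" using Suc.prems(2) z(2) by auto
 have each: "lw.V (slot rp t (off u + r mod N u)) ?z \<le> 2 / real (N ?w) * \<theta> ^ Suc k * pw (Suc k) u ?w" for r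
 proof -
  let ?p = "off u + r mod N u"
  have p: "?p < Tt" "own ?p = u" using slot_pos[OF Suc.prems(3)] by auto
  note sx = slot_arith[OF Suc.prems(1) t(2) p(1)]
  have ne: "?z \<noteq> slot rp t ?p" using slot_arith(7)[OF z] sx(7) Suc.prems(2) by auto
  have "lw.V (slot rp t ?p) ?z = (1 - \<theta>) * 0 + \<theta> * (\<Sum>i<dg u. (\<Sum>r<Q.
    lw.V (slot rp (Suc t) (off (eh (eo u + i)) + r mod N (eh (eo u + i)))) ?z) / real Q) / real (dg u)"
   unfolding lw.V_step[OF sx(1) ne] sum_Dk_slot[OF Suc.prems(1) t(2) p(1) t(3)] p(2) ..
  also have "\<dots> \<le> (1 - \<theta>) * 0 + \<theta> * (\<Sum>i<dg u. 2 / real (N ?w) * \<theta> ^ k * pw k (eh (eo u + i)) ?w) / real (dg u)"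
   using \<theta>0 Suc.IH[OF Suc.prems(1)] Suc.prems(2) eh[OF Suc.prems(3)]
   by (intro add_left_mono divide_right_mono mult_left_mono sum_mono) auto
  also have "\<dots> = 2 / real (N ?w) * \<theta> ^ Suc k * ((\<Sum>i<dg u. pw k (eh (eo u + i)) ?w) / real (dg u))"
   by (simp only: sum_distrib_left[symmetric] power_Suc) simp
  also have "(\<Sum>i<dg u. pw k (eh (eo u + i)) ?w) / real (dg u) = pw (Suc k) u ?w"
   using Pm_avg[OF Suc.prems(3), of "\<lambda>w. pw k w ?w"] by simp
  finally show ?thesis .
 qed
 have "(\<Sum>r<Q. lw.V (slot rp t (off u + r mod N u)) ?z) \<le> (\<Sum>r<Q. 2 / real (N ?w) * \<theta> ^ Suc k * pw (Suc k) u ?w)"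
  by (intro sum_mono each)
 then show ?case using Q0 by (simp add: field_simps)
qed

text \<open>For a fixed target level \<open>tz\<close> different start levels \<open>i\<close> give
  different step numbers \<open>tz - i\<close>. Averaging over the \<open>l\<close> start levels
  thus yields at most the discounted visits in \<open>DD\<close> steps, divided by \<open>l\<close>;
  without the random start level this division would be missing.\<close>

lemma V_token:
 assumes z: "rz < R" "tz < DD" "pz < Tt" and a: "n * R \<le> a" "a < Tt"
 shows "lw.V a (slot rz tz pz) \<le> 2 / (real l * real (N (own pz))) *
  (\<Sum>k<DD. \<theta> ^ k * pw k (a mod (n * R) div R) (own pz))"
proof -
 let ?z = "slot rz tz pz" and ?w = "own pz" and ?u = "a mod (n * R) div R"
 note sz = slot_arith[OF z]
 have u: "?u < n" by (rule token_vertex)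
 have aR: "a mod R < R" using R0 by simp
 have w: "?w < n" by (rule own_less'[OF z(3)])
 have ne: "?z \<noteq> a" using sz(2) a(2) by linarith
 define S where "S i = (\<Sum>r<Q. lw.V (slot (a mod R) i (off ?u + r mod N ?u)) ?z) / real Q" for i
 have Sle: "S i \<le> (if i \<le> tz then 2 / real (N ?w) * (\<theta> ^ (tz - i) * pw (tz - i) ?u ?w) else 0)" if "i < l" for i
 proof (cases "i \<le> tz")
  case True
  then show ?thesis using V_avg[OF z aR _ u, of i "tz - i"] by (simp add: S_def mult.assoc)
 next
  case False
  have "lw.V (slot (a mod R) i (off ?u + r mod N ?u)) ?z = 0" for r
  proof -
   have "i < DD" using that by (rule lD)
   note sx = slot_arith[OF aR this slot_pos(1)[OF u, of r]]
   have "?z \<noteq> slot (a mod R) i (off ?u + r mod N ?u)" using sx(7) sz(7) False by auto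
   then show ?thesis using lw.V_zero[OF sx(1)] sx(7) sz(7) False by simp
  qed
  then show ?thesis using False by (simp add: S_def)
 qed
 have "lw.V a ?z = (\<Sum>i<l. S i) / real l"
  unfolding lw.V_step[OF token_in[OF a(2)] ne] S_def by (rule sum_Dk_token[OF a])
 also have "\<dots> \<le> (\<Sum>i<l. if i \<le> tz then 2 / real (N ?w) * (\<theta> ^ (tz - i) * pw (tz - i) ?u ?w) else 0) / real l"
  using Sle by (intro divide_right_mono sum_mono) auto
 also have "(\<Sum>i<l. if i \<le> tz then 2 / real (N ?w) * (\<theta> ^ (tz - i) * pw (tz - i) ?u ?w) else 0) =
   (\<Sum>i\<in>{i. i < l \<and> i \<le> tz}. 2 / real (N ?w) * (\<theta> ^ (tz - i) * pw (tz - i) ?u ?w))"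
  by (simp add: sum.If_cases lessThan_def Collect_conj_eq[symmetric])
 also have "\<dots> = (\<Sum>k\<in>(\<lambda>i. tz - i) ` {i. i < l \<and> i \<le> tz}. 2 / real (N ?w) * (\<theta> ^ k * pw k ?u ?w))"
  by (subst sum.reindex) (auto simp: inj_on_def)
 also have "\<dots> \<le> (\<Sum>k<DD. 2 / real (N ?w) * (\<theta> ^ k * pw k ?u ?w))"
  using z(2) \<theta>0 by (intro sum_mono2) (auto intro!: divide_nonneg_nonneg mult_nonneg_nonneg pw_nonneg)
 finally have "lw.V a ?z \<le> (\<Sum>k<DD. 2 / real (N ?w) * (\<theta> ^ k * pw k ?u ?w)) / real l"
  using l0 by (simp add: divide_right_mono)
 moreover have "(2 / y * S) / x = 2 / (x * y) * S" for x y S :: real by simp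
 ultimately show ?thesis by (simp only: sum_distrib_left[symmetric])
qed

lemma sum_tok:
 assumes "rp < R"
 shows "(\<Sum>a\<in>tok rp. f (a mod (n * R) div R)) = real K * (\<Sum>u<n. f u)"
proof -
 let ?g = "\<lambda>(k, u). Suc k * (n * R) + (u * R + rp)"
 have nR: "0 < n * R" using n0 R0 by simp
 have lt: "u * R + rp < n * R" if "u < n" for u by (rule mult_add_less[OF that assms])
 have md: "(Suc k * (n * R) + (u * R + rp)) mod (n * R) = u * R + rp"
  "(Suc k * (n * R) + (u * R + rp)) div (n * R) = Suc k" if "u < n" for k u
  using mult_add_div_mod[OF lt[OF that], of "Suc k"] by blast+
 have ud: "(u * R + rp) div R = u" "(u * R + rp) mod R = rp" for u using mult_add_div_mod[OF assms] by blast+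
 have inj: "inj_on ?g ({..<K} \<times> {..<n})"
 proof (rule inj_onI)
  fix x y assume xy: "x \<in> {..<K} \<times> {..<n}" "y \<in> {..<K} \<times> {..<n}" "?g x = ?g y"
  obtain k u where x: "x = (k, u)" "u < n" using xy(1) by auto
  obtain k' u' where y: "y = (k', u')" "u' < n" using xy(2) by auto
  have e: "Suc k * (n * R) + (u * R + rp) = Suc k' * (n * R) + (u' * R + rp)"
   using xy(3) unfolding x(1) y(1) prod.case .
  have "Suc k = Suc k'" using md(2)[OF x(2), of k] md(2)[OF y(2), of k'] unfolding e by simp
  moreover have "u * R + rp = u' * R + rp" using md(1)[OF x(2), of k] md(1)[OF y(2), of k'] unfolding e by simp
  then have "u = u'" using R0 by simp
  ultimately show "x = y" using x(1) y(1) by simp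
 qed
 have im: "?g ` ({..<K} \<times> {..<n}) = tok rp"
 proof (intro equalityI subsetI)
  fix a assume "a \<in> ?g ` ({..<K} \<times> {..<n})"
  then obtain k u where k: "k < K" "u < n" "a = Suc k * (n * R) + (u * R + rp)" by auto
  have "n * R \<le> Suc k * (n * R)" by simp
  then have "n * R \<le> a" using k(3) by linarith
  moreover have "a < Tt"
  proof -
   have "a < (K + 1) * (n * R)" unfolding k(3) using k(1) by (intro mult_add_less lt k(2)) simp
   then show ?thesis by (simp only: Tt_def mult.commute)
  qed
  moreover have "a mod R = rp"
  proof -
   have "a = (Suc k * n + u) * R + rp" unfolding k(3) by (simp add: algebra_simps)
   then show ?thesis using mult_add_div_mod(2)[OF assms] by simp
  qed
  ultimately show "a \<in> tok rp" by (simp add: tok_def)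
 next
  fix a assume "a \<in> tok rp"
  then have a: "n * R \<le> a" "a < Tt" "a mod R = rp" by (auto simp: tok_def)
  define k u where "k = a div (n * R)" and "u = a mod (n * R) div R"
  have "1 \<le> k" using div_le_mono[OF a(1), of "n * R"] nR by (simp add: k_def)
  moreover have "k < K + 1" using a(2) div_less_iff[OF nR, of a "K + 1"] by (simp only: k_def Tt_def)
  ultimately obtain k' where k': "k = Suc k'" "k' < K" by (cases k) auto
  have "u < n" unfolding u_def by (rule token_vertex)
  have "a mod (n * R) mod R = rp" using a(3) mod_mod_cancel[OF token_vertex(2), of a] by simp
  then have "a mod (n * R) = u * R + rp" using div_mult_mod_eq[of "a mod (n * R)" R] by (simp add: u_def)
  then have "a = Suc k' * (n * R) + (u * R + rp)"
   using div_mult_mod_eq[of a "n * R"] k' by (simp add: k_def[symmetric])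
  then show "a \<in> ?g ` ({..<K} \<times> {..<n})" using k'(2) \<open>u < n\<close> by (intro image_eqI[of _ _ "(k', u)"]) auto
 qed
 have "(\<Sum>a\<in>tok rp. f (a mod (n * R) div R)) = (\<Sum>ku\<in>{..<K} \<times> {..<n}. f (?g ku mod (n * R) div R))"
  unfolding im[symmetric] by (rule sum.reindex[OF inj, unfolded o_def])
 also have "\<dots> = (\<Sum>ku\<in>{..<K} \<times> {..<n}. f (snd ku))"
 proof (intro sum.cong refl arg_cong[of _ _ f])
  fix ku assume "ku \<in> {..<K} \<times> {..<n}"
  then obtain k u where "ku = (k, u)" "u < n" by auto
  then show "?g ku mod (n * R) div R = snd ku" using md(1)[of u k] ud(1)[of u] by (simp only: prod.case snd_conv)
 qed
 also have "\<dots> = (\<Sum>k<K. \<Sum>u<n. f u)" by (subst sum.cartesian_product) (simp add: case_prod_unfold)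
 finally show ?thesis by simp
qed

lemma finite_tok: "finite (tok rp)" and tok_sub: "tok rp \<subseteq> Xs"
 using token_in by (auto simp: tok_def intro: finite_subset[of _ "{..<Tt}"])

lemma sum_V_le:
 assumes z: "rz < R" "tz < DD" "pz < Tt" and rp: "rp < R"
  and \<kappa>: "green \<theta> DD (own pz) \<le> \<kappa> * real (N (own pz))"
 shows "(\<Sum>a\<in>tok rp. lw.V a (slot rz tz pz)) \<le> 2 * real K * real n * \<kappa> / real l"
proof -
 let ?w = "own pz"
 let ?c = "2 / (real l * real (N ?w))"
 have w: "?w < n" by (rule own_less'[OF z(3)])
 have Nw: "0 < real (N ?w)" using N0[OF w] by simp
 have "(\<Sum>a\<in>tok rp. lw.V a (slot rz tz pz)) \<le> (\<Sum>a\<in>tok rp. ?c * (\<Sum>k<DD. \<theta> ^ k * pw k (a mod (n * R) div R) ?w))"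
  using V_token[OF z] by (intro sum_mono) (auto simp: tok_def)
 also have "\<dots> = real K * (\<Sum>u<n. ?c * (\<Sum>k<DD. \<theta> ^ k * pw k u ?w))" by (rule sum_tok[OF rp])
 also have "(\<Sum>u<n. ?c * (\<Sum>k<DD. \<theta> ^ k * pw k u ?w)) = ?c * (\<Sum>k<DD. \<theta> ^ k * (\<Sum>u<n. pw k u ?w))"
  by (subst sum_distrib_left[symmetric], subst sum.swap) (simp only: sum_distrib_left)
 also have "(\<Sum>k<DD. \<theta> ^ k * (\<Sum>u<n. pw k u ?w)) = real n * green \<theta> DD ?w"
  unfolding green_def occ_def sum_distrib_left[of "real n"] using n0 by (intro sum.cong refl) simp
 also have "real K * (?c * (real n * green \<theta> DD ?w)) \<le> real K * (?c * (real n * (\<kappa> * real (N ?w))))"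
  using \<kappa> by (intro mult_left_mono) auto
 also have "\<dots> = 2 * real K * real n * \<kappa> / real l" using Nw by simp
 finally show ?thesis .
qed

text \<open>One of the two factors \<open>lw.V\<close> is replaced by the load bound of
  \<open>sum_V_le\<close>, which is of order \<open>1 / l\<close>. By \<open>layer_sum\<close> the
  rest contributes at most the expectation on each of the \<open>2 * l\<close> levels, so
  \<open>l\<close> cancels. The summand 1 comes from the tokens themselves.\<close>

lemma variance_bound:
 assumes rp: "rp < R" and v: "v < n" and \<kappa>0: "0 \<le> \<kappa>"
  and \<kappa>: "\<And>w. w < n \<Longrightarrow> green \<theta> DD w \<le> \<kappa> * real (N w)"
 shows "(\<Sum>z\<in>Xs. (\<Sum>a\<in>tok rp. lw.V a z)\<^sup>2 * lw.h v z) \<le> (\<Sum>a\<in>tok rp. lw.h v a) * (1 + 4 * real K * real n * \<kappa>)"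
proof -
 let ?S = "\<lambda>z. \<Sum>a\<in>tok rp. lw.V a z" and ?h = "lw.h v" and ?\<beta> = "2 * real K * real n * \<kappa> / real l"
 have split: "Xs = {..<Tt} \<union> {z\<in>Xs. Tt \<le> z}" using token_in by auto
 have fin: "finite Xs" by (simp add: Xs_def)
 have S0: "0 \<le> ?S z" for z using lw.V_nonneg by (intro sum_nonneg)
 have tokens: "(\<Sum>z<Tt. (?S z)\<^sup>2 * ?h z) = (\<Sum>a\<in>tok rp. ?h a)"
 proof -
  have S: "?S z = of_bool (z \<in> tok rp)" if "z < Tt" for z
  proof -
   have "?S z = (\<Sum>a\<in>tok rp. if z = a then 1 else 0)"
   proof (rule sum.cong[OF refl])
    fix a assume a: "a \<in> tok rp"
    then have "a \<in> Xs" "a < Tt" using tok_sub by (auto simp: tok_def)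
    then show "lw.V a z = (if z = a then 1 else 0)"
     using lw.V_self lw.V_zero[of a z] that by (auto simp: lev_def)
   qed
   then show ?thesis using finite_tok by (simp add: sum.delta)
  qed
  have "(\<Sum>z<Tt. (?S z)\<^sup>2 * ?h z) = (\<Sum>z<Tt. if z \<in> tok rp then ?h z else 0)"
   by (intro sum.cong refl) (simp add: S)
  also have "\<dots> = (\<Sum>z\<in>{..<Tt} \<inter> tok rp. ?h z)" by (simp add: sum.If_cases)
  also have "{..<Tt} \<inter> tok rp = tok rp" by (auto simp: tok_def)
  finally show ?thesis .
 qed
 have slots: "(\<Sum>z\<in>{z\<in>Xs. Tt \<le> z}. (?S z)\<^sup>2 * ?h z) \<le> ?\<beta> * (real DD * (\<Sum>a\<in>tok rp. ?h a))"
 proof -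
  have "(\<Sum>z\<in>{z\<in>Xs. Tt \<le> z}. (?S z)\<^sup>2 * ?h z) \<le> (\<Sum>z\<in>{z\<in>Xs. Tt \<le> z}. ?\<beta> * (?S z * ?h z))"
  proof (rule sum_mono)
   fix z assume "z \<in> {z\<in>Xs. Tt \<le> z}"
   then have zX: "z \<in> Xs" "Tt \<le> z" by auto
   obtain rz tz pz where z: "rz < R" "tz < DD" "pz < Tt" "z = slot rz tz pz" using slot_cases[OF zX] .
   have "?S z \<le> ?\<beta>" unfolding z(4) by (rule sum_V_le[OF z(1-3) rp \<kappa>[OF own_less'[OF z(3)]]])
   then have "?S z * (?S z * ?h z) \<le> ?\<beta> * (?S z * ?h z)"
    using S0 lw.h_nonneg by (intro mult_right_mono mult_nonneg_nonneg)
   then show "(?S z)\<^sup>2 * ?h z \<le> ?\<beta> * (?S z * ?h z)" by (simp only: power2_eq_square mult.assoc)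
  qed
  also have "\<dots> = ?\<beta> * (\<Sum>z\<in>{z\<in>Xs. Tt \<le> z}. ?S z * ?h z)" by (simp only: sum_distrib_left)
  finally have A: "(\<Sum>z\<in>{z\<in>Xs. Tt \<le> z}. (?S z)\<^sup>2 * ?h z) \<le> ?\<beta> * (\<Sum>z\<in>{z\<in>Xs. Tt \<le> z}. ?S z * ?h z)" .
  have "(\<Sum>z\<in>{z\<in>Xs. Tt \<le> z}. ?S z * ?h z) = (\<Sum>a\<in>tok rp. \<Sum>z\<in>{z\<in>Xs. Tt \<le> z}. lw.V a z * ?h z)"
   unfolding sum_distrib_right by (rule sum.swap)
  also have "\<dots> \<le> (\<Sum>a\<in>tok rp. real DD * ?h a)"
  proof (rule sum_mono)
   fix a assume "a \<in> tok rp"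
   then have aX: "a \<in> Xs" using tok_sub by auto
   have "(\<Sum>z\<in>{z\<in>Xs. Tt \<le> z}. lw.V a z * ?h z) =
     (\<Sum>t\<in>{1..DD}. \<Sum>z\<in>{z\<in>{z\<in>Xs. Tt \<le> z}. lev z = t}. lw.V a z * ?h z)"
   proof (rule sum.group[symmetric])
    show "lev ` {z\<in>Xs. Tt \<le> z} \<subseteq> {1..DD}"
    proof
     fix t assume "t \<in> lev ` {z\<in>Xs. Tt \<le> z}"
     then obtain z where zX: "z \<in> Xs" "Tt \<le> z" "t = lev z" by auto
     obtain rz tz pz where "rz < R" "tz < DD" "pz < Tt" "z = slot rz tz pz" using slot_cases[OF zX(1,2)] .
     then show "t \<in> {1..DD}" using slot_arith(7) zX(3) by auto
    qed
   qed (use fin in auto)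
   also have "\<dots> \<le> (\<Sum>t\<in>{1..DD}. ?h a)"
   proof (rule sum_mono)
    fix t
    have "(\<Sum>z\<in>{z\<in>{z\<in>Xs. Tt \<le> z}. lev z = t}. lw.V a z * ?h z) \<le> (\<Sum>z\<in>{z\<in>Xs. lev z = t}. lw.V a z * ?h z)"
     using fin lw.V_nonneg lw.h_nonneg by (intro sum_mono2) (auto intro: mult_nonneg_nonneg)
    also have "\<dots> \<le> ?h a" by (rule lw.layer_sum[OF aX])
    finally show "(\<Sum>z\<in>{z\<in>{z\<in>Xs. Tt \<le> z}. lev z = t}. lw.V a z * ?h z) \<le> ?h a" .
   qed
   finally show "(\<Sum>z\<in>{z\<in>Xs. Tt \<le> z}. lw.V a z * ?h z) \<le> real DD * ?h a" by simp
  qed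
  also have "\<dots> = real DD * (\<Sum>a\<in>tok rp. ?h a)" by (simp only: sum_distrib_left)
  finally have B: "(\<Sum>z\<in>{z\<in>Xs. Tt \<le> z}. ?S z * ?h z) \<le> real DD * (\<Sum>a\<in>tok rp. ?h a)" .
  have "0 \<le> ?\<beta>" using \<kappa>0 by simp
  from mult_left_mono[OF B this] show ?thesis using A by linarith
 qed
 have "(\<Sum>z\<in>Xs. (?S z)\<^sup>2 * ?h z) = (\<Sum>z<Tt. (?S z)\<^sup>2 * ?h z) + (\<Sum>z\<in>{z\<in>Xs. Tt \<le> z}. (?S z)\<^sup>2 * ?h z)"
  by (subst split, subst sum.union_disjoint) (use fin in auto)
 also have "\<dots> \<le> (\<Sum>a\<in>tok rp. ?h a) + ?\<beta> * (real DD * (\<Sum>a\<in>tok rp. ?h a))"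
  using tokens slots by linarith
 also have "\<dots> = (\<Sum>a\<in>tok rp. ?h a) * (1 + 4 * real K * real n * \<kappa>)"
 proof -
  have e: "s + 2 * k * m * x / y * (2 * y * s) = s * (1 + 4 * k * m * x)" if "0 < y" for s k m x y :: real
   using that by (simp add: distrib_left)
  have "real DD = 2 * real l" by (simp add: DD_def)
  then show ?thesis using e[of "real l" "\<Sum>a\<in>tok rp. ?h a" "real K" "real n" \<kappa>] l0 by simp
 qed
 finally show ?thesis .
qed

definition cnt :: "nat \<Rightarrow> nat \<Rightarrow> (nat \<Rightarrow> nat) \<Rightarrow> nat" where
 "cnt rp v F = card {a \<in> tok rp. (F ^^ J) a \<in> Tg v}"

lemma cnt_eq: "real (cnt rp v F) = (\<Sum>a\<in>tok rp. lw.Z v a F)"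
proof -
 have "(\<Sum>a\<in>tok rp. lw.Z v a F) = (\<Sum>a\<in>tok rp. if (F ^^ J) a \<in> Tg v then 1 else 0)"
  by (intro sum.cong refl) (simp add: lw.Z_def)
 also have "\<dots> = (\<Sum>a\<in>{a\<in>tok rp. (F ^^ J) a \<in> Tg v}. 1)"
  by (rule sum.inter_filter[OF finite_tok, symmetric])
 finally show ?thesis by (simp add: cnt_def)
qed

definition bad :: "real \<Rightarrow> (nat \<Rightarrow> real) \<Rightarrow> nat \<Rightarrow> nat \<Rightarrow> (nat \<Rightarrow> nat) \<Rightarrow> bool" where
 "bad \<alpha> \<pi> v rp F \<longleftrightarrow> \<alpha> * (real K * real n * \<pi> v) < \<bar>real (cnt rp v F) - real K * real n * \<pi> v\<bar>"

text \<open>Half of the allowed error \<open>\<alpha>\<close> pays for truncation, as every walk has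
  at least \<open>l\<close> levels left after its start; the other half goes into Chebyshev's
  inequality. There \<open>8 * (1 / Kn + 4 * \<kappa>)\<close> divided by
  \<open>\<alpha>\<^sup>2 * \<pi> v\<close> must be at most 1/16, which is the origin of
  128.\<close>

lemma bad_prob:
 assumes pr: "is_pr \<theta> \<pi>" and rp: "rp < R" and v: "v < n" and \<kappa>0: "0 \<le> \<kappa>" and K: "0 < K"
  and \<kappa>: "\<And>w. w < n \<Longrightarrow> green \<theta> DD w \<le> \<kappa> * real (N w)"
  and \<alpha>: "0 < \<alpha>" "\<alpha> \<le> 1" and tail: "2 * \<theta> ^ l \<le> \<alpha> / 2 * \<pi> v"
  and c3: "128 * (1 / (real K * real n) + 4 * \<kappa>) \<le> \<alpha>\<^sup>2 * \<pi> v"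
 shows "measure_pmf.prob (Pi_pmf Xs 0 Dk) {F. bad \<alpha> \<pi> v rp F} \<le> 1 / 16"
proof -
 define Kn where "Kn = real K * real n"
 have Kn0: "0 < Kn" using K n0 by (simp add: Kn_def)
 define eX where "eX = (\<Sum>a\<in>tok rp. lw.h v a)"
 define \<mu> where "\<mu> = Kn * \<pi> v"
 have \<pi>0: "0 < \<pi> v"
 proof -
  have "0 < (1 - \<theta>) / n" using \<theta>0 n0 by simp
  then show ?thesis using pr_ge[OF pr \<theta>0(1) v] by linarith
 qed
 have \<mu>0: "0 < \<mu>" using Kn0 \<pi>0 by (simp add: \<mu>_def)
 have "eX = real K * (\<Sum>u<n. (\<Sum>i<l. absorb \<theta> (DD - 1 - i) u v) / real l)"
 proof -
  have "eX = (\<Sum>a\<in>tok rp. (\<Sum>i<l. absorb \<theta> (DD - 1 - i) (a mod (n * R) div R) v) / real l)"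
   unfolding eX_def using h_token v by (intro sum.cong refl) (auto simp: tok_def)
  then show ?thesis using sum_tok[OF rp] by simp
 qed
 also have "(\<Sum>u<n. (\<Sum>i<l. absorb \<theta> (DD - 1 - i) u v) / real l) = (\<Sum>i<l. (\<Sum>u<n. absorb \<theta> (DD - 1 - i) u v)) / real l"
  by (subst sum.swap) (simp only: sum_divide_distrib)
 also have "(\<Sum>i<l. (\<Sum>u<n. absorb \<theta> (DD - 1 - i) u v)) = real n * (\<Sum>i<l. iter \<theta> (DD - 1 - i) v)"
  unfolding iter_def sum_distrib_left[of "real n"] using n0 by (intro sum.cong refl) simp
 finally have eX: "eX = Kn * ((\<Sum>i<l. iter \<theta> (DD - 1 - i) v) / real l)" by (simp add: Kn_def)
 have avg: "\<bar>(\<Sum>i<l. iter \<theta> (DD - 1 - i) v) / real l - \<pi> v\<bar> \<le> \<alpha> / 2 * \<pi> v"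
 proof -
  have each: "\<bar>iter \<theta> (DD - 1 - i) v - \<pi> v\<bar> \<le> \<alpha> / 2 * \<pi> v" if "i < l" for i
  proof -
   have "\<bar>iter \<theta> (DD - 1 - i) v - \<pi> v\<bar> \<le> 2 * \<theta> ^ (DD - 1 - i)"
    using iter_close[OF pr \<theta>0(1) _ v] \<theta>0 by simp
   also have "\<theta> ^ (DD - 1 - i) \<le> \<theta> ^ l" using that \<theta>0 by (intro power_decreasing) (auto simp: DD_def)
   finally show ?thesis using tail by simp
  qed
  have "(\<Sum>i<l. iter \<theta> (DD - 1 - i) v) / real l - \<pi> v = (\<Sum>i<l. iter \<theta> (DD - 1 - i) v - \<pi> v) / real l"
   using l0 by (simp add: sum_subtractf diff_divide_distrib)
  then have "\<bar>(\<Sum>i<l. iter \<theta> (DD - 1 - i) v) / real l - \<pi> v\<bar> = \<bar>\<Sum>i<l. iter \<theta> (DD - 1 - i) v - \<pi> v\<bar> / real l" by simp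
  also have "\<dots> \<le> (\<Sum>i<l. \<bar>iter \<theta> (DD - 1 - i) v - \<pi> v\<bar>) / real l" by (intro divide_right_mono sum_abs) simp
  also have "\<dots> \<le> (\<Sum>i<l. \<alpha> / 2 * \<pi> v) / real l" using each by (intro divide_right_mono sum_mono) auto
  also have "\<dots> = \<alpha> / 2 * \<pi> v" using l0 by simp
  finally show ?thesis .
 qed
 have deX: "\<bar>eX - \<mu>\<bar> \<le> \<alpha> / 2 * \<mu>"
 proof -
  have "eX - \<mu> = Kn * ((\<Sum>i<l. iter \<theta> (DD - 1 - i) v) / real l - \<pi> v)" by (simp add: eX \<mu>_def right_diff_distrib)
  then have "\<bar>eX - \<mu>\<bar> = Kn * \<bar>(\<Sum>i<l. iter \<theta> (DD - 1 - i) v) / real l - \<pi> v\<bar>" using Kn0 by (simp add: abs_mult)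
  also have "\<dots> \<le> Kn * (\<alpha> / 2 * \<pi> v)" using avg Kn0 by (intro mult_left_mono) auto
  finally show ?thesis by (simp add: \<mu>_def mult_ac)
 qed
 have "eX \<le> \<mu> + \<alpha> / 2 * \<mu>" using deX by linarith
 also have "\<alpha> / 2 * \<mu> \<le> 1 * \<mu>" using \<alpha> \<mu>0 by (intro mult_right_mono) auto
 finally have eX2: "eX \<le> 2 * \<mu>" by simp
 define t where "t = \<alpha> / 2 * \<mu>"
 have t0: "0 < t" using \<alpha> \<mu>0 by (simp add: t_def)
 have "measure_pmf.prob (Pi_pmf Xs 0 Dk) {F. bad \<alpha> \<pi> v rp F} \<le>
   measure_pmf.prob (Pi_pmf Xs 0 Dk) {F. t \<le> \<bar>(\<Sum>a\<in>tok rp. lw.Z v a F) - (\<Sum>a\<in>tok rp. lw.h v a)\<bar>}"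
 proof (intro measure_pmf.finite_measure_mono subsetI CollectI)
  fix F assume "F \<in> {F. bad \<alpha> \<pi> v rp F}"
  then have "\<alpha> * \<mu> < \<bar>(\<Sum>a\<in>tok rp. lw.Z v a F) - \<mu>\<bar>" by (simp add: bad_def cnt_eq \<mu>_def Kn_def)
  then show "t \<le> \<bar>(\<Sum>a\<in>tok rp. lw.Z v a F) - (\<Sum>a\<in>tok rp. lw.h v a)\<bar>"
   using deX abs_triangle_ineq[of "(\<Sum>a\<in>tok rp. lw.Z v a F) - eX" "eX - \<mu>"]
   unfolding eX_def[symmetric] t_def by simp
 qed simp
 also have "\<dots> \<le> (eX * (1 + 4 * Kn * \<kappa>)) / t\<^sup>2"
  using lw.deviation[OF finite_tok tok_sub t0 variance_bound[OF rp v \<kappa>0 \<kappa>]]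
  by (simp add: lw.P_def eX_def Kn_def mult.assoc)
 also have "\<dots> \<le> (2 * \<mu> * (1 + 4 * Kn * \<kappa>)) / t\<^sup>2"
  using eX2 \<kappa>0 Kn0 by (intro divide_right_mono mult_right_mono) auto
 also have "\<dots> = 8 * (1 / Kn + 4 * \<kappa>) / (\<alpha>\<^sup>2 * \<pi> v)"
 proof -
  have "2 * (x * y) * (1 + 4 * x * k) / (a / 2 * (x * y))\<^sup>2 = 8 * (1 / x + 4 * k) / (a\<^sup>2 * y)"
   if "0 < x" "0 < y" "0 < a" for x y a k :: real
   using that by (simp add: divide_simps power2_eq_square)
  then show ?thesis using Kn0 \<pi>0 \<alpha> by (simp only: t_def \<mu>_def)
 qed
 also have "\<dots> \<le> 1 / 16"
  using c3 \<alpha> \<pi>0 unfolding Kn_def[symmetric] by (simp add: divide_le_eq)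
 finally show ?thesis .
qed

definition repof :: "nat \<Rightarrow> nat" where
 "repof c = (if c < Tt then c mod R else (c div Tt - 1) div DD)"

lemma repof_slot:
 assumes "rp < R" "t < DD" "p < Tt" shows "repof (slot rp t p) = rp"
proof -
 have "\<not> slot rp t p < Tt" using slot_arith(2)[OF assms] by simp
 then show ?thesis unfolding repof_def using slot_arith(6)[OF assms] by (simp only: if_False)
qed

lemma repof_less: "c \<in> Xs \<Longrightarrow> repof c < R"
proof -
 assume c: "c \<in> Xs"
 show ?thesis
 proof (cases "c < Tt")
  case False
  then have "Tt \<le> c" by simp
  obtain rp t p where "rp < R" "t < DD" "p < Tt" "c = slot rp t p" using slot_cases[OF c \<open>Tt \<le> c\<close>] .
  then show ?thesis using repof_slot by simp
 qed (use R0 in \<open>simp add: repof_def\<close>)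
qed

lemma repof_Dk:
 assumes c: "c \<in> Xs" and w: "w \<in> set_pmf (Dk c)"
 shows "repof w = repof c"
proof -
 obtain st i r where d: "(st, i, r) \<in> set_pmf (draw c)" "w = nx c (st, i, r)"
  using w by (auto simp: Dk_def)
 note b = set_draw[OF c d(1)]
 consider "c < n * R" | "n * R \<le> c" "c < Tt" | "Tt \<le> c" by linarith
 then show ?thesis
 proof cases
  case 1
  then show ?thesis using d(2) by (simp add: nx_def)
 next
  case 2
  have "i < l" using b(1) 2 by (simp add: bd_def)
  then have "i < DD" by (rule lD)
  have "repof w = c mod R" unfolding d(2) nx_token[OF 2]
   by (rule repof_slot[OF mod_less_divisor[OF R0] \<open>i < DD\<close> slot_pos(1)[OF token_vertex(1)]])
  then show ?thesis using 2(2) by (simp only: repof_def if_True)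
 next
  case 3
  obtain rp t p where s: "rp < R" "t < DD" "p < Tt" "c = slot rp t p" using slot_cases[OF c 3] .
  show ?thesis
  proof (cases "st \<or> t = DD - 1")
   case True
   then show ?thesis using d(2) nx_slot[OF s(1-3)] s(4) by simp
  next
   case False
   have "i < dg (own p)" using b(1) 3 slot_arith[OF s(1-3)] s(4) by (simp add: bd_def)
   then have w': "eh (eo (own p) + i) < n" using eh own_less'[OF s(3)] by blast
   have "Suc t < DD" using False s(2) by auto
   then have "repof (slot rp (Suc t) (off (eh (eo (own p) + i)) + r mod N (eh (eo (own p) + i)))) = rp"
    by (rule repof_slot[OF s(1) _ slot_pos(1)[OF w']])
   then show ?thesis using repof_slot[OF s(1-3)] False unfolding d(2) s(4) nx_slot[OF s(1-3)] by simp
  qed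
 qed
qed

text \<open>The repetitions share the pool layout but not the cells: a walk never leaves the cells
  of its repetition, as \<open>repof\<close> is invariant under the pointers. The bad events are
  therefore functions of disjoint blocks of draws and hence independent.\<close>

lemma majority_good:
 assumes R: "even R" and p: "\<And>rp. rp < R \<Longrightarrow> measure_pmf.prob (Pi_pmf Xs 0 Dk) {F. bad \<alpha> \<pi> v rp F} \<le> 1 / 16"
 shows "measure_pmf.prob (Pi_pmf Xs 0 Dk) {F. R \<le> 2 * card {rp. rp < R \<and> bad \<alpha> \<pi> v rp F}} \<le> (1 / 2) ^ R"
proof -
 let ?P = "Pi_pmf Xs 0 Dk" and ?B = "\<lambda>i. {c\<in>Xs. repof c = i}"
 define q where "q i = map_pmf (bad \<alpha> \<pi> v i) (Pi_pmf (?B i) 0 Dk)" for i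
 have fin: "finite Xs" by (simp add: Xs_def)
 have U: "(\<Union>i\<in>{..<R}. ?B i) = Xs" using repof_less by auto
 have "Pi_pmf {..<R} False q = map_pmf (\<lambda>y i. if i \<in> {..<R}
   then bad \<alpha> \<pi> v i (\<lambda>c. if c \<in> ?B i then y c else 0) else False) (Pi_pmf (\<Union>i\<in>{..<R}. ?B i) 0 Dk)"
  unfolding q_def using fin by (intro Pi_pmf_blocks) auto
 then have blocks: "Pi_pmf {..<R} False q = map_pmf (\<lambda>y i. if i \<in> {..<R}
   then bad \<alpha> \<pi> v i (\<lambda>c. if c \<in> ?B i then y c else 0) else False) ?P"
  by (simp only: U)
 have res: "bad \<alpha> \<pi> v i (\<lambda>c. if c \<in> ?B i then F c else 0) = bad \<alpha> \<pi> v i F" if F: "F \<in> set_pmf ?P" for i F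
 proof -
  let ?F' = "\<lambda>c. if c \<in> ?B i then F c else 0"
  have orb: "(F ^^ k) a \<in> ?B i \<and> (?F' ^^ k) a = (F ^^ k) a" if a: "a \<in> tok i" for a k
  proof (induction k)
   case 0
   have "a < Tt" "a mod R = i" "a \<in> Xs" using a tok_sub by (auto simp: tok_def)
   then show ?case by (simp add: repof_def)
  next
   case (Suc k)
   let ?y = "(F ^^ k) a"
   have y: "?y \<in> Xs" "repof ?y = i" using Suc by auto
   have "F ?y \<in> set_pmf (Dk ?y)" using F y(1) fin by (auto simp: set_Pi_pmf PiE_dflt_def)
   then have "F ?y \<in> Xs" "repof (F ?y) = i" using lw.setD[OF y(1)] repof_Dk[OF y(1)] y(2) by auto
   then show ?case using Suc y by simp
  qed
  have "{a \<in> tok i. (?F' ^^ J) a \<in> Tg v} = {a \<in> tok i. (F ^^ J) a \<in> Tg v}"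
   using orb by (intro Collect_cong conj_cong refl) simp
  then have "cnt i v ?F' = cnt i v F" by (simp only: cnt_def)
  then show ?thesis by (simp only: bad_def)
 qed
 have blocks': "Pi_pmf {..<R} False q = map_pmf (\<lambda>F i. i < R \<and> bad \<alpha> \<pi> v i F) ?P"
  unfolding blocks by (intro map_pmf_cong refl ext) (simp add: res del: mem_Collect_eq)
 have qb: "measure_pmf.prob (q i) {True} \<le> 1 / 16" if "i < R" for i
 proof -
  have "q i = map_pmf (\<lambda>f. f i) (Pi_pmf {..<R} False q)"
   using that by (subst Pi_pmf_component) auto
  also have "\<dots> = map_pmf (bad \<alpha> \<pi> v i) ?P" unfolding blocks' using that by (simp add: pmf.map_comp o_def)
  finally have "measure_pmf.prob (q i) {True} = measure_pmf.prob ?P (bad \<alpha> \<pi> v i -` {True})" by simp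
  also have "bad \<alpha> \<pi> v i -` {True} = {F. bad \<alpha> \<pi> v i F}" by auto
  finally show ?thesis using p[OF that] by simp
 qed
 from majority_bound[where p = q, OF R qb]
 have "measure_pmf.prob (map_pmf (\<lambda>F i. i < R \<and> bad \<alpha> \<pi> v i F) ?P) {f. R \<le> 2 * card {i. i < R \<and> f i}} \<le> (1 / 2) ^ R"
  unfolding blocks' by blast
 then show ?thesis by (simp add: vimage_def)
qed

end

section \<open>Programs on records\<close>

fun digits_code :: "nat \<Rightarrow> nat list \<Rightarrow> nat" where
 "digits_code Z [] = 0"
| "digits_code Z (x # xs) = digits_code Z xs * Z + x"

lemma digits_code_less: "\<forall>x\<in>set xs. x < Z \<Longrightarrow> digits_code Z xs < Z ^ length xs"
proof (induction xs)
 case (Cons x xs)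
 then have "digits_code Z xs < Z ^ length xs" "x < Z" by auto
 from mult_add_less[OF this] show ?case by (simp add: mult.commute)
qed simp

lemma digits_code_inj:
 "length xs = length ys \<Longrightarrow> \<forall>x\<in>set xs. x < Z \<Longrightarrow> \<forall>y\<in>set ys. y < Z \<Longrightarrow>
  digits_code Z xs = digits_code Z ys \<Longrightarrow> xs = ys"
proof (induction xs ys rule: list_induct2)
 case (Cons x xs y ys)
 have lt: "x < Z" "y < Z" using Cons.prems by auto
 have e: "digits_code Z xs * Z + x = digits_code Z ys * Z + y" using Cons.prems by simp
 have "x = y" using mult_add_div_mod(2)[OF lt(1), of "digits_code Z xs"] mult_add_div_mod(2)[OF lt(2), of "digits_code Z ys"]
  unfolding e by simp
 moreover have "digits_code Z xs = digits_code Z ys"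
  using mult_add_div_mod(1)[OF lt(1), of "digits_code Z xs"] mult_add_div_mod(1)[OF lt(2), of "digits_code Z ys"]
  unfolding e by simp
 ultimately show ?case using Cons by simp
qed simp

text \<open>A cell plays several roles at once. As an edge it stores its head \<open>c_eh\<close>;
  as a vertex its edge interval \<open>c_eo\<close>, \<open>c_dg\<close> and its pool
  \<open>c_of\<close>, \<open>c_nn\<close>; as a token its label \<open>c_cl\<close>; as a point of
  the walk its owner \<open>c_ow\<close> with the edge interval \<open>c_oe\<close>,
  \<open>c_od\<close> of the owner, the draws \<open>c_st\<close>, \<open>c_ii\<close>,
  \<open>c_rr\<close> and the pointer \<open>c_pt\<close>.\<close>

record cell =
 c_eh :: nat  c_eo :: nat  c_dg :: nat  c_cl :: nat  c_rk :: nat  c_of :: nat  c_nn :: nat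
 c_ow :: nat  c_oe :: nat  c_od :: nat  c_st :: nat  c_ii :: nat  c_rr :: nat  c_pt :: nat

definition fields :: "cell \<Rightarrow> nat list" where
 "fields r = [c_eh r, c_eo r, c_dg r, c_cl r, c_rk r, c_of r, c_nn r, c_ow r, c_oe r, c_od r,
   c_st r, c_ii r, c_rr r, c_pt r]"

definition cells :: "nat \<Rightarrow> cell set" where "cells Z = {r. \<forall>x\<in>set (fields r). x < Z}"

definition enc :: "nat \<Rightarrow> cell \<Rightarrow> nat" where "enc Z r = digits_code Z (fields r)"

definition dec :: "nat \<Rightarrow> nat \<Rightarrow> cell" where "dec Z w = inv_into (cells Z) (enc Z) w"

lemma in_cells: "r \<in> cells Z \<longleftrightarrow> c_eh r < Z \<and> c_eo r < Z \<and> c_dg r < Z \<and> c_cl r < Z \<and> c_rk r < Z \<and>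
  c_of r < Z \<and> c_nn r < Z \<and> c_ow r < Z \<and> c_oe r < Z \<and> c_od r < Z \<and> c_st r < Z \<and> c_ii r < Z \<and>
  c_rr r < Z \<and> c_pt r < Z"
 by (simp add: cells_def fields_def)

lemma enc_less: "r \<in> cells Z \<Longrightarrow> enc Z r < Z ^ 14"
proof -
 assume "r \<in> cells Z"
 then have "digits_code Z (fields r) < Z ^ length (fields r)" by (intro digits_code_less) (simp add: cells_def)
 moreover have "length (fields r) = 14" by (simp add: fields_def)
 ultimately show ?thesis by (simp only: enc_def)
qed

lemma dec_enc: "r \<in> cells Z \<Longrightarrow> dec Z (enc Z r) = r"
proof -
 have "inj_on (enc Z) (cells Z)"
 proof (rule inj_onI)
  fix r s assume rs: "r \<in> cells Z" "s \<in> cells Z" "enc Z r = enc Z s"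
  have "fields r = fields s"
   by (rule digits_code_inj[of _ _ Z]) (use rs in \<open>auto simp: cells_def enc_def fields_def\<close>)
  then show "r = s" by (simp add: fields_def)
 qed
 then show "r \<in> cells Z \<Longrightarrow> dec Z (enc Z r) = r" unfolding dec_def by (rule inv_into_f_f)
qed

text \<open>The word bound is that of \<open>prog_sem_sort_scan\<close> for packed records, which
  lie below \<open>Z ^ 14\<close>, and for keys below \<open>Z * Z + 1\<close>.\<close>

locale machine =
 fixes a b d f Z W :: nat
 assumes a1: "1 \<le> a" and b4: "4 \<le> b" and depth: "shrink d a \<le> b" "a \<le> f * b"
  and Z2: "2 \<le> Z" and WZ: "2 ^ a * 2 ^ a * (Z * Z + 1) * (Z * Z + 1) * (Z * Z + 1) * Z ^ 14 < W"
begin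

definition "half = (2::nat) ^ (a - 1)"
definition "L = (2::nat) ^ a"

lemma L2: "L = 2 * half" unfolding L_def half_def using a1 by (cases a) auto
lemma W_pos: "0 < W" using WZ by simp

lemma ZW: "Z ^ 14 \<le> W" "(Z * Z + 1) * (Z * Z + 1) \<le> W"
proof -
 let ?A = "(2::nat) ^ a" and ?X = "Z * Z + 1" and ?Y = "Z ^ 14"
 have Y0: "0 < ?Y" using Z2 by simp
 have "0 < ?A * ?A * ?X * ?X * ?X" by (intro mult_pos_pos) simp_all
 then have "1 \<le> ?A * ?A * ?X * ?X * ?X" by (simp only: less_eq_Suc_le One_nat_def)
 then have "1 * ?Y \<le> ?A * ?A * ?X * ?X * ?X * ?Y" by (rule mult_le_mono1)
 then show "?Y \<le> W" using WZ by linarith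
 have "0 < ?A * ?A * ?X" by (intro mult_pos_pos) simp_all
 then have one: "1 \<le> ?A * ?A * ?X" "1 \<le> ?Y" using Y0 by (simp_all only: less_eq_Suc_le One_nat_def)
 have "1 * (?X * ?X) * 1 \<le> (?A * ?A * ?X) * (?X * ?X) * ?Y" by (rule mult_le_mono[OF mult_le_mono[OF one(1) le_refl] one(2)])
 also have "\<dots> = ?A * ?A * ?X * ?X * ?X * ?Y" by (simp only: mult.assoc)
 finally show "?X * ?X \<le> W" using WZ by linarith
qed

definition arr :: "(nat \<Rightarrow> cell) \<Rightarrow> array" where "arr s = crop half (\<lambda>c. enc Z (s c))"

definition wfs :: "(nat \<Rightarrow> cell) \<Rightarrow> bool" where "wfs s \<longleftrightarrow> (\<forall>c<half. s c \<in> cells Z)"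

lemma wf_arr: "wfs s \<Longrightarrow> wf_array L W (arr s)"
 unfolding wf_array_def
proof (intro conjI allI impI)
 fix c assume s: "wfs s"
 show "arr s c < W" using enc_less[of "s c" Z] ZW(1) W_pos s by (auto simp: arr_def crop_def wfs_def intro: less_le_trans)
qed (simp add: arr_def crop_def L2)

text \<open>Records are ordered by key and then by value, and absent ones come first. A query for
  \<open>q\<close> has the key \<open>Suc q * Z\<close>, which lies above exactly the records with
  key at most \<open>q\<close>, so the prefix maximum returns the value stored under the largest
  such key.\<close>

definition recw :: "(nat \<times> nat) option \<Rightarrow> nat" where
 "recw x = (case x of None \<Rightarrow> 0 | Some (k, v) \<Rightarrow> Suc (k * Z + v))"

definition sread :: "(nat \<Rightarrow> cell \<Rightarrow> (nat \<times> nat) option) \<Rightarrow> (nat \<Rightarrow> cell \<Rightarrow> nat) \<Rightarrow>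
  (nat \<Rightarrow> cell \<Rightarrow> nat \<Rightarrow> nat \<Rightarrow> cell) \<Rightarrow> array_step list" where
 "sread recs qry upd = sort_scan_prog W a b d f (Z * Z + 1) (Z ^ 14)
   (\<lambda>c w. recw (recs c (dec Z w))) (\<lambda>c w. Suc (qry c (dec Z w)) * Z)
   (\<lambda>c w p ps. enc Z (upd c (dec Z w) ((p - 1) mod Z) ps))"

definition answer :: "(nat \<Rightarrow> cell \<Rightarrow> (nat \<times> nat) option) \<Rightarrow> (nat \<Rightarrow> cell) \<Rightarrow> nat \<Rightarrow> nat" where
 "answer recs s q = (smax {e. e < half \<and> recw (recs e (s e)) \<le> Suc q * Z} (\<lambda>e. recw (recs e (s e))) - 1) mod Z"

definition rank_of :: "(nat \<Rightarrow> cell \<Rightarrow> nat) \<Rightarrow> (nat \<Rightarrow> cell) \<Rightarrow> nat \<Rightarrow> nat" where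
 "rank_of qry s c = card {e. e < half \<and> (qry e (s e) < qry c (s c) \<or> qry e (s e) = qry c (s c) \<and> e < c)}"

lemma length_sread: "length (sread recs qry upd) \<le> 4 * 6 ^ d + 2 * f + 5"
 unfolding sread_def by (rule length_sort_scan_prog)

lemma valid_sread: "\<forall>st\<in>set (sread recs qry upd). valid_step L (2 ^ b) W st"
 unfolding sread_def
 by (rule valid_sort_scan_prog) (use a1 b4 depth W_pos ZW in \<open>auto simp: L_def\<close>)

lemma prog_sem_sread:
 assumes s: "wfs s" and recs: "\<And>c k v. c < half \<Longrightarrow> recs c (s c) = Some (k, v) \<Longrightarrow> k < Z \<and> v < Z"
  and qry: "\<And>c. c < half \<Longrightarrow> qry c (s c) < Z"
  and s': "\<And>c. c < half \<Longrightarrow> s' c = upd c (s c) (answer recs s (qry c (s c)))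
   (card {e. e < half \<and> recw (recs e (s e)) \<le> Suc (qry c (s c)) * Z} + rank_of qry s c)"
  and wf': "wfs s'"
 shows "prog_sem L (sread recs qry upd) (arr s) = return_pmf (arr s')"
proof -
 let ?x = "arr s" and ?X = "Z * Z + 1"
 let ?rk = "\<lambda>c w. recw (recs c (dec Z w))" and ?qk = "\<lambda>c w. Suc (qry c (dec Z w)) * Z"
 have xd: "dec Z (?x c) = s c" if "c < half" for c
  using that s dec_enc by (simp add: arr_def crop_def wfs_def)
 have xY: "?x c < Z ^ 14" if "c < half" for c
  using that s enc_less by (simp add: arr_def crop_def wfs_def)
 have rkX: "?rk c (?x c) < ?X" if c: "c < half" for c
 proof (cases "recs c (s c)")
  case (Some kv)
  obtain k v where kv: "kv = (k, v)" by (cases kv)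
  have "k < Z" "v < Z" using recs[OF c] Some kv by auto
  from mult_add_less[OF this] show ?thesis using Some kv by (simp add: xd[OF c] recw_def)
 qed (simp add: xd[OF c] recw_def)
 have qkX: "?qk c (?x c) < ?X" if c: "c < half" for c
 proof -
  have "Suc (qry c (s c)) * Z \<le> Z * Z" using qry[OF c] by (intro mult_le_mono1) simp
  then show ?thesis by (simp add: xd[OF c])
 qed
 have Z0: "0 < Z" using Z2 by simp
 have main: "prog_sem (2 ^ a) (sort_scan_prog W a b d f ?X (Z ^ 14) ?rk ?qk
    (\<lambda>c w p ps. enc Z (upd c (dec Z w) ((p - 1) mod Z) ps))) ?x = return_pmf (crop (2 ^ (a - 1)) (\<lambda>c.
   enc Z (upd c (dec Z (?x c)) ((smax {e. e < 2 ^ (a - 1) \<and> ?rk e (?x e) \<le> ?qk c (?x c)} (\<lambda>e. ?rk e (?x e)) - 1) mod Z)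
    (card {e. e < 2 ^ (a - 1) \<and> ?rk e (?x e) \<le> ?qk c (?x c)} +
    card {e. e < 2 ^ (a - 1) \<and> (?qk e (?x e) < ?qk c (?x c) \<or> ?qk e (?x e) = ?qk c (?x c) \<and> e < c)})) mod W))"
 proof (rule prog_sem_sort_scan[OF a1 b4 depth])
  show "2 ^ a * 2 ^ a * ?X * ?X * ?X * Z ^ 14 < W" by (rule WZ)
  show "wf_array (2 ^ a) W ?x" using wf_arr[OF s] by (simp add: L_def)
 qed (use xY rkX qkX in \<open>auto simp: half_def\<close>)
 have cell: "enc Z (upd c (dec Z (?x c)) ((smax {e. e < half \<and> ?rk e (?x e) \<le> ?qk c (?x c)} (\<lambda>e. ?rk e (?x e)) - 1) mod Z)
    (card {e. e < half \<and> ?rk e (?x e) \<le> ?qk c (?x c)} +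
    card {e. e < half \<and> (?qk e (?x e) < ?qk c (?x c) \<or> ?qk e (?x e) = ?qk c (?x c) \<and> e < c)})) mod W = enc Z (s' c)"
  if c: "c < half" for c
 proof -
  have A: "{e. e < half \<and> ?rk e (?x e) \<le> ?qk c (?x c)} = {e. e < half \<and> recw (recs e (s e)) \<le> Suc (qry c (s c)) * Z}"
   using xd c by (intro Collect_cong conj_cong refl) simp
  have B: "{e. e < half \<and> (?qk e (?x e) < ?qk c (?x c) \<or> ?qk e (?x e) = ?qk c (?x c) \<and> e < c)} =
   {e. e < half \<and> (qry e (s e) < qry c (s c) \<or> qry e (s e) = qry c (s c) \<and> e < c)}"
   using xd c Z0 by (intro Collect_cong conj_cong refl) (simp del: mult_Suc)
  have C: "smax {e. e < half \<and> recw (recs e (s e)) \<le> Suc (qry c (s c)) * Z} (\<lambda>e. ?rk e (?x e)) =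
   smax {e. e < half \<and> recw (recs e (s e)) \<le> Suc (qry c (s c)) * Z} (\<lambda>e. recw (recs e (s e)))"
   by (rule smax_cong[OF refl]) (use xd in auto)
  have "enc Z (s' c) < W" using wf' c enc_less[of "s' c" Z] ZW(1) by (auto simp: wfs_def)
  then have "enc Z (s' c) mod W = enc Z (s' c)" by (rule mod_less)
  then show ?thesis unfolding A B unfolding C unfolding xd[OF c] s'[OF c] answer_def rank_of_def .
 qed
 have "prog_sem L (sread recs qry upd) (arr s) = return_pmf (crop half (\<lambda>c.
   enc Z (upd c (dec Z (?x c)) ((smax {e. e < half \<and> ?rk e (?x e) \<le> ?qk c (?x c)} (\<lambda>e. ?rk e (?x e)) - 1) mod Z)
    (card {e. e < half \<and> ?rk e (?x e) \<le> ?qk c (?x c)} +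
    card {e. e < half \<and> (?qk e (?x e) < ?qk c (?x c) \<or> ?qk e (?x e) = ?qk c (?x c) \<and> e < c)})) mod W))"
  using main unfolding L_def half_def sread_def .
 also have "\<dots> = return_pmf (arr s')"
  unfolding arr_def[of s'] unfolding crop_def
  by (rule arg_cong[of _ _ return_pmf], rule ext, rule if_cong[OF refl _ refl], rule cell)
 finally show ?thesis .
qed

lemma answer_eq:
 assumes e: "e < half" "recs e (s e) = Some (k, v)" "k \<le> q" and v: "v < Z"
  and vZ: "\<And>e k v. e < half \<Longrightarrow> recs e (s e) = Some (k, v) \<Longrightarrow> v < Z"
  and best: "\<And>e' k' v'. e' < half \<Longrightarrow> recs e' (s e') = Some (k', v') \<Longrightarrow> k' \<le> q \<Longrightarrow> k' < k \<or> k' = k \<and> v' \<le> v"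
 shows "answer recs s q = v"
proof -
 let ?A = "{e. e < half \<and> recw (recs e (s e)) \<le> Suc q * Z}"
 have le: "Suc (k' * Z + v') \<le> Suc q * Z \<longleftrightarrow> k' \<le> q" if "v' < Z" for k' v'
 proof
  assume "Suc (k' * Z + v') \<le> Suc q * Z"
  then have "k' * Z < Suc q * Z" by linarith
  then show "k' \<le> q" by (simp only: mult_less_cancel2) simp
 next
  assume "k' \<le> q"
  then have "k' * Z \<le> q * Z" by (rule mult_le_mono1)
  then have "Suc (k' * Z + v') \<le> Z + q * Z" using that by linarith
  then show "Suc (k' * Z + v') \<le> Suc q * Z" by (simp only: mult_Suc)
 qed
 have "smax ?A (\<lambda>e. recw (recs e (s e))) = Suc (k * Z + v)"
  unfolding smax_def
 proof (rule Max_eqI)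
  fix y assume "y \<in> insert 0 ((\<lambda>e. recw (recs e (s e))) ` ?A)"
  then show "y \<le> Suc (k * Z + v)"
  proof
   assume "y \<in> (\<lambda>e. recw (recs e (s e))) ` ?A"
   then obtain e' where e': "e' < half" "recw (recs e' (s e')) \<le> Suc q * Z" "y = recw (recs e' (s e'))" by auto
   show ?thesis
   proof (cases "recs e' (s e')")
    case None
    then show ?thesis using e'(3) by (simp add: recw_def)
   next
    case (Some kv)
    obtain k' v' where kv: "recs e' (s e') = Some (k', v')" using Some by (cases kv) auto
    have v': "v' < Z" by (rule vZ[OF e'(1) kv])
    have y: "y = Suc (k' * Z + v')" using e'(3) kv by (simp add: recw_def)
    have "k' \<le> q" using e'(2) le[OF v'] kv by (simp add: recw_def)
    from best[OF e'(1) kv this] show ?thesis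
    proof
     assume "k' < k"
     then have "Suc k' * Z \<le> k * Z" by (intro mult_le_mono1) simp
     then show ?thesis using y v' by simp
    next
     assume "k' = k \<and> v' \<le> v"
     then show ?thesis using y by simp
    qed
   qed
  qed simp
 next
  have "e \<in> ?A" using e le[OF v] by (simp add: recw_def)
  moreover have "recw (recs e (s e)) = Suc (k * Z + v)" using e by (simp add: recw_def)
  ultimately show "Suc (k * Z + v) \<in> insert 0 ((\<lambda>e. recw (recs e (s e))) ` ?A)"
   by (intro insertI2 image_eqI[of _ _ e]) simp_all
 qed simp
 then show ?thesis unfolding answer_def using mult_add_div_mod(2)[OF v] by simp
qed

lemma answer_lookup:
 assumes "m \<le> half" "\<And>c r. recs c r = (if c < m then Some (c, g r) else None)" "q < m" "\<And>e. e < m \<Longrightarrow> g (s e) < Z"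
 shows "answer recs s q = g (s q)"
 by (rule answer_eq[where e = q and k = q]) (use assms in \<open>auto split: if_splits\<close>)

definition rstep :: "nat \<Rightarrow> (nat \<Rightarrow> cell \<Rightarrow> 'r pmf) \<Rightarrow> (cell \<Rightarrow> 'r \<Rightarrow> cell) \<Rightarrow> array_step" where
 "rstep m p upd = (\<lambda>x c. if c < m then map_pmf (\<lambda>r. enc Z (upd (dec Z (x c)) r) mod W) (p c (dec Z (x c)))
   else return_pmf (x c), id)"

lemma valid_rstep: "valid_step L (2 ^ b) W (rstep m p upd)"
proof -
 have "fst (rstep m p upd) x c = fst (rstep m p upd) y c" if "x c = y c" for x y c
  using that by (simp add: rstep_def)
 then have "block_local (2 ^ b) (fst (rstep m p upd))" unfolding block_local_def by blast
 then show ?thesis unfolding valid_step_def using W_pos by (auto simp: rstep_def)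
qed

lemma prog_sem_rstep:
 assumes s: "wfs s" and m: "m \<le> half"
  and u: "\<And>c r. c < m \<Longrightarrow> r \<in> set_pmf (p c (s c)) \<Longrightarrow> upd (s c) r \<in> cells Z"
 shows "prog_sem L [rstep m p upd] (arr s) =
  map_pmf (\<lambda>g. arr (\<lambda>c. if c < m then upd (s c) (g c) else s c)) (Pi_pmf {..<m} d0 (\<lambda>c. p c (s c)))"
proof -
 let ?x = "arr s"
 have xd: "dec Z (?x c) = s c" if "c < half" for c
  using that s dec_enc by (simp add: arr_def crop_def wfs_def)
 define p' where "p' c = (if c < m then p c (s c) else return_pmf d0)" for c
 define h where "h c r = (if c < m then enc Z (upd (s c) r) mod W else ?x c)" for c r
 have mL: "m \<le> L" using m L2 by simp
 have set: "{c \<in> {..<L}. c < m} = {..<m}" using mL by auto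
 have "Pi_pmf {..<L} 0 (fst (rstep m p upd) ?x) = Pi_pmf {..<L} 0 (\<lambda>c. bind_pmf (p' c) (\<lambda>r. return_pmf (h c r)))"
 proof (rule Pi_pmf_cong[OF refl refl])
  fix c
  show "fst (rstep m p upd) ?x c = bind_pmf (p' c) (\<lambda>r. return_pmf (h c r))"
  proof (cases "c < m")
   case True
   then have "dec Z (?x c) = s c" using xd m by simp
   then show ?thesis using True by (simp add: rstep_def p'_def h_def map_pmf_def)
  qed (simp add: rstep_def p'_def h_def bind_return_pmf)
 qed
 also have "\<dots> = bind_pmf (Pi_pmf {..<L} d0 p') (\<lambda>g. Pi_pmf {..<L} 0 (\<lambda>c. return_pmf (h c (g c))))"
  by (rule Pi_pmf_bind) simp
 also have "Pi_pmf {..<L} d0 p' = Pi_pmf {..<m} d0 (\<lambda>c. p c (s c))"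
  unfolding p'_def using Pi_pmf_if_set[of "{..<L}" d0 "\<lambda>c. c < m" "\<lambda>c. p c (s c)"] set by simp
 also have "bind_pmf (Pi_pmf {..<m} d0 (\<lambda>c. p c (s c))) (\<lambda>g. Pi_pmf {..<L} 0 (\<lambda>c. return_pmf (h c (g c)))) =
   map_pmf (\<lambda>g c. if c < L then h c (g c) else 0) (Pi_pmf {..<m} d0 (\<lambda>c. p c (s c)))"
  by (simp add: map_pmf_def)
 finally have P: "Pi_pmf {..<L} 0 (fst (rstep m p upd) ?x) =
   map_pmf (\<lambda>g c. if c < L then h c (g c) else 0) (Pi_pmf {..<m} d0 (\<lambda>c. p c (s c)))" .
 have "prog_sem L [rstep m p upd] ?x = map_pmf (\<lambda>g c. if c < L then h c (g c) else 0) (Pi_pmf {..<m} d0 (\<lambda>c. p c (s c)))"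
  unfolding prog_sem_single step_sem_def P pmf.map_comp by (simp add: o_def rstep_def cong: if_cong)
 also have "\<dots> = map_pmf (\<lambda>g. arr (\<lambda>c. if c < m then upd (s c) (g c) else s c)) (Pi_pmf {..<m} d0 (\<lambda>c. p c (s c)))"
 proof (intro map_pmf_cong refl ext)
  fix g c assume g: "g \<in> set_pmf (Pi_pmf {..<m} d0 (\<lambda>c. p c (s c)))"
  show "(if c < L then h c (g c) else 0) = arr (\<lambda>c. if c < m then upd (s c) (g c) else s c) c"
  proof (cases "c < m")
   case True
   then have "g c \<in> set_pmf (p c (s c))" using g by (auto simp: set_Pi_pmf PiE_dflt_def)
   then have "enc Z (upd (s c) (g c)) < W" using enc_less[OF u[OF True]] ZW(1) by (meson less_le_trans)
   then show ?thesis using True m mL by (simp add: h_def arr_def crop_def)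
  next
   case False
   then show ?thesis using L2 by (simp add: h_def arr_def crop_def)
  qed
 qed
 finally show ?thesis .
qed

end

section \<open>Lookups and counts as programs\<close>

context machine
begin

definition run :: "array_step list \<Rightarrow> (nat \<Rightarrow> cell) \<Rightarrow> (nat \<Rightarrow> cell) \<Rightarrow> bool" where
 "run p s s' \<longleftrightarrow> prog_sem L p (arr s) = return_pmf (arr s') \<and> wfs s'"

lemma run_append: "run p s s' \<Longrightarrow> run q s' s'' \<Longrightarrow> run (p @ q) s s''"
 by (simp add: run_def prog_sem_append bind_return_pmf)

definition rd :: "nat \<Rightarrow> (cell \<Rightarrow> nat) \<Rightarrow> (nat \<Rightarrow> cell \<Rightarrow> nat) \<Rightarrow> (nat \<Rightarrow> cell \<Rightarrow> nat \<Rightarrow> cell) \<Rightarrow> array_step list" where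
 "rd m g q upd = sread (\<lambda>c r. if c < m then Some (c, g r) else None) (\<lambda>c r. if q c r < m then q c r else 0)
   (\<lambda>c r p ps. upd c r p)"

lemma run_rd:
 assumes s: "wfs s" and m: "0 < m" "m \<le> half" "half < Z" and g: "\<And>r. r \<in> cells Z \<Longrightarrow> g r < Z"
  and u: "\<And>c r p. r \<in> cells Z \<Longrightarrow> p < Z \<Longrightarrow> upd c r p \<in> cells Z"
  and s': "s' = (\<lambda>c. upd c (s c) (g (s (if q c (s c) < m then q c (s c) else 0))))"
 shows "run (rd m g q upd) s s'"
proof -
 have gs: "g (s e) < Z" if "e < m" for e using g s that m by (simp add: wfs_def)
 have wf: "wfs s'" unfolding wfs_def s' using u s gs m by (simp add: wfs_def)
 have "prog_sem L (rd m g q upd) (arr s) = return_pmf (arr s')"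
  unfolding rd_def
 proof (rule prog_sem_sread[OF s _ _ _ wf])
  fix c
  let ?recs = "\<lambda>c r. if c < m then Some (c, g r) else None"
  show "s' c = upd c (s c) (answer ?recs s (if q c (s c) < m then q c (s c) else 0))" if "c < half"
   unfolding s' by (subst answer_lookup[where g = g and m = m]) (use m gs in auto)
 qed (use m gs in \<open>auto split: if_splits\<close>)
 then show ?thesis using wf by (simp add: run_def)
qed

text \<open>Every cell \<open>c\<close> queries its own index. From its position in the sorted order
  the \<open>c\<close> earlier queries are subtracted, and the \<open>half - m\<close> cells that
  offer no record, since these are coded by 0 and precede every query.\<close>

definition count :: "nat \<Rightarrow> (cell \<Rightarrow> nat) \<Rightarrow> (nat \<Rightarrow> cell \<Rightarrow> nat \<Rightarrow> cell) \<Rightarrow> array_step list" where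
 "count m g upd = sread (\<lambda>c r. if c < m then Some (g r, 0) else None) (\<lambda>c r. c)
   (\<lambda>c r p ps. upd c r (ps - c - (half - m)))"

lemma run_count:
 assumes s: "wfs s" and m: "m \<le> half" "half < Z" and g: "\<And>r. r \<in> cells Z \<Longrightarrow> g r < Z"
  and u: "\<And>c r p. r \<in> cells Z \<Longrightarrow> p \<le> m \<Longrightarrow> upd c r p \<in> cells Z"
  and s': "s' = (\<lambda>c. upd c (s c) (card {i. i < m \<and> g (s i) \<le> c}))"
 shows "run (count m g upd) s s'"
proof -
 have gs: "g (s e) < Z" if "e < m" for e using g s that m by (simp add: wfs_def)
 have cm: "card {i. i < m \<and> g (s i) \<le> c} \<le> m" for c
  using card_mono[of "{..<m}" "{i. i < m \<and> g (s i) \<le> c}"] by auto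
 have wf: "wfs s'" unfolding wfs_def s' using u s cm by (simp add: wfs_def)
 let ?recs = "\<lambda>c r. if c < m then Some (g r, 0) else None"
 have "prog_sem L (count m g upd) (arr s) = return_pmf (arr s')"
  unfolding count_def
 proof (rule prog_sem_sread[OF s _ _ _ wf])
  fix c assume c: "c < half"
  have "rank_of (\<lambda>c r. c) s c = card {..<c}" unfolding rank_of_def by (rule arg_cong[of _ _ card]) (use c in auto)
  then have rk: "rank_of (\<lambda>c r. c) s c = c" by simp
  have le: "recw (Some (g (s e), 0)) \<le> Suc c * Z \<longleftrightarrow> g (s e) \<le> c" for e
  proof -
   have "recw (Some (g (s e), 0)) \<le> Suc c * Z \<longleftrightarrow> g (s e) * Z < Suc c * Z" by (simp only: recw_def option.case prod.case add_0_right less_eq_Suc_le)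
   also have "\<dots> \<longleftrightarrow> g (s e) \<le> c" using Z2 by (simp only: mult_less_cancel2) auto
   finally show ?thesis .
  qed
  have A: "{e. e < half \<and> recw (?recs e (s e)) \<le> Suc c * Z} = {m..<half} \<union> {i. i < m \<and> g (s i) \<le> c}"
  proof (intro set_eqI iffI)
   fix e assume "e \<in> {e. e < half \<and> recw (?recs e (s e)) \<le> Suc c * Z}"
   then show "e \<in> {m..<half} \<union> {i. i < m \<and> g (s i) \<le> c}" using le[of e] by (cases "e < m") simp_all
  next
   fix e assume e: "e \<in> {m..<half} \<union> {i. i < m \<and> g (s i) \<le> c}"
   have "recw (?recs e (s e)) \<le> Suc c * Z"
   proof (cases "e < m")
    case True
    then have "g (s e) \<le> c" using e by simp
    then show ?thesis using le[of e] True by (simp only: if_True)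
   qed (simp add: recw_def)
   moreover have "e < half" using e m by auto
   ultimately show "e \<in> {e. e < half \<and> recw (?recs e (s e)) \<le> Suc c * Z}" by simp
  qed
  have "card ({m..<half} \<union> {i. i < m \<and> g (s i) \<le> c}) = card {m..<half} + card {i. i < m \<and> g (s i) \<le> c}"
   by (rule card_Un_disjoint) auto
  then have "card {e. e < half \<and> recw (?recs e (s e)) \<le> Suc c * Z} = (half - m) + card {i. i < m \<and> g (s i) \<le> c}"
   unfolding A by (simp only: card_atLeastLessThan)
  then show "s' c = upd c (s c) (card {e. e < half \<and> recw (?recs e (s e)) \<le> Suc c * Z} + rank_of (\<lambda>c r. c) s c - c - (half - m))"
   unfolding rk s' by (simp only: add_diff_cancel_right' add_diff_cancel_left')
 qed (use m gs Z2 in \<open>auto split: if_splits\<close>)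
 then show ?thesis using wf by (simp add: run_def)
qed

text \<open>An upper bound for the rounds of one sort-and-scan program; from here on the length of
  programs is measured in this unit.\<close>

definition "ulen = 4 * 6 ^ d + 2 * f + 5"

definition vprog :: "array_step list \<Rightarrow> nat \<Rightarrow> bool" where
 "vprog p k \<longleftrightarrow> (\<forall>st\<in>set p. valid_step L (2 ^ b) W st) \<and> length p \<le> k * ulen"

lemma vprog_append: "vprog p k \<Longrightarrow> vprog q k' \<Longrightarrow> vprog (p @ q) (k + k')"
 by (auto simp: vprog_def algebra_simps)

lemma vprog_rd: "vprog (rd m g q upd) 1"
 using length_sread valid_sread by (auto simp: vprog_def rd_def ulen_def)

lemma vprog_count: "vprog (count m g upd) 1"
 using length_sread valid_sread by (auto simp: vprog_def count_def ulen_def)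

lemma vprog_rstep: "vprog [rstep m p upd] 1"
 using valid_rstep by (auto simp: vprog_def ulen_def)

end

section \<open>The data of a phase, derived from token labels\<close>

locale walker = machine a b d f Z W + markov n Pm for a b d f Z W n :: nat and Pm :: "nat \<Rightarrow> nat \<Rightarrow> real" +
 fixes R K l J' m :: nat and eh eo dg :: "nat \<Rightarrow> nat"
 assumes R0: "0 < R" and l0: "0 < l" and J: "2 * l \<le> 2 ^ J'"
  and NN: "(1 + R * (2 * l)) * (n * R * (K + 1)) \<le> half" and m: "m \<le> half" and halfZ: "half < Z"
  and eh: "c < m \<Longrightarrow> eh c < n" and edges: "v < n \<Longrightarrow> eo v + dg v \<le> m" and dg0: "v < n \<Longrightarrow> 0 < dg v"
  and PmE: "v < n \<Longrightarrow> w < n \<Longrightarrow> Pm v w = real (card {i. i < dg v \<and> eh (eo v + i) = w}) / real (dg v)"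
begin

definition "T = n * R * (K + 1)"
definition "nR = n * R"
definition "D = 2 * l"
definition "NN = (1 + R * D) * T"

lemma NN_le: "NN \<le> half" using NN by (simp only: NN_def T_def D_def)
lemma nR0: "0 < nR" using n0 R0 by (simp add: nR_def)
lemma nR_T: "nR \<le> T" by (simp add: nR_def T_def)
lemma T0: "0 < T" using nR0 nR_T by simp
lemma T_NN: "T \<le> NN" by (simp add: NN_def)
lemma n_nR: "n \<le> nR" using R0 by (simp add: nR_def)
lemma le_chain: "n \<le> half" "nR \<le> half" "T \<le> half" "n < Z" "nR < Z" "T < Z" "NN < Z" "n \<le> T" "nR \<le> NN" "n \<le> NN" "m < Z" "0 < Z"
 using NN_le T_NN nR_T n_nR halfZ m by linarith+
lemma m0: "0 < m" using dg0[OF n0] edges[OF n0] by linarith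

text \<open>The label \<open>v * R + rp\<close> of a token means that it stopped at \<open>v\<close>
  in repetition \<open>rp\<close> of the previous phase. The tokens below \<open>nR\<close>, one for
  each label, keep their own label forever.\<close>

definition okcl :: "(nat \<Rightarrow> nat) \<Rightarrow> bool" where
 "okcl cl \<longleftrightarrow> (\<forall>c<T. cl c < nR) \<and> (\<forall>c<nR. cl c = c)"

text \<open>Counting sort of the tokens by the vertex in their label: the pool of \<open>v\<close>
  has one slot for each token that stopped at \<open>v\<close>, over all repetitions. The offsets
  are the prefix sums, and the owner of a position is the last vertex whose offset does not exceed
  it, which is correct because no pool is empty.\<close>

definition "offc cl v = card {i. i < T \<and> cl i div R + 1 \<le> v}"
definition "nnc cl v = card {i. i < T \<and> cl i div R \<le> v} - offc cl v"
definition "ownc cl p = card {v. v < n \<and> offc cl v \<le> p} - 1"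

lemma offc_le: "offc cl v \<le> T"
 unfolding offc_def using card_mono[of "{..<T}" "{i. i < T \<and> cl i div R + 1 \<le> v}"] by auto

lemma nnc_eq: "nnc cl v = card {i. i < T \<and> cl i div R = v}" "offc cl v + nnc cl v = offc cl (Suc v)"
proof -
 have "{i. i < T \<and> cl i div R \<le> v} = {i. i < T \<and> cl i div R + 1 \<le> v} \<union> {i. i < T \<and> cl i div R = v}" by auto
 then have "card {i. i < T \<and> cl i div R \<le> v} = card ({i. i < T \<and> cl i div R + 1 \<le> v} \<union> {i. i < T \<and> cl i div R = v})"
  by (rule arg_cong)
 also have "\<dots> = offc cl v + card {i. i < T \<and> cl i div R = v}"
  unfolding offc_def by (rule card_Un_disjoint) auto
 finally have "card {i. i < T \<and> cl i div R \<le> v} = offc cl v + card {i. i < T \<and> cl i div R = v}" .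
 then show "nnc cl v = card {i. i < T \<and> cl i div R = v}" "offc cl v + nnc cl v = offc cl (Suc v)"
  by (simp_all add: nnc_def offc_def)
qed

lemma nnc_pos: assumes "okcl cl" "v < n" shows "0 < nnc cl v"
proof -
 have lt: "v * R + 0 < n * R" by (rule mult_add_less[OF assms(2) R0])
 then have lt': "v * R < nR" by (simp only: nR_def add_0_right)
 then have "cl (v * R) = v * R" using assms(1) unfolding okcl_def by blast
 moreover have "v * R < T" using lt' nR_T by linarith
 moreover have "v * R div R = v" using R0 by simp
 ultimately have "v * R \<in> {i. i < T \<and> cl i div R = v}" by simp
 then show ?thesis unfolding nnc_eq(1) by (subst card_gt_0_iff) auto
qed

lemma offc_mono: "u \<le> v \<Longrightarrow> offc cl u \<le> offc cl v"
 unfolding offc_def by (intro card_mono) auto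

lemma ownc_eq: assumes "okcl cl" "w < n" "j < nnc cl w" shows "ownc cl (offc cl w + j) = w"
proof -
 have "{v. v < n \<and> offc cl v \<le> offc cl w + j} = {..w}"
 proof (intro set_eqI iffI)
  fix v assume "v \<in> {v. v < n \<and> offc cl v \<le> offc cl w + j}"
  then have "offc cl v < offc cl (Suc w)" using assms(3) nnc_eq(2)[of cl w] by simp
  then show "v \<in> {..w}" using offc_mono[of "Suc w" v cl] by (cases "v \<le> w") auto
 next
  fix v assume "v \<in> {..w}"
  then show "v \<in> {v. v < n \<and> offc cl v \<le> offc cl w + j}" using offc_mono[of v w cl] assms(2) by auto
 qed
 then show ?thesis by (simp add: ownc_def)
qed

lemma ownc_less: "ownc cl p < n"
proof -
 have "card {v. v < n \<and> offc cl v \<le> p} \<le> card {..<n}" by (intro card_mono) auto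
 then show ?thesis using n0 by (simp add: ownc_def)
qed

lemma phaseI: assumes "okcl cl" "0 \<le> \<theta>" "\<theta> < 1"
 shows "phase n Pm R K l Z (2 ^ J') \<theta> (ownc cl) (offc cl) (nnc cl) eh eo dg"
proof unfold_locales
 fix v i assume "v < n" "i < dg v"
 then show "eh (eo v + i) < n" using edges[of v] by (intro eh) simp
next
 fix w j assume w: "w < n" "j < nnc cl w"
 then have "offc cl w + j < offc cl (Suc w)" using nnc_eq(2)[of cl w] by simp
 then show "offc cl w + j < n * R * (K + 1)" using offc_le[of cl "Suc w"] by (simp add: T_def)
 show "ownc cl (offc cl w + j) = w" by (rule ownc_eq[OF assms(1) w])
next
 fix w assume "w < n"
 then show "nnc cl w \<le> Z" using nnc_eq(2)[of cl w] offc_le[of cl "Suc w"] le_chain by linarith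
qed (use assms R0 l0 J dg0 PmE nnc_pos ownc_less in auto)

definition graph :: "(nat \<Rightarrow> cell) \<Rightarrow> bool" where
 "graph s \<longleftrightarrow> (\<forall>c<m. c_eh (s c) = eh c) \<and> (\<forall>v<n. c_eo (s v) = eo v \<and> c_dg (s v) = dg v)"

definition inv :: "(nat \<Rightarrow> cell) \<Rightarrow> (nat \<Rightarrow> nat) \<Rightarrow> bool" where
 "inv s cl \<longleftrightarrow> wfs s \<and> graph s \<and> (\<forall>c<T. c_cl (s c) = cl c) \<and> okcl cl"

text \<open>The field \<open>c_ow\<close> first holds the owner of the row position \<open>c\<close>
  and is then copied to all rows by the residue of \<open>c\<close> modulo \<open>T\<close>. For the
  tokens it is replaced by the vertex from which they start.\<close>

definition prep :: "array_step list" where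
 "prep = count T (\<lambda>r. (c_cl r div R + 1) mod Z) (\<lambda>c r p. r\<lparr>c_of := p\<rparr>)
  @ count T (\<lambda>r. c_cl r div R) (\<lambda>c r p. r\<lparr>c_nn := p - c_of r\<rparr>)
  @ count n c_of (\<lambda>c r p. r\<lparr>c_ow := p - 1\<rparr>)
  @ rd T c_ow (\<lambda>c r. c mod T) (\<lambda>c r p. r\<lparr>c_ow := if c < T then (c mod nR div R) mod Z else p\<rparr>)
  @ rd n c_eo (\<lambda>c r. c_ow r) (\<lambda>c r p. r\<lparr>c_oe := p\<rparr>)
  @ rd n c_dg (\<lambda>c r. c_ow r) (\<lambda>c r p. r\<lparr>c_od := p\<rparr>)"

lemma vprog_prep: "vprog prep 6"
 unfolding prep_def using vprog_append[OF vprog_count vprog_append[OF vprog_count vprog_append[OF vprog_count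
   vprog_append[OF vprog_rd vprog_append[OF vprog_rd vprog_rd]]]]] by (simp add: numeral_eq_Suc)

definition owner :: "(nat \<Rightarrow> nat) \<Rightarrow> nat \<Rightarrow> nat" where
 "owner cl c = (if c < T then c mod nR div R else ownc cl (c mod T))"

definition prepared :: "(nat \<Rightarrow> cell) \<Rightarrow> (nat \<Rightarrow> nat) \<Rightarrow> bool" where
 "prepared s cl \<longleftrightarrow> inv s cl \<and> (\<forall>v<n. c_of (s v) = offc cl v \<and> c_nn (s v) = nnc cl v) \<and>
   (\<forall>c<NN. c_ow (s c) = owner cl c \<and> c_oe (s c) = eo (owner cl c) \<and> c_od (s c) = dg (owner cl c))"

lemma owner_less: "owner cl c < n"
proof -
 have "c mod nR < n * R" using nR0 mod_less_divisor[of nR c] by (simp add: nR_def)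
 then have "c mod nR div R < n" by (simp add: less_mult_imp_div_less)
 then show ?thesis using ownc_less by (simp add: owner_def)
qed

lemma run_prep:
 assumes i: "inv s cl"
 shows "\<exists>s'. run prep s s' \<and> prepared s' cl"
proof -
 note le = le_chain
 have wf: "wfs s" and g: "graph s" and cl: "\<And>c. c < T \<Longrightarrow> c_cl (s c) = cl c" and ok: "okcl cl"
  using i by (auto simp: inv_def)
 define s1 where "s1 = (\<lambda>c. (s c)\<lparr>c_of := card {i. i < T \<and> (c_cl (s i) div R + 1) mod Z \<le> c}\<rparr>)"
 have r1: "run (count T (\<lambda>r. (c_cl r div R + 1) mod Z) (\<lambda>c r p. r\<lparr>c_of := p\<rparr>)) s s1"
  by (rule run_count[OF wf _ halfZ]) (use le in \<open>auto simp: in_cells s1_def\<close>)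
 have w1: "wfs s1" using r1 by (simp add: run_def)
 define s2 where "s2 = (\<lambda>c. (s1 c)\<lparr>c_nn := card {i. i < T \<and> c_cl (s1 i) div R \<le> c} - c_of (s1 c)\<rparr>)"
 have r2: "run (count T (\<lambda>r. c_cl r div R) (\<lambda>c r p. r\<lparr>c_nn := p - c_of r\<rparr>)) s1 s2"
  by (rule run_count[OF w1 _ halfZ]) (use le in \<open>auto simp: in_cells s2_def intro: le_less_trans[OF div_le_dividend]\<close>)
 have w2: "wfs s2" using r2 by (simp add: run_def)
 define s3 where "s3 = (\<lambda>c. (s2 c)\<lparr>c_ow := card {i. i < n \<and> c_of (s2 i) \<le> c} - 1\<rparr>)"
 have r3: "run (count n c_of (\<lambda>c r p. r\<lparr>c_ow := p - 1\<rparr>)) s2 s3"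
  by (rule run_count[OF w2 _ halfZ]) (use le in \<open>auto simp: in_cells s3_def\<close>)
 have w3: "wfs s3" using r3 by (simp add: run_def)
 define s4 where "s4 = (\<lambda>c. (s3 c)\<lparr>c_ow := if c < T then (c mod nR div R) mod Z
   else c_ow (s3 (if c mod T < T then c mod T else 0))\<rparr>)"
 have r4: "run (rd T c_ow (\<lambda>c r. c mod T) (\<lambda>c r p. r\<lparr>c_ow := if c < T then (c mod nR div R) mod Z else p\<rparr>)) s3 s4"
  by (rule run_rd[OF w3 T0 _ halfZ]) (use le in \<open>auto simp: in_cells s4_def\<close>)
 have w4: "wfs s4" using r4 by (simp add: run_def)
 define s5 where "s5 = (\<lambda>c. (s4 c)\<lparr>c_oe := c_eo (s4 (if c_ow (s4 c) < n then c_ow (s4 c) else 0))\<rparr>)"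
 have r5: "run (rd n c_eo (\<lambda>c r. c_ow r) (\<lambda>c r p. r\<lparr>c_oe := p\<rparr>)) s4 s5"
  by (rule run_rd[OF w4 n0 _ halfZ]) (use le in \<open>auto simp: in_cells s5_def\<close>)
 have w5: "wfs s5" using r5 by (simp add: run_def)
 define s6 where "s6 = (\<lambda>c. (s5 c)\<lparr>c_od := c_dg (s5 (if c_ow (s5 c) < n then c_ow (s5 c) else 0))\<rparr>)"
 have r6: "run (rd n c_dg (\<lambda>c r. c_ow r) (\<lambda>c r p. r\<lparr>c_od := p\<rparr>)) s5 s6"
  by (rule run_rd[OF w5 n0 _ halfZ]) (use le in \<open>auto simp: in_cells s6_def\<close>)
 have w6: "wfs s6" using r6 by (simp add: run_def)
 have run: "run prep s s6" unfolding prep_def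
  by (intro run_append[OF r1] run_append[OF r2] run_append[OF r3] run_append[OF r4] run_append[OF r5] r6)
 have clR: "(cl i div R + 1) mod Z = cl i div R + 1" if "i < T" for i
 proof -
  have "cl i < n * R" using ok that by (simp add: okcl_def nR_def)
  then have "cl i div R < n" by (simp add: less_mult_imp_div_less)
  then show ?thesis using le(4) by (intro mod_less) linarith
 qed
 have o1: "c_of (s1 c) = offc cl c" for c
  unfolding s1_def offc_def using clR cl by (auto intro!: arg_cong[of _ _ card])
 have n2: "c_nn (s2 c) = nnc cl c" for c
  unfolding s2_def nnc_def using o1[of c] cl by (auto simp: s1_def intro!: arg_cong[of _ _ card] arg_cong2[of _ _ _ _ "(-)"])
 have o2: "c_of (s2 c) = offc cl c" for c using o1 by (simp add: s2_def)
 have ow3: "c_ow (s3 c) = ownc cl c" for c unfolding s3_def ownc_def by (simp add: o2)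
 have ow4: "c_ow (s4 c) = owner cl c" for c
 proof -
  have "owner cl c < Z" using owner_less[of cl c] le(4) by linarith
  moreover have "c mod T < T" using T0 by (rule mod_less_divisor)
  ultimately show ?thesis unfolding s4_def owner_def by (cases "c < T") (simp_all add: ow3)
 qed
 have f12: "c_eh (s2 c) = c_eh (s c)" "c_eo (s2 c) = c_eo (s c)" "c_dg (s2 c) = c_dg (s c)" "c_cl (s2 c) = c_cl (s c)" for c
  unfolding s2_def s1_def by simp_all
 have f34: "c_eh (s4 c) = c_eh (s2 c)" "c_eo (s4 c) = c_eo (s2 c)" "c_dg (s4 c) = c_dg (s2 c)" "c_cl (s4 c) = c_cl (s2 c)"
  "c_of (s4 c) = c_of (s2 c)" "c_nn (s4 c) = c_nn (s2 c)" for c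
  unfolding s4_def s3_def by simp_all
 have f5: "c_eh (s5 c) = c_eh (s4 c)" "c_eo (s5 c) = c_eo (s4 c)" "c_dg (s5 c) = c_dg (s4 c)" "c_cl (s5 c) = c_cl (s4 c)"
  "c_of (s5 c) = c_of (s4 c)" "c_nn (s5 c) = c_nn (s4 c)" "c_ow (s5 c) = c_ow (s4 c)" for c
  unfolding s5_def by simp_all
 have f6: "c_eh (s6 c) = c_eh (s5 c)" "c_eo (s6 c) = c_eo (s5 c)" "c_dg (s6 c) = c_dg (s5 c)" "c_cl (s6 c) = c_cl (s5 c)"
  "c_of (s6 c) = c_of (s5 c)" "c_nn (s6 c) = c_nn (s5 c)" "c_ow (s6 c) = c_ow (s5 c)" "c_oe (s6 c) = c_oe (s5 c)" for c
  unfolding s6_def by simp_all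
 have oe: "c_oe (s5 c) = c_eo (s4 (if c_ow (s4 c) < n then c_ow (s4 c) else 0))" for c unfolding s5_def by simp
 have od: "c_od (s6 c) = c_dg (s5 (if c_ow (s5 c) < n then c_ow (s5 c) else 0))" for c unfolding s6_def by simp
 have eo4: "c_eo (s4 v) = eo v" "c_dg (s4 v) = dg v" if "v < n" for v
  using g that by (simp_all add: graph_def f34 f12)
 have "c_oe (s6 c) = eo (owner cl c)" "c_od (s6 c) = dg (owner cl c)" for c
  using owner_less[of cl c] eo4 by (simp_all add: f6(8) oe od f5 ow4)
 moreover have "graph s6" using g by (simp add: graph_def f6 f5 f34 f12)
 moreover have "c_cl (s6 c) = cl c" if "c < T" for c using cl[OF that] by (simp add: f6 f5 f34 f12)
 moreover have "c_ow (s6 c) = owner cl c" "c_of (s6 c) = offc cl c" "c_nn (s6 c) = nnc cl c" for c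
  using ow4 o2 n2 by (simp_all add: f6 f5 f34)
 ultimately have "prepared s6 cl" using w6 ok unfolding prepared_def inv_def by simp
 then show ?thesis using run by blast
qed

end

section \<open>One phase as a program\<close>

context walker
begin

definition rand_kernel :: "real \<Rightarrow> nat \<Rightarrow> cell \<Rightarrow> (bool \<times> nat \<times> nat) pmf" where
 "rand_kernel \<theta> c r = pair_pmf (bernoulli_pmf (1 - \<theta>)) (pmf_of_set ({..<(if c < T then l else c_od r)} \<times> {..<Z}))"

definition rand_upd :: "cell \<Rightarrow> bool \<times> nat \<times> nat \<Rightarrow> cell" where
 "rand_upd r z = r\<lparr>c_st := if fst z then 1 else 0, c_ii := fst (snd z) mod Z, c_rr := snd (snd z) mod Z\<rparr>"

text \<open>The counterpart of \<open>nx\<close> at a time when \<open>c_oe\<close> has been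
  overwritten by the pool offset of the target vertex and \<open>p\<close> is the size of its
  pool.\<close>

definition nxt :: "nat \<Rightarrow> cell \<Rightarrow> nat \<Rightarrow> nat" where
 "nxt c r p = (if c < nR then c
   else if c < T then (1 + c mod R * D + c_ii r) * T + (c_oe r + c_rr r mod p)
   else if c_st r = 1 \<or> (c div T - 1) mod D = D - 1 then c
   else (c div T + 1) * T + (c_oe r + c_rr r mod p))"

definition jump :: "array_step list" where
 "jump = rd NN c_pt (\<lambda>c r. c_pt r) (\<lambda>c r p. r\<lparr>c_pt := p\<rparr>)"

definition point :: "array_step list" where
 "point = rd m c_eh (\<lambda>c r. c_oe r + c_ii r) (\<lambda>c r p. r\<lparr>c_pt := if c < T then c_ow r else p\<rparr>)
  @ rd n c_of (\<lambda>c r. c_pt r) (\<lambda>c r p. r\<lparr>c_oe := p\<rparr>)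
  @ rd n c_nn (\<lambda>c r. c_pt r) (\<lambda>c r p. r\<lparr>c_pt := nxt c r p mod Z\<rparr>)"

definition jumps :: "nat \<Rightarrow> array_step list" where "jumps k = concat (replicate k jump)"

definition relabel :: "array_step list" where
 "relabel = rd NN c_ow (\<lambda>c r. c_pt r)
   (\<lambda>c r p. r\<lparr>c_cl := if c < nR \<or> T \<le> c then c_cl r else (p * R + c mod R) mod Z\<rparr>)"

definition phase_prog :: "real \<Rightarrow> array_step list" where
 "phase_prog \<theta> = prep @ [rstep NN (rand_kernel \<theta>) rand_upd] @ point @ jumps J' @ relabel"

lemma vprog_jumps: "vprog (jumps k) k"
proof (induction k)
 case (Suc k)
 from vprog_append[OF vprog_rd this] show ?case unfolding jumps_def jump_def by simp
qed (simp add: jumps_def vprog_def)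

lemma vprog_phase: "vprog (phase_prog \<theta>) (J' + 11)"
proof -
 have p: "vprog point 3"
  unfolding point_def using vprog_append[OF vprog_rd vprog_append[OF vprog_rd vprog_rd]] by (simp add: numeral_eq_Suc)
 have "vprog relabel 1" unfolding relabel_def by (rule vprog_rd)
 from vprog_append[OF vprog_prep vprog_append[OF vprog_rstep vprog_append[OF p vprog_append[OF vprog_jumps this]]]]
 show ?thesis unfolding phase_prog_def by (simp add: add.commute)
qed

definition same :: "(nat \<Rightarrow> cell) \<Rightarrow> (nat \<Rightarrow> cell) \<Rightarrow> bool" where
 "same s s' \<longleftrightarrow> (\<forall>c. c_eh (s' c) = c_eh (s c) \<and> c_eo (s' c) = c_eo (s c) \<and> c_dg (s' c) = c_dg (s c) \<and>
   c_cl (s' c) = c_cl (s c) \<and> c_ow (s' c) = c_ow (s c))"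

text \<open>Pointer doubling: one lookup replaces \<open>F\<close> by its square, and the induction
  hypothesis is applied to the square. Coalescence of the walks is what makes this possible, since a
  pointer depends only on the cell.\<close>

lemma run_jumps:
 assumes "wfs s" "\<And>c. c < NN \<Longrightarrow> F c < NN" "\<And>c. c < NN \<Longrightarrow> c_pt (s c) = F c"
 shows "\<exists>s'. run (jumps k) s s' \<and> same s s' \<and> (\<forall>c<NN. c_pt (s' c) = (F ^^ (2 ^ k)) c)"
 using assms
proof (induction k arbitrary: s F)
 case 0
 then show ?case by (intro exI[of _ s]) (simp add: jumps_def run_def prog_sem_Nil same_def)
next
 case (Suc k)
 define s1 where "s1 = (\<lambda>c. (s c)\<lparr>c_pt := c_pt (s (if c_pt (s c) < NN then c_pt (s c) else 0))\<rparr>)"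
 have NN0: "0 < NN" using T0 T_NN by linarith
 have r1: "run jump s s1" unfolding jump_def
  by (rule run_rd[OF Suc.prems(1) NN0 NN_le halfZ]) (auto simp: in_cells s1_def)
 have F2: "c_pt (s1 c) = (F ^^ 2) c" if "c < NN" for c
  using Suc.prems(2,3) that by (simp add: s1_def numeral_2_eq_2)
 have "(F ^^ 2) c < NN" if "c < NN" for c using Suc.prems(2) that by (simp add: numeral_2_eq_2)
 from Suc.IH[of s1 "F ^^ 2", OF _ this F2] obtain s' where s': "run (jumps k) s1 s'" "same s1 s'"
  "\<And>c. c < NN \<Longrightarrow> c_pt (s' c) = ((F ^^ 2) ^^ (2 ^ k)) c" using r1 by (auto simp: run_def)
 have "run (jumps (Suc k)) s s'" using run_append[OF r1 s'(1)] by (simp add: jumps_def)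
 moreover have "same s s'" using s'(2) by (simp add: same_def s1_def)
 moreover have "(F ^^ 2) ^^ (2 ^ k) = F ^^ (2 ^ Suc k)" by (simp add: funpow_mult mult.commute)
 ultimately show ?case using s'(3) by auto
qed

definition newcl :: "(nat \<Rightarrow> nat) \<Rightarrow> (nat \<Rightarrow> nat) \<Rightarrow> nat \<Rightarrow> nat" where
 "newcl cl F c = (if c < nR then c else ownc cl ((F ^^ (2 ^ J')) c mod T) * R + c mod R)"

text \<open>Only the walking tokens are counted; the immobile token with label \<open>k\<close>
  would bias the estimate.\<close>

definition ccnt :: "(nat \<Rightarrow> nat) \<Rightarrow> nat \<Rightarrow> nat" where
 "ccnt cl k = card {i. nR \<le> i \<and> i < T \<and> cl i = k}"

definition "d0 = (False, 0::nat, 0::nat)"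

end

section \<open>The program of a phase simulates the layered walk\<close>

locale walk_phase = walker + ph: phase n Pm R K l Z "2 ^ J'" \<theta> "ownc cl" "offc cl" "nnc cl" eh eo dg for \<theta> cl +
 assumes ok: "okcl cl"
begin

lemma T_eq: "ph.Tt = T" and D_eq: "ph.DD = D" and X_eq: "ph.Xs = {..<NN}"
 by (simp_all only: ph.Tt_def T_def ph.DD_def D_def ph.Xs_def NN_def)

definition Fg :: "(nat \<Rightarrow> bool \<times> nat \<times> nat) \<Rightarrow> nat \<Rightarrow> nat" where
 "Fg g c = (if c < NN then ph.nx c (g c) else 0)"

definition draws :: "(nat \<Rightarrow> bool \<times> nat \<times> nat) pmf" where "draws = Pi_pmf {..<NN} d0 ph.draw"

text \<open>The program stores raw draws while the analysis speaks about pointers. Applying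
  \<open>ph.nx\<close> cell by cell carries one product measure to the other, so the probability
  bounds may be pulled back to the draws.\<close>

lemma draws_Dk: "map_pmf Fg draws = Pi_pmf ph.Xs 0 ph.Dk"
proof -
 have "Pi_pmf {..<NN} 0 ph.Dk = Pi_pmf {..<NN} 0 (\<lambda>c. bind_pmf (ph.draw c) (\<lambda>r. return_pmf (ph.nx c r)))"
  by (simp add: ph.Dk_def[abs_def] map_pmf_def)
 also have "\<dots> = bind_pmf draws (\<lambda>g. Pi_pmf {..<NN} 0 (\<lambda>c. return_pmf (ph.nx c (g c))))"
  unfolding draws_def by (rule Pi_pmf_bind) simp
 also have "\<dots> = map_pmf Fg draws"
  by (simp add: map_pmf_def Fg_def[abs_def])
 finally show ?thesis by (simp add: X_eq)
qed

context
 fixes g assumes g: "g \<in> set_pmf draws"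
begin

lemma g_draw: "c < NN \<Longrightarrow> g c \<in> set_pmf (ph.draw c)"
 using g by (auto simp: draws_def set_Pi_pmf PiE_dflt_def)

lemma g_bounds: assumes "c < NN" shows "fst (snd (g c)) < (if c < T then l else dg (ownc cl (c mod T)))" "snd (snd (g c)) < Z"
proof -
 have "(fst (g c), fst (snd (g c)), snd (snd (g c))) \<in> set_pmf (ph.draw c)" using g_draw[OF assms] by simp
 then show "fst (snd (g c)) < (if c < T then l else dg (ownc cl (c mod T)))" "snd (snd (g c)) < Z"
  using ph.set_draw[of c "fst (g c)" "fst (snd (g c))" "snd (snd (g c))"] assms unfolding X_eq ph.bd_def T_eq by simp_all
qed

lemma Fg_step: "c < NN \<Longrightarrow> Fg g c = c \<or> Fg g c < NN \<and> ph.lev c < ph.lev (Fg g c)"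
 using ph.Dk_supp[of c "Fg g c"] g_draw[of c] by (auto simp: X_eq Fg_def ph.Dk_def)

lemma Fg_less: "c < NN \<Longrightarrow> Fg g c < NN" using Fg_step[of c] by auto

lemma Fg_slots:
 assumes c: "nR \<le> c" "c < T"
 shows "T \<le> (Fg g ^^ Suc k) c \<and> (Fg g ^^ Suc k) c < NN"
proof (induction k)
 case 0
 have cN: "c < NN" using c(2) T_NN by linarith
 have i: "fst (snd (g c)) < l" using g_bounds(1)[OF cN] c by simp
 obtain st i r where gc: "g c = (st, i, r)" by (cases "g c") auto
 have "Fg g c = ph.slot (c mod R) i (offc cl (c mod (n * R) div R) + r mod nnc cl (c mod (n * R) div R))"
  using ph.nx_token[of c st i r] c cN by (simp add: Fg_def gc T_eq nR_def)
 moreover have "T \<le> ph.slot (c mod R) i (offc cl (c mod (n * R) div R) + r mod nnc cl (c mod (n * R) div R))"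
  using ph.slot_arith(2)[of "c mod R" i "offc cl (c mod (n * R) div R) + r mod nnc cl (c mod (n * R) div R)"]
   ph.slot_pos(1)[OF ph.token_vertex(1), of c r] ph.lD[of i] i gc R0 mod_less_divisor[OF R0, of c] by (simp add: T_eq)
 ultimately show ?case using Fg_less[OF cN] by simp
next
 case (Suc k)
 let ?x = "(Fg g ^^ Suc k) c"
 have "T \<le> Fg g ?x"
 proof (cases "Fg g ?x = ?x")
  case False
  then have "0 < ph.lev (Fg g ?x)" using Fg_step[of ?x] Suc by linarith
  then show ?thesis by (cases "Fg g ?x < T") (simp_all add: ph.lev_def T_eq)
 qed (use Suc in simp)
 then show ?case using Fg_less[of ?x] Suc by (simp del: funpow.simps add: funpow.simps(2)[of "Suc k"])
qed

lemma Fg_end: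
 assumes "nR \<le> c" "c < T"
 shows "T \<le> (Fg g ^^ (2 ^ J')) c" "(Fg g ^^ (2 ^ J')) c < NN"
 using Fg_slots[OF assms, of "2 ^ J' - 1"] by simp_all

lemma newcl_less: "c < T \<Longrightarrow> newcl cl (Fg g) c < nR"
 using mult_add_less[OF ownc_less mod_less_divisor[OF R0], of cl "(Fg g ^^ (2 ^ J')) c mod T" c]
 by (simp add: newcl_def nR_def)

lemma ccnt_newcl:
 assumes v: "v < n" and rp: "rp < R"
 shows "ccnt (newcl cl (Fg g)) (v * R + rp) = ph.cnt rp v (Fg g)"
proof -
 have eq: "x * R + c mod R = v * R + rp \<longleftrightarrow> x = v \<and> c mod R = rp" for x c
 proof
  assume e: "x * R + c mod R = v * R + rp"
  have c: "c mod R < R" using R0 by simp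
  show "x = v \<and> c mod R = rp"
   using mult_add_div_mod[OF c, of x] mult_add_div_mod[OF rp, of v] unfolding e by simp
 qed simp
 have "{i. nR \<le> i \<and> i < T \<and> newcl cl (Fg g) i = v * R + rp} = {i \<in> ph.tok rp. (Fg g ^^ (2 ^ J')) i \<in> ph.Tg v}"
 proof (intro set_eqI iffI)
  fix i assume "i \<in> {i. nR \<le> i \<and> i < T \<and> newcl cl (Fg g) i = v * R + rp}"
  then have i: "nR \<le> i" "i < T" and "ownc cl ((Fg g ^^ (2 ^ J')) i mod T) * R + i mod R = v * R + rp"
   by (auto simp: newcl_def)
  from this(3) have "ownc cl ((Fg g ^^ (2 ^ J')) i mod T) = v" "i mod R = rp" by (simp_all only: eq)
  then show "i \<in> {i \<in> ph.tok rp. (Fg g ^^ (2 ^ J')) i \<in> ph.Tg v}"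
   using i Fg_end[OF i] by (simp add: ph.tok_def ph.Tg_def T_eq nR_def[symmetric])
 next
  fix i assume "i \<in> {i \<in> ph.tok rp. (Fg g ^^ (2 ^ J')) i \<in> ph.Tg v}"
  then show "i \<in> {i. nR \<le> i \<and> i < T \<and> newcl cl (Fg g) i = v * R + rp}"
   by (simp add: ph.tok_def ph.Tg_def T_eq nR_def[symmetric] newcl_def)
 qed
 then show ?thesis by (simp only: ccnt_def ph.cnt_def)
qed

lemma run_rest:
 assumes p: "prepared s cl"
 defines "s0 \<equiv> (\<lambda>c. if c < NN then rand_upd (s c) (g c) else s c)"
 shows "\<exists>s'. run (point @ jumps J' @ relabel) s0 s' \<and> inv s' (newcl cl (Fg g))"
proof -
 note le = le_chain
 have i: "inv s cl" using p by (simp add: prepared_def)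
 have wf: "wfs s" and gs: "graph s" using i by (auto simp: inv_def)
 have w0: "wfs s0" unfolding wfs_def s0_def
  using wf Z2 le by (auto simp: wfs_def in_cells rand_upd_def)
 have f0: "c_eh (s0 c) = c_eh (s c)" "c_eo (s0 c) = c_eo (s c)" "c_dg (s0 c) = c_dg (s c)" "c_cl (s0 c) = c_cl (s c)"
  "c_of (s0 c) = c_of (s c)" "c_nn (s0 c) = c_nn (s c)" "c_ow (s0 c) = c_ow (s c)" "c_oe (s0 c) = c_oe (s c)" for c
  by (simp_all add: s0_def rand_upd_def)
 define s1 where "s1 = (\<lambda>c. (s0 c)\<lparr>c_pt := if c < T then c_ow (s0 c) else
   c_eh (s0 (if c_oe (s0 c) + c_ii (s0 c) < m then c_oe (s0 c) + c_ii (s0 c) else 0))\<rparr>)"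
 have r1: "run (rd m c_eh (\<lambda>c r. c_oe r + c_ii r) (\<lambda>c r p. r\<lparr>c_pt := if c < T then c_ow r else p\<rparr>)) s0 s1"
  by (rule run_rd[OF w0 m0 m halfZ]) (auto simp: in_cells s1_def)
 have w1: "wfs s1" using r1 by (simp add: run_def)
 define s2 where "s2 = (\<lambda>c. (s1 c)\<lparr>c_oe := c_of (s1 (if c_pt (s1 c) < n then c_pt (s1 c) else 0))\<rparr>)"
 have r2: "run (rd n c_of (\<lambda>c r. c_pt r) (\<lambda>c r p. r\<lparr>c_oe := p\<rparr>)) s1 s2"
  by (rule run_rd[OF w1 n0 le(1) halfZ]) (auto simp: in_cells s2_def)
 have w2: "wfs s2" using r2 by (simp add: run_def)
 define s3 where "s3 = (\<lambda>c. (s2 c)\<lparr>c_pt := nxt c (s2 c) (c_nn (s2 (if c_pt (s2 c) < n then c_pt (s2 c) else 0))) mod Z\<rparr>)"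
 have r3: "run (rd n c_nn (\<lambda>c r. c_pt r) (\<lambda>c r p. r\<lparr>c_pt := nxt c r p mod Z\<rparr>)) s2 s3"
  by (rule run_rd[OF w2 n0 le(1) halfZ]) (use le in \<open>auto simp: in_cells s3_def\<close>)
 have w3: "wfs s3" using r3 by (simp add: run_def)
 have r123: "run point s0 s3" unfolding point_def by (intro run_append[OF r1] run_append[OF r2] r3)
 have f1: "c_eh (s1 c) = c_eh (s c)" "c_eo (s1 c) = c_eo (s c)" "c_dg (s1 c) = c_dg (s c)" "c_cl (s1 c) = c_cl (s c)"
  "c_of (s1 c) = c_of (s c)" "c_nn (s1 c) = c_nn (s c)" "c_ow (s1 c) = c_ow (s c)"
  "c_st (s1 c) = c_st (s0 c)" "c_ii (s1 c) = c_ii (s0 c)" "c_rr (s1 c) = c_rr (s0 c)" for c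
  unfolding s1_def by (simp_all add: f0)
 have f2: "c_eh (s2 c) = c_eh (s c)" "c_eo (s2 c) = c_eo (s c)" "c_dg (s2 c) = c_dg (s c)" "c_cl (s2 c) = c_cl (s c)"
  "c_nn (s2 c) = c_nn (s c)" "c_ow (s2 c) = c_ow (s c)" "c_pt (s2 c) = c_pt (s1 c)"
  "c_st (s2 c) = c_st (s0 c)" "c_ii (s2 c) = c_ii (s0 c)" "c_rr (s2 c) = c_rr (s0 c)" for c
  unfolding s2_def by (simp_all add: f1)
 have f3: "same s s3" unfolding same_def s3_def by (simp add: f2)
 have pt1: "c_pt (s1 c) = (if c < T then c_ow (s0 c) else
   c_eh (s0 (if c_oe (s0 c) + c_ii (s0 c) < m then c_oe (s0 c) + c_ii (s0 c) else 0)))" for c unfolding s1_def by simp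
 have oe2: "c_oe (s2 c) = c_of (s1 (if c_pt (s1 c) < n then c_pt (s1 c) else 0))" for c unfolding s2_def by simp
 have pt3: "c_pt (s3 c) = nxt c (s2 c) (c_nn (s2 (if c_pt (s2 c) < n then c_pt (s2 c) else 0))) mod Z" for c unfolding s3_def by simp
 have pt: "c_pt (s3 c) = Fg g c" if c: "c < NN" for c
 proof -
  obtain st i r where gc: "g c = (st, i, r)" by (cases "g c") auto
  define u where "u = owner cl c"
  have u: "u < n" unfolding u_def by (rule owner_less)
  have ow: "c_ow (s c) = u" "c_oe (s c) = eo u" using p c by (simp_all add: prepared_def u_def)
  have rZ: "r < Z" using g_bounds(2)[OF c] gc by simp
  have ib: "i < (if c < T then l else dg u)" using g_bounds(1)[OF c] gc by (cases "c < T") (simp_all add: u_def owner_def)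
  have "dg u < Z" using edges[OF u] le(11) by linarith
  moreover have "l < Z"
  proof -
   have "l * 1 \<le> D * R" using R0 by (intro mult_le_mono) (auto simp: D_def)
   then have "l * 1 \<le> (1 + R * D) * T" using T0 mult_le_mono[of "D * R" "1 + R * D" 1 T] by (simp add: mult.commute)
   then show ?thesis using le(7) by (simp add: NN_def)
  qed
  ultimately have iZ: "i < Z" using ib by (auto split: if_splits)
  have s0c: "c_st (s0 c) = (if st then 1 else 0)" "c_ii (s0 c) = i" "c_rr (s0 c) = r"
   using c rZ iZ by (simp_all add: s0_def rand_upd_def gc)
  \<comment> \<open>The vertex whose pool is entered next: a token enters the pool of its own
    vertex, a slot that of the head of the drawn edge.\<close>
  define w where "w = (if c < T then u else eh (eo u + i))"
  have w: "w < n" unfolding w_def using u ib edges[OF u] eh[of "eo u + i"] by auto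
  have "c_pt (s1 c) = w"
  proof (cases "c < T")
   case False
   then have lt: "eo u + i < m" using ib edges[OF u] by simp
   then have "c_eh (s (eo u + i)) = eh (eo u + i)" using gs by (simp add: graph_def)
   then show ?thesis using False lt by (simp add: pt1 f0 ow s0c w_def)
  qed (simp add: pt1 f0 ow w_def)
  then have pw: "c_pt (s1 c) = w" "c_oe (s2 c) = offc cl w" "c_nn (s2 w) = nnc cl w"
   using w p by (simp_all add: oe2 f1 f2 prepared_def)
  have cT: "(1 + c mod R * D + i) * T + y = ph.slot (c mod R) i y" for y
   by (simp only: ph.slot_def T_eq D_eq)
  have "nxt c (s2 c) (nnc cl w) = Fg g c"
   unfolding nxt_def Fg_def f2 pw s0c gc cT using c
   by (simp add: ph.nx_def T_eq D_eq nR_def[symmetric] w_def u_def owner_def)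
  moreover have "Fg g c < Z" using Fg_less[OF c] le(7) by linarith
  ultimately show ?thesis using w by (simp add: pt3 f2(7) pw)
 qed
 from run_jumps[OF w3 Fg_less pt, of J'] obtain s4 where s4: "run (jumps J') s3 s4" "same s3 s4"
  "\<And>c. c < NN \<Longrightarrow> c_pt (s4 c) = (Fg g ^^ (2 ^ J')) c" by blast
 have w4: "wfs s4" using s4(1) by (simp add: run_def)
 define s5 where "s5 = (\<lambda>c. (s4 c)\<lparr>c_cl := if c < nR \<or> T \<le> c then c_cl (s4 c)
   else (c_ow (s4 (if c_pt (s4 c) < NN then c_pt (s4 c) else 0)) * R + c mod R) mod Z\<rparr>)"
 have NN0: "0 < NN" using T0 T_NN by linarith
 have r5: "run relabel s4 s5" unfolding relabel_def
  by (rule run_rd[OF w4 NN0 NN_le halfZ]) (use le in \<open>auto simp: in_cells s5_def\<close>)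
 have w5: "wfs s5" using r5 by (simp add: run_def)
 have run: "run (point @ jumps J' @ relabel) s0 s5" by (intro run_append[OF r123] run_append[OF s4(1)] r5)
 have f4: "same s s4" using f3 s4(2) unfolding same_def by simp
 have ow4: "c_ow (s4 c) = owner cl c" if "c < NN" for c using f4 p that by (simp add: same_def prepared_def)
 have cl5: "c_cl (s5 c) = newcl cl (Fg g) c" if c: "c < T" for c
 proof (cases "c < nR")
  case True
  then have "c_cl (s4 c) = c" using f4 i c ok by (simp add: same_def inv_def okcl_def)
  then show ?thesis using True by (simp add: s5_def newcl_def)
 next
  case False
  have cN: "c < NN" using c T_NN by linarith
  let ?x = "(Fg g ^^ (2 ^ J')) c"
  have x: "T \<le> ?x" "?x < NN" using Fg_end[of c] False c by auto
  have "c_ow (s4 ?x) = ownc cl (?x mod T)" using ow4[OF x(2)] x(1) by (simp add: owner_def)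
  moreover have "newcl cl (Fg g) c < Z" using newcl_less[OF c] le(5) by linarith
  ultimately show ?thesis using False c x s4(3)[OF cN] by (simp add: s5_def newcl_def)
 qed
 have "graph s5" using gs f4 by (simp add: graph_def same_def s5_def)
 moreover have "okcl (newcl cl (Fg g))" using newcl_less by (simp add: okcl_def newcl_def)
 ultimately have "inv s5 (newcl cl (Fg g))" using w5 cl5 by (simp add: inv_def)
 then show ?thesis using run by blast
qed

end

end

context walker
begin

definition off_target :: "real \<Rightarrow> real \<Rightarrow> nat \<Rightarrow> bool" where
 "off_target \<alpha> p k \<longleftrightarrow> \<alpha> * (real K * real n * p) < \<bar>real k - real K * real n * p\<bar>"

definition good :: "real \<Rightarrow> (nat \<Rightarrow> real) \<Rightarrow> (nat \<Rightarrow> nat) \<Rightarrow> bool" where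
 "good \<alpha> \<pi> cl \<longleftrightarrow> (\<forall>v<n. 2 * card {rp. rp < R \<and> off_target \<alpha> (\<pi> v) (ccnt cl (v * R + rp))} < R)"

definition reached :: "real \<Rightarrow> (nat \<Rightarrow> real) \<Rightarrow> array set" where
 "reached \<alpha> \<pi> = {x. \<exists>s cl. x = arr s \<and> inv s cl \<and> good \<alpha> \<pi> cl}"

text \<open>Once the draws are fixed the phase is deterministic, so its law is the image of
  \<open>draws\<close>. The failure probability is a union bound over the \<open>n\<close> vertices,
  each of which loses its majority with probability at most \<open>(1 / 2) ^ R\<close>.\<close>

lemma phase_prob:
 assumes i: "inv s cl" and th: "0 \<le> \<theta>" "\<theta> < 1" and R: "even R" and pr: "is_pr \<theta> \<pi>" and \<kappa>0: "0 \<le> \<kappa>" and K: "0 < K"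
  and \<kappa>: "\<And>w. w < n \<Longrightarrow> green \<theta> (2 * l) w \<le> \<kappa> * real (nnc cl w)"
  and \<alpha>: "0 < \<alpha>" "\<alpha> \<le> 1" and tail: "\<And>v. v < n \<Longrightarrow> 2 * \<theta> ^ l \<le> \<alpha> / 2 * \<pi> v"
  and c3: "\<And>v. v < n \<Longrightarrow> 128 * (1 / (real K * real n) + 4 * \<kappa>) \<le> \<alpha>\<^sup>2 * \<pi> v"
 shows "measure_pmf.prob (prog_sem L (phase_prog \<theta>) (arr s)) (reached \<alpha> \<pi>) \<ge> 1 - real n * (1 / 2) ^ R"
proof -
 have ok: "okcl cl" using i by (simp add: inv_def)
 interpret walk_phase a b d f Z W n Pm R K l J' m eh eo dg \<theta> cl
  using phaseI[OF ok th] ok by (simp add: walk_phase_def walk_phase_axioms_def walker_axioms)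
 obtain s1 where s1: "run prep s s1" "prepared s1 cl" using run_prep[OF i] by blast
 have w1: "wfs s1" using s1(1) by (simp add: run_def)
 define s0 where "s0 g = (\<lambda>c. if c < NN then rand_upd (s1 c) (g c) else s1 c)" for g
 have ker: "rand_kernel \<theta> c (s1 c) = ph.draw c" if "c < NN" for c
  using s1(2) that by (simp add: rand_kernel_def ph.draw_def ph.bd_def T_eq prepared_def owner_def)
 have "prog_sem L [rstep NN (rand_kernel \<theta>) rand_upd] (arr s1) =
   map_pmf (\<lambda>g. arr (s0 g)) (Pi_pmf {..<NN} d0 (\<lambda>c. rand_kernel \<theta> c (s1 c)))"
  unfolding s0_def
 proof (rule prog_sem_rstep[OF w1 NN_le])
  fix c r assume "c < NN"
  then have "s1 c \<in> cells Z" using w1 NN_le by (simp add: wfs_def)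
  then show "rand_upd (s1 c) r \<in> cells Z" using Z2 by (auto simp: in_cells rand_upd_def)
 qed
 also have "Pi_pmf {..<NN} d0 (\<lambda>c. rand_kernel \<theta> c (s1 c)) = draws"
  unfolding draws_def by (rule Pi_pmf_cong) (use ker in auto)
 finally have rs: "prog_sem L [rstep NN (rand_kernel \<theta>) rand_upd] (arr s1) = map_pmf (\<lambda>g. arr (s0 g)) draws" .
 have "\<forall>g\<in>set_pmf draws. \<exists>s'. run (point @ jumps J' @ relabel) (s0 g) s' \<and> inv s' (newcl cl (Fg g))"
  using run_rest[OF _ s1(2)] unfolding s0_def by blast
 then obtain s' where s': "\<And>g. g \<in> set_pmf draws \<Longrightarrow> run (point @ jumps J' @ relabel) (s0 g) (s' g)"
  "\<And>g. g \<in> set_pmf draws \<Longrightarrow> inv (s' g) (newcl cl (Fg g))" by metis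
 have "prog_sem L (phase_prog \<theta>) (arr s) = bind_pmf draws (\<lambda>g. prog_sem L (point @ jumps J' @ relabel) (arr (s0 g)))"
  unfolding phase_prog_def prog_sem_append[of _ prep] prog_sem_append[of _ "[_]"] s1(1)[unfolded run_def, THEN conjunct1] bind_return_pmf
  unfolding rs by (simp only: bind_return_pmf bind_map_pmf)
 also have "\<dots> = bind_pmf draws (\<lambda>g. return_pmf (arr (s' g)))"
  by (intro bind_pmf_cong refl) (use s'(1) in \<open>simp add: run_def\<close>)
 finally have sem: "prog_sem L (phase_prog \<theta>) (arr s) = map_pmf (\<lambda>g. arr (s' g)) draws" by (simp add: map_pmf_def)
 define B where "B v = {F. R \<le> 2 * card {rp. rp < R \<and> ph.bad \<alpha> \<pi> v rp F}}" for v
 have Bp: "measure_pmf.prob draws (Fg -` B v) \<le> (1 / 2) ^ R" if v: "v < n" for v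
 proof -
  have "measure_pmf.prob draws (Fg -` B v) = measure_pmf.prob (Pi_pmf ph.Xs 0 ph.Dk) (B v)"
   unfolding draws_Dk[symmetric] by simp
  also have "\<dots> \<le> (1 / 2) ^ R" unfolding B_def
  proof (rule ph.majority_good[OF R])
   fix rp assume "rp < R"
   then show "measure_pmf.prob (Pi_pmf ph.Xs 0 ph.Dk) {F. ph.bad \<alpha> \<pi> v rp F} \<le> 1 / 16"
    by (rule ph.bad_prob[OF pr _ v \<kappa>0 K _ \<alpha> tail[OF v] c3[OF v]]) (use \<kappa> in \<open>simp add: ph.DD_def\<close>)
  qed
  finally show ?thesis .
 qed
 have "good \<alpha> \<pi> (newcl cl (Fg g))" if g: "g \<in> set_pmf draws" and nB: "g \<notin> (\<Union>v<n. Fg -` B v)" for g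
  unfolding good_def
 proof (intro allI impI)
  fix v assume v: "v < n"
  have "{rp. rp < R \<and> off_target \<alpha> (\<pi> v) (ccnt (newcl cl (Fg g)) (v * R + rp))} = {rp. rp < R \<and> ph.bad \<alpha> \<pi> v rp (Fg g)}"
   using ccnt_newcl[OF g v] by (auto simp: off_target_def ph.bad_def)
  moreover have "\<not> R \<le> 2 * card {rp. rp < R \<and> ph.bad \<alpha> \<pi> v rp (Fg g)}" using nB v by (auto simp: B_def)
  ultimately show "2 * card {rp. rp < R \<and> off_target \<alpha> (\<pi> v) (ccnt (newcl cl (Fg g)) (v * R + rp))} < R" by simp
 qed
 then have sub: "set_pmf draws - (\<Union>v<n. Fg -` B v) \<subseteq> (\<lambda>g. arr (s' g)) -` reached \<alpha> \<pi>"
  using s'(2) unfolding reached_def by blast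
 have "1 - real n * (1 / 2) ^ R \<le> 1 - measure_pmf.prob draws (\<Union>v<n. Fg -` B v)"
 proof -
  have "measure_pmf.prob draws (\<Union>v<n. Fg -` B v) \<le> (\<Sum>v<n. measure_pmf.prob draws (Fg -` B v))"
   by (intro measure_pmf.finite_measure_subadditive_finite) auto
  also have "\<dots> \<le> (\<Sum>v<n. (1 / 2) ^ R)" by (intro sum_mono Bp) auto
  finally show ?thesis by simp
 qed
 also have "\<dots> = measure_pmf.prob draws (UNIV - (\<Union>v<n. Fg -` B v))"
  using measure_pmf.prob_compl[of "\<Union>v<n. Fg -` B v" draws] by simp
 \<comment> \<open>Correctness of the deterministic part is known only for draws in the
   support.\<close>
 also have "\<dots> = measure_pmf.prob draws (set_pmf draws - (\<Union>v<n. Fg -` B v))"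
  by (rule measure_prob_cong_0) (auto simp: pmf_eq_0_set_pmf)
 also have "\<dots> \<le> measure_pmf.prob draws ((\<lambda>g. arr (s' g)) -` reached \<alpha> \<pi>)"
  by (intro measure_pmf.finite_measure_mono sub) simp
 finally show ?thesis unfolding sem by simp
qed

end

section \<open>Loading the edges\<close>

context machine
begin

text \<open>The sorted array contains the edge codes \<open>tail * n + head\<close>. The field
  \<open>c_ow\<close> keeps the tail for the two counts that compute offsets and degrees, and the
  label \<open>c mod q\<close> distributes the tokens evenly.\<close>

definition load :: "nat \<Rightarrow> nat \<Rightarrow> array \<Rightarrow> array" where
 "load n q x c = (if c < half then enc Z \<lparr>c_eh = (x c mod n) mod Z, c_eo = 0, c_dg = 0, c_cl = (c mod q) mod Z, c_rk = 0,
   c_of = 0, c_nn = 0, c_ow = (x c div n) mod Z, c_oe = 0, c_od = 0, c_st = 0, c_ii = 0, c_rr = 0, c_pt = 0\<rparr> mod W else 0)"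

definition setup_prog :: "nat \<Rightarrow> nat \<Rightarrow> nat \<Rightarrow> array_step list" where
 "setup_prog n m q = sort_prog b d a @ [detstep (load n q) id]
  @ count m (\<lambda>r. (c_ow r + 1) mod Z) (\<lambda>c r p. r\<lparr>c_eo := p\<rparr>)
  @ count m c_ow (\<lambda>c r p. r\<lparr>c_dg := p - c_eo r\<rparr>)"

lemma vprog_setup: "vprog (setup_prog n m q) 4"
proof -
 have "computes L (2 ^ b) W (sort_prog b d a) (\<lambda>x. crop L (seg_sort (2 ^ a) x))"
  by (rule computes_sort_prog[OF b4 W_pos _ depth(1)]) (simp add: L_def)
 then have "vprog (sort_prog b d a) 1"
  using length_sort_prog[of b d a] by (auto simp: vprog_def computes_def ulen_def)
 moreover have "vprog [detstep (load n q) id] 1"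
 proof -
  have "valid_step L (2 ^ b) W (detstep (load n q) id)"
   by (rule valid_cellwise) (use W_pos in \<open>simp_all add: load_def\<close>)
  then show ?thesis by (simp add: vprog_def ulen_def)
 qed
 ultimately have "vprog (setup_prog n m q) (1 + (1 + (1 + 1)))" unfolding setup_prog_def
  by (intro vprog_append vprog_count)
 then show ?thesis by (simp add: numeral_eq_Suc)
qed

lemma run_setup:
 assumes x: "wf_array L W x" and m: "m \<le> half" "half < Z" and n: "0 < n" "n < Z" and q: "0 < q" "q \<le> half"
  and ym: "\<And>c. c < m \<Longrightarrow> seg_sort L x c < n * n"
 defines "y \<equiv> seg_sort L x"
 shows "\<exists>s. prog_sem L (setup_prog n m q) x = return_pmf (arr s) \<and> wfs s \<and> (\<forall>c<m. c_eh (s c) = y c mod n) \<and>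
  (\<forall>v. c_eo (s v) = card {c. c < m \<and> y c div n < v} \<and> c_dg (s v) = card {c. c < m \<and> y c div n = v}) \<and>
  (\<forall>c<half. c_cl (s c) = c mod q)"
proof -
 have Z0: "0 < Z" using Z2 by simp
 have "computes L (2 ^ b) W (sort_prog b d a) (\<lambda>x. crop L (seg_sort (2 ^ a) x))"
  by (rule computes_sort_prog[OF b4 W_pos _ depth(1)]) (simp add: L_def)
 then have p1: "prog_sem L (sort_prog b d a) x = return_pmf (crop L y)"
  using x unfolding computes_def y_def L_def by blast
 define s1 :: "nat \<Rightarrow> cell" where "s1 c = \<lparr>c_eh = (y c mod n) mod Z, c_eo = 0, c_dg = 0, c_cl = (c mod q) mod Z, c_rk = 0,
   c_of = 0, c_nn = 0, c_ow = (y c div n) mod Z, c_oe = 0, c_od = 0, c_st = 0, c_ii = 0, c_rr = 0, c_pt = 0\<rparr>" for c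
 have w1: "wfs s1" unfolding wfs_def using Z0 by (simp add: in_cells s1_def)
 have "prog_sem L [detstep (load n q) id] (crop L y) = return_pmf (arr s1)"
 proof -
  have "crop L (\<lambda>c. load n q (crop L y) (id c)) = arr s1"
  proof
   fix c
   show "crop L (\<lambda>c. load n q (crop L y) (id c)) c = arr s1 c"
   proof (cases "c < half")
    case True
    then have "s1 c \<in> cells Z" using w1 by (simp add: wfs_def)
    then have "enc Z (s1 c) < W" using enc_less[of "s1 c" Z] ZW(1) by linarith
    then show ?thesis using True L2 by (simp add: crop_def load_def arr_def s1_def)
   qed (simp add: crop_def load_def arr_def)
  qed
  then show ?thesis by (subst prog_sem_detstep) auto
 qed
 then have p12: "prog_sem L (sort_prog b d a @ [detstep (load n q) id]) x = return_pmf (arr s1)"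
  by (simp only: prog_sem_append p1 bind_return_pmf)
 define s2 where "s2 = (\<lambda>c. (s1 c)\<lparr>c_eo := card {i. i < m \<and> (c_ow (s1 i) + 1) mod Z \<le> c}\<rparr>)"
 have r2: "run (count m (\<lambda>r. (c_ow r + 1) mod Z) (\<lambda>c r p. r\<lparr>c_eo := p\<rparr>)) s1 s2"
  by (rule run_count[OF w1 m]) (use m Z0 in \<open>auto simp: in_cells s2_def\<close>)
 have w2: "wfs s2" using r2 by (simp add: run_def)
 define s3 where "s3 = (\<lambda>c. (s2 c)\<lparr>c_dg := card {i. i < m \<and> c_ow (s2 i) \<le> c} - c_eo (s2 c)\<rparr>)"
 have r3: "run (count m c_ow (\<lambda>c r p. r\<lparr>c_dg := p - c_eo r\<rparr>)) s2 s3"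
  by (rule run_count[OF w2 m]) (use m Z0 in \<open>auto simp: in_cells s3_def\<close>)
 have w3: "wfs s3" using r3 by (simp add: run_def)
 have "prog_sem L (setup_prog n m q) x = return_pmf (arr s3)"
 proof -
  have "run (count m (\<lambda>r. (c_ow r + 1) mod Z) (\<lambda>c r p. r\<lparr>c_eo := p\<rparr>) @ count m c_ow (\<lambda>c r p. r\<lparr>c_dg := p - c_eo r\<rparr>)) s1 s3"
   by (rule run_append[OF r2 r3])
  then show ?thesis
   unfolding setup_prog_def append_assoc[symmetric, of "sort_prog b d a"] prog_sem_append[of L "sort_prog b d a @ _"] p12
   by (simp only: bind_return_pmf run_def)
 qed
 moreover have yd: "y c div n < n" if "c < m" for c using ym[OF that] by (simp add: y_def less_mult_imp_div_less)
 have ow: "c_ow (s1 c) = y c div n" "(c_ow (s1 c) + 1) mod Z = y c div n + 1" if "c < m" for c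
  using yd[OF that] n by (simp_all add: s1_def)
 have eo: "c_eo (s2 v) = card {c. c < m \<and> y c div n < v}" for v
  unfolding s2_def using ow by (auto intro!: arg_cong[of _ _ card])
 have "c_dg (s3 v) = card {c. c < m \<and> y c div n = v}" for v
 proof -
  have "{c. c < m \<and> y c div n \<le> v} = {c. c < m \<and> y c div n < v} \<union> {c. c < m \<and> y c div n = v}" by auto
  then have "card {c. c < m \<and> y c div n \<le> v} = card ({c. c < m \<and> y c div n < v} \<union> {c. c < m \<and> y c div n = v})"
   by (rule arg_cong)
  also have "\<dots> = card {c. c < m \<and> y c div n < v} + card {c. c < m \<and> y c div n = v}"
   by (rule card_Un_disjoint) auto
  finally have e: "card {c. c < m \<and> y c div n \<le> v} = card {c. c < m \<and> y c div n < v} + card {c. c < m \<and> y c div n = v}" .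
  have "{i. i < m \<and> c_ow (s2 i) \<le> v} = {c. c < m \<and> y c div n \<le> v}"
   using ow(1) by (auto simp: s2_def)
  then have "c_dg (s3 v) = card {c. c < m \<and> y c div n \<le> v} - c_eo (s2 v)" unfolding s3_def by simp
  then show ?thesis unfolding e eo by simp
 qed
 moreover have "c_eo (s3 v) = c_eo (s2 v)" "c_eh (s3 v) = c_eh (s1 v)" "c_cl (s3 v) = c_cl (s1 v)" for v
  by (simp_all add: s3_def s2_def)
 moreover have "c_eh (s1 c) = y c mod n" for c
 proof -
  have "y c mod n < n" using n by simp
  then have "y c mod n < Z" using n by linarith
  then show ?thesis by (simp only: s1_def cell.simps mod_less)
 qed
 moreover have "c_cl (s1 c) = c mod q" for c
 proof -
  have "c mod q < q" using q by simp
  then have "c mod q < Z" using q m by linarith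
  then show ?thesis by (simp only: s1_def cell.simps mod_less)
 qed
 ultimately show ?thesis using w3 eo by (intro exI[of _ s3]) simp
qed

end

text \<open>Sorting by \<open>tail * n + head\<close> makes the edges with tail \<open>v\<close>
  contiguous, from the number of edges with smaller tail onwards. Parallel edges occupy separate
  places, so multiplicities survive.\<close>

lemma sorted_edges:
 fixes y :: "nat \<Rightarrow> nat"
 assumes mono: "\<And>c c'. c \<le> c' \<Longrightarrow> c' < m \<Longrightarrow> y c \<le> y c'" and n: "0 < n"
 defines "eo \<equiv> \<lambda>v. card {c. c < m \<and> y c div n < v}" and "dg \<equiv> \<lambda>v. card {c. c < m \<and> y c div n = v}"
 shows "eo v + dg v \<le> m"
  and "w < n \<Longrightarrow> card {i. i < dg v \<and> y (eo v + i) mod n = w} = card {c. c < m \<and> y c = v * n + w}"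
proof -
 let ?A = "\<lambda>v. {c. c < m \<and> y c div n < v}"
 have A: "?A v = {..<eo v}" for v
 proof -
  have down: "c' \<in> ?A v \<Longrightarrow> c \<le> c' \<Longrightarrow> c \<in> ?A v" for c c'
   using mono[of c c'] div_le_mono[of "y c" "y c'" n] by auto
  have fin: "finite (?A v)" by simp
  show ?thesis
  proof (cases "?A v = {}")
   case False
   have "?A v = {..Max (?A v)}"
    using Max_in[OF fin False] Max_ge[OF fin] down by blast
   then have "eo v = Suc (Max (?A v))" unfolding eo_def using card_atMost by metis
   then show ?thesis using \<open>?A v = {..Max (?A v)}\<close> by (simp add: lessThan_Suc_atMost)
  next
   case True
   then show ?thesis unfolding eo_def by (simp only: card.empty lessThan_0)
  qed
 qed
 have un: "?A (Suc v) = ?A v \<union> {c. c < m \<and> y c div n = v}" by auto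
 have "card (?A v \<union> {c. c < m \<and> y c div n = v}) = eo v + dg v"
  unfolding eo_def dg_def by (rule card_Un_disjoint) auto
 then have S: "eo (Suc v) = eo v + dg v" unfolding eo_def un .
 have "card (?A (Suc v)) \<le> card {..<m}" by (intro card_mono) auto
 then show "eo v + dg v \<le> m" using S by (simp add: eo_def)
 have seg: "c < m \<and> y c div n = v \<longleftrightarrow> eo v \<le> c \<and> c < eo v + dg v" for c
 proof -
  have "c < m \<and> y c div n = v \<longleftrightarrow> c \<in> ?A (Suc v) \<and> c \<notin> ?A v" by auto
  then show ?thesis unfolding A S by auto
 qed
 show "card {i. i < dg v \<and> y (eo v + i) mod n = w} = card {c. c < m \<and> y c = v * n + w}" if w: "w < n"
 proof -
  have eq: "c < m \<and> y c = v * n + w \<longleftrightarrow> (c < m \<and> y c div n = v) \<and> y c mod n = w" for c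
   using mult_add_div_mod[OF w, of v] div_mult_mod_eq[of "y c" n] by auto
  have "bij_betw (\<lambda>i. eo v + i) {i. i < dg v \<and> y (eo v + i) mod n = w} {c. c < m \<and> y c = v * n + w}"
  proof (rule bij_betwI[where g = "\<lambda>c. c - eo v"])
   show "(\<lambda>i. eo v + i) \<in> {i. i < dg v \<and> y (eo v + i) mod n = w} \<rightarrow> {c. c < m \<and> y c = v * n + w}"
    unfolding eq seg by auto
   show "(\<lambda>c. c - eo v) \<in> {c. c < m \<and> y c = v * n + w} \<rightarrow> {i. i < dg v \<and> y (eo v + i) mod n = w}"
    unfolding eq seg by auto
   show "eo v + (c - eo v) = c" if "c \<in> {c. c < m \<and> y c = v * n + w}" for c
    using that unfolding eq seg by auto
  qed auto
  then show ?thesis by (rule bij_betw_same_card)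
 qed
qed

text \<open>Two words of input become one edge code. Free places are filled with
  \<open>W - 1\<close>, which exceeds every code and is sorted behind all edges.\<close>

definition pack :: "nat \<Rightarrow> nat \<Rightarrow> nat list \<Rightarrow> nat \<Rightarrow> nat" where
 "pack n W xs j = (if 2 * j + 1 < length xs then (xs ! (2 * j) * n + xs ! (2 * j + 1)) mod W else W - 1)"

lemma length_pairs: "length (concat (map (\<lambda>(u, v). [u, v]) es)) = 2 * length es"
 by (induction es) auto

lemma nth_pairs:
 "j < length es \<Longrightarrow> concat (map (\<lambda>(u, v). [u, v]) es) ! (2 * j) = fst (es ! j) \<and>
   concat (map (\<lambda>(u, v). [u, v]) es) ! (2 * j + 1) = snd (es ! j)"
proof (induction es arbitrary: j)
 case (Cons e es)
 then show ?case by (cases j) (auto split: prod.splits)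
qed simp

lemma card_blocks:
 assumes "0 < (B::nat)"
 shows "card {c. c < M * B \<and> P c} = (\<Sum>i<M. card {j. j < B \<and> P (i * B + j)})"
proof -
 have "{c. c < M * B \<and> P c} = (\<lambda>(i, j). i * B + j) ` (SIGMA i:{..<M}. {j. j < B \<and> P (i * B + j)})"
 proof (intro set_eqI iffI)
  fix c assume c: "c \<in> {c. c < M * B \<and> P c}"
  then have "(c div B, c mod B) \<in> (SIGMA i:{..<M}. {j. j < B \<and> P (i * B + j)})"
   using assms by (auto simp: div_less_iff_less_mult)
  then show "c \<in> (\<lambda>(i, j). i * B + j) ` (SIGMA i:{..<M}. {j. j < B \<and> P (i * B + j)})"
   by (rule rev_image_eqI) simp
 next
  fix c assume "c \<in> (\<lambda>(i, j). i * B + j) ` (SIGMA i:{..<M}. {j. j < B \<and> P (i * B + j)})"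
  then obtain i j where "i < M" "j < B" "P (i * B + j)" "c = i * B + j" by auto
  then show "c \<in> {c. c < M * B \<and> P c}" using mult_add_less[of i M j B] by simp
 qed
 moreover have "inj_on (\<lambda>(i, j). i * B + j) (SIGMA i:{..<M}. {j. j < B \<and> P (i * B + j)})"
 proof (rule inj_onI, clarify)
  fix i j i' j' assume jj: "j < B" "j' < B" and e: "i * B + j = i' * B + j'"
  show "i = i' \<and> j = j'" using mult_add_div_mod[OF jj(1), of i] mult_add_div_mod[OF jj(2), of i'] unfolding e by simp
 qed
 ultimately show ?thesis by (simp add: card_image)
qed

text \<open>A machine stores an edge in two words, so at most \<open>S / 2\<close> edges, which is
  less than \<open>B\<close>; its whole input fits into one block after packing. However the edges
  are distributed, the array has the same number of cells for each pair of tail and head, and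
  nothing else is used later.\<close>

lemma packed_input:
 assumes G: "fin_digraph G" "verts G = {..<n}" and inp: "edge_input S M G mem" and B: "S < 2 * B" "0 < B" and W: "n * n < W"
 defines "x \<equiv> \<lambda>c. pack n W (mem (c div B)) (c mod B)"
 shows "card {c. c < M * B \<and> x c < n * n} = card (arcs G)"
  and "v < n \<Longrightarrow> w < n \<Longrightarrow> card {c. c < M * B \<and> x c = v * n + w} = card {e \<in> arcs G. tail G e = v \<and> head G e = w}"
  and "x c < W"
proof -
 interpret fin_digraph G by (rule G(1))
 show "x c < W" using W by (auto simp: x_def pack_def)
 obtain es where es: "\<And>i. i < M \<Longrightarrow> mem i = concat (map (\<lambda>(u, v). [u, v]) (es i))"
  "\<And>i. i < M \<Longrightarrow> length (mem i) \<le> S" "(\<Sum>i<M. mset (es i)) = image_mset (arc_to_ends G) (mset_set (arcs G))"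
  using inp unfolding edge_input_def by blast
 have lenB: "length (es i) < B" if "i < M" for i
  using es(1,2)[OF that] B length_pairs[of "es i"] by simp
 have ends: "fst e < n \<and> snd e < n" if i: "i < M" and e: "e \<in> set (es i)" for i e
 proof -
  have "e \<in># (\<Sum>i<M. mset (es i))" using i e by (auto simp: set_mset_sum)
  then obtain a where "a \<in> arcs G" "e = (tail G a, head G a)" unfolding es(3) by (auto simp: arc_to_ends_def)
  then show ?thesis using wellformed G(2) by auto
 qed
 have x: "x (i * B + j) = (if j < length (es i) then fst (es i ! j) * n + snd (es i ! j) else W - 1)" if i: "i < M" and j: "j < B" for i j
 proof -
  have "x (i * B + j) = pack n W (mem i) j" unfolding x_def by (simp only: mult_add_div_mod[OF j])
  also have "\<dots> = (if j < length (es i) then (fst (es i ! j) * n + snd (es i ! j)) mod W else W - 1)"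
   using nth_pairs[of j "es i"] unfolding pack_def es(1)[OF i] length_pairs by auto
  also have "\<dots> = (if j < length (es i) then fst (es i ! j) * n + snd (es i ! j) else W - 1)"
  proof (cases "j < length (es i)")
   case True
   then have "fst (es i ! j) * n + snd (es i ! j) < n * n" using ends[OF i nth_mem[OF True]] mult_add_less by blast
   then show ?thesis using W True by simp
  qed simp
  finally show ?thesis .
 qed
 have big: "\<not> W - 1 < n * n" using W by simp
 have c1: "card {j. j < B \<and> x (i * B + j) < n * n} = length (es i)" if i: "i < M" for i
 proof -
  have "{j. j < B \<and> x (i * B + j) < n * n} = {..<length (es i)}"
  proof (intro set_eqI iffI)
   fix j assume "j \<in> {j. j < B \<and> x (i * B + j) < n * n}"
   then show "j \<in> {..<length (es i)}" using x[OF i, of j] big by (auto split: if_splits)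
  next
   fix j assume j: "j \<in> {..<length (es i)}"
   then have "fst (es i ! j) * n + snd (es i ! j) < n * n" using ends[OF i, of "es i ! j"] mult_add_less by simp
   then show "j \<in> {j. j < B \<and> x (i * B + j) < n * n}" using x[OF i, of j] j lenB[OF i] by simp
  qed
  then show ?thesis by simp
 qed
 have "card {c. c < M * B \<and> x c < n * n} = (\<Sum>i<M. length (es i))"
  unfolding card_blocks[OF B(2)] using c1 by simp
 also have "\<dots> = size (\<Sum>i<M. mset (es i))" by (simp add: size_multiset_sum)
 also have "\<dots> = card (arcs G)" unfolding es(3) by simp
 finally show "card {c. c < M * B \<and> x c < n * n} = card (arcs G)" .
 assume v: "v < n" and w: "w < n"
 have c2: "card {j. j < B \<and> x (i * B + j) = v * n + w} = count (mset (es i)) (v, w)" if i: "i < M" for i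
 proof -
  have vw: "v * n + w < n * n" by (rule mult_add_less[OF v w])
  have eq: "fst e * n + snd e = v * n + w \<longleftrightarrow> e = (v, w)" if "e \<in> set (es i)" for e
  proof
   assume e: "fst e * n + snd e = v * n + w"
   have s: "snd e < n" using ends[OF i that] by blast
   show "e = (v, w)" using mult_add_div_mod[OF s, of "fst e"] mult_add_div_mod[OF w, of v] unfolding e by (simp add: prod_eq_iff)
  qed auto
  have "{j. j < B \<and> x (i * B + j) = v * n + w} = {j. j < length (es i) \<and> (v, w) = es i ! j}"
  proof (intro set_eqI iffI)
   fix j assume j: "j \<in> {j. j < B \<and> x (i * B + j) = v * n + w}"
   then have "j < length (es i)" using x[OF i, of j] big vw by (cases "j < length (es i)") auto
   then show "j \<in> {j. j < length (es i) \<and> (v, w) = es i ! j}" using x[OF i, of j] j eq[OF nth_mem, of j] by auto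
  next
   fix j assume j: "j \<in> {j. j < length (es i) \<and> (v, w) = es i ! j}"
   then have "j < B" "es i ! j = (v, w)" using lenB[OF i] by auto
   then show "j \<in> {j. j < B \<and> x (i * B + j) = v * n + w}" using x[OF i, of j] j by simp
  qed
  then show ?thesis by (simp add: count_mset length_filter_conv_card count_list_eq_length_filter)
 qed
 have "card {c. c < M * B \<and> x c = v * n + w} = (\<Sum>i<M. count (mset (es i)) (v, w))"
  unfolding card_blocks[OF B(2)] using c2 by simp
 also have "\<dots> = count (\<Sum>i<M. mset (es i)) (v, w)" by (simp add: count_sum)
 also have "\<dots> = card {e \<in> arcs G. tail G e = v \<and> head G e = w}"
  unfolding es(3) by (subst count_image_mset_eq_card_vimage) (auto simp: arc_to_ends_def intro!: arg_cong[of _ _ card])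
 finally show "card {c. c < M * B \<and> x c = v * n + w} = card {e \<in> arcs G. tail G e = v \<and> head G e = w}" .
qed

lemma prob_bind_ge:
 assumes f: "\<And>x. x \<in> A \<Longrightarrow> measure_pmf.prob (f x) B \<ge> 1 - \<delta>" and p: "measure_pmf.prob p A \<ge> 1 - \<delta>'" and \<delta>: "0 \<le> \<delta>"
 shows "measure_pmf.prob (bind_pmf p f) B \<ge> 1 - (\<delta>' + \<delta>)"
proof -
 have "measure_pmf.prob (bind_pmf p f) B = measure_pmf.expectation p (\<lambda>x. measure_pmf.prob (f x) B)"
  unfolding measure_pmf_bind by (subst measure_pmf.measure_bind[where N = "count_space UNIV"]) (auto simp: measure_pmf_in_subprob_algebra)
 also have "\<dots> \<ge> measure_pmf.expectation p (\<lambda>x. indicat_real A x - \<delta>)"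
 proof (rule integral_mono)
  show "indicat_real A x - \<delta> \<le> measure_pmf.prob (f x) B" for x
  proof (cases "x \<in> A")
   case False
   then show ?thesis using order_trans[of "- \<delta>" 0 "measure_pmf.prob (f x) B"] \<delta> by simp
  qed (use f[of x] in simp)
  show "integrable (measure_pmf p) (\<lambda>x. measure_pmf.prob (f x) B)"
   by (rule measure_pmf.integrable_const_bound[where B = 1]) (auto)
  show "integrable (measure_pmf p) (\<lambda>x. indicat_real A x - \<delta>)"
   by (rule measure_pmf.integrable_const_bound[where B = "1 + \<delta>"]) (use \<delta> in \<open>auto simp: indicator_def\<close>)
 qed
 also have "measure_pmf.expectation p (\<lambda>x. indicat_real A x - \<delta>) = measure_pmf.prob p A - \<delta>"
 proof -
  have "integrable (measure_pmf p) (indicat_real A)"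
   by (rule measure_pmf.integrable_const_bound[where B = 1]) (auto simp: indicator_def)
  then show ?thesis by (subst Bochner_Integration.integral_diff) auto
 qed
 finally show ?thesis using p by linarith
qed

text \<open>The number \<open>p\<close> is a median. More than half of the values are within
  \<open>e\<close> of \<open>c\<close>, so neither a majority at or below \<open>p\<close> can lie
  under this interval nor can \<open>p\<close> lie above it.\<close>

lemma majority_least:
 fixes X :: "nat \<Rightarrow> nat"
 assumes maj: "2 * card {rp. rp < R \<and> e < \<bar>real (X rp) - c\<bar>} < R"
 defines "p \<equiv> (LEAST p. R < 2 * card {rp. rp < R \<and> X rp \<le> p})"
 shows "\<bar>real p - c\<bar> \<le> e"
proof -
 let ?B = "{rp. rp < R \<and> e < \<bar>real (X rp) - c\<bar>}" and ?G = "{rp. rp < R \<and> \<bar>real (X rp) - c\<bar> \<le> e}"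
 have "?B \<union> ?G = {..<R}" by auto
 moreover have "card (?B \<union> ?G) = card ?B + card ?G" by (rule card_Un_disjoint) auto
 ultimately have "card ?B + card ?G = R" by simp
 then have G: "R < 2 * card ?G" using maj by linarith
 then have ne: "?G \<noteq> {}" by (metis card.empty mult_0_right not_less_zero)
 define p0 where "p0 = Max (X ` ?G)"
 have p0: "p0 \<in> X ` ?G" unfolding p0_def by (rule Max_in) (use ne in auto)
 have "card ?G \<le> card {rp. rp < R \<and> X rp \<le> p0}" by (intro card_mono) (auto simp: p0_def)
 then have ok: "R < 2 * card {rp. rp < R \<and> X rp \<le> p0}" using G by linarith
 have "p \<le> p0" unfolding p_def using ok by (rule Least_le)
 moreover have "real p0 - c \<le> e" using p0 by auto
 moreover have "- e \<le> real p - c"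
 proof (rule ccontr)
  assume lt: "\<not> - e \<le> real p - c"
  have "R < 2 * card {rp. rp < R \<and> X rp \<le> p}" unfolding p_def using ok by (rule LeastI)
  moreover have "card {rp. rp < R \<and> X rp \<le> p} \<le> card ?B"
  proof (intro card_mono subsetI)
   fix rp assume "rp \<in> {rp. rp < R \<and> X rp \<le> p}"
   then have "rp < R" "real (X rp) \<le> real p" by auto
   then show "rp \<in> ?B" using lt by auto
  qed simp
  ultimately show False using maj by linarith
 qed
 ultimately show ?thesis by linarith
qed

section \<open>Iterating the phases and reading off the estimates\<close>

context walker
begin

definition phases :: "(nat \<Rightarrow> real) \<Rightarrow> nat \<Rightarrow> array_step list" where
 "phases \<theta>s I = concat (map (\<lambda>i. phase_prog (\<theta>s (Suc i))) [0..<I])"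

lemma phases_Suc: "phases \<theta>s (Suc I) = phases \<theta>s I @ phase_prog (\<theta>s (Suc I))"
 by (simp add: phases_def)

lemma vprog_phases: "vprog (phases \<theta>s I) (I * (J' + 11))"
proof (induction I)
 case (Suc I)
 from vprog_append[OF this vprog_phase, of "\<theta>s (Suc I)"] show ?case by (simp add: phases_Suc add.commute)
qed (simp add: phases_def vprog_def)

text \<open>The requirements of one phase, stated for the ideal vectors \<open>\<pi>\<close> before
  and \<open>\<pi>'\<close> after it. The pool sizes are random, so they are replaced by the lower
  bound of \<open>nnc_lower\<close>.\<close>

definition step_ok :: "real \<Rightarrow> real \<Rightarrow> (nat \<Rightarrow> real) \<Rightarrow> real \<Rightarrow> (nat \<Rightarrow> real) \<Rightarrow> bool" where
 "step_ok \<alpha> \<kappa> \<pi> \<theta> \<pi>' \<longleftrightarrow> 0 \<le> \<theta> \<and> \<theta> < 1 \<and> is_pr \<theta> \<pi>' \<and>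
   (\<forall>w<n. 0 \<le> \<pi> w \<and> green \<theta> (2 * l) w \<le> \<kappa> * (3 / 8 * real R * real K * real n * \<pi> w) \<and>
    2 * \<theta> ^ l \<le> \<alpha> / 2 * \<pi>' w \<and> 128 * (1 / (real K * real n) + 4 * \<kappa>) \<le> \<alpha>\<^sup>2 * \<pi>' w)"

text \<open>At least half of the repetitions are accurate and each of these has at least 3/4 of the
  expected number of tokens at \<open>w\<close>; pools collect the tokens of all repetitions. This
  gives the constant 3/8, and inaccurate repetitions can only enlarge the pool.\<close>

lemma nnc_lower:
 assumes good: "good \<alpha> \<pi> cl" and \<alpha>: "\<alpha> \<le> 1 / 4" and w: "w < n" and \<pi>: "0 \<le> \<pi> w"
 shows "3 / 8 * real R * real K * real n * \<pi> w \<le> real (nnc cl w)"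
proof -
 define e where "e = real K * real n * \<pi> w"
 have e0: "0 \<le> e" using \<pi> by (simp add: e_def)
 let ?B = "{rp. rp < R \<and> off_target \<alpha> (\<pi> w) (ccnt cl (w * R + rp))}" and ?G = "{rp. rp < R \<and> \<not> off_target \<alpha> (\<pi> w) (ccnt cl (w * R + rp))}"
 have "?B \<union> ?G = {..<R}" by auto
 moreover have "card (?B \<union> ?G) = card ?B + card ?G" by (rule card_Un_disjoint) auto
 ultimately have "card ?B + card ?G = R" by simp
 moreover have "2 * card ?B < R" using good w by (simp add: good_def)
 ultimately have G: "R \<le> 2 * card ?G" by linarith
 have c: "3 / 4 * e \<le> real (ccnt cl (w * R + rp))" if "rp \<in> ?G" for rp
 proof -
  have "\<bar>real (ccnt cl (w * R + rp)) - e\<bar> \<le> \<alpha> * e" using that by (simp add: off_target_def e_def)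
  moreover have "\<alpha> * e \<le> 1 / 4 * e" by (rule mult_right_mono[OF \<alpha> e0])
  ultimately show ?thesis by linarith
 qed
 have "real R / 2 * (3 / 4 * e) \<le> real (card ?G) * (3 / 4 * e)"
  using G e0 by (intro mult_right_mono) auto
 also have "\<dots> = (\<Sum>rp\<in>?G. 3 / 4 * e)" by simp
 also have "\<dots> \<le> (\<Sum>rp\<in>?G. real (ccnt cl (w * R + rp)))" by (intro sum_mono c)
 also have "\<dots> = real (card (\<Union>rp\<in>?G. {i. nR \<le> i \<and> i < T \<and> cl i = w * R + rp}))"
  unfolding ccnt_def by (subst card_UN_disjoint) auto
 also have "\<dots> \<le> real (nnc cl w)"
 proof -
  have "(w * R + rp) div R = w" if "rp < R" for rp by (rule mult_add_div_mod(1)[OF that])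
  then show ?thesis unfolding nnc_eq(1) of_nat_le_iff by (intro card_mono) auto
 qed
 finally show ?thesis by (simp add: e_def)
qed

lemma phases_prob:
 assumes R: "even R" and K: "0 < K" and \<kappa>0: "0 \<le> \<kappa>" and \<alpha>: "0 < \<alpha>" "\<alpha> \<le> 1 / 4"
  and ok: "\<And>i. i < I \<Longrightarrow> step_ok \<alpha> \<kappa> (\<pi>s i) (\<theta>s (Suc i)) (\<pi>s (Suc i))" and x: "x \<in> reached \<alpha> (\<pi>s 0)"
 shows "measure_pmf.prob (prog_sem L (phases \<theta>s I) x) (reached \<alpha> (\<pi>s I)) \<ge> 1 - real I * (real n * (1 / 2) ^ R)"
 using ok
proof (induction I)
 case 0
 then show ?case using x by (simp add: phases_def prog_sem_Nil)
next
 case (Suc I)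
 have so: "step_ok \<alpha> \<kappa> (\<pi>s I) (\<theta>s (Suc I)) (\<pi>s (Suc I))" using Suc.prems by simp
 have "measure_pmf.prob (prog_sem L (phase_prog (\<theta>s (Suc I))) y) (reached \<alpha> (\<pi>s (Suc I))) \<ge> 1 - real n * (1 / 2) ^ R"
  if "y \<in> reached \<alpha> (\<pi>s I)" for y
 proof -
  obtain s cl where s: "y = arr s" "inv s cl" "good \<alpha> (\<pi>s I) cl" using \<open>y \<in> _\<close> unfolding reached_def by blast
  show ?thesis unfolding s(1)
  proof (rule phase_prob[OF s(2) _ _ R _ \<kappa>0 K _ \<alpha>(1)])
   fix w assume w: "w < n"
   have p: "0 \<le> \<pi>s I w" using so w by (simp add: step_ok_def)
   have "green (\<theta>s (Suc I)) (2 * l) w \<le> \<kappa> * (3 / 8 * real R * real K * real n * \<pi>s I w)"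
    using so w by (simp add: step_ok_def)
   also have "\<dots> \<le> \<kappa> * real (nnc cl w)" by (rule mult_left_mono[OF nnc_lower[where \<pi> = "\<pi>s I", OF s(3) \<alpha>(2) w p] \<kappa>0])
   finally show "green (\<theta>s (Suc I)) (2 * l) w \<le> \<kappa> * real (nnc cl w)" .
  qed (use so \<alpha> in \<open>auto simp: step_ok_def\<close>)
 qed
 moreover have "measure_pmf.prob (prog_sem L (phases \<theta>s I) x) (reached \<alpha> (\<pi>s I)) \<ge> 1 - real I * (real n * (1 / 2) ^ R)"
  by (rule Suc.IH) (use Suc.prems in simp)
 ultimately have "measure_pmf.prob (prog_sem L (phases \<theta>s I) x \<bind> prog_sem L (phase_prog (\<theta>s (Suc I)))) (reached \<alpha> (\<pi>s (Suc I)))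
   \<ge> 1 - (real I * (real n * (1 / 2) ^ R) + real n * (1 / 2) ^ R)"
  by (rule prob_bind_ge) (auto intro!: mult_nonneg_nonneg zero_le_power)
 moreover have "real I * (real n * (1 / 2) ^ R) + real n * (1 / 2) ^ R = real (Suc I) * (real n * (1 / 2) ^ R)"
  by (simp add: distrib_right add.commute)
 ultimately show ?case by (simp only: phases_Suc prog_sem_append)
qed

definition fin_prog :: "array_step list" where
 "fin_prog = count T c_cl (\<lambda>c r p. r\<lparr>c_nn := p\<rparr>) @ count T (\<lambda>r. (c_cl r + 1) mod Z) (\<lambda>c r p. r\<lparr>c_of := p\<rparr>)"

lemma vprog_fin: "vprog fin_prog 2"
 unfolding fin_prog_def using vprog_append[OF vprog_count vprog_count] by (simp add: numeral_eq_Suc)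

text \<open>After \<open>fin_prog\<close> the two fields count the labels up to \<open>c\<close> and
  below \<open>c\<close>. Their difference is the number of tokens with label \<open>c\<close>, of
  which one is immobile.\<close>

definition est :: "array \<Rightarrow> nat \<Rightarrow> nat" where
 "est x c = c_nn (dec Z (x c)) - c_of (dec Z (x c)) - 1"

definition med :: "array \<Rightarrow> nat \<Rightarrow> nat" where
 "med x c = (LEAST p. R < 2 * card {rp. rp < R \<and> est x (c + rp) \<le> p})"

definition estimates :: "real \<Rightarrow> (nat \<Rightarrow> real) \<Rightarrow> array set" where
 "estimates \<alpha> \<pi> = {x. \<forall>v<n. \<bar>real (med x (v * R)) - real K * real n * \<pi> v\<bar> \<le> \<alpha> * (real K * real n * \<pi> v) \<and> med x (v * R) < W}"

lemma class_less: "v < n \<Longrightarrow> rp < R \<Longrightarrow> v * R + rp < nR"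
 unfolding nR_def by (rule mult_add_less)

lemma fin_reached:
 assumes "x \<in> reached \<alpha> \<pi>"
 shows "\<exists>y\<in>estimates \<alpha> \<pi>. prog_sem L fin_prog x = return_pmf y"
proof -
 obtain s cl where s: "x = arr s" "inv s cl" "good \<alpha> \<pi> cl" using assms unfolding reached_def by blast
 note le = le_chain
 have w: "wfs s" and cl: "\<And>c. c < T \<Longrightarrow> c_cl (s c) = cl c" and ok: "okcl cl" using s(2) by (auto simp: inv_def)
 define s1 where "s1 = (\<lambda>c. (s c)\<lparr>c_nn := card {i. i < T \<and> c_cl (s i) \<le> c}\<rparr>)"
 have r1: "run (count T c_cl (\<lambda>c r p. r\<lparr>c_nn := p\<rparr>)) s s1"
  by (rule run_count[OF w le(3) halfZ]) (use le in \<open>auto simp: in_cells s1_def\<close>)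
 have w1: "wfs s1" using r1 by (simp add: run_def)
 define s2 where "s2 = (\<lambda>c. (s1 c)\<lparr>c_of := card {i. i < T \<and> (c_cl (s1 i) + 1) mod Z \<le> c}\<rparr>)"
 have r2: "run (count T (\<lambda>r. (c_cl r + 1) mod Z) (\<lambda>c r p. r\<lparr>c_of := p\<rparr>)) s1 s2"
  by (rule run_count[OF w1 le(3) halfZ]) (use le in \<open>auto simp: in_cells s2_def\<close>)
 have run: "run fin_prog s s2" unfolding fin_prog_def by (rule run_append[OF r1 r2])
 have w2: "wfs s2" using r2 by (simp add: run_def)
 have clZ: "(cl i + 1) mod Z = cl i + 1" if "i < T" for i
 proof -
  have "cl i < nR" using ok that by (simp add: okcl_def)
  then show ?thesis using le(5) by (intro mod_less) linarith
 qed
 have dec2: "dec Z (arr s2 c) = s2 c" if "c < nR" for c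
 proof -
  have "c < half" using that le(2) by linarith
  then show ?thesis using w2 dec_enc by (simp add: arr_def crop_def wfs_def)
 qed
 have est: "est (arr s2) c = ccnt cl c" if c: "c < nR" for c
 proof -
  have e1: "c_nn (s2 c) = card {i. i < T \<and> cl i \<le> c}"
   unfolding s2_def s1_def using cl by (auto intro!: arg_cong[of _ _ card])
  have e2: "c_of (s2 c) = card {i. i < T \<and> cl i + 1 \<le> c}"
   unfolding s2_def s1_def using cl clZ by (auto intro!: arg_cong[of _ _ card])
  have cT: "c < T" using c nR_T by linarith
  have u: "{i. i < T \<and> cl i \<le> c} = {i. i < T \<and> cl i + 1 \<le> c} \<union> insert c {i. nR \<le> i \<and> i < T \<and> cl i = c}"
  proof (intro set_eqI iffI)
   fix i assume i: "i \<in> {i. i < T \<and> cl i \<le> c}"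
   show "i \<in> {i. i < T \<and> cl i + 1 \<le> c} \<union> insert c {i. nR \<le> i \<and> i < T \<and> cl i = c}"
   proof (cases "i < nR")
    case True
    then have "cl i = i" using ok by (simp add: okcl_def)
    then show ?thesis using i by auto
   qed (use i in auto)
  next
   fix i assume "i \<in> {i. i < T \<and> cl i + 1 \<le> c} \<union> insert c {i. nR \<le> i \<and> i < T \<and> cl i = c}"
   moreover have "cl c = c" using ok c by (simp add: okcl_def)
   ultimately show "i \<in> {i. i < T \<and> cl i \<le> c}" using cT by auto
  qed
  have "cl c = c" using ok c by (simp add: okcl_def)
  then have "card ({i. i < T \<and> cl i + 1 \<le> c} \<union> insert c {i. nR \<le> i \<and> i < T \<and> cl i = c}) =
    card {i. i < T \<and> cl i + 1 \<le> c} + card (insert c {i. nR \<le> i \<and> i < T \<and> cl i = c})"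
   by (intro card_Un_disjoint) auto
  moreover have "card (insert c {i. nR \<le> i \<and> i < T \<and> cl i = c}) = Suc (ccnt cl c)"
   unfolding ccnt_def using c by (subst card_insert_disjoint) auto
  ultimately show ?thesis unfolding est_def dec2[OF c] e1 e2 u by simp
 qed
 have "arr s2 \<in> estimates \<alpha> \<pi>" unfolding estimates_def
 proof (intro CollectI allI impI conjI)
  fix v assume v: "v < n"
  have "{rp. rp < R \<and> \<alpha> * (real K * real n * \<pi> v) < \<bar>real (est (arr s2) (v * R + rp)) - real K * real n * \<pi> v\<bar>} =
   {rp. rp < R \<and> off_target \<alpha> (\<pi> v) (ccnt cl (v * R + rp))}"
   using est[OF class_less[OF v]] by (auto simp: off_target_def)
  then have "2 * card {rp. rp < R \<and> \<alpha> * (real K * real n * \<pi> v) < \<bar>real (est (arr s2) (v * R + rp)) - real K * real n * \<pi> v\<bar>} < R"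
   using s(3) v by (simp add: good_def)
  from majority_least[OF this]
  show "\<bar>real (med (arr s2) (v * R)) - real K * real n * \<pi> v\<bar> \<le> \<alpha> * (real K * real n * \<pi> v)" by (simp add: med_def)
  have "est (arr s2) (v * R + rp) \<le> Z - 1" if rp: "rp < R" for rp
  proof -
   have c: "v * R + rp < nR" by (rule class_less[OF v rp])
   then have "s2 (v * R + rp) \<in> cells Z" using w2 le(2) by (simp add: wfs_def)
   then have "c_nn (s2 (v * R + rp)) < Z" by (simp add: in_cells)
   then show ?thesis unfolding est_def dec2[OF c] by linarith
  qed
  then have "{rp. rp < R \<and> est (arr s2) (v * R + rp) \<le> Z - 1} = {..<R}" by auto
  then have "R < 2 * card {rp. rp < R \<and> est (arr s2) (v * R + rp) \<le> Z - 1}" using R0 by simp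
  then have "med (arr s2) (v * R) \<le> Z - 1" unfolding med_def by (rule Least_le)
  moreover have "Z * 1 \<le> Z * Z ^ 13" using Z2 by (intro mult_le_mono2) simp
  then have "Z \<le> W" using ZW(1) by (simp add: power_Suc[symmetric] del: power_Suc)
  ultimately show "med (arr s2) (v * R) < W" using Z2 by linarith
 qed
 then show ?thesis using run s(1) by (auto simp: run_def)
qed

definition initcl :: "nat \<Rightarrow> nat" where "initcl c = c mod nR"

lemma okcl_init: "okcl initcl"
 using nR0 by (simp add: okcl_def initcl_def)

text \<open>Initially every label has exactly \<open>K\<close> walking tokens, so the state
  represents the uniform vector without error. This is the starting point that
  \<open>green_uniform\<close> asks for.\<close>

lemma good_init: assumes "0 \<le> \<alpha>" shows "good \<alpha> (\<lambda>_. 1 / real n) initcl"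
proof -
 have cc: "ccnt initcl k = K" if k: "k < nR" for k
 proof -
  have TnR: "T = (K + 1) * nR" by (simp add: T_def nR_def mult.commute)
  have "bij_betw (\<lambda>j. j * nR + k) {1..K} {i. nR \<le> i \<and> i < T \<and> initcl i = k}"
  proof (rule bij_betwI[where g = "\<lambda>i. i div nR"])
   show "(\<lambda>j. j * nR + k) \<in> {1..K} \<rightarrow> {i. nR \<le> i \<and> i < T \<and> initcl i = k}"
   proof
    fix j assume j: "j \<in> {1..K}"
    have "j * nR + k < (K + 1) * nR" by (rule mult_add_less) (use j k in auto)
    moreover have "nR \<le> j * nR + k"
    proof -
     have "1 * nR \<le> j * nR" using j by (intro mult_le_mono1) simp
     then show ?thesis by linarith
    qed
    moreover have "(j * nR + k) mod nR = k" by (rule mult_add_div_mod(2)[OF k])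
    ultimately show "j * nR + k \<in> {i. nR \<le> i \<and> i < T \<and> initcl i = k}"
     unfolding initcl_def TnR by blast
   qed
   show "(\<lambda>i. i div nR) \<in> {i. nR \<le> i \<and> i < T \<and> initcl i = k} \<rightarrow> {1..K}"
   proof
    fix i assume i: "i \<in> {i. nR \<le> i \<and> i < T \<and> initcl i = k}"
    then have "i div nR < K + 1" unfolding TnR using less_mult_imp_div_less by blast
    moreover have "nR div nR \<le> i div nR" using i by (intro div_le_mono) simp
    ultimately show "i div nR \<in> {1..K}" using nR0 by simp
   qed
   show "(j * nR + k) div nR = j" for j by (rule mult_add_div_mod(1)[OF k])
   show "i div nR * nR + k = i" if "i \<in> {i. nR \<le> i \<and> i < T \<and> initcl i = k}" for i
    using that div_mult_mod_eq[of i nR] by (simp add: initcl_def)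
  qed
  from bij_betw_same_card[OF this] show ?thesis by (simp add: ccnt_def)
 qed
 have e: "{rp. rp < R \<and> off_target \<alpha> (1 / real n) (ccnt initcl (v * R + rp))} = {}" if "v < n" for v
 proof -
  have "\<not> off_target \<alpha> (1 / real n) K" using assms n0 by (simp add: off_target_def not_less)
  then show ?thesis using cc[OF class_less[OF that]] by auto
 qed
 show ?thesis unfolding good_def
 proof (intro allI impI)
  fix v assume "v < n"
  from e[OF this] show "2 * card {rp. rp < R \<and> off_target \<alpha> (1 / real n) (ccnt initcl (v * R + rp))} < R"
   using R0 by (simp only: card.empty mult_0_right)
 qed
qed

definition whole :: "(nat \<Rightarrow> real) \<Rightarrow> nat \<Rightarrow> array_step list" where
 "whole \<theta>s I = setup_prog n m nR @ phases \<theta>s I @ fin_prog"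

lemma vprog_whole: "vprog (whole \<theta>s I) (6 + I * (J' + 11))"
proof -
 have "vprog (whole \<theta>s I) (4 + (I * (J' + 11) + 2))" unfolding whole_def
  by (intro vprog_append vprog_setup vprog_phases vprog_fin)
 then show ?thesis by (simp add: add.commute)
qed

lemma whole_prob:
 assumes R: "even R" and K: "0 < K" and \<kappa>0: "0 \<le> \<kappa>" and \<alpha>: "0 < \<alpha>" "\<alpha> \<le> 1 / 4"
  and ok: "\<And>i. i < I \<Longrightarrow> step_ok \<alpha> \<kappa> (\<pi>s i) (\<theta>s (Suc i)) (\<pi>s (Suc i))" and p0: "\<pi>s 0 = (\<lambda>_. 1 / real n)"
  and s: "prog_sem L (setup_prog n m nR) x = return_pmf (arr s)" "inv s initcl"
 shows "measure_pmf.prob (prog_sem L (whole \<theta>s I) x) (estimates \<alpha> (\<pi>s I)) \<ge> 1 - real I * (real n * (1 / 2) ^ R)"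
proof -
 have "arr s \<in> reached \<alpha> (\<pi>s 0)"
  unfolding reached_def p0 using s(2) good_init[of \<alpha>] \<alpha> by auto
 from phases_prob[OF R K \<kappa>0 \<alpha> ok this]
 have P: "measure_pmf.prob (prog_sem L (phases \<theta>s I) (arr s)) (reached \<alpha> (\<pi>s I)) \<ge> 1 - real I * (real n * (1 / 2) ^ R)" .
 have "measure_pmf.prob (prog_sem L fin_prog y) (estimates \<alpha> (\<pi>s I)) \<ge> 1 - 0" if y: "y \<in> reached \<alpha> (\<pi>s I)" for y
 proof -
  from fin_reached[OF y] obtain z where "z \<in> estimates \<alpha> (\<pi>s I)" "prog_sem L fin_prog y = return_pmf z" by blast
  then show ?thesis by simp
 qed
 from prob_bind_ge[OF this P] show ?thesis
  unfolding whole_def prog_sem_append s(1) bind_return_pmf by simp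
qed

text \<open>The \<open>R\<close> repetitions of a vertex are consecutive cells, and \<open>R\<close>
  divides the block size, so one machine sees all of them and computes their median. As
  \<open>R\<close> is at least 3, the three words for each vertex fit into the space of its
  cells.\<close>

definition outl :: "array \<Rightarrow> nat \<Rightarrow> (nat \<times> nat \<times> nat) list" where
 "outl x i = map (\<lambda>c. (c div R, med x c mod W, K * n))
   (filter (\<lambda>c. c < nR) (map (\<lambda>k. i * 2 ^ b + k * R) [0..<2 ^ b div R]))"

definition out_words :: "array \<Rightarrow> nat \<Rightarrow> nat list" where
 "out_words x i = concat (map (\<lambda>(v, p, q). [v, p, q]) (outl x i))"

lemma length_out_words: assumes "3 \<le> R" shows "length (out_words x i) \<le> 2 ^ b"
proof -
 have len: "length (concat (map (\<lambda>(v, p, q). [v, p, q]) ys)) = 3 * length ys" for ys :: "(nat \<times> nat \<times> nat) list"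
  by (induction ys) auto
 have "length (outl x i) \<le> length (map (\<lambda>k. i * 2 ^ b + k * R) [0..<2 ^ b div R])"
  unfolding outl_def length_map by (rule length_filter_le[THEN order_trans]) simp
 then have "length (out_words x i) \<le> 3 * (2 ^ b div R)" unfolding out_words_def len by simp
 also have "\<dots> \<le> R * (2 ^ b div R)" by (rule mult_le_mono1[OF assms])
 also have "\<dots> \<le> 2 ^ b" by (rule times_div_less_eq_dividend)
 finally show ?thesis .
qed

lemma set_out_words: "set (out_words x i) \<subseteq> {..<W}"
proof -
 have "Z * 1 \<le> Z * Z ^ 13" using Z2 by (intro mult_le_mono2) simp
 then have ZW': "Z \<le> W" using ZW(1) by (simp add: power_Suc[symmetric] del: power_Suc)
 have "n * 1 * K \<le> n * R * (K + 1)" using R0 by (intro mult_le_mono) auto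
 then have "K * n \<le> T" unfolding T_def by (simp only: mult_1_right mult.commute[of K n])
 then have Kn: "K * n < W" using le_chain(6) ZW' by linarith
 have "c div R < W" if "c < nR" for c
 proof -
  have "c div R < n" using that unfolding nR_def by (rule less_mult_imp_div_less)
  then show ?thesis using le_chain(4) ZW' by linarith
 qed
 then show ?thesis using Kn W_pos by (auto simp: out_words_def outl_def)
qed

lemma out_words_local:
 assumes R: "R dvd 2 ^ b" and xy: "\<And>c. c div 2 ^ b = i \<Longrightarrow> x c = y c"
 shows "out_words x i = out_words y i"
proof -
 have "med x (i * 2 ^ b + k * R) = med y (i * 2 ^ b + k * R)" if k: "k < 2 ^ b div R" for k
 proof -
  have "est x (i * 2 ^ b + k * R + rp) = est y (i * 2 ^ b + k * R + rp)" if rp: "rp < R" for rp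
  proof -
   have "k * R + rp < 2 ^ b div R * R" by (rule mult_add_less[OF k rp])
   then have lt: "k * R + rp < 2 ^ b" using R by simp
   have "(i * 2 ^ b + (k * R + rp)) div 2 ^ b = i" by (rule mult_add_div_mod(1)[OF lt])
   then have "x (i * 2 ^ b + k * R + rp) = y (i * 2 ^ b + k * R + rp)" by (intro xy) (simp only: add.assoc)
   then show ?thesis by (simp only: est_def)
  qed
  then have "{rp. rp < R \<and> est x (i * 2 ^ b + k * R + rp) \<le> p} = {rp. rp < R \<and> est y (i * 2 ^ b + k * R + rp) \<le> p}" for p
   by auto
  then show ?thesis by (simp only: med_def)
 qed
 then have "outl x i = outl y i" unfolding outl_def by (auto intro!: map_cong)
 then show ?thesis by (simp only: out_words_def)
qed

lemma vector_output_estimates: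
 assumes R: "R dvd 2 ^ b" and M: "M * 2 ^ b = L" and x: "x \<in> estimates \<alpha> \<pi>" and G: "verts G = {..<n}" and K: "0 < K"
 shows "vector_output M G (\<lambda>j. if j < M then out_words x j else []) (\<lambda>v. real (med x (v * R)) / (real K * real n))"
  "v < n \<Longrightarrow> \<bar>real (med x (v * R)) / (real K * real n) - \<pi> v\<bar> \<le> \<alpha> * \<pi> v"
proof -
 have Kn: "0 < real K * real n" using K n0 by simp
 have b0: "0 < (2::nat) ^ b" by simp
 have mem: "(v, p, q) \<in> (\<Union>i<M. set (outl x i)) \<longleftrightarrow> p = med x (v * R) \<and> q = K * n" if v: "v < n" for v p q
 proof
  assume "(v, p, q) \<in> (\<Union>i<M. set (outl x i))"
  then obtain i k where k: "k < 2 ^ b div R" "v = (i * 2 ^ b + k * R) div R" "p = med x (i * 2 ^ b + k * R) mod W" "q = K * n"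
   by (auto simp: outl_def)
  have "R dvd i * 2 ^ b + k * R" using R by simp
  then have "i * 2 ^ b + k * R = v * R" unfolding k(2) by (rule dvd_div_mult_self[symmetric])
  then show "p = med x (v * R) \<and> q = K * n" using k(3,4) x v by (simp add: estimates_def)
 next
  assume pq: "p = med x (v * R) \<and> q = K * n"
  define i where "i = v * R div 2 ^ b"
  define k where "k = v * R mod 2 ^ b div R"
  have vR: "v * R + 0 < nR" by (rule class_less[OF v R0])
  then have "v * R < M * 2 ^ b" using le_chain(2) M L2 by linarith
  then have i: "i < M" unfolding i_def by (rule less_mult_imp_div_less)
  have "v * R mod 2 ^ b < 2 ^ b div R * R" using R by simp
  then have k: "k < 2 ^ b div R" unfolding k_def by (rule less_mult_imp_div_less)
  have "R dvd v * R mod 2 ^ b" using R by (simp add: dvd_mod)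
  then have kR: "k * R = v * R mod 2 ^ b" by (simp add: k_def)
  have c: "v * R = i * 2 ^ b + k * R" unfolding i_def kR by (rule div_mult_mod_eq[symmetric])
  have "(v, p, q) = (v * R div R, med x (v * R) mod W, K * n)" using pq R0 x v by (simp add: estimates_def)
  moreover have "v * R \<in> set (filter (\<lambda>c. c < nR) (map (\<lambda>k. i * 2 ^ b + k * R) [0..<2 ^ b div R]))"
   using k vR unfolding c by (auto intro!: image_eqI[of _ _ k])
  ultimately have "(v, p, q) \<in> set (outl x i)" unfolding outl_def set_map by (rule image_eqI)
  then show "(v, p, q) \<in> (\<Union>i<M. set (outl x i))" using i by blast
 qed
 show "vector_output M G (\<lambda>j. if j < M then out_words x j else []) (\<lambda>v. real (med x (v * R)) / (real K * real n))"
  unfolding vector_output_def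
 proof (intro exI[of _ "outl x"] conjI allI impI ballI)
  fix v assume "v \<in> verts G"
  then have v: "v < n" using G by simp
  show "{real p / real q |p q. (v, p, q) \<in> (\<Union>i<M. set (outl x i))} = {real (med x (v * R)) / (real K * real n)}"
   unfolding mem[OF v] by auto
 qed (simp add: out_words_def)
 assume v: "v < n"
 have "\<bar>real (med x (v * R)) / (real K * real n) - \<pi> v\<bar> = \<bar>real (med x (v * R)) - real K * real n * \<pi> v\<bar> / (real K * real n)"
  using Kn n0 K by (simp add: abs_if field_simps)
 also have "\<dots> \<le> \<alpha> * (real K * real n * \<pi> v) / (real K * real n)"
  using x v Kn by (intro divide_right_mono) (simp_all add: estimates_def)
 also have "\<dots> = \<alpha> * \<pi> v" using Kn n0 K by simp
 finally show "\<bar>real (med x (v * R)) / (real K * real n) - \<pi> v\<bar> \<le> \<alpha> * \<pi> v" .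
qed

end

section \<open>The algorithm for given parameters\<close>

lemma card_seg_sort_eq:
 fixes x :: array
 shows "card {c. c < L \<and> seg_sort L x c = u} = card {c. c < L \<and> x c = u}"
proof -
 have less: "card {c. c < L \<and> seg_sort L x c < \<tau>} = card {c. c < L \<and> x c < \<tau>}" for \<tau>
 proof -
  have "card {c. c < L \<and> x c < \<tau>} \<le> card {..<L}" by (intro card_mono) auto
  then have "{c. c < L \<and> seg_sort L x c < \<tau>} = {..<card {c. c < L \<and> x c < \<tau>}}"
   using seg_sort_full_less[of _ L x \<tau>] by auto
  then show ?thesis by (simp only: card_lessThan)
 qed
 have split: "card {c. c < L \<and> z c < Suc u} = card {c. c < L \<and> z c < u} + card {c. c < L \<and> z c = u}" for z :: array
 proof -
  have "{c. c < L \<and> z c < Suc u} = {c. c < L \<and> z c < u} \<union> {c. c < L \<and> z c = u}" by auto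
  then have "card {c. c < L \<and> z c < Suc u} = card ({c. c < L \<and> z c < u} \<union> {c. c < L \<and> z c = u})" by (rule arg_cong)
  also have "\<dots> = card {c. c < L \<and> z c < u} + card {c. c < L \<and> z c = u}" by (rule card_Un_disjoint) auto
  finally show ?thesis .
 qed
 show ?thesis using split[of "seg_sort L x"] split[of x] less[of u] less[of "Suc u"] by linarith
qed

lemma card_fibres:
 assumes "finite A" "\<And>a. a \<in> A \<Longrightarrow> g a < (n::nat)"
 shows "card A = (\<Sum>w<n. card {a \<in> A. g a = w})"
proof -
 have "A = (\<Union>w<n. {a \<in> A. g a = w})" using assms(2) by auto
 then have "card A = card (\<Union>w<n. {a \<in> A. g a = w})" by (rule arg_cong)
 also have "\<dots> = (\<Sum>w<n. card {a \<in> A. g a = w})" using assms(1) by (intro card_UN_disjoint) auto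
 finally show ?thesis .
qed

lemma prob_Some: "measure (measure_spmf (map_pmf (\<lambda>x. Some (g x)) p)) A = measure_pmf.prob p (g -` A)"
proof -
 have "map_pmf (\<lambda>x. Some (g x)) p = spmf_of_pmf (map_pmf g p)" by (simp add: spmf_of_pmf_def map_pmf_comp)
 then show ?thesis by (simp add: measure_spmf_spmf_of_pmf)
qed

definition solves :: "nat \<Rightarrow> nat \<Rightarrow> nat \<Rightarrow> nat \<Rightarrow> real \<Rightarrow> real \<Rightarrow> mpc_algorithm \<Rightarrow> real \<Rightarrow> bool" where
 "solves W S n m \<alpha> \<epsilon> Alg p \<longleftrightarrow> (\<forall>G :: (nat, nat) pre_digraph. fin_digraph G \<and> verts G = {..<n} \<and> card (arcs G) = m \<and>
   (\<forall>v\<in>verts G. out_degree G v \<ge> 1) \<longrightarrow> (\<forall>mem. edge_input S (machines Alg) G mem \<longrightarrow>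
    measure (measure_spmf (mpc_result W S Alg mem))
     {res. \<exists>x. vector_output (machines Alg) G res x \<and> multiplicative_approx \<alpha> G (pagerank G \<epsilon>) x} \<ge> 1 - p))"

lemma solves_mono:
 assumes "solves W S n m \<alpha> \<epsilon> Alg p" "p \<le> q"
 shows "solves W S n m \<alpha> \<epsilon> Alg q"
proof -
 have "1 - q \<le> 1 - p" using assms(2) by simp
 then show ?thesis using assms(1) unfolding solves_def by (blast intro: order_trans)
qed

text \<open>All numerical requirements are left as hypotheses: \<open>budget\<close> makes the pools
  large enough for the loss \<open>\<rho>\<close> between consecutive damping factors,
  \<open>tail\<close> controls truncation and \<open>var\<close> the variance. They use the bound
  \<open>\<epsilon> / n\<close> in place of PageRank values, which holds in every phase because no
  damping factor exceeds \<open>1 - \<epsilon>\<close>.\<close>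

lemma pagerank_algorithm:
 fixes a b d f Z W n m S R K l J' I :: nat and \<alpha> \<epsilon> \<kappa> \<rho> :: real and \<theta>s :: "nat \<Rightarrow> real"
 assumes mach: "machine a b d f Z W" and S: "2 ^ b \<le> S" "S < 2 * 2 ^ b" "b \<le> a" and n: "0 < n" "n * n < W" and m: "0 < m" "m \<le> 2 ^ (a - 1)"
  and R: "even R" "3 \<le> R" "R dvd 2 ^ b" and l: "0 < l" "2 * l \<le> 2 ^ J'" and K: "0 < K"
  and NN: "(1 + R * (2 * l)) * (n * R * (K + 1)) \<le> 2 ^ (a - 1)" and Z: "2 ^ (a - 1) < Z"
  and \<alpha>: "0 < \<alpha>" "\<alpha> \<le> 1 / 4" and \<epsilon>: "0 < \<epsilon>" "\<epsilon> \<le> 1" and \<kappa>0: "0 \<le> \<kappa>" and \<rho>: "1 \<le> \<rho>" and I: "0 < I"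
  and \<theta>: "\<And>i. i < I \<Longrightarrow> 0 \<le> \<theta>s (Suc i) \<and> \<theta>s (Suc i) \<le> 1 - \<epsilon>" and \<theta>1: "\<theta>s 1 \<le> 1 / (real n + 1)" and \<theta>I: "\<theta>s I = 1 - \<epsilon>"
  and ratio: "\<And>i. 0 < i \<Longrightarrow> i < I \<Longrightarrow> \<exists>s. (\<forall>k<s. \<theta>s (Suc i) ^ k \<le> \<rho> * \<theta>s i ^ k) \<and> \<theta>s (Suc i) ^ s / (1 - \<theta>s (Suc i)) \<le> 1 / real n"
  and budget: "2 * \<rho> / \<epsilon> \<le> \<kappa> * (3 / 8 * real R * real K * real n)"
  and tail: "2 * (1 - \<epsilon>) ^ l \<le> \<alpha> / 2 * (\<epsilon> / real n)" and var: "128 * (1 / (real K * real n) + 4 * \<kappa>) \<le> \<alpha>\<^sup>2 * (\<epsilon> / real n)"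
 shows "\<exists>Alg. machines Alg = 2 ^ (a - b) \<and> rounds Alg \<le> (6 + I * (J' + 11)) * (4 * 6 ^ d + 2 * f + 5) + 1 \<and>
  solves W S n m \<alpha> \<epsilon> Alg (real I * (real n * (1 / 2) ^ R))"
proof -
 interpret mc: machine a b d f Z W by (rule mach)
 define M where "M = (2::nat) ^ (a - b)"
 define prog where "prog = walker.whole a b d f Z W n R K l J' m \<theta>s I"
 define out where "out = walker.out_words b Z W n R K"
 define Alg where "Alg = compile M (2 ^ b) prog (pack n W) out"
 have MB: "M * 2 ^ b = mc.L" unfolding M_def mc.L_def using S(3) by (simp add: power_add[symmetric])
 have half: "mc.half = 2 ^ (a - 1)" by (simp add: mc.half_def)
 have R0: "0 < R" using R by simp
 have wI: "walker a b d f Z W n Pm R K l J' m eh eo dg"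
  if "markov n Pm" "\<And>c. c < m \<Longrightarrow> eh c < n" "\<And>v. v < n \<Longrightarrow> eo v + dg v \<le> m" "\<And>v. v < n \<Longrightarrow> 0 < dg v"
   "\<And>v w. v < n \<Longrightarrow> w < n \<Longrightarrow> Pm v w = real (card {i. i < dg v \<and> eh (eo v + i) = w}) / real (dg v)" for Pm eh eo dg
  using that mach R0 l NN m Z unfolding walker_def walker_axioms_def half by blast
 \<comment> \<open>The program does not depend on the graph, so its validity and length are obtained
   before any graph is given, from a dummy instance in which every vertex has one edge to 0.\<close>
 have "walker a b d f Z W n (\<lambda>u w. of_bool (w = 0)) R K l J' m (\<lambda>_. 0) (\<lambda>_. 0) (\<lambda>_. 1)"
 proof (rule wI)
  show "markov n (\<lambda>u w. of_bool (w = 0))"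
   using n(1) by unfold_locales (simp_all add: of_bool_def)
  show "of_bool (w = 0) = real (card {i::nat. i < 1 \<and> 0 = w}) / real 1" if "v < n" "w < n" for v w :: nat
   by (cases "w = 0") simp_all
 qed (use n m in auto)
 then interpret w0: walker a b d f Z W n "\<lambda>u w. of_bool (w = 0)" R K l J' m "\<lambda>_. 0" "\<lambda>_. 0" "\<lambda>_. 1" .
 have vp: "mc.vprog prog (6 + I * (J' + 11))" unfolding prog_def by (rule w0.vprog_whole)
 have rnd: "rounds Alg \<le> (6 + I * (J' + 11)) * (4 * 6 ^ d + 2 * f + 5) + 1"
  using vp by (simp add: Alg_def mc.vprog_def mc.ulen_def)
 have "measure (measure_spmf (mpc_result W S Alg mem))
     {res. \<exists>x. vector_output M G res x \<and> multiplicative_approx \<alpha> G (pagerank G \<epsilon>) x} \<ge> 1 - real I * (real n * (1 / 2) ^ R)"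
  if G: "fin_digraph G" "verts G = {..<n}" "card (arcs G) = m" "\<forall>v\<in>verts G. out_degree G v \<ge> 1" and mem: "edge_input S M G mem"
  for G :: "(nat, nat) pre_digraph" and mem
 proof -
  interpret G: fin_digraph G by (rule G(1))
  have ne: "out_arcs G v \<noteq> {}" if "v \<in> verts G" for v
   using G(4) that by (auto simp: out_degree_def)
  define Pm where "Pm = (\<lambda>u w. if u < n then pmf (map_pmf (head G) (pmf_of_set (out_arcs G u))) w else 0)"
  have mk: "markov n Pm" unfolding Pm_def by (rule pagerank_is_pr(1)[OF G(1,2) n(1) ne \<epsilon>])
  define x1 where "x1 c = pack n W (mem (c div 2 ^ b)) (c mod 2 ^ b)" for c
  define x0 where "x0 = crop mc.L x1"
  have b0: "0 < (2::nat) ^ b" by simp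
  note pk = packed_input[OF G(1,2) mem S(2) b0 n(2), folded x1_def, unfolded MB]
  have x01: "x0 c = x1 c" if "c < mc.L" for c using that by (simp add: x0_def crop_def)
  have c1: "card {c. c < mc.L \<and> x0 c < n * n} = m"
  proof -
   have "{c. c < mc.L \<and> x0 c < n * n} = {c. c < mc.L \<and> x1 c < n * n}" using x01 by auto
   then show ?thesis using pk(1) G(3) by simp
  qed
  have c2: "card {c. c < mc.L \<and> x0 c = v * n + w} = card {e \<in> arcs G. tail G e = v \<and> head G e = w}" if "v < n" "w < n" for v w
  proof -
   have "{c. c < mc.L \<and> x0 c = v * n + w} = {c. c < mc.L \<and> x1 c = v * n + w}" using x01 by auto
   then show ?thesis using pk(2)[OF that] by simp
  qed
  have x0W: "x0 c < W" for c using pk(3)[of c] mc.W_pos by (simp add: x0_def crop_def)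
  have wf: "wf_array mc.L W x0" using x0W by (simp add: wf_array_def x0_def crop_def)
  define y where "y = seg_sort mc.L x0"
  have mL: "m \<le> mc.L" using m half mc.L2 by simp
  have y_less: "c < mc.L \<Longrightarrow> y c < n * n \<longleftrightarrow> c < m" for c
   unfolding y_def using seg_sort_full_less[of c mc.L x0 "n * n"] c1 by simp
  have mono: "y c \<le> y c'" if "c \<le> c'" "c' < m" for c c'
   unfolding y_def using that mL by (intro seg_sort_full_mono) auto
  define eo where "eo = (\<lambda>v. card {c. c < m \<and> y c div n < v})"
  define dg where "dg = (\<lambda>v. card {c. c < m \<and> y c div n = v})"
  define eh where "eh = (\<lambda>c. y c mod n)"
  have se1: "eo v + dg v \<le> m" for v
   unfolding eo_def dg_def by (rule sorted_edges(1)) (use mono n in auto)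
  have se2: "card {i. i < dg v \<and> eh (eo v + i) = w} = card {c. c < m \<and> y c = v * n + w}" if "w < n" for v w
   unfolding eo_def dg_def eh_def by (rule sorted_edges(2)) (use mono n that in auto)
  have arcs: "card {i. i < dg v \<and> eh (eo v + i) = w} = card {e \<in> out_arcs G v. head G e = w}" if vw: "v < n" "w < n" for v w
  proof -
   have "v * n + w < n * n" by (rule mult_add_less[OF vw])
   then have "c < m" if "c < mc.L" "y c = v * n + w" for c using y_less[OF that(1)] that(2) by simp
   then have "{c. c < m \<and> y c = v * n + w} = {c. c < mc.L \<and> y c = v * n + w}" using mL by auto
   then have "card {c. c < m \<and> y c = v * n + w} = card {e \<in> arcs G. tail G e = v \<and> head G e = w}"
    using card_seg_sort_eq[of mc.L x0 "v * n + w"] c2[OF vw] by (simp add: y_def)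
   moreover have "{e \<in> out_arcs G v. head G e = w} = {e \<in> arcs G. tail G e = v \<and> head G e = w}" by auto
   ultimately show ?thesis using se2[OF vw(2), of v] by simp
  qed
  have dgo: "dg v = card (out_arcs G v)" if v: "v < n" for v
  proof -
   have "card {..<dg v} = (\<Sum>w<n. card {i \<in> {..<dg v}. eh (eo v + i) = w})"
    by (rule card_fibres) (use n in \<open>auto simp: eh_def\<close>)
   also have "\<dots> = (\<Sum>w<n. card {e \<in> out_arcs G v. head G e = w})"
    using arcs[OF v] by (intro sum.cong refl) simp
   also have "\<dots> = card (out_arcs G v)"
    by (rule card_fibres[symmetric]) (use G.wellformed G(2) in \<open>auto simp: G.finite_out_arcs\<close>)
   finally show ?thesis by simp
  qed
  have PmE: "Pm v w = real (card {i. i < dg v \<and> eh (eo v + i) = w}) / real (dg v)" if vw: "v < n" "w < n" for v w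
  proof -
   have o: "out_arcs G v \<noteq> {}" "finite (out_arcs G v)" using ne[of v] G(2) vw by (auto simp: G.finite_out_arcs)
   have "out_arcs G v \<inter> head G -` {w} = {e \<in> out_arcs G v. head G e = w}" by auto
   then show ?thesis unfolding Pm_def arcs[OF vw] unfolding dgo[OF vw(1)] pmf_map using vw o by (simp add: measure_pmf_of_set)
  qed
  have dg0: "0 < dg v" if "v < n" for v using dgo[OF that] ne[of v] G(2) that by (simp add: card_gt_0_iff G.finite_out_arcs)
  have wk: "walker a b d f Z W n Pm R K l J' m eh eo dg"
   by (rule wI[OF mk _ se1 dg0 PmE]) (use n in \<open>simp_all add: eh_def\<close>)
  interpret wk: walker a b d f Z W n Pm R K l J' m eh eo dg by (rule wk)
  have nR: "0 < wk.nR" "wk.nR \<le> mc.half" using wk.nR0 wk.le_chain(2) by auto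
  obtain s where s: "prog_sem mc.L (mc.setup_prog n m wk.nR) x0 = return_pmf (mc.arr s)" "mc.wfs s"
   "\<forall>c<m. c_eh (s c) = y c mod n" "\<forall>v. c_eo (s v) = eo v \<and> c_dg (s v) = dg v" "\<forall>c<mc.half. c_cl (s c) = c mod wk.nR"
   using mc.run_setup[OF wf wk.m wk.halfZ n(1) wk.le_chain(4) nR] y_less mL unfolding y_def eo_def dg_def by (auto simp: y_def)
  have cl: "c_cl (s c) = c mod wk.nR" if "c < wk.T" for c using s(5) that wk.le_chain(3) by simp
  have ehs: "\<forall>c<m. c_eh (s c) = eh c" using s(3) by (simp add: eh_def)
  have inv: "wk.inv s wk.initcl"
   using s(2,4) ehs cl wk.okcl_init by (simp add: wk.inv_def wk.graph_def wk.initcl_def)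
  \<comment> \<open>The vectors approximated along the way: uniform before the first phase, then
    PageRank for the damping factor of each phase, and finally the PageRank in question.\<close>
  define \<pi>s where "\<pi>s i = (if i = 0 then (\<lambda>_. 1 / real n) else pmf (pagerank G (1 - \<theta>s i)))" for i
  have pr: "wk.is_pr (\<theta>s (Suc i)) (\<pi>s (Suc i))" if "i < I" for i
  proof -
   have e: "0 < 1 - \<theta>s (Suc i)" "1 - \<theta>s (Suc i) \<le> 1" using \<theta>[OF that] \<epsilon> by auto
   from pagerank_is_pr(2)[OF G(1,2) n(1) ne e] show ?thesis unfolding \<pi>s_def Pm_def by simp
  qed
  have Kn: "0 < real K * real n" using K n by simp
  have step: "wk.step_ok \<alpha> \<kappa> (\<pi>s i) (\<theta>s (Suc i)) (\<pi>s (Suc i))" if i: "i < I" for i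
   unfolding wk.step_ok_def
  proof (intro conjI allI impI)
   note th = \<theta>[OF i]
   show "0 \<le> \<theta>s (Suc i)" "\<theta>s (Suc i) < 1" using th \<epsilon> by auto
   show "wk.is_pr (\<theta>s (Suc i)) (\<pi>s (Suc i))" by (rule pr[OF i])
   fix w assume w: "w < n"
   show p0: "0 \<le> \<pi>s i w" by (simp add: \<pi>s_def)
   have "\<epsilon> / real n \<le> (1 - \<theta>s (Suc i)) / real n" using th n by (intro divide_right_mono) auto
   also have "\<dots> \<le> \<pi>s (Suc i) w" by (rule wk.pr_ge[OF pr[OF i] _ w]) (use th in simp)
   finally have pe: "\<epsilon> / real n \<le> \<pi>s (Suc i) w" .
   have "2 * \<theta>s (Suc i) ^ l \<le> 2 * (1 - \<epsilon>) ^ l" using th by (intro mult_left_mono power_mono) auto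
   also have "\<dots> \<le> \<alpha> / 2 * (\<epsilon> / real n)" by (rule tail)
   also have "\<dots> \<le> \<alpha> / 2 * \<pi>s (Suc i) w" using pe \<alpha> by (intro mult_left_mono) auto
   finally show "2 * \<theta>s (Suc i) ^ l \<le> \<alpha> / 2 * \<pi>s (Suc i) w" .
   have "\<alpha>\<^sup>2 * (\<epsilon> / real n) \<le> \<alpha>\<^sup>2 * \<pi>s (Suc i) w" using pe by (intro mult_left_mono) auto
   then show "128 * (1 / (real K * real n) + 4 * \<kappa>) \<le> \<alpha>\<^sup>2 * \<pi>s (Suc i) w" using var by linarith
   have "wk.green (\<theta>s (Suc i)) (2 * l) w \<le> 2 * \<rho> / \<epsilon> * \<pi>s i w"
   proof (cases "i = 0")
    case True
    have "wk.green (\<theta>s (Suc i)) (2 * l) w \<le> 2 / real n"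
     by (rule wk.green_uniform[OF _ _ w]) (use th \<theta>1 True in \<open>simp_all add: add.commute\<close>)
    also have "\<dots> = 2 * (1 / real n)" by simp
    also have "\<dots> \<le> 2 * \<rho> / \<epsilon> * (1 / real n)"
    proof (rule mult_right_mono)
     show "2 \<le> 2 * \<rho> / \<epsilon>" using \<rho> \<epsilon> by (simp add: le_divide_eq)
    qed simp
    finally show ?thesis using True by (simp add: \<pi>s_def)
   next
    case False
    then obtain i' where i': "i = Suc i'" by (cases i) auto
    have i'I: "i' < I" using i i' by simp
    obtain s where hs: "\<forall>k<s. \<theta>s (Suc i) ^ k \<le> \<rho> * \<theta>s i ^ k" "\<theta>s (Suc i) ^ s / (1 - \<theta>s (Suc i)) \<le> 1 / real n"
     using ratio[of i] False i by auto
    have pri: "wk.is_pr (\<theta>s i) (\<pi>s i)" using pr[OF i'I] i' by simp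
    have thi: "0 \<le> \<theta>s i" "\<theta>s i \<le> 1 - \<epsilon>" using \<theta>[OF i'I] i' by auto
    have "wk.green (\<theta>s (Suc i)) (2 * l) w \<le> 2 * \<rho> * \<pi>s i w / (1 - \<theta>s i)"
     by (rule wk.green_compare[OF pri _ _ _ _ w _ \<rho> hs(2)]) (use hs(1) th thi \<epsilon> in auto)
    also have "\<dots> \<le> 2 * \<rho> * \<pi>s i w / \<epsilon>" using thi \<epsilon> p0 \<rho> by (intro divide_left_mono mult_pos_pos mult_nonneg_nonneg) auto
    finally show ?thesis by simp
   qed
   also have "\<dots> \<le> \<kappa> * (3 / 8 * real R * real K * real n) * \<pi>s i w" by (rule mult_right_mono[OF budget p0])
   finally show "wk.green (\<theta>s (Suc i)) (2 * l) w \<le> \<kappa> * (3 / 8 * real R * real K * real n * \<pi>s i w)" by (simp only: mult.assoc)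
  qed
  have prob: "measure_pmf.prob (prog_sem mc.L prog x0) (wk.estimates \<alpha> (\<pi>s I)) \<ge> 1 - real I * (real n * (1 / 2) ^ R)"
   unfolding prog_def by (rule wk.whole_prob[where \<pi>s = \<pi>s and \<theta>s = \<theta>s and I = I, OF R(1) K \<kappa>0 \<alpha> step _ s(1) inv]) (simp_all add: \<pi>s_def)
  have res: "mpc_result W S Alg mem = map_pmf (\<lambda>x. Some (\<lambda>j. if j < M then out x j else [])) (prog_sem (M * 2 ^ b) prog x0)"
   unfolding Alg_def
  proof (rule mpc_result_compile)
   show "valid_step (M * 2 ^ b) (2 ^ b) W s" if "s \<in> set prog" for s
    using vp that unfolding MB mc.vprog_def by blast
   show "x0 c = pack n W (mem (c div 2 ^ b)) (c mod 2 ^ b)" if "c < M * 2 ^ b" for c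
    using that unfolding MB x0_def crop_def x1_def by simp
   show "out x i = out y i" if "\<forall>c. c div 2 ^ b = i \<longrightarrow> x c = y c" for x y i
    unfolding out_def by (rule wk.out_words_local[OF R(3)]) (use that in blast)
   show "length (out x i) \<le> S \<and> set (out x i) \<subseteq> {..<W}" for x i
    unfolding out_def using wk.length_out_words[OF R(2), of x i] wk.set_out_words[of x i] S(1) by simp
  qed (use x0W S(1) in auto)
  have fin: "wk.estimates \<alpha> (\<pi>s I) \<subseteq> (\<lambda>x j. if j < M then out x j else []) -`
   {res. \<exists>x. vector_output M G res x \<and> multiplicative_approx \<alpha> G (pagerank G \<epsilon>) x}"
  proof
   fix x assume x: "x \<in> wk.estimates \<alpha> (\<pi>s I)"
   note vo = wk.vector_output_estimates[OF R(3) MB x G(2) K]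
   have "\<pi>s I = pmf (pagerank G \<epsilon>)" using I \<theta>I by (simp add: \<pi>s_def)
   then have "multiplicative_approx \<alpha> G (pagerank G \<epsilon>) (\<lambda>v. real (wk.med x (v * R)) / (real K * real n))"
    using vo(2) G(2) by (simp add: multiplicative_approx_def)
   then show "x \<in> (\<lambda>x j. if j < M then out x j else []) -`
    {res. \<exists>x. vector_output M G res x \<and> multiplicative_approx \<alpha> G (pagerank G \<epsilon>) x}"
    using vo(1) unfolding out_def by blast
  qed
  show ?thesis unfolding res prob_Some MB using measure_pmf.finite_measure_mono[OF fin] prob
   by (rule order_trans[rotated]) simp
 qed
 moreover have mA: "machines Alg = M" by (simp add: Alg_def)
 ultimately have "solves W S n m \<alpha> \<epsilon> Alg (real I * (real n * (1 / 2) ^ R))"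
  unfolding solves_def mA by blast
 then show ?thesis using rnd mA unfolding M_def by blast
qed

section \<open>Choice of parameters\<close>

lemma shrink_le: "shrink d a \<le> a"
proof (induction d arbitrary: a)
 case (Suc d)
 from Suc[of "a - (a - 1) div 3"] show ?case by simp
qed simp

text \<open>One level replaces \<open>a\<close> by about two thirds of it. Rounding costs 1, and for
  \<open>a \<ge> 5\<close> the bound \<open>(2 * a + 3) / 3\<close> is at most
  \<open>13 / 15 * a\<close>.\<close>

lemma shrink_geometric:
 assumes "4 \<le> b"
 shows "real (shrink d a) \<le> max (real b) ((13 / 15) ^ d * real a)"
proof (induction d arbitrary: a)
 case (Suc d)
 define a' where "a' = a - (a - 1) div 3"
 have step: "shrink (Suc d) a = shrink d a'" by (simp add: a'_def)
 show ?case
 proof (cases "a \<le> b")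
  case True
  have "shrink d a' \<le> a'" by (rule shrink_le)
  also have "a' \<le> b" using True by (simp add: a'_def)
  finally show ?thesis unfolding step by simp
 next
  case False
  then have a5: "5 \<le> a" using assms by simp
  have "3 * a' \<le> 2 * a + 3" unfolding a'_def by presburger
  then have "15 * a' \<le> 13 * a" using a5 by linarith
  then have "real (15 * a') \<le> real (13 * a)" by (simp only: of_nat_le_iff)
  then have "real a' \<le> 13 / 15 * real a" by simp
  then have "(13 / 15) ^ d * real a' \<le> (13 / 15) ^ d * (13 / 15 * real a)" by (intro mult_left_mono) auto
  then have "(13 / 15) ^ d * real a' \<le> (13 / 15) ^ Suc d * real a" by (simp add: mult.assoc mult.left_commute)
  with Suc[of a'] show ?thesis unfolding step by linarith
 qed
qed simp

text \<open>The depth depends only on \<open>f\<close>. Hence nested columnsort takes a constant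
  number of rounds when the block size is a fixed power of the array length.\<close>

lemma shrink_depth: "\<exists>d. \<forall>a b. 4 \<le> b \<longrightarrow> a \<le> f * b \<longrightarrow> shrink d a \<le> b"
proof -
 obtain d where d: "(13 / 15 :: real) ^ d < 1 / (real f + 1)"
  using real_arch_pow_inv[of "1 / (real f + 1)" "13 / 15"] by auto
 have "shrink d a \<le> b" if ab: "4 \<le> b" "a \<le> f * b" for a b
 proof -
  have "(13 / 15) ^ d * real a \<le> 1 / (real f + 1) * (real f * real b)"
   using d ab(2) by (intro mult_mono) (auto simp: of_nat_mult[symmetric] simp del: of_nat_mult)
  also have "\<dots> = real f / (real f + 1) * real b" by simp
  also have "\<dots> \<le> 1 * real b" by (intro mult_right_mono) auto
  finally show ?thesis using shrink_geometric[OF ab(1), of d a] by simp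
 qed
 then show ?thesis by blast
qed

lemma pow2_below: "1 \<le> (x::nat) \<Longrightarrow> \<exists>k. 2 ^ k \<le> x \<and> x < 2 * 2 ^ k"
 using ex_power_ivl1[of 2 x] by auto

lemma pow2_above: "1 \<le> (x::nat) \<Longrightarrow> \<exists>k. x \<le> 2 ^ k \<and> 2 ^ k \<le> 2 * x"
proof -
 assume "1 \<le> x"
 from pow2_below[OF this] obtain k where "2 ^ k \<le> x" "x < 2 * 2 ^ k" by blast
 then show ?thesis by (intro exI[of _ "Suc k"]) simp
qed

section \<open>The sequence of damping factors\<close>

definition slow :: "nat \<Rightarrow> real" where "slow n = ln (ln (ln (real n)) ^ 2 + 2)"

text \<open>The error exponent of the space bound: the first term stands for the loss
  \<open>n powr (4 / slow n)\<close>, and the second writes the polylogarithmic factor of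
  \<open>walk_space_bound\<close> as a power of \<open>n\<close>.\<close>

definition expo :: "nat \<Rightarrow> real" where
 "expo n = 4 / slow n + ln (18468 * (12 * ln (real n) + 16) ^ 2 * ln (real n)) / ln (real n)"

lemma expo_tendsto: "expo \<longlonglongrightarrow> 0"
 unfolding expo_def slow_def by real_asymp

text \<open>Written as \<open>exp (- \<mu>)\<close>, the factor starts at
  \<open>1 / (n + 1)\<close>, and every phase multiplies \<open>\<mu>\<close> by
  \<open>1 - 1 / slow n\<close>, until the value \<open>1 - \<epsilon>\<close> is reached and
  kept.\<close>

definition discount :: "nat \<Rightarrow> real \<Rightarrow> nat \<Rightarrow> real" where
 "discount n \<epsilon> i = min (1 - \<epsilon>) (exp (- (ln (real n + 1) * (1 - 1 / slow n) ^ (i - 1))))"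

text \<open>The cut is made at \<open>s\<close> about \<open>4 * ln n / \<mu>\<close>. Before it the
  quotient of the powers is \<open>exp (k * \<mu> * r)\<close>, at most
  \<open>n powr (4 * r)\<close>. At \<open>s\<close> the new power is at most
  \<open>exp (- 2 * ln n)\<close>, as \<open>r \<le> 1 / 2\<close>, and dividing by
  \<open>1 - \<theta>' \<ge> \<epsilon> \<ge> 1 / n\<close> costs only one factor
  \<open>n\<close>.\<close>

lemma discount_ratio:
 fixes \<mu> r \<epsilon> :: real and n :: nat
 assumes n: "2 \<le> n" and \<mu>: "0 < \<mu>" and r: "0 \<le> r" "r \<le> 1 / 2" and \<epsilon>: "1 / real n \<le> \<epsilon>" "\<epsilon> \<le> 1"
 defines "\<theta> \<equiv> min (1 - \<epsilon>) (exp (- \<mu>))" and "\<theta>' \<equiv> min (1 - \<epsilon>) (exp (- (\<mu> * (1 - r))))"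
 shows "\<exists>s. (\<forall>k<s. \<theta>' ^ k \<le> real n powr (4 * r) * \<theta> ^ k) \<and> \<theta>' ^ s / (1 - \<theta>') \<le> 1 / real n"
proof -
 have n0: "0 < real n" using n by simp
 have e0: "0 < \<epsilon>" using \<epsilon>(1) n0 by (meson divide_pos_pos less_le_trans zero_less_one)
 have lnn: "0 < ln (real n)" using n by simp
 have \<theta>': "0 \<le> \<theta>'" "\<theta>' \<le> 1 - \<epsilon>" "\<theta>' \<le> exp (- (\<mu> * (1 - r)))" unfolding \<theta>'_def using \<epsilon> by auto
 have \<theta>0: "0 \<le> \<theta>" unfolding \<theta>_def using \<epsilon> by auto
 have one: "1 \<le> real n powr (4 * r)" using n r by (intro ge_one_powr_ge_zero) auto
 have fin: "\<theta>' ^ s / (1 - \<theta>') \<le> 1 / real n" if "\<theta>' ^ s \<le> exp (- (2 * ln (real n)))" for s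
 proof -
  have e: "exp (- (2 * ln (real n))) = 1 / real n * (1 / real n)"
  proof -
   have "exp (2 * ln (real n)) = exp (ln (real n)) * exp (ln (real n))" by (simp only: mult_2 exp_add)
   also have "\<dots> = real n * real n" using n0 by simp
   finally show ?thesis by (simp add: exp_minus inverse_eq_divide)
  qed
  have "\<theta>' ^ s / (1 - \<theta>') \<le> exp (- (2 * ln (real n))) / \<epsilon>"
   using \<theta>' e0 that by (intro frac_le) auto
  also have "\<dots> \<le> exp (- (2 * ln (real n))) / (1 / real n)" using \<epsilon>(1) n0 e0 by (intro divide_left_mono) auto
  also have "\<dots> = 1 / real n" unfolding e using n0 by simp
  finally show ?thesis .
 qed
 show ?thesis
 proof (cases "1 - \<epsilon> \<le> exp (- \<mu>)")
  case True
  have "\<mu> * (1 - r) \<le> \<mu> * 1" using \<mu> r by (intro mult_left_mono) auto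
  then have "exp (- \<mu>) \<le> exp (- (\<mu> * (1 - r)))" by simp
  then have "1 - \<epsilon> \<le> exp (- (\<mu> * (1 - r)))" using True by linarith
  then have eq: "\<theta>' = 1 - \<epsilon>" "\<theta> = 1 - \<epsilon>" unfolding \<theta>_def \<theta>'_def using True by (simp_all only: min.absorb1)
  define s where "s = nat \<lceil>2 * ln (real n) / \<epsilon>\<rceil>"
  have "2 * ln (real n) / \<epsilon> \<le> real s" unfolding s_def by (rule real_nat_ceiling_ge)
  then have s: "2 * ln (real n) \<le> real s * \<epsilon>" using e0 by (simp add: divide_le_eq)
  have "\<theta>' ^ s \<le> exp (- \<epsilon>) ^ s" unfolding eq using \<epsilon> exp_ge_add_one_self[of "- \<epsilon>"] by (intro power_mono) auto
  also have "\<dots> = exp (- (real s * \<epsilon>))" by (simp add: exp_of_nat_mult[symmetric])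
  also have "\<dots> \<le> exp (- (2 * ln (real n)))" using s by simp
  finally have "\<theta>' ^ s / (1 - \<theta>') \<le> 1 / real n" by (rule fin)
  moreover have "\<theta>' ^ k \<le> real n powr (4 * r) * \<theta> ^ k" for k
   unfolding eq using mult_right_mono[OF one, of "(1 - \<epsilon>) ^ k"] \<epsilon> by simp
  ultimately show ?thesis by blast
 next
  case False
  then have eq: "\<theta> = exp (- \<mu>)" unfolding \<theta>_def by auto
  define s where "s = nat \<lceil>4 * ln (real n) / \<mu>\<rceil>"
  have "4 * ln (real n) / \<mu> \<le> real s" unfolding s_def by (rule real_nat_ceiling_ge)
  then have s: "4 * ln (real n) \<le> real s * \<mu>" using \<mu> by (simp add: divide_le_eq)
  have "\<mu> * (1 / 2) \<le> \<mu> * (1 - r)" using \<mu> r by (intro mult_left_mono) auto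
  then have "real s * (\<mu> * (1 / 2)) \<le> real s * (\<mu> * (1 - r))" by (rule mult_left_mono) simp
  then have s2: "2 * ln (real n) \<le> real s * (\<mu> * (1 - r))" using s by linarith
  have "\<theta>' ^ s \<le> exp (- (\<mu> * (1 - r))) ^ s" by (intro power_mono \<theta>')
  also have "\<dots> = exp (- (real s * (\<mu> * (1 - r))))" by (simp add: exp_of_nat_mult[symmetric])
  also have "\<dots> \<le> exp (- (2 * ln (real n)))" using s2 by simp
  finally have "\<theta>' ^ s / (1 - \<theta>') \<le> 1 / real n" by (rule fin)
  moreover have "\<theta>' ^ k \<le> real n powr (4 * r) * \<theta> ^ k" if "k < s" for k
  proof -
   have "real k \<le> 4 * ln (real n) / \<mu>"
    using that unfolding s_def by linarith
   then have km: "real k * \<mu> \<le> 4 * ln (real n)" using \<mu> by (simp add: le_divide_eq)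
   have "r * (real k * \<mu>) \<le> r * (4 * ln (real n))" by (rule mult_left_mono[OF km r(1)])
   then have le: "- (real k * (\<mu> * (1 - r))) \<le> 4 * r * ln (real n) + - (real k * \<mu>)" by (simp add: algebra_simps)
   have "\<theta>' ^ k \<le> exp (- (\<mu> * (1 - r))) ^ k" by (intro power_mono \<theta>')
   also have "\<dots> = exp (- (real k * (\<mu> * (1 - r))))" by (simp add: exp_of_nat_mult[symmetric])
   also have "\<dots> \<le> exp (4 * r * ln (real n) + - (real k * \<mu>))" using le by simp
   also have "\<dots> = real n powr (4 * r) * exp (- (real k * \<mu>))" using n0 by (simp only: exp_add powr_def) simp
   also have "exp (- (real k * \<mu>)) = \<theta> ^ k" unfolding eq by (simp add: exp_of_nat_mult[symmetric])
   finally show ?thesis .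
  qed
  ultimately show ?thesis by blast
 qed
qed

lemma discount_step:
 assumes n: "2 \<le> n" and q: "2 \<le> slow n" and \<epsilon>: "1 / real n \<le> \<epsilon>" "\<epsilon> \<le> 1" and i: "0 < i"
 shows "\<exists>s. (\<forall>k<s. discount n \<epsilon> (Suc i) ^ k \<le> real n powr (4 / slow n) * discount n \<epsilon> i ^ k) \<and>
  discount n \<epsilon> (Suc i) ^ s / (1 - discount n \<epsilon> (Suc i)) \<le> 1 / real n"
proof -
 define \<mu> where "\<mu> = ln (real n + 1) * (1 - 1 / slow n) ^ (i - 1)"
 have r: "0 \<le> 1 / slow n" "1 / slow n \<le> 1 / 2" using q by (auto simp: divide_le_eq)
 have "0 < \<mu>" unfolding \<mu>_def using n r by (intro mult_pos_pos zero_less_power) auto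
 from discount_ratio[OF n this r \<epsilon>]
 have "\<exists>s. (\<forall>k<s. min (1 - \<epsilon>) (exp (- (\<mu> * (1 - 1 / slow n)))) ^ k \<le> real n powr (4 * (1 / slow n)) * min (1 - \<epsilon>) (exp (- \<mu>)) ^ k) \<and>
  min (1 - \<epsilon>) (exp (- (\<mu> * (1 - 1 / slow n)))) ^ s / (1 - min (1 - \<epsilon>) (exp (- (\<mu> * (1 - 1 / slow n))))) \<le> 1 / real n" .
 moreover have "discount n \<epsilon> i = min (1 - \<epsilon>) (exp (- \<mu>))" by (simp add: discount_def \<mu>_def)
 moreover have "discount n \<epsilon> (Suc i) = min (1 - \<epsilon>) (exp (- (\<mu> * (1 - 1 / slow n))))"
 proof -
  have "(1 - 1 / slow n) ^ i = (1 - 1 / slow n) ^ (i - 1) * (1 - 1 / slow n)" using i by (cases i) auto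
  then have "ln (real n + 1) * (1 - 1 / slow n) ^ i = \<mu> * (1 - 1 / slow n)" by (simp only: \<mu>_def mult.assoc)
  then show ?thesis by (simp only: discount_def diff_Suc_1)
 qed
 ultimately show ?thesis by simp
qed

text \<open>After \<open>slow n * ln (ln (n + 1) / \<epsilon>)\<close> further phases
  \<open>\<mu>\<close> has dropped from \<open>ln (n + 1)\<close> to at most
  \<open>\<epsilon>\<close>, and then \<open>exp (- \<mu>)\<close> is at least
  \<open>1 - \<epsilon>\<close>.\<close>

lemma discount_last:
 assumes n: "2 \<le> n" and q: "2 \<le> slow n" and \<epsilon>: "0 < \<epsilon>" "\<epsilon> \<le> 1" and I: "ln (ln (real n + 1) / \<epsilon>) * slow n \<le> real (I - 1)"
 shows "discount n \<epsilon> I = 1 - \<epsilon>"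
proof -
 define r where "r = 1 / slow n"
 have r: "0 < r" "r \<le> 1 / 2" using q by (auto simp: r_def divide_le_eq)
 have ln0: "0 < ln (real n + 1)" using n by simp
 have "ln (ln (real n + 1) / \<epsilon>) \<le> real (I - 1) * r"
  using I q by (simp add: r_def le_divide_eq)
 then have rI: "exp (- (real (I - 1) * r)) \<le> exp (- ln (ln (real n + 1) / \<epsilon>))" by simp
 have "(1 - r) ^ (I - 1) \<le> exp (- r) ^ (I - 1)" using r exp_ge_add_one_self[of "- r"] by (intro power_mono) auto
 also have "\<dots> = exp (- (real (I - 1) * r))" by (simp add: exp_of_nat_mult[symmetric])
 also note rI
 also have "exp (- ln (ln (real n + 1) / \<epsilon>)) = \<epsilon> / ln (real n + 1)" using ln0 \<epsilon> by (simp add: exp_minus)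
 finally have "ln (real n + 1) * (1 - r) ^ (I - 1) \<le> ln (real n + 1) * (\<epsilon> / ln (real n + 1))"
  using ln0 by (intro mult_left_mono) auto
 then have "ln (real n + 1) * (1 - r) ^ (I - 1) \<le> \<epsilon>" using ln0 by simp
 then have "1 - \<epsilon> \<le> exp (- (ln (real n + 1) * (1 - r) ^ (I - 1)))"
  using exp_ge_add_one_self[of "- (ln (real n + 1) * (1 - r) ^ (I - 1))"] by linarith
 then show ?thesis by (simp add: discount_def r_def)
qed

text \<open>There are about \<open>2 * R * l\<close> rows of \<open>n * R * (K + 1)\<close> cells.
  The number of levels contributes one factor \<open>1 / \<epsilon>\<close> and the number of walks
  two, and the constant 18468 is \<open>3 * 6 * 1026\<close>.\<close>

lemma walk_space_bound:
 fixes n R l K :: nat and \<alpha> \<epsilon> Y :: real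
 assumes n: "16 \<le> n" "1 \<le> ln (real n)" and R: "1 \<le> R" "real R \<le> Y" "Y = 12 * ln (real n) + 16"
  and l: "1 \<le> l" "real l \<le> 6 * ln (real n) / \<epsilon>" and \<alpha>: "0 < \<alpha>" "\<alpha> \<le> 1" and \<epsilon>: "0 < \<epsilon>" "\<epsilon> \<le> 1"
  and K: "real K + 1 \<le> 1026 * (real n powr (4 / slow n) / (\<epsilon> ^ 2 * \<alpha>\<^sup>2))"
 shows "real ((1 + R * (2 * l)) * (n * R * (K + 1))) \<le> real n powr (1 + expo n) / (\<epsilon> ^ 3 * \<alpha>\<^sup>2)"
proof -
 define \<rho> where "\<rho> = real n powr (4 / slow n)"
 have n0: "0 < real n" using n by simp
 have Y0: "0 \<le> Y" using R by linarith
 have "1 * 1 \<le> real R * real l" using R l by (intro mult_mono) auto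
 then have "1 + real R * (2 * real l) \<le> 3 * (real R * real l)" by simp
 also have "\<dots> \<le> 3 * (Y * (6 * ln (real n) / \<epsilon>))" using R l Y0 by (intro mult_left_mono mult_mono) auto
 finally have A: "1 + real R * (2 * real l) \<le> 3 * (Y * (6 * ln (real n) / \<epsilon>))" .
 have B: "real n * real R * (real K + 1) \<le> real n * Y * (1026 * (\<rho> / (\<epsilon> ^ 2 * \<alpha>\<^sup>2)))"
  using R K n0 Y0 unfolding \<rho>_def by (intro mult_mono mult_left_mono mult_nonneg_nonneg) auto
 have A0: "0 \<le> 3 * (Y * (6 * ln (real n) / \<epsilon>))" using Y0 n \<epsilon> by simp
 have "real ((1 + R * (2 * l)) * (n * R * (K + 1))) = (1 + real R * (2 * real l)) * (real n * real R * (real K + 1))"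
  by (simp only: of_nat_add of_nat_mult of_nat_numeral of_nat_1)
 also have "\<dots> \<le> (3 * (Y * (6 * ln (real n) / \<epsilon>))) * (real n * Y * (1026 * (\<rho> / (\<epsilon> ^ 2 * \<alpha>\<^sup>2))))"
  by (rule mult_mono[OF A B A0]) simp
 also have "\<dots> = real n * \<rho> * (18468 * Y ^ 2 * ln (real n)) / (\<epsilon> ^ 3 * \<alpha>\<^sup>2)"
  using \<epsilon> \<alpha> by (simp add: field_simps power2_eq_square power3_eq_cube)
 also have "real n * \<rho> * (18468 * Y ^ 2 * ln (real n)) = real n powr (1 + expo n)"
 proof -
  define A where "A = 18468 * Y ^ 2 * ln (real n)"
  have "0 < Y" using R(3) n by linarith
  then have "0 < A" using n by (simp add: A_def)
  moreover have "ln (real n) \<noteq> 0" using n by linarith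
  ultimately have "real n powr (ln A / ln (real n)) = A" using n0 by (simp add: powr_def)
  moreover have "1 + expo n = 1 + 4 / slow n + ln A / ln (real n)" by (simp add: expo_def A_def R(3))
  ultimately show ?thesis using n0 by (simp add: powr_add \<rho>_def A_def)
 qed
 finally show ?thesis .
qed

text \<open>With \<open>Z = 2 ^ a\<close> the product in the word bound is at most
  \<open>Z ^ 25\<close>: two factors from the array length, nine from the three keys, fourteen from
  the record. The exponent \<open>c + 8\<close> pays for the edges, the cells of the walk and the
  rounding to a power of two.\<close>

lemma word_bound:
 fixes n c a m N :: nat
 assumes n: "8 \<le> n" and m: "m \<le> n ^ c" and N: "N \<le> n ^ 7" and a: "2 ^ a \<le> 4 * (m + N)" "1 \<le> a"
 shows "2 ^ a \<le> n ^ (c + 8)"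
  and "2 ^ a * 2 ^ a * (2 ^ a * 2 ^ a + 1) * (2 ^ a * 2 ^ a + 1) * (2 ^ a * 2 ^ a + 1) * (2 ^ a) ^ 14 < n ^ (25 * (c + 8) + 1)"
proof -
 define p where "p = n ^ (c + 7)"
 have "n ^ c \<le> p" "n ^ 7 \<le> p" unfolding p_def using n by (auto intro!: power_increasing)
 then have "m \<le> p" "N \<le> p" using m N by (blast intro: order_trans)+
 then have "4 * (m + N) \<le> 4 * (p + p)" by (intro mult_le_mono2 add_mono)
 with a(1) have "2 ^ a \<le> 4 * (p + p)" by (rule order_trans)
 also have "\<dots> = 8 * p" by simp
 also have "\<dots> \<le> n * p" using n by (rule mult_le_mono1)
 also have "\<dots> = n ^ (c + 8)" by (simp add: p_def power_add numeral_eq_Suc)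
 finally show *: "2 ^ a \<le> n ^ (c + 8)" .
 define Z :: nat where "Z = 2 ^ a"
 have "2 ^ 1 \<le> Z" unfolding Z_def using a(2) by (intro power_increasing) auto
 then have Z2: "2 \<le> Z" by simp
 have "Z * Z + 1 \<le> 2 * (Z * Z)" using Z2 by simp
 also have "\<dots> \<le> Z * (Z * Z)" using Z2 by (rule mult_le_mono1)
 finally have X: "Z * Z + 1 \<le> Z ^ 3" by (simp add: power3_eq_cube mult.assoc)
 have "Z * Z * (Z * Z + 1) * (Z * Z + 1) * (Z * Z + 1) * Z ^ 14 \<le> Z * Z * Z ^ 3 * Z ^ 3 * Z ^ 3 * Z ^ 14"
  by (intro mult_le_mono X order_refl)
 also have "\<dots> = Z ^ 25" by (simp add: numeral_eq_Suc mult_ac)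
 also have "\<dots> \<le> (n ^ (c + 8)) ^ 25" using * unfolding Z_def by (rule power_mono) simp
 also have "\<dots> = n ^ (25 * (c + 8))" by (simp add: power_mult[symmetric] mult.commute)
 also have "\<dots> < n ^ (25 * (c + 8) + 1)" using n by (intro power_strict_increasing) auto
 finally show "2 ^ a * 2 ^ a * (2 ^ a * 2 ^ a + 1) * (2 ^ a * 2 ^ a + 1) * (2 ^ a * 2 ^ a + 1) * (2 ^ a) ^ 14 < n ^ (25 * (c + 8) + 1)"
  unfolding Z_def .
qed

text \<open>With \<open>u = ln (ln n) + ln (1 / \<epsilon>)\<close> there are at most
  \<open>3 * u * slow n\<close> phases, of at most \<open>18 * u\<close> units each. Here
  \<open>u\<close> squared is at most \<open>2 * X\<close>, and \<open>slow n\<close> is at most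
  \<open>ln (X + 2)\<close>: the slow growth of \<open>slow\<close> is made to fit the logarithmic
  factor.\<close>

lemma round_bound:
 fixes n I J' l U :: nat and \<epsilon> :: real
 assumes lam: "1 \<le> ln (ln (real n))" and n: "16 \<le> n" and q: "2 \<le> slow n" and \<epsilon>: "0 < \<epsilon>" "\<epsilon> \<le> 1"
  and I: "real I \<le> ln (ln (real n + 1) / \<epsilon>) * slow n + 2"
  and J: "2 ^ J' \<le> 4 * l" and l: "real l \<le> 6 * ln (real n) / \<epsilon>" and U: "1 \<le> U"
 defines "X \<equiv> ln (ln (real n)) ^ 2 + ln (1 / \<epsilon>) ^ 2"
 shows "real ((6 + I * (J' + 11)) * U + 1) \<le> 122 * real U * X * ln (X + 2)"
proof -
 define t where "t = ln (1 / \<epsilon>)"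
 define u where "u = ln (ln (real n)) + t"
 define q where "q = slow n"
 have t0: "0 \<le> t" unfolding t_def using \<epsilon> by simp
 have u1: "1 \<le> u" unfolding u_def using lam t0 by linarith
 have q2: "2 \<le> q" unfolding q_def by (rule assms(3))
 have lnn: "0 < ln (real n)" using n by simp
 have lnn1: "0 < ln (real n + 1)" using n by simp
 have "ln (real n + 1) \<le> ln (real n * real n)"
 proof -
  have "real n + 1 \<le> 2 * real n" using n by simp
  also have "\<dots> \<le> real n * real n" using n by (intro mult_right_mono) auto
  finally show ?thesis using n by simp
 qed
 also have "\<dots> = 2 * ln (real n)" using n by (simp add: ln_mult)
 finally have "ln (ln (real n + 1)) \<le> ln (2 * ln (real n))"
  using lnn lnn1 by (simp only: ln_le_cancel_iff mult_pos_pos zero_less_numeral)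
 also have "\<dots> = ln 2 + ln (ln (real n))" using lnn by (simp add: ln_mult)
 also have "\<dots> \<le> 1 + ln (ln (real n))" using ln_2_less_1 by simp
 finally have ll: "ln (ln (real n + 1)) \<le> 1 + ln (ln (real n))" .
 have "ln (ln (real n + 1) / \<epsilon>) = ln (ln (real n + 1)) + t"
  using lnn1 \<epsilon> by (simp add: t_def ln_div)
 then have "ln (ln (real n + 1) / \<epsilon>) \<le> u + u" using ll u1 by (simp add: u_def)
 then have "ln (ln (real n + 1) / \<epsilon>) * q \<le> (u + u) * q" using q2 by (intro mult_right_mono) auto
 moreover have uq: "1 * 2 \<le> u * q" using u1 q2 by (intro mult_mono) auto
 ultimately have I3: "real I \<le> 3 * (u * q)" using I by (simp add: q_def algebra_simps)
 have eu: "ln (real n) / \<epsilon> = exp u" unfolding u_def t_def using lnn \<epsilon> by (simp add: exp_add)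
 have "real (2 ^ J') \<le> real (4 * l)" using J by (simp only: of_nat_le_iff)
 then have "2 ^ J' \<le> 24 * exp u" using l unfolding eu[symmetric] by simp
 also have "\<dots> \<le> 2 ^ 5 * exp u" by simp
 finally have "ln ((2::real) ^ J') \<le> ln (2 ^ 5 * exp u)" by simp
 moreover have "ln ((2::real) ^ J') = real J' * ln 2" "ln ((2::real) ^ 5) = 5 * ln 2" using ln_realpow[of 2 5] by (simp_all add: ln_realpow)
 moreover have "ln (2 ^ 5 * exp u) = ln (2 ^ 5) + ln (exp u)" by (simp add: ln_mult)
 ultimately have J1: "real J' * ln 2 \<le> 5 * ln 2 + u" by (simp only: ln_exp)
 have l2: "2 / 3 \<le> ln (2::real)" by (rule ln2_ge_two_thirds)
 have "u * 1 \<le> u * (3 / 2 * ln 2)" using l2 u1 by (intro mult_left_mono) auto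
 then have "real J' * ln 2 \<le> (5 + 3 / 2 * u) * ln 2" using J1 by (simp add: algebra_simps)
 then have "real J' \<le> 5 + 3 / 2 * u" by (rule mult_right_le_imp_le) simp
 then have J18: "real J' + 11 \<le> 18 * u" using u1 by linarith
 have uuq: "1 * 2 \<le> u * (u * q)" using u1 uq by (intro mult_mono) auto
 have "real I * (real J' + 11) \<le> 3 * (u * q) * (18 * u)" using I3 J18 uq by (intro mult_mono) auto
 then have "6 + real I * (real J' + 11) \<le> 60 * (u * (u * q))" using uuq by (simp add: algebra_simps)
 then have "(6 + real I * (real J' + 11)) * real U \<le> 60 * (u * (u * q)) * real U" by (intro mult_right_mono) auto
 moreover have "1 * 1 \<le> u * (u * q) * real U" using uuq U by (intro mult_mono) auto
 ultimately have le61: "(6 + real I * (real J' + 11)) * real U + 1 \<le> 61 * (u * (u * q) * real U)" by simp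
 have "0 \<le> (ln (ln (real n)) - t) ^ 2" by simp
 then have "u * u \<le> 2 * X" unfolding u_def X_def t_def[symmetric] by (simp add: power2_eq_square algebra_simps)
 moreover have "q \<le> ln (X + 2)" unfolding q_def slow_def X_def
  by (subst ln_le_cancel_iff) (auto intro: add_nonneg_pos add_nonneg_nonneg)
 moreover have "0 \<le> X" by (simp add: X_def)
 ultimately have "(u * u) * q \<le> (2 * X) * ln (X + 2)" using q2 by (intro mult_mono[of "u * u" "2 * X" q]) auto
 then have "(u * u) * q * real U \<le> (2 * X) * ln (X + 2) * real U" by (intro mult_right_mono) auto
 then have "61 * (u * (u * q) * real U) \<le> 122 * real U * X * ln (X + 2)" by (simp add: mult_ac)
 moreover have "real ((6 + I * (J' + 11)) * U + 1) = (6 + real I * (real J' + 11)) * real U + 1"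
  by (simp only: of_nat_add of_nat_mult of_nat_numeral of_nat_1)
 ultimately show ?thesis using le61 by linarith
qed

lemma pagerank_instance:
 fixes n S c m f d :: nat and \<delta> \<alpha> \<epsilon> :: real
 assumes n: "16 \<le> n" and \<delta>: "0 < \<delta>" and lam: "1 \<le> ln (ln (real n))" and q: "2 \<le> slow n"
  and S: "S \<le> n" "2 * real n powr (\<delta> / 2) \<le> real S" and s16: "16 \<le> real n powr (\<delta> / 2)"
  and Y: "12 * ln (real n) + 16 \<le> real n powr (\<delta> / 2)"
  and few: "(ln (ln (real n + 1)) + ln (real n)) * slow n + 2 \<le> real n" and ex: "expo n \<le> 1"
  and f: "(real c + 8) * 2 / \<delta> \<le> real f" and d: "\<And>a b. 4 \<le> b \<Longrightarrow> a \<le> f * b \<Longrightarrow> shrink d a \<le> b"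
  and m: "0 < m" "m \<le> n ^ c" and \<alpha>: "1 / real n \<le> \<alpha>" "\<alpha> \<le> 1 / 4" and \<epsilon>: "1 / real n \<le> \<epsilon>" "\<epsilon> \<le> 1"
 defines "X \<equiv> ln (ln (real n)) ^ 2 + ln (1 / \<epsilon>) ^ 2" and "U \<equiv> 4 * 6 ^ d + 2 * f + (5::nat)"
 shows "\<exists>Alg. real (rounds Alg) \<le> 122 * real U * X * ln (X + 2) \<and>
  real (machines Alg * S) \<le> 8 * (real m / \<alpha>\<^sup>2 + real n powr (1 + expo n) / (\<epsilon> powr 3.5 * \<alpha>\<^sup>2)) \<and>
  m \<le> machines Alg * (S div 2) \<and> solves (n ^ (25 * (c + 8) + 1)) S n m \<alpha> \<epsilon> Alg (1 / real n)"
proof -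
 have n0: "0 < real n" using n by simp
 have "0 < 1 / real n" using n0 by simp
 then have \<epsilon>0: "0 < \<epsilon>" and \<alpha>0: "0 < \<alpha>" using \<epsilon>(1) \<alpha>(1) by linarith+
 have lnpos: "0 < ln (real n)" using n by simp
 have lnn: "1 \<le> ln (real n)"
 proof -
  have "exp 1 \<le> exp (ln (ln (real n)))" using lam by simp
  then show ?thesis using lnpos exp_ge_add_one_self[of 1] by simp
 qed
 have "1 \<le> real S" using S(2) s16 by linarith
 then have "1 \<le> S" by simp
 from pow2_below[OF this] obtain b where b: "2 ^ b \<le> S" "S < 2 * 2 ^ b" by blast
 have bn: "real n powr (\<delta> / 2) < 2 ^ b"
 proof -
  have "real S < real (2 * 2 ^ b)" using b(2) by (simp only: of_nat_less_iff)
  then show ?thesis using S(2) by simp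
 qed
 have "(2::real) ^ 4 < 2 ^ b" using bn s16 by simp
 then have "4 < b" by (rule power_less_imp_less_exp[rotated]) simp
 then have b4: "4 \<le> b" by simp
 \<comment> \<open>\<open>R\<close> becomes a power of two of size at least \<open>5 * ln n\<close>,
   so \<open>2 ^ R\<close> is at least \<open>n ^ 3\<close>; this beats the union over at most
   \<open>n\<close> phases and \<open>n\<close> vertices. Being a power of two below
   \<open>2 ^ b\<close>, it divides the block size. The summand 8 secures \<open>R \<ge> 8\<close>
   for the budget.\<close>
 define X0 where "X0 = nat \<lceil>5 * ln (real n)\<rceil> + 8"
 have X0: "5 * ln (real n) + 7 \<le> real X0" "real X0 \<le> 5 * ln (real n) + 9" unfolding X0_def using lnn by linarith+
 have "1 \<le> X0" unfolding X0_def by simp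
 from pow2_above[OF this] obtain j where j: "X0 \<le> 2 ^ j" "2 ^ j \<le> 2 * X0" by blast
 define R :: nat where "R = 2 ^ j"
 have "real (2 ^ j) \<le> real (2 * X0)" using j(2) by (simp only: of_nat_le_iff)
 then have RY: "real R \<le> 12 * ln (real n) + 16" unfolding R_def using X0 lnn by simp
 have "real X0 \<le> real (2 ^ j)" using j(1) by (simp only: of_nat_le_iff)
 then have R5: "5 * ln (real n) \<le> real R" unfolding R_def using X0 by linarith
 have R8: "8 \<le> R" unfolding R_def using j(1) by (simp add: X0_def)
 have "real R = 2 ^ j" by (simp add: R_def)
 then have jb: "(2::real) ^ j < 2 ^ b" using RY Y bn by linarith
 then have "j < b" by (simp only: power_strict_increasing_iff)
 then have Rb: "R dvd 2 ^ b" unfolding R_def by (intro le_imp_power_dvd) simp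
 have Re: "even R" using R8 unfolding R_def by (cases j) auto
 \<comment> \<open>This makes \<open>(1 - \<epsilon>) ^ l\<close> at most \<open>n ^ (- 5)\<close>,
   which is small compared with \<open>\<alpha> * \<epsilon> / n\<close>, a quantity of at least
   \<open>n ^ (- 3)\<close>.\<close>
 define l where "l = nat \<lceil>5 * ln (real n) / \<epsilon>\<rceil>"
 have l1: "5 * ln (real n) / \<epsilon> \<le> real l" unfolding l_def by (rule real_nat_ceiling_ge)
 have "1 \<le> ln (real n) / \<epsilon>" using lnn \<epsilon> \<epsilon>0 by (simp add: le_divide_eq)
 moreover have "0 \<le> 5 * ln (real n) / \<epsilon>" using lnn \<epsilon>0 by simp
 then have "real l \<le> 5 * ln (real n) / \<epsilon> + 1" unfolding l_def by linarith
 ultimately have l2: "real l \<le> 6 * ln (real n) / \<epsilon>" by simp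
 have "0 < 5 * ln (real n) / \<epsilon>" using lnn \<epsilon>0 by simp
 then have "0 < real l" using l1 by linarith
 then have l0: "0 < l" by simp
 then have "1 \<le> 2 * l" by simp
 from pow2_above[OF this] obtain J' where J: "2 * l \<le> 2 ^ J'" "2 ^ J' \<le> 2 * (2 * l)" by blast
 define \<rho> where "\<rho> = real n powr (4 / slow n)"
 have \<rho>: "1 \<le> \<rho>" unfolding \<rho>_def using n q by (intro ge_one_powr_ge_zero) auto
 \<comment> \<open>With this choice \<open>128 * 4 * \<kappa>\<close> is exactly half of the
   right-hand side of the variance condition.\<close>
 define \<kappa> where "\<kappa> = \<alpha>\<^sup>2 * \<epsilon> / (1024 * real n)"
 define E where "E = \<epsilon> ^ 2 * \<alpha>\<^sup>2"
 have E0: "0 < E" unfolding E_def using \<epsilon>0 \<alpha>0 by simp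
 have "\<epsilon> ^ 2 * \<alpha>\<^sup>2 \<le> 1 * 1" using \<epsilon> \<alpha> \<epsilon>0 \<alpha>0 by (intro mult_mono power_le_one) auto
 then have E1: "E \<le> 1" by (simp add: E_def)
 \<comment> \<open>For \<open>R \<ge> 8\<close> the budget needs
   \<open>3 * \<kappa> * K * n \<ge> 2 * \<rho> / \<epsilon>\<close>, which this value meets with
   \<open>3 * \<rho> / \<epsilon>\<close> on the left. It also keeps \<open>128 / (K * n)\<close>
   within the other half of the variance condition.\<close>
 define K where "K = nat \<lceil>1024 * (\<rho> / E)\<rceil>"
 have K1: "1024 * (\<rho> / E) \<le> real K" unfolding K_def by (rule real_nat_ceiling_ge)
 have "E \<le> \<rho>" using E1 \<rho> by linarith
 then have rE: "1 \<le> \<rho> / E" using E0 by (simp add: le_divide_eq)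
 have K2: "real K + 1 \<le> 1026 * (\<rho> / E)" unfolding K_def using rE by linarith
 have "0 < real K" using K1 rE by linarith
 then have K0: "0 < K" by simp
 define NN where "NN = (1 + R * (2 * l)) * (n * R * (K + 1))"
 have NNr: "real NN \<le> real n powr (1 + expo n) / (\<epsilon> ^ 3 * \<alpha>\<^sup>2)"
  unfolding NN_def
  by (rule walk_space_bound[OF n lnn _ RY refl _ l2 \<alpha>0 _ \<epsilon>0 \<epsilon>(2)])
   (use R8 l0 \<alpha> K2 in \<open>auto simp: \<rho>_def E_def\<close>)
 have NNn: "NN \<le> n ^ 7"
 proof -
  have e: "1 / \<epsilon> \<le> real n" "1 / \<alpha> \<le> real n" using \<epsilon>(1) \<alpha>(1) n0 \<epsilon>0 \<alpha>0 by (simp_all add: divide_le_eq mult.commute)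
  have "real n powr (1 + expo n) \<le> real n powr 2" using ex n by (intro powr_mono) auto
  then have p: "real n powr (1 + expo n) \<le> real n ^ 2" using n0 by (simp add: powr_numeral)
  have "real n powr (1 + expo n) / (\<epsilon> ^ 3 * \<alpha>\<^sup>2) = real n powr (1 + expo n) * ((1 / \<epsilon>) ^ 3 * (1 / \<alpha>) ^ 2)"
   by (simp add: power_divide)
  also have "\<dots> \<le> real n ^ 2 * (real n ^ 3 * real n ^ 2)"
   using p e \<epsilon>0 \<alpha>0 by (intro mult_mono power_mono) auto
  also have "\<dots> = real (n ^ 7)" by (simp add: power_add[symmetric])
  finally have "real NN \<le> real (n ^ 7)" using NNr by linarith
  then show ?thesis by (simp only: of_nat_le_iff)
 qed
 have "1 \<le> m + NN" using m by simp
 \<comment> \<open>The home cells have to hold the edges as well as the cells of the walk; the array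
   is twice as long to give records and queries separate cells.\<close>
 from pow2_above[OF this] obtain a' where a': "m + NN \<le> 2 ^ a'" "2 ^ a' \<le> 2 * (m + NN)" by blast
 define a where "a = Suc a'"
 have a1: "a - 1 = a'" "2 ^ a = 2 * (2::nat) ^ a'" by (simp_all add: a_def)
 define W where "W = n ^ (25 * (c + 8) + 1)"
 have aw: "2 ^ a \<le> n ^ (c + 8)"
  and WZ: "2 ^ a * 2 ^ a * (2 ^ a * 2 ^ a + 1) * (2 ^ a * 2 ^ a + 1) * (2 ^ a * 2 ^ a + 1) * (2 ^ a) ^ 14 < W"
  unfolding W_def using word_bound[of n m c NN a] n m NNn a' by (simp_all add: a_def)
 have n_NN: "n \<le> NN"
 proof -
  have "1 * (n * 1 * 1) \<le> (1 + R * (2 * l)) * (n * R * (K + 1))" using R8 by (intro mult_le_mono) auto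
  then show ?thesis by (simp add: NN_def)
 qed
 have "2 ^ b \<le> (2::nat) ^ a" using b(1) S(1) n_NN a' a1 by linarith
 then have ba: "b \<le> a" by (rule power_le_imp_le_exp[rotated]) simp
 \<comment> \<open>The array has at most \<open>n ^ (c + 8)\<close> cells and a block more than
   \<open>n powr (\<delta> / 2)\<close>, so the ratio of the exponents is bounded. This bounds both
   the nesting depth of the sorts and the number of scan stages.\<close>
 have afb: "a \<le> f * b"
 proof -
  have l2: "0 < ln (2::real)" by simp
  have "real (2 ^ a) \<le> real (n ^ (c + 8))" using aw by (simp only: of_nat_le_iff)
  then have "(2::real) ^ a \<le> real n ^ (c + 8)" by simp
  then have "ln ((2::real) ^ a) \<le> ln (real n ^ (c + 8))" using n0 by simp
  then have A: "real a * ln 2 \<le> (real c + 8) * ln (real n)" by (simp add: ln_realpow n0)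
  have "ln (real n powr (\<delta> / 2)) \<le> ln (2 ^ b)" using bn n0 by (subst ln_le_cancel_iff) auto
  then have "\<delta> / 2 * ln (real n) \<le> real b * ln 2" using n0 by (simp add: ln_powr ln_realpow)
  then have "(real c + 8) * 2 / \<delta> * (\<delta> / 2 * ln (real n)) \<le> (real c + 8) * 2 / \<delta> * (real b * ln 2)"
   using \<delta> by (intro mult_left_mono) auto
  moreover have "(real c + 8) * 2 / \<delta> * (\<delta> / 2 * ln (real n)) = (real c + 8) * ln (real n)" using \<delta> by simp
  moreover have "(real c + 8) * 2 / \<delta> * (real b * ln 2) \<le> real f * (real b * ln 2)" by (rule mult_right_mono[OF f]) simp
  ultimately have "real a * ln 2 \<le> real f * real b * ln 2" using A by linarith
  then have "real a \<le> real f * real b" using l2 by (rule mult_right_le_imp_le)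
  then have "real a \<le> real (f * b)" by simp
  then show ?thesis by (simp only: of_nat_le_iff)
 qed
 have mach: "machine a b d f (2 ^ a) W"
 proof unfold_locales
  show "2 \<le> (2::nat) ^ a" by (simp add: a_def)
 qed (use b4 d[OF b4 afb] afb WZ in \<open>simp_all add: a_def\<close>)
 \<comment> \<open>The additional phase is due to the exponent \<open>i - 1\<close> in
   \<open>discount\<close>: the first phase works with the initial factor.\<close>
 define I where "I = nat \<lceil>ln (ln (real n + 1) / \<epsilon>) * slow n\<rceil> + 1"
 have lnn1: "1 \<le> ln (real n + 1)"
 proof -
  have "ln (real n) \<le> ln (real n + 1)" using n0 by simp
  then show ?thesis using lnn by linarith
 qed
 have "1 \<le> ln (real n + 1) / \<epsilon>" using lnn1 \<epsilon> \<epsilon>0 by (simp add: le_divide_eq)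
 then have "0 \<le> ln (ln (real n + 1) / \<epsilon>)" by simp
 then have I0: "0 \<le> ln (ln (real n + 1) / \<epsilon>) * slow n" using q by simp
 have I1: "ln (ln (real n + 1) / \<epsilon>) * slow n \<le> real (I - 1)"
  unfolding I_def add_diff_cancel_right' by (rule real_nat_ceiling_ge)
 have I2: "real I \<le> ln (ln (real n + 1) / \<epsilon>) * slow n + 2" unfolding I_def using I0 by linarith
 have In: "real I \<le> real n"
 proof -
  have "1 / \<epsilon> \<le> real n" using \<epsilon>(1) n0 \<epsilon>0 by (simp add: divide_le_eq mult.commute)
  then have "ln (1 / \<epsilon>) \<le> ln (real n)" using \<epsilon>0 n0 by (subst ln_le_cancel_iff) auto
  moreover have "0 < ln (real n + 1)" using lnn1 by linarith
  then have "ln (ln (real n + 1) / \<epsilon>) = ln (ln (real n + 1)) + ln (1 / \<epsilon>)" using \<epsilon>0 by (simp add: ln_div)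
  ultimately have "ln (ln (real n + 1) / \<epsilon>) * slow n \<le> (ln (ln (real n + 1)) + ln (real n)) * slow n"
   using q by (intro mult_right_mono) auto
  then show ?thesis using I2 few by linarith
 qed
 have two: "2 \<le> n" using n by simp
 have fail: "real I * (real n * (1 / 2) ^ R) \<le> 1 / real n"
 proof -
  have "3 * ln (real n) \<le> 2 / 3 * (5 * ln (real n))" using lnn by simp
  also have "\<dots> \<le> ln 2 * real R" using R5 lnn ln2_ge_two_thirds by (intro mult_mono) auto
  finally have "exp (3 * ln (real n)) \<le> exp (real R * ln 2)" by (simp add: mult.commute)
  moreover have "exp (real R * ln 2) = (2::real) ^ R" by (simp add: exp_of_nat_mult)
  moreover have "exp (3 * ln (real n)) = real n ^ 3" using n0 exp_of_nat_mult[of 3 "ln (real n)"] by simp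
  ultimately have R3: "real n ^ 3 \<le> 2 ^ R" by simp
  have "real I * (real n * (1 / 2) ^ R) = real I * real n / 2 ^ R" by (simp add: power_divide)
  also have "\<dots> \<le> real n * real n / real n ^ 3" using In R3 n0 by (intro frac_le mult_right_mono) auto
  also have "\<dots> = 1 / real n" using n0 by (simp add: power3_eq_cube)
  finally show ?thesis .
 qed
 have budget: "2 * \<rho> / \<epsilon> \<le> \<kappa> * (3 / 8 * real R * real K * real n)"
 proof -
  have "2 * \<rho> / \<epsilon> \<le> 3 * (\<rho> / \<epsilon>)" using \<rho> \<epsilon>0 by (simp add: divide_right_mono)
  also have "\<dots> = \<alpha>\<^sup>2 * \<epsilon> / 1024 * (3 / 8 * 8 * (1024 * (\<rho> / E)))"
   unfolding E_def using \<epsilon>0 \<alpha>0 by (simp add: field_simps power2_eq_square)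
  also have "\<dots> \<le> \<alpha>\<^sup>2 * \<epsilon> / 1024 * (3 / 8 * real R * real K)"
   using K1 R8 \<epsilon>0 \<rho> E0 by (intro mult_left_mono mult_mono) auto
  also have "\<dots> = \<kappa> * (3 / 8 * real R * real K * real n)" unfolding \<kappa>_def using n0 by simp
  finally show ?thesis .
 qed
 have var: "128 * (1 / (real K * real n) + 4 * \<kappa>) \<le> \<alpha>\<^sup>2 * (\<epsilon> / real n)"
 proof -
  have "256 \<le> 1024 * \<rho>" using \<rho> by simp
  also have "\<dots> = 1024 * (\<rho> / E) * E" using E0 by simp
  also have "\<dots> \<le> real K * E" using K1 E0 by (intro mult_right_mono) auto
  also have "(\<alpha>\<^sup>2 * \<epsilon>) * \<epsilon> \<le> (\<alpha>\<^sup>2 * \<epsilon>) * 1" using \<epsilon> \<epsilon>0 by (intro mult_left_mono) auto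
  then have "E \<le> \<alpha>\<^sup>2 * \<epsilon>" unfolding E_def by (simp only: power2_eq_square mult_ac mult_1_right)
  then have "real K * E \<le> real K * (\<alpha>\<^sup>2 * \<epsilon>)" by (rule mult_left_mono) simp
  finally have "256 / real K \<le> \<alpha>\<^sup>2 * \<epsilon>" using K0 by (simp add: divide_le_eq mult.commute)
  then have "256 / real K / (2 * real n) \<le> \<alpha>\<^sup>2 * \<epsilon> / (2 * real n)" using n0 by (intro divide_right_mono) auto
  then have "128 * (1 / (real K * real n)) \<le> \<alpha>\<^sup>2 * \<epsilon> / (2 * real n)" by simp
  moreover have "128 * (4 * \<kappa>) = \<alpha>\<^sup>2 * \<epsilon> / (2 * real n)" by (simp add: \<kappa>_def)
  moreover have "\<alpha>\<^sup>2 * (\<epsilon> / real n) = \<alpha>\<^sup>2 * \<epsilon> / (2 * real n) + \<alpha>\<^sup>2 * \<epsilon> / (2 * real n)" using n0 by (simp add: field_simps)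
  ultimately show ?thesis by (simp only: distrib_left)
 qed
 have tail: "2 * (1 - \<epsilon>) ^ l \<le> \<alpha> / 2 * (\<epsilon> / real n)"
 proof -
  have "(1 - \<epsilon>) ^ l \<le> exp (- \<epsilon>) ^ l" using \<epsilon> exp_ge_add_one_self[of "- \<epsilon>"] by (intro power_mono) auto
  also have "\<dots> = exp (- (real l * \<epsilon>))" by (simp add: exp_of_nat_mult[symmetric])
  also have "\<dots> \<le> exp (- (5 * ln (real n)))" using l1 \<epsilon>0 by (simp add: divide_le_eq)
  also have "exp (- (5 * ln (real n))) = 1 / real n ^ 5"
   using n0 exp_of_nat_mult[of 5 "ln (real n)"] by (simp add: exp_minus inverse_eq_divide)
  finally have "2 * (1 - \<epsilon>) ^ l \<le> 2 / real n ^ 5" by simp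
  also have "\<dots> \<le> 1 / (2 * real n ^ 3)"
  proof -
   have "2 * 2 \<le> real n * real n" using n by (intro mult_mono) auto
   then have "(2 * 2) * real n ^ 3 \<le> (real n * real n) * real n ^ 3" by (rule mult_right_mono) simp
   also have "\<dots> = real n ^ 5" by (simp add: numeral_eq_Suc)
   finally have "2 * (2 * real n ^ 3) \<le> 1 * real n ^ 5" by simp
   then show ?thesis using n0 by (subst frac_le_eq[THEN iffD2]) (auto simp: divide_le_0_iff)
  qed
  also have "\<dots> = (1 / real n) / 2 * ((1 / real n) / real n)" by (simp add: power3_eq_cube)
  also have "\<dots> \<le> \<alpha> / 2 * (\<epsilon> / real n)" using \<alpha> \<epsilon> n0 \<alpha>0 by (intro mult_mono divide_right_mono) auto
  finally show ?thesis .
 qed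
 have th0: "0 \<le> discount n \<epsilon> i" "discount n \<epsilon> i \<le> 1 - \<epsilon>" for i using \<epsilon> by (auto simp: discount_def)
 have th1: "discount n \<epsilon> 1 \<le> 1 / (real n + 1)"
 proof -
  have "exp (- ln (real n + 1)) = 1 / (real n + 1)" using n0 by (simp add: exp_minus inverse_eq_divide)
  then show ?thesis by (simp add: discount_def)
 qed
 have nW: "n * n < W"
 proof -
  have "n * n = n ^ 2" by (simp add: power2_eq_square)
  also have "\<dots> < W" unfolding W_def using n by (intro power_strict_increasing) auto
  finally show ?thesis .
 qed
 have "\<exists>Alg. machines Alg = 2 ^ (a - b) \<and> rounds Alg \<le> (6 + I * (J' + 11)) * (4 * 6 ^ d + 2 * f + 5) + 1 \<and>
  solves W S n m \<alpha> \<epsilon> Alg (real I * (real n * (1 / 2) ^ R))"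
 proof (rule pagerank_algorithm[where \<kappa> = \<kappa> and \<rho> = \<rho> and K = K and l = l and J' = J' and \<theta>s = "discount n \<epsilon>",
    OF mach b ba _ nW m(1) _ Re _ Rb l0 J(1) K0 _ _ \<alpha>0 \<alpha>(2) \<epsilon>0 \<epsilon>(2) _ \<rho> _ _ th1 _ _ budget tail var])
  show "m \<le> 2 ^ (a - 1)" "(1 + R * (2 * l)) * (n * R * (K + 1)) \<le> 2 ^ (a - 1)"
   using a' unfolding a1 NN_def by linarith+
  show "2 ^ (a - 1) < (2::nat) ^ a" by (simp add: a_def)
  show "0 \<le> \<kappa>" unfolding \<kappa>_def using \<epsilon>0 by simp
  show "0 < I" by (simp add: I_def)
  show "discount n \<epsilon> I = 1 - \<epsilon>" by (rule discount_last[OF two q \<epsilon>0 \<epsilon>(2) I1])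
  show "\<exists>s. (\<forall>k<s. discount n \<epsilon> (Suc i) ^ k \<le> \<rho> * discount n \<epsilon> i ^ k) \<and>
   discount n \<epsilon> (Suc i) ^ s / (1 - discount n \<epsilon> (Suc i)) \<le> 1 / real n" if "0 < i" for i
   unfolding \<rho>_def by (rule discount_step[OF two q \<epsilon> that])
 qed (use n R8 th0 in auto)
 then obtain Alg where Alg: "machines Alg = 2 ^ (a - b)" "rounds Alg \<le> (6 + I * (J' + 11)) * U + 1"
  "solves W S n m \<alpha> \<epsilon> Alg (real I * (real n * (1 / 2) ^ R))" unfolding U_def by blast
 have Mb: "2 ^ (a - b) * 2 ^ b = (2::nat) ^ a" using ba by (simp add: power_add[symmetric])
 have rounds: "real (rounds Alg) \<le> 122 * real U * X * ln (X + 2)"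
 proof -
  have "real ((6 + I * (J' + 11)) * U + 1) \<le> 122 * real U * X * ln (X + 2)" unfolding X_def
   by (rule round_bound[OF lam n q \<epsilon>0 \<epsilon>(2) I2 _ l2]) (use J(2) in \<open>auto simp: U_def\<close>)
  moreover have "real (rounds Alg) \<le> real ((6 + I * (J' + 11)) * U + 1)" using Alg(2) by (simp only: of_nat_le_iff)
  ultimately show ?thesis by linarith
 qed
 have space: "real (machines Alg * S) \<le> 8 * (real m / \<alpha>\<^sup>2 + real n powr (1 + expo n) / (\<epsilon> powr 3.5 * \<alpha>\<^sup>2))"
 proof -
  have "machines Alg * S \<le> 2 ^ (a - b) * (2 * 2 ^ b)" unfolding Alg(1) using b(2) by (intro mult_le_mono) auto
  also have "\<dots> = 2 * 2 ^ a" using Mb by simp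
  also have "\<dots> \<le> 8 * (m + NN)" using a' a1 by linarith
  finally have "real (machines Alg * S) \<le> real (8 * (m + NN))" by (simp only: of_nat_le_iff)
  also have "\<dots> = 8 * (real m + real NN)" by simp
  also have "\<dots> \<le> 8 * (real m / \<alpha>\<^sup>2 + real n powr (1 + expo n) / (\<epsilon> powr 3.5 * \<alpha>\<^sup>2))"
  proof (intro mult_left_mono add_mono)
   have "\<alpha>\<^sup>2 \<le> 1" using \<alpha> \<alpha>0 by (intro power_le_one) auto
   then show "real m \<le> real m / \<alpha>\<^sup>2" using \<alpha>0 by (simp add: le_divide_eq mult_left_le)
   have "\<epsilon> powr 3.5 \<le> \<epsilon> powr 3" using \<epsilon> \<epsilon>0 by (intro powr_mono') auto
   then have "\<epsilon> powr 3.5 \<le> \<epsilon> ^ 3" using \<epsilon>0 by (simp add: powr_numeral)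
   then have "real n powr (1 + expo n) / (\<epsilon> ^ 3 * \<alpha>\<^sup>2) \<le> real n powr (1 + expo n) / (\<epsilon> powr 3.5 * \<alpha>\<^sup>2)"
    using \<epsilon>0 \<alpha>0 by (intro divide_left_mono mult_right_mono mult_pos_pos) auto
   then show "real NN \<le> real n powr (1 + expo n) / (\<epsilon> powr 3.5 * \<alpha>\<^sup>2)" using NNr by linarith
  qed simp
  finally show ?thesis .
 qed
 have cap: "m \<le> machines Alg * (S div 2)"
 proof -
  obtain b' where b': "b = Suc b'" using b4 by (cases b) auto
  have "2 ^ b' \<le> S div 2" using b(1) unfolding b' by simp
  then have "2 ^ (a - b) * 2 ^ b' \<le> machines Alg * (S div 2)" unfolding Alg(1) by (rule mult_le_mono2)
  moreover have "2 * (2 ^ (a - b) * 2 ^ b') = 2 * (2::nat) ^ a'" using Mb unfolding a1(2) b' by simp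
  ultimately show ?thesis using a' by linarith
 qed
 have "solves W S n m \<alpha> \<epsilon> Alg (1 / real n)" by (rule solves_mono[OF Alg(3) fail])
 then show ?thesis unfolding W_def
  using rounds space cap by blast
qed

section \<open>From eventual inequalities to one family of algorithms\<close>

theorem theorem1p5:
  fixes \<gamma> \<delta> :: real and c :: nat and S :: "nat \<Rightarrow> nat" and h :: "nat \<Rightarrow> real"
  assumes "0 < \<gamma>" "\<gamma> < 1" and "(\<lambda>n. real (S n)) \<in> O(\<lambda>n. real n powr \<gamma>)"
    and "0 < \<delta>" and "(\<lambda>n. real (S n)) \<in> \<Omega>(\<lambda>n. real n powr \<delta>)"
    and "\<And>n. 0 < h n" and "h \<in> o(\<lambda>n. real (S n))"
  shows "\<exists>(A :: nat \<Rightarrow> nat \<Rightarrow> real \<Rightarrow> real \<Rightarrow> mpc_algorithm) (w :: nat) (C :: real) (k :: nat)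
            (\<eta> :: nat \<Rightarrow> real) (N :: nat).
      \<eta> \<longlonglongrightarrow> 0 \<and>
      (\<forall>n\<ge>N. \<forall>m \<alpha> \<epsilon>. \<forall>G :: (nat, nat) pre_digraph.
         fin_digraph G \<and> verts G = {..<n} \<and> card (arcs G) = m \<and> m \<le> n ^ c \<and>
         (\<forall>v\<in>verts G. out_degree G v \<ge> 1) \<and>
         \<alpha> \<in> {1 / real n..1 / 4} \<and> \<epsilon> \<in> {ln (real n) ^ 3 / h n..1} \<longrightarrow>
         real (rounds (A n m \<alpha> \<epsilon>)) \<le> soft C k (ln (ln (real n)) ^ 2 + ln (1 / \<epsilon>) ^ 2) \<and>
         real (machines (A n m \<alpha> \<epsilon>) * S n) \<le>
           soft C k (real m / \<alpha>\<^sup>2 + real n powr (1 + \<eta> n) / (\<epsilon> powr 3.5 * \<alpha>\<^sup>2)) \<and>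
         m \<le> machines (A n m \<alpha> \<epsilon>) * (S n div 2) \<and>
         (\<forall>mem. edge_input (S n) (machines (A n m \<alpha> \<epsilon>)) G mem \<longrightarrow>
            measure (measure_spmf (mpc_result (n ^ w) (S n) (A n m \<alpha> \<epsilon>) mem))
              {res. \<exists>x. vector_output (machines (A n m \<alpha> \<epsilon>)) G res x \<and>
                        multiplicative_approx \<alpha> G (pagerank G \<epsilon>) x}
            \<ge> 1 - C / real n))"
proof -
 note \<gamma> = assms(1,2) and SO = assms(3) and \<delta> = assms(4) and S\<Omega> = assms(5) and h0 = assms(6) and hS = assms(7)
 define f where "f = nat \<lceil>(real c + 8) * 2 / \<delta>\<rceil>"
 have f: "(real c + 8) * 2 / \<delta> \<le> real f" unfolding f_def by (rule real_nat_ceiling_ge)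
 obtain d where d: "\<And>a b. 4 \<le> b \<Longrightarrow> a \<le> f * b \<Longrightarrow> shrink d a \<le> b" using shrink_depth[of f] by blast
 define U :: nat where "U = 4 * 6 ^ d + 2 * f + 5"
 define C where "C = 122 * real U + 8"
 have "(\<lambda>n. real n powr \<gamma>) \<in> o(\<lambda>n. real n)" using \<gamma> by real_asymp
 from landau_o.big_small_trans[OF SO this] have So: "(\<lambda>n. real (S n)) \<in> o(\<lambda>n. real n)" .
 have e1: "\<forall>\<^sub>F n in sequentially. S n \<le> n"
  using landau_o.smallD[OF So, of 1] by (auto elim: eventually_mono)
 have "(\<lambda>n. real n powr (\<delta> / 2)) \<in> o(\<lambda>n. real n powr \<delta>)" using \<delta> by real_asymp
 moreover have "(\<lambda>n. real n powr \<delta>) \<in> O(\<lambda>n. real (S n))" using S\<Omega> by (simp add: bigomega_iff_bigo)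
 ultimately have "(\<lambda>n. real n powr (\<delta> / 2)) \<in> o(\<lambda>n. real (S n))" by (rule landau_o.small_big_trans)
 from landau_o.smallD[OF this, of "1 / 2"]
 \<comment> \<open>The block exponent is measured against \<open>\<delta> / 2\<close> instead of
   \<open>\<delta>\<close>, so that the unknown constant of the lower bound on the space disappears
   for large \<open>n\<close>.\<close>
 have e2: "\<forall>\<^sub>F n in sequentially. 2 * real n powr (\<delta> / 2) \<le> real (S n)" by (auto elim: eventually_mono)
 have e3: "\<forall>\<^sub>F n in sequentially. h n \<le> real (S n)"
  using landau_o.smallD[OF hS, of 1] by (auto elim!: eventually_mono)
 have e4: "\<forall>\<^sub>F n in sequentially. 16 \<le> real n powr (\<delta> / 2)" using \<delta> by real_asymp
 have e5: "\<forall>\<^sub>F n in sequentially. 12 * ln (real n) + 16 \<le> real n powr (\<delta> / 2)" using \<delta> by real_asymp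
 have e6: "\<forall>\<^sub>F n in sequentially. 1 \<le> ln (ln (real n))" by real_asymp
 have e7: "\<forall>\<^sub>F n in sequentially. 2 \<le> slow n" unfolding slow_def by real_asymp
 have e8: "\<forall>\<^sub>F n in sequentially. (ln (ln (real n + 1)) + ln (real n)) * slow n + 2 \<le> real n" unfolding slow_def by real_asymp
 have e9: "\<forall>\<^sub>F n in sequentially. expo n \<le> 1" using order_tendstoD(2)[OF expo_tendsto, of 1] by (auto elim: eventually_mono)
 have e10: "\<forall>\<^sub>F n in sequentially. 1 \<le> ln (real n)" by real_asymp
 define large where "large n \<longleftrightarrow> 16 \<le> n \<and> S n \<le> n \<and> 2 * real n powr (\<delta> / 2) \<le> real (S n) \<and> h n \<le> real (S n) \<and>
   16 \<le> real n powr (\<delta> / 2) \<and> 12 * ln (real n) + 16 \<le> real n powr (\<delta> / 2) \<and> 1 \<le> ln (ln (real n)) \<and> 2 \<le> slow n \<and>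
   (ln (ln (real n + 1)) + ln (real n)) * slow n + 2 \<le> real n \<and> expo n \<le> 1 \<and> 1 \<le> ln (real n)" for n
 have "\<forall>\<^sub>F n in sequentially. large n" unfolding large_def
  by (intro eventually_conj eventually_ge_at_top e1 e2 e3 e4 e5 e6 e7 e8 e9 e10)
 then obtain N where N: "\<And>n. N \<le> n \<Longrightarrow> large n"
  unfolding eventually_sequentially by blast
 define w where "w = 25 * (c + 8) + 1"
 define Q where "Q n m \<alpha> \<epsilon> Alg \<longleftrightarrow>
  real (rounds Alg) \<le> 122 * real U * (ln (ln (real n)) ^ 2 + ln (1 / \<epsilon>) ^ 2) * ln (ln (ln (real n)) ^ 2 + ln (1 / \<epsilon>) ^ 2 + 2) \<and>
  real (machines Alg * S n) \<le> 8 * (real m / \<alpha>\<^sup>2 + real n powr (1 + expo n) / (\<epsilon> powr 3.5 * \<alpha>\<^sup>2)) \<and>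
  m \<le> machines Alg * (S n div 2) \<and>
  solves (n ^ w) (S n) n m \<alpha> \<epsilon> Alg (1 / real n)" for n m :: nat and \<alpha> \<epsilon> :: real and Alg
 \<comment> \<open>The algorithm may depend on \<open>n\<close>, \<open>m\<close>,
   \<open>\<alpha>\<close> and \<open>\<epsilon>\<close> but not on the graph or its distribution;
   \<open>Q\<close> therefore quantifies over these inside \<open>solves\<close>.\<close>
 define A where "A n m \<alpha> \<epsilon> = (SOME Alg. Q n m \<alpha> \<epsilon> Alg)" for n m \<alpha> \<epsilon>
 have Q: "Q n m \<alpha> \<epsilon> (A n m \<alpha> \<epsilon>)" if "N \<le> n" "0 < m" "m \<le> n ^ c" "1 / real n \<le> \<alpha>" "\<alpha> \<le> 1 / 4" "1 / real n \<le> \<epsilon>" "\<epsilon> \<le> 1" for n m \<alpha> \<epsilon>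
  unfolding A_def
 proof (rule someI_ex)
  note nN = N[OF that(1), unfolded large_def]
  show "\<exists>Alg. Q n m \<alpha> \<epsilon> Alg" unfolding Q_def w_def U_def
   by (rule pagerank_instance[OF _ \<delta> _ _ _ _ _ _ _ _ f d that(2-7)]) (use nN in auto)
 qed
 \<comment> \<open>Vertex 0 has an outgoing edge, so there is an edge at all. The lower limit for
   \<open>\<epsilon>\<close> gives \<open>1 / n \<le> \<epsilon>\<close> because
   \<open>h n \<le> S n \<le> n\<close> and \<open>ln n \<ge> 1\<close>.\<close>
 have bounds: "0 < m \<and> 1 / real n \<le> \<epsilon>"
  if "N \<le> n" "fin_digraph G" "verts G = {..<n}" "card (arcs G) = m" "\<forall>v\<in>verts G. out_degree G v \<ge> 1" "ln (real n) ^ 3 / h n \<le> \<epsilon>"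
  for n m \<epsilon> and G :: "(nat, nat) pre_digraph"
 proof
  interpret fin_digraph G by fact
  note nN = N[OF that(1), unfolded large_def]
  have "0 \<in> verts G" using nN that(3) by simp
  then have "1 \<le> card (out_arcs G 0)" using that(5) by (auto simp: out_degree_def)
  then have "out_arcs G 0 \<noteq> {}" by auto
  then have "arcs G \<noteq> {}" by auto
  then show "0 < m" using that(4) by (auto simp: card_gt_0_iff)
  have "1 ^ 3 \<le> ln (real n) ^ 3" using nN by (intro power_mono) auto
  moreover have "h n \<le> real n" using nN by linarith
  ultimately have "1 / real n \<le> ln (real n) ^ 3 / h n" using h0[of n] by (intro frac_le) auto
  then show "1 / real n \<le> \<epsilon>" using that(6) by linarith
 qed
 have rounds: "122 * real U * X * ln (X + 2) \<le> soft C 1 X" if "0 \<le> X" for X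
 proof -
  have "122 * real U * (X * ln (X + 2)) \<le> C * (X * ln (X + 2))"
   using that by (intro mult_right_mono) (auto simp: C_def)
  then show ?thesis by (simp add: soft_def mult_ac)
 qed
 have space: "8 * x \<le> soft C 1 x" if "1 \<le> x" for x
 proof -
  have "exp 1 \<le> x + 2" using that exp_le by linarith
  then have "1 \<le> ln (x + 2)" using that by (subst ln_ge_iff) auto
  then have "8 * x * 1 \<le> C * x * ln (x + 2)" using that by (intro mult_mono) (auto simp: C_def)
  then show ?thesis by (simp add: soft_def)
 qed
 show ?thesis
 proof (rule exI[of _ A], rule exI[of _ w], rule exI[of _ C], rule exI[of _ "1::nat"], rule exI[of _ expo], rule exI[of _ N],
   intro conjI allI impI)
  show "expo \<longlonglongrightarrow> 0" by (rule expo_tendsto)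
  fix n m \<alpha> \<epsilon> and G :: "(nat, nat) pre_digraph"
  assume n: "N \<le> n" and H: "fin_digraph G \<and> verts G = {..<n} \<and> card (arcs G) = m \<and> m \<le> n ^ c \<and>
     (\<forall>v\<in>verts G. out_degree G v \<ge> 1) \<and> \<alpha> \<in> {1 / real n..1 / 4} \<and> \<epsilon> \<in> {ln (real n) ^ 3 / h n..1}"
  have b: "0 < m" "1 / real n \<le> \<epsilon>" using bounds[OF n, of G m \<epsilon>] H by auto
  have q: "Q n m \<alpha> \<epsilon> (A n m \<alpha> \<epsilon>)" by (rule Q[OF n b(1)]) (use H b in auto)
  let ?X = "ln (ln (real n)) ^ 2 + ln (1 / \<epsilon>) ^ 2"
  show "real (rounds (A n m \<alpha> \<epsilon>)) \<le> soft C 1 ?X"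
   using q rounds[of ?X] unfolding Q_def by (auto intro: order_trans)
  let ?x = "real m / \<alpha>\<^sup>2 + real n powr (1 + expo n) / (\<epsilon> powr 3.5 * \<alpha>\<^sup>2)"
  have "0 < 1 / real n" using N[OF n] by (simp add: large_def)
  moreover have "1 / real n \<le> \<alpha>" "\<alpha> \<le> 1 / 4" using H by simp_all
  ultimately have \<alpha>: "0 < \<alpha>" "\<alpha> \<le> 1" by linarith+
  have "\<alpha>\<^sup>2 \<le> 1" using \<alpha> by (intro power_le_one) auto
  moreover have "1 \<le> real m" using b(1) by simp
  ultimately have "1 \<le> real m / \<alpha>\<^sup>2" using \<alpha> by (subst le_divide_eq) auto
  moreover have "0 \<le> real n powr (1 + expo n) / (\<epsilon> powr 3.5 * \<alpha>\<^sup>2)" by simp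
  ultimately have "1 \<le> ?x" by linarith
  from space[OF this] show "real (machines (A n m \<alpha> \<epsilon>) * S n) \<le> soft C 1 ?x"
   using q unfolding Q_def by (auto intro: order_trans)
  show "m \<le> machines (A n m \<alpha> \<epsilon>) * (S n div 2)" using q unfolding Q_def by blast
  fix mem assume mem: "edge_input (S n) (machines (A n m \<alpha> \<epsilon>)) G mem"
  have "1 - 1 / real n \<le> measure (measure_spmf (mpc_result (n ^ w) (S n) (A n m \<alpha> \<epsilon>) mem))
       {res. \<exists>x. vector_output (machines (A n m \<alpha> \<epsilon>)) G res x \<and> multiplicative_approx \<alpha> G (pagerank G \<epsilon>) x}"
   using q H mem unfolding Q_def solves_def by blast
  moreover have "1 / real n \<le> C / real n" by (intro divide_right_mono) (auto simp: C_def)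
  ultimately show "1 - C / real n \<le> measure (measure_spmf (mpc_result (n ^ w) (S n) (A n m \<alpha> \<epsilon>) mem))
       {res. \<exists>x. vector_output (machines (A n m \<alpha> \<epsilon>)) G res x \<and> multiplicative_approx \<alpha> G (pagerank G \<epsilon>) x}"
   by linarith
 qed
qed

end
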